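(* Let $\mathfrak g$ be any finite-dimensional Lie algebra over a field $\mathbb F$ of characteristic $0$, with a nondegenerate symmetric invariant bilinear form $(\cdot|\cdot)$, and let $k\in\mathbb F$ be nonzero. Let $\mathcal V^k_{\mathfrak g}$ be the affine PVA of level $k$. Then $$H^n_{\mathrm{PV}}(\mathcal V^k_{\mathfrak g},\mathcal V^k_{\mathfrak g})\simeq H^n(\mathfrak g,\mathbb F)\oplus H^{n+1}(\mathfrak g,\mathbb F),\qquad n\ge0,$$ where $H^\bullet(\mathfrak g,\mathbb F)$ is the Lie algebra cohomology with trivial coefficients. Explicitly, let $\{u_1,\dots,u_N\}$ be a basis of $\mathfrak g$ with dual basis $\{u^1,\dots,u^N\}$ with respect to $(\cdot|\cdot)$. Then an element $[\alpha]+[\beta]\in H^n(\mathfrak g,\mathbb F)\oplus H^{n+1}(\mathfrak g,\mathbb F)$ corresponds under this isomorphism to the class of the $n$-cocycle $Y\in C^n_{\mathrm{PV}}(\mathcal V^k_{\mathfrak g},\mathcal V^k_{\mathfrak g})$ uniquely defined by $$Y_{\lambda_1,\dots,\lambda_n}(u)=\alpha(u)+\sum_{j=1}^N\beta(u\otimes u^j)\,u_j+\langle\partial+\lambda_1+\dots+\lambda_n\rangle,\qquad u\in\mathfrak g^{\otimes n}.$$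
   Context: $\mathbb F$ is a field of characteristic $0$. Everything here is purely even. PVA: a Poisson vertex algebra is a commutative associative unital algebra $\mathcal V$ with a derivation $\partial$ and a bilinear map $\mathcal V\otimes\mathcal V\to\mathcal V[\lambda]$, $a\otimes b\mapsto[a_\lambda b]$, with $[\partial a_\lambda b]=-\lambda[a_\lambda b]$, $[a_\lambda\partial b]=(\lambda+\partial)[a_\lambda b]$, $[a_\lambda b]=-[b_{-\lambda-\partial}a]$ ($\partial$ acting from the left on coefficients), $[a_\lambda[b_\mu c]]-[b_\mu[a_\lambda c]]=[[a_\lambda b]_{\lambda+\mu}c]$, $[a_\lambda bc]=[a_\lambda b]c+[a_\lambda c]b$. Variational PVA cohomology of $\mathcal V$ with coefficients in the adjoint module $M=\mathcal V$ (with $a_\lambda m=[a_\lambda m]$): $C^n_{\mathrm{PV}}(\mathcal V,M)$, $n\ge0$, is the space of linear maps $Y:\mathcal V^{\otimes n}\to M[\lambda_1,\dots,\lambda_n]/\langle\partial+\lambda_1+\cdots+\lambda_n\rangle$ ($\langle\Phi\rangle$ = image of $\Phi$) satisfying: sesquilinearity $Y_{\lambda_1,\dots,\lambda_n}(\cdots\otimes\partial a_i\otimes\cdots)=-\lambda_iY_{\lambda_1,\dots,\lambda_n}(\cdots\otimes a_i\otimes\cdots)$; skewsymmetry under simultaneous permutations of the $a_i$ and the $\lambda_i$; Leibniz rules $Y(\cdots\otimes b_ic_i\otimes\cdots)=(e^{\partial\partial_{\lambda_i}}b_i)Y(\cdots\otimes c_i\otimes\cdots)+(e^{\partial\partial_{\lambda_i}}c_i)Y(\cdots\otimes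 b_i\otimes\cdots)$, where $(e^{\partial\partial_\lambda}a)P(\lambda)=\sum_{k\ge0}\frac1{k!}(\partial^ka)\frac{d^kP}{d\lambda^k}$. In particular $C^0_{\mathrm{PV}}=M/\partial M$. The differential $d:C^n_{\mathrm{PV}}\to C^{n+1}_{\mathrm{PV}}$, $d^2=0$, is $$(dY)_{\lambda_0,\dots,\lambda_n}(a_0\otimes\cdots\otimes a_n)=\sum_{i=0}^n(-1)^{n+i+1}{a_i}_{\lambda_i}Y_{\lambda_0,\overset{i}{\check\dots},\lambda_n}(a_0\otimes\overset{i}{\check\cdots}\otimes a_n)+\sum_{i<j}(-1)^{n+i+j+1}Y_{\lambda_i+\lambda_j,\lambda_0,\overset{i}{\check\dots}\overset{j}{\check\dots},\lambda_n}([{a_i}_{\lambda_i}a_j]\otimes a_0\otimes\overset{i}{\check\cdots}\overset{j}{\check\cdots}\otimes a_n),$$ with $\check{}$ meaning omission. $H^n_{\mathrm{PV}}(\mathcal V,M)=\ker(d|_{C^n_{\mathrm{PV}}})/d(C^{n-1}_{\mathrm{PV}})$. A cochain is determined by its values on generators of $\mathcal V$ as a differential algebra. Affine PVA: $\mathcal V^k_{\mathfrak g}=S(\mathbb F[\partial]\otimes\mathfrak g)$ (symmetric algebra), with $\partial$ extended as a derivation and with the unique PVA $\lambda$-bracket such that $[a_\lambda b]=[a,b]+k\lambda(a|b)1$ for $a,b\in\mathfrak g$. Lie algebra cochains $\alpha,\beta$ are alternating multilinear forms, viewed as linear functions on $\mathfrak g^{\otimes n}$, $\mathfrak g^{\otimes(n+1)}$.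 Dual basis: $(u_i|u^j)=\delta_{ij}$. *)

theory Defs
  imports
    "HOL-Library.Poly_Mapping"
    "HOL-Library.Function_Algebras"
    "HOL-Library.Set_Algebras"
    "HOL-Computational_Algebra.Polynomial"
    "HOL-Combinatorics.Permutations"
begin

section \<open>Multivariate polynomials\<close>

text \<open>
  A polynomial in commuting variables indexed by \<open>'x\<close> with coefficients in \<open>'r\<close> is a finitely
  supported map from exponents (themselves finitely supported) to coefficients.
\<close>

type_synonym ('x, 'r) mpoly = "('x \<Rightarrow>\<^sub>0 nat) \<Rightarrow>\<^sub>0 'r"

definition Cst :: "'r::zero \<Rightarrow> ('x, 'r) mpoly" where
  "Cst c = Poly_Mapping.single 0 c"

definition Var :: "'x \<Rightarrow> ('x, 'r::zero_neq_one) mpoly" where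
  "Var x = Poly_Mapping.single (Poly_Mapping.single x 1) 1"

text \<open>Substitution of \<open>\<sigma> x\<close> for the variable \<open>x\<close>, the coefficients being mapped by \<open>h\<close>.\<close>

definition peval :: "('r::zero \<Rightarrow> 's::comm_ring_1) \<Rightarrow> ('x \<Rightarrow> 's) \<Rightarrow> ('x, 'r) mpoly \<Rightarrow> 's" where
  "peval h \<sigma> P = (\<Sum>e\<in>Poly_Mapping.keys P. h (Poly_Mapping.lookup P e) *
      (\<Prod>x\<in>Poly_Mapping.keys e. \<sigma> x ^ Poly_Mapping.lookup e x))"

text \<open>
  Extension of \<open>f\<close>, defined on coefficients, to polynomials: the variables are pulled out, i.e.
  \<open>\<Sum> c\<^sub>e x\<^sup>e\<close> goes to \<open>\<Sum> x\<^sup>e f(c\<^sub>e)\<close>.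
\<close>

definition pext :: "('r::zero \<Rightarrow> ('x, 's::comm_ring_1) mpoly) \<Rightarrow> ('x, 'r) mpoly \<Rightarrow> ('x, 's) mpoly" where
  "pext f P = (\<Sum>e\<in>Poly_Mapping.keys P.
      Poly_Mapping.single e 1 * f (Poly_Mapping.lookup P e))"

definition pdiff :: "'x \<Rightarrow> ('x, 'r::comm_ring_1) mpoly \<Rightarrow> ('x, 'r) mpoly" where
  "pdiff x P = (\<Sum>e\<in>Poly_Mapping.keys P.
      Poly_Mapping.single (e - Poly_Mapping.single x 1)
        (of_nat (Poly_Mapping.lookup e x) * Poly_Mapping.lookup P e))"

text \<open>Polynomials in the variables with index \<open>0, \<dots>, n - 1\<close> only.\<close>

definition mpolys :: "nat \<Rightarrow> (nat, 'r::zero) mpoly set" where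
  "mpolys n = {P. \<forall>e\<in>Poly_Mapping.keys P. Poly_Mapping.keys e \<subseteq> {..<n}}"


section \<open>Symmetric algebras\<close>

locale comm_algebra = vector_space scale
  for scale :: "'k::field_char_0 \<Rightarrow> 'v::comm_ring_1 \<Rightarrow> 'v" +
  assumes scale_mult: "scale c (x * y) = scale c x * y"

text \<open>
  The symmetric algebra \<open>S(W)\<close> is the quotient of the free commutative algebra on the set \<open>W\<close> by
  the ideal which forces the canonical map from \<open>W\<close> to be linear.  The predicate says that the
  algebra \<open>'v\<close>, together with the map \<open>\<iota>\<close> from \<open>W\<close>, is this quotient.
\<close>

definition sym_relations :: "('k::field_char_0 \<Rightarrow> 'w::ab_group_add \<Rightarrow> 'w) \<Rightarrow> ('w, 'k) mpoly set" where
  "sym_relations scaleW =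
     {Var (v + w) - Var v - Var w | v w. True} \<union> {Var (scaleW c w) - Cst c * Var w | c w. True}"

definition is_symmetric_algebra ::
    "('k::field_char_0 \<Rightarrow> 'w::ab_group_add \<Rightarrow> 'w) \<Rightarrow> ('k \<Rightarrow> 'v::comm_ring_1 \<Rightarrow> 'v) \<Rightarrow>
     ('w \<Rightarrow> 'v) \<Rightarrow> bool" where
  "is_symmetric_algebra scaleW scale \<iota> \<longleftrightarrow>
     comm_algebra scale \<and>
     surj (peval (\<lambda>c. scale c 1) \<iota>) \<and>
     {P. peval (\<lambda>c. scale c 1) \<iota> P = 0} = module.span (*) (sym_relations scaleW)"


section \<open>Lie algebras and their cohomology with trivial coefficients\<close>

locale lie_algebra = vector_space scale
  for scale :: "'k::field_char_0 \<Rightarrow> 'g::ab_group_add \<Rightarrow> 'g" +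
  fixes bracket :: "'g \<Rightarrow> 'g \<Rightarrow> 'g"
  assumes bracket_linear_left: "Vector_Spaces.linear scale scale (\<lambda>a. bracket a b)"
    and bracket_linear_right: "Vector_Spaces.linear scale scale (\<lambda>b. bracket a b)"
    and bracket_alternating: "bracket a a = 0"
    and bracket_jacobi: "bracket a (bracket b c) - bracket b (bracket a c) = bracket (bracket a b) c"
begin

text \<open>
  Linear functions on the \<open>n\<close>-th tensor power are represented by multilinear functions of lists of
  length \<open>n\<close>, with the junk value \<open>0\<close> on lists of other lengths.
\<close>

definition lie_cochains :: "nat \<Rightarrow> ('g list \<Rightarrow> 'k) set" where
  "lie_cochains n = {\<alpha>.
     (\<forall>as. length as \<noteq> n \<longrightarrow> \<alpha> as = 0) \<and>
     (\<forall>as i x y. length as = n \<longrightarrow> i < n \<longrightarrow> \<alpha> (as[i := x + y]) = \<alpha> (as[i := x]) + \<alpha> (as[i := y])) \<and>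
     (\<forall>as i c x. length as = n \<longrightarrow> i < n \<longrightarrow> \<alpha> (as[i := scale c x]) = c * \<alpha> (as[i := x])) \<and>
     (\<forall>as i j. length as = n \<longrightarrow> i < j \<longrightarrow> j < n \<longrightarrow> as ! i = as ! j \<longrightarrow> \<alpha> as = 0)}"

text \<open>The differential from \<open>n\<close>-cochains to \<open>(n+1)\<close>-cochains.\<close>

definition lie_d :: "nat \<Rightarrow> ('g list \<Rightarrow> 'k) \<Rightarrow> 'g list \<Rightarrow> 'k" where
  "lie_d n \<alpha> as =
     (if length as = Suc n then
        (\<Sum>j<Suc n. \<Sum>i<j. (- 1) ^ (i + j) *
           \<alpha> (bracket (as ! i) (as ! j) # map ((!) as) (filter (\<lambda>m. m \<noteq> i \<and> m \<noteq> j) [0..<Suc n])))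
      else 0)"

definition lie_cocycles :: "nat \<Rightarrow> ('g list \<Rightarrow> 'k) set" where
  "lie_cocycles n = {\<alpha> \<in> lie_cochains n. lie_d n \<alpha> = (\<lambda>_. 0)}"

definition lie_coboundaries :: "nat \<Rightarrow> ('g list \<Rightarrow> 'k) set" where
  "lie_coboundaries n = (case n of 0 \<Rightarrow> {\<lambda>_. 0} | Suc m \<Rightarrow> lie_d m ` lie_cochains m)"

definition lie_class :: "nat \<Rightarrow> ('g list \<Rightarrow> 'k) \<Rightarrow> ('g list \<Rightarrow> 'k) set" where
  "lie_class n \<alpha> = \<alpha> +o lie_coboundaries n"

text \<open>
  Cohomology spaces are sets of cosets.  Cosets are added elementwise; the scalar multiple by \<open>c\<close>
  has to absorb the coboundaries, for the sake of \<open>c = 0\<close>.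
\<close>

definition lie_H :: "nat \<Rightarrow> ('g list \<Rightarrow> 'k) set set" where
  "lie_H n = lie_class n ` lie_cocycles n"

definition lie_H_scale :: "nat \<Rightarrow> 'k \<Rightarrow> ('g list \<Rightarrow> 'k) set \<Rightarrow> ('g list \<Rightarrow> 'k) set" where
  "lie_H_scale n c A = (\<lambda>\<alpha> as. c * \<alpha> as) ` A + lie_coboundaries n"

end

locale quadratic_lie_algebra = lie_algebra scale bracket
  for scale :: "'k::field_char_0 \<Rightarrow> 'g::ab_group_add \<Rightarrow> 'g" and bracket +
  fixes form :: "'g \<Rightarrow> 'g \<Rightarrow> 'k"
  assumes finite_dimensional: "\<exists>B. finite B \<and> span B = UNIV"
    and form_linear: "Vector_Spaces.linear scale (*) (\<lambda>b. form a b)"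
    and form_symmetric: "form a b = form b a"
    and form_invariant: "form (bracket a b) c = form a (bracket b c)"
    and form_nondegenerate: "(\<And>b. form a b = 0) \<Longrightarrow> a = 0"
begin

definition is_basis_with_dual :: "nat \<Rightarrow> (nat \<Rightarrow> 'g) \<Rightarrow> (nat \<Rightarrow> 'g) \<Rightarrow> bool" where
  "is_basis_with_dual N u u' \<longleftrightarrow>
     inj_on u {1..N} \<and> independent (u ` {1..N}) \<and> span (u ` {1..N}) = UNIV \<and>
     (\<forall>i\<in>{1..N}. \<forall>j\<in>{1..N}. form (u i) (u' j) = (if i = j then 1 else 0))"

end


section \<open>Poisson vertex algebras and their variational cohomology\<close>

text \<open>
  The polynomial \<open>br a b\<close> is the \<open>\<lambda>\<close>-bracket of \<open>a\<close> and \<open>b\<close>, with \<open>\<lambda>\<close> the variable of the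
  univariate polynomial.
\<close>

definition bracket_at :: "('v::comm_ring_1 \<Rightarrow> 'v \<Rightarrow> 'v poly) \<Rightarrow> (nat, 'v) mpoly \<Rightarrow> 'v \<Rightarrow> 'v \<Rightarrow> (nat, 'v) mpoly" where
  "bracket_at br t a b = poly (map_poly Cst (br a b)) t"

locale pva = comm_algebra scale
  for scale :: "'k::field_char_0 \<Rightarrow> 'v::comm_ring_1 \<Rightarrow> 'v" +
  fixes D :: "'v \<Rightarrow> 'v" and br :: "'v \<Rightarrow> 'v \<Rightarrow> 'v poly"
  assumes D_linear: "Vector_Spaces.linear scale scale D"
    and D_mult: "D (a * b) = D a * b + a * D b"
    and br_add_left: "br (a + b) c = br a c + br b c"
    and br_add_right: "br a (b + c) = br a b + br a c"
    and br_scale_left: "br (scale x a) b = map_poly (scale x) (br a b)"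
    and br_scale_right: "br a (scale x b) = map_poly (scale x) (br a b)"
    and br_D_left: "br (D a) b = - ([:0, 1:] * br a b)"
    and br_D_right: "br a (D b) = [:0, 1:] * br a b + map_poly D (br a b)"
    and br_skew: "br a b =
      - (\<Sum>k\<le>degree (br b a).
           ((\<lambda>p. - ([:0, 1:] * p) - map_poly D p) ^^ k) [:coeff (br b a) k:])"
    and br_jacobi: \<comment> \<open>\<open>\<lambda>\<close> and \<open>\<mu>\<close> are the variables \<open>0\<close> and \<open>1\<close>\<close>
      "pext (bracket_at br (Var 0) a) (bracket_at br (Var 1) b c)
       - pext (bracket_at br (Var 1) b) (bracket_at br (Var 0) a c)
       = pext (\<lambda>v. bracket_at br (Var 0 + Var 1) v c) (bracket_at br (Var 0) a b)"
    and br_leibniz: "br a (b * c) = smult c (br a b) + smult b (br a c)"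
begin

text \<open>
  The variables \<open>\<lambda>\<^sub>1, \<dots>, \<lambda>\<^sub>n\<close> are numbered \<open>0, \<dots>, n - 1\<close>.  The space
  \<open>V[\<lambda>\<^sub>1, \<dots>, \<lambda>\<^sub>n]/\<langle>\<partial> + \<lambda>\<^sub>1 + \<dots> + \<lambda>\<^sub>n\<rangle>\<close> is the set of cosets of \<open>tot_image n\<close>, added elementwise.
\<close>

definition tot_image :: "nat \<Rightarrow> (nat, 'v) mpoly set" where
  "tot_image n = (\<lambda>P. Poly_Mapping.map D P + (\<Sum>i<n. Var i) * P) ` mpolys n"

definition tot_class :: "nat \<Rightarrow> (nat, 'v) mpoly \<Rightarrow> (nat, 'v) mpoly set" where
  "tot_class n P = P +o tot_image n"

text \<open>The coset of \<open>tot_image n\<close> obtained by applying a linear operator to a coset.\<close>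

definition apply_class ::
    "nat \<Rightarrow> ((nat, 'v) mpoly \<Rightarrow> (nat, 'v) mpoly) \<Rightarrow> (nat, 'v) mpoly set \<Rightarrow> (nat, 'v) mpoly set" where
  "apply_class n T A = T ` A + tot_image n"

definition subst :: "(nat \<Rightarrow> (nat, 'v) mpoly) \<Rightarrow> (nat, 'v) mpoly \<Rightarrow> (nat, 'v) mpoly" where
  "subst \<sigma> P = peval Cst \<sigma> P"

text \<open>Multiplication by \<open>e\<^bsup>\<partial> \<partial>\<^sub>\<lambda>\<^esup> b\<close> with \<open>\<lambda>\<close> the variable \<open>i\<close>; only finitely many summands are nonzero.\<close>

definition exp_mult :: "nat \<Rightarrow> 'v \<Rightarrow> (nat, 'v) mpoly \<Rightarrow> (nat, 'v) mpoly" where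
  "exp_mult i b P = Sum_any (\<lambda>k. Cst (scale (1 / fact k) ((D ^^ k) b)) * (pdiff i ^^ k) P)"

text \<open>
  As for Lie algebras, linear maps on a tensor power are multilinear functions of lists of the
  given length; on other lists the junk value is \<open>0\<close>, the set \<open>{0}\<close>, neutral for addition.
\<close>

definition pv_cochains :: "nat \<Rightarrow> ('v list \<Rightarrow> (nat, 'v) mpoly set) set" where
  "pv_cochains n = {Y.
     (\<forall>as. length as \<noteq> n \<longrightarrow> Y as = 0) \<and>
     (\<forall>as. length as = n \<longrightarrow> Y as \<in> tot_class n ` mpolys n) \<and>
     (\<forall>as i x y. length as = n \<longrightarrow> i < n \<longrightarrow> Y (as[i := x + y]) = Y (as[i := x]) + Y (as[i := y])) \<and>
     (\<forall>as i c x. length as = n \<longrightarrow> i < n \<longrightarrow>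
        Y (as[i := scale c x]) = apply_class n (Poly_Mapping.map (scale c)) (Y (as[i := x]))) \<and>
     (\<forall>as i x. length as = n \<longrightarrow> i < n \<longrightarrow>
        Y (as[i := D x]) = apply_class n ((*) (- Var i)) (Y (as[i := x]))) \<and>
     (\<forall>as \<pi>. length as = n \<longrightarrow> \<pi> permutes {..<n} \<longrightarrow>
        apply_class n (subst (\<lambda>i. Var (\<pi> i))) (Y (permute_list \<pi> as)) =
        apply_class n ((*) (of_int (sign \<pi>))) (Y as)) \<and>
     (\<forall>as i b c. length as = n \<longrightarrow> i < n \<longrightarrow>
        Y (as[i := b * c]) =
          apply_class n (exp_mult i b) (Y (as[i := c])) + apply_class n (exp_mult i c) (Y (as[i := b])))}"

text \<open>
  The differential from \<open>n\<close>-cochains to \<open>(n+1)\<close>-cochains.  In the second sum, the coefficient of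
  \<open>\<lambda>\<^sub>i\<^sup>k\<close> in the \<open>\<lambda>\<^sub>i\<close>-bracket of \<open>a\<^sub>i\<close> and \<open>a\<^sub>j\<close> is inserted in \<open>Y\<close> and the power of \<open>\<lambda>\<^sub>i\<close> is pulled out.
\<close>

definition pv_d :: "nat \<Rightarrow> ('v list \<Rightarrow> (nat, 'v) mpoly set) \<Rightarrow> 'v list \<Rightarrow> (nat, 'v) mpoly set" where
  "pv_d n Y as =
     (if length as = Suc n then
        (\<Sum>i<Suc n.
           let I = filter (\<lambda>m. m \<noteq> i) [0..<Suc n] in
           apply_class (Suc n)
             (\<lambda>P. (- 1) ^ (n + i + 1) *
                pext (bracket_at br (Var i) (as ! i)) (subst ((!) (map Var I)) P))
             (Y (map ((!) as) I)))
        +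
        (\<Sum>j<Suc n. \<Sum>i<j.
           let I = filter (\<lambda>m. m \<noteq> i \<and> m \<noteq> j) [0..<Suc n] in
           \<Sum>k\<le>degree (br (as ! i) (as ! j)).
             apply_class (Suc n)
               (\<lambda>P. (- 1) ^ (n + i + j + 1) *
                  (Var i ^ k * subst ((!) ((Var i + Var j) # map Var I)) P))
               (Y (coeff (br (as ! i) (as ! j)) k # map ((!) as) I)))
      else 0)"

definition pv_zero :: "nat \<Rightarrow> 'v list \<Rightarrow> (nat, 'v) mpoly set" where
  "pv_zero n as = (if length as = n then tot_class n 0 else 0)"

definition pv_scale ::
    "nat \<Rightarrow> 'k \<Rightarrow> ('v list \<Rightarrow> (nat, 'v) mpoly set) \<Rightarrow> 'v list \<Rightarrow> (nat, 'v) mpoly set" where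
  "pv_scale n c Y as =
     (if length as = n then apply_class n (Poly_Mapping.map (scale c)) (Y as) else 0)"

definition pv_cocycles :: "nat \<Rightarrow> ('v list \<Rightarrow> (nat, 'v) mpoly set) set" where
  "pv_cocycles n = {Y \<in> pv_cochains n. pv_d n Y = pv_zero (Suc n)}"

definition pv_coboundaries :: "nat \<Rightarrow> ('v list \<Rightarrow> (nat, 'v) mpoly set) set" where
  "pv_coboundaries n = (case n of 0 \<Rightarrow> {pv_zero 0} | Suc m \<Rightarrow> pv_d m ` pv_cochains m)"

definition pv_class ::
    "nat \<Rightarrow> ('v list \<Rightarrow> (nat, 'v) mpoly set) \<Rightarrow> ('v list \<Rightarrow> (nat, 'v) mpoly set) set" where
  "pv_class n Y = Y +o pv_coboundaries n"

definition pv_H :: "nat \<Rightarrow> ('v list \<Rightarrow> (nat, 'v) mpoly set) set set" where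
  "pv_H n = pv_class n ` pv_cocycles n"

definition pv_H_scale ::
    "nat \<Rightarrow> 'k \<Rightarrow> ('v list \<Rightarrow> (nat, 'v) mpoly set) set \<Rightarrow> ('v list \<Rightarrow> (nat, 'v) mpoly set) set" where
  "pv_H_scale n c A = pv_scale n c ` A + pv_coboundaries n"

end


section \<open>Affine Poisson vertex algebras\<close>

text \<open>
  The space \<open>F[\<partial>] \<otimes> g\<close> is \<open>nat \<Rightarrow>\<^sub>0 'g\<close>, with \<open>Poly_Mapping.single m a\<close> in the role of \<open>\<partial>\<^sup>m \<otimes> a\<close>.
  A linear map \<open>j\<close> from \<open>g\<close> to a differential algebra extends to it by sending \<open>\<partial>\<^sup>m \<otimes> a\<close> to
  \<open>D\<^sup>m (j a)\<close>.
\<close>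

definition current_embedding :: "('v::comm_ring_1 \<Rightarrow> 'v) \<Rightarrow> ('g::zero \<Rightarrow> 'v) \<Rightarrow> (nat \<Rightarrow>\<^sub>0 'g) \<Rightarrow> 'v" where
  "current_embedding D j w = (\<Sum>m\<in>Poly_Mapping.keys w. (D ^^ m) (j (Poly_Mapping.lookup w m)))"

text \<open>
  The locale says that the Poisson vertex algebra \<open>'v\<close>, with the inclusion \<open>j\<close> of the Lie algebra,
  is the affine one of level \<open>k\<close>: as a differential algebra it is \<open>S(F[\<partial>] \<otimes> g)\<close>, and its
  \<open>\<lambda>\<close>-bracket is the one prescribed on \<open>g\<close>.
\<close>

locale affine_pva =
  g: quadratic_lie_algebra scaleg bracket form + pva scale D br
  for scaleg :: "'k::field_char_0 \<Rightarrow> 'g::ab_group_add \<Rightarrow> 'g" and bracket and form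
    and k :: 'k
    and scale :: "'k \<Rightarrow> 'v::comm_ring_1 \<Rightarrow> 'v" and D and br
    and j :: "'g \<Rightarrow> 'v" +
  assumes symmetric_algebra:
      "is_symmetric_algebra (\<lambda>c. Poly_Mapping.map (scaleg c)) scale (current_embedding D j)"
    and br_generators: "br (j a) (j b) = [:j (bracket a b), scale (k * form a b) 1:]"

end

theory Submission
  imports Defs Complex_Main
begin

text \<open>
  A cochain amounts to an alternating function of modes of elements of \<open>V\<close> (that is, on \<open>V[x]\<close>
  modulo the image of \<open>\<partial> + d/dx\<close>) with values in \<open>V\<close>, taken modulo total derivatives; the coefficients of
  the powers of the \<open>\<lambda>\<^sub>i\<close> are its values, up to factorials, and the differential becomes the
  Chevalley--Eilenberg differential \<open>d\<close> up to sign.  As \<open>k \<noteq> 0\<close>, the conformal vector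
  \<open>L = \<Sum> u\<^sub>i u\<^sup>i / 2k\<close> exists.  The Lie derivative along its mode of index \<open>1\<close> is the grading by conformal
  weight, so by Cartan's formula the cohomology of the modes sits in weight zero, which is the complex of
  \<open>g\<close> with trivial coefficients.  The Lie derivative along its mode of index \<open>0\<close> is the total derivative
  \<open>T = d \<iota> + \<iota> d\<close>.  Being injective in positive degrees and homotopic to zero, \<open>T\<close> splits the
  cohomology of the quotient into two copies, in degrees \<open>n\<close> and \<open>n + 1\<close>, the second one embedded by
  \<open>\<iota>\<close>: on generators \<open>\<iota> \<beta>\<close> is \<open>\<Sum> \<beta>(u\<^sup>i, -) u\<^sub>i / k\<close>.
\<close>

text \<open>Three obstacles shape the proof. The bracket of modes satisfies the Jacobi identity on
  the nose but is skewsymmetric only up to relations, so the Cartan calculus is set up for such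
  brackets, without a quotient type. The Leibniz rule on modes is an infinite sum with finitely many
  nonzero terms; it is replaced by truncations valid for all large N, and vanishing at large indices
  is required jointly in all slots, as otherwise the values are not the coefficients of one
  polynomial. Finally, cochains with values in the quotient must be lifted to polynomials:
  representatives on generators are made multilinear by a linear section of \<partial> + \<lambda>_1
  + ... + \<lambda>_n, skewsymmetric by averaging over permutations, and are then extended by the
  universal property of the symmetric algebra. The same lift shows that exactly the image of T is
  lost. Since T raises the weight by one, the equation d\<omega> = T\<theta> couples neighbouring
  weights, and the two copies of the cohomology of g appear in weights 0 and 1.\<close>

abbreviation (input) lookup :: "('x \<Rightarrow>\<^sub>0 'r::zero) \<Rightarrow> 'x \<Rightarrow> 'r" where "lookup \<equiv> Poly_Mapping.lookup"
abbreviation (input) single :: "'x \<Rightarrow> 'r \<Rightarrow> 'x \<Rightarrow>\<^sub>0 'r::zero" where "single \<equiv> Poly_Mapping.single"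
abbreviation (input) pmap :: "('r::zero \<Rightarrow> 's::zero) \<Rightarrow> ('x \<Rightarrow>\<^sub>0 'r) \<Rightarrow> 'x \<Rightarrow>\<^sub>0 's" where "pmap \<equiv> Poly_Mapping.map"
abbreviation (input) keys :: "('x \<Rightarrow>\<^sub>0 'r::zero) \<Rightarrow> 'x set" where "keys \<equiv> Poly_Mapping.keys"

section \<open>Omission of list entries, in the form used by the differentials\<close>

definition del :: "nat \<Rightarrow> 'a list \<Rightarrow> 'a list" where
  "del i xs = map ((!) xs) (filter (\<lambda>m. m \<noteq> i) [0..<length xs])"

definition del2 :: "nat \<Rightarrow> nat \<Rightarrow> 'a list \<Rightarrow> 'a list" where
  "del2 i j xs = map ((!) xs) (filter (\<lambda>m. m \<noteq> i \<and> m \<noteq> j) [0..<length xs])"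

lemma upt_Suc_map: "[0..<Suc n] = 0 # map Suc [0..<n]"
  by (simp add: map_Suc_upt upt_conv_Cons)

lemma del_0 [simp]: "del 0 (x # xs) = xs"
  by (simp add: del_def upt_Suc_map filter_map comp_def map_nth del: upt_Suc)

lemma del_Suc [simp]: "del (Suc i) (x # xs) = x # del i xs"
  by (simp add: del_def upt_Suc_map filter_map comp_def del: upt_Suc)

lemma del2_0 [simp]: "del2 0 (Suc j) (x # xs) = del j xs"
  by (simp add: del_def del2_def upt_Suc_map filter_map comp_def del: upt_Suc)

lemma del2_Suc [simp]: "del2 (Suc i) (Suc j) (x # xs) = x # del2 i j xs"
  by (simp add: del2_def upt_Suc_map filter_map comp_def del: upt_Suc)

lemma length_del: "i < length xs \<Longrightarrow> length (del i xs) = length xs - 1"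
proof (induction xs arbitrary: i)
  case (Cons x xs) then show ?case by (cases i) auto
qed simp

lemma length_del2: "i < j \<Longrightarrow> j < length xs \<Longrightarrow> length (del2 i j xs) = length xs - 2"
proof (induction xs arbitrary: i j)
  case (Cons x xs)
  then show ?case by (cases j; cases i) (auto simp: length_del)
qed simp

lemma map_del: "map f (del i xs) = del i (map f xs)"
  by (simp add: del_def)

lemma map_del2: "map f (del2 i j xs) = del2 i j (map f xs)"
  by (simp add: del2_def)

section \<open>Cochains of a Lie algebra up to relations\<close>

text \<open>
  \<open>B\<close> is a Lie bracket modulo the subgroup \<open>R\<close> of relations, which acts on \<open>'v\<close> through \<open>A\<close>.
\<close>

locale lie_up_to =
  fixes A :: "'x::ab_group_add \<Rightarrow> 'v::comm_ring_1 \<Rightarrow> 'v"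
    and B :: "'x \<Rightarrow> 'x \<Rightarrow> 'x" and R :: "'x set"
  assumes A_add: "A (x + y) v = A x v + A y v"
    and A_add_right: "A x (v + w) = A x v + A x w"
    and B_add: "B (x + y) z = B x z + B y z"
    and B_add_right: "B x (y + z) = B x y + B x z"
    and B_skew: "B x y + B y x \<in> R"
    and B_jacobi: "B x (B y z) - B y (B x z) = B (B x y) z"
    and A_B: "A x (A y v) - A y (A x v) = A (B x y) v"
    and A_R: "r \<in> R \<Longrightarrow> A r v = 0"
    and B_R: "r \<in> R \<Longrightarrow> B r x = 0"
    and B_R_right: "r \<in> R \<Longrightarrow> B x r \<in> R"
begin

text \<open>The Lie derivative. The recursion peels off one argument and passes to the contraction
  of \<open>\<omega>\<close> with it, so identities follow by induction on the arguments with
  \<open>\<omega>\<close> generalised; the closed form is \<open>lieder_closed\<close>.\<close>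

fun lieder :: "'x \<Rightarrow> ('x list \<Rightarrow> 'v) \<Rightarrow> 'x list \<Rightarrow> 'v" where
  "lieder x \<omega> [] = A x (\<omega> [])"
| "lieder x \<omega> (z # zs) = lieder x (\<lambda>ys. \<omega> (z # ys)) zs - \<omega> (B x z # zs)"

text \<open>The recursion is Cartan's formula \<open>\<iota>\<^sub>x d = L\<^sub>x - d \<iota>\<^sub>x\<close>.\<close>

fun ced :: "('x list \<Rightarrow> 'v) \<Rightarrow> 'x list \<Rightarrow> 'v" where
  "ced \<omega> [] = 0"
| "ced \<omega> (x # xs) = lieder x \<omega> xs - ced (\<lambda>ys. \<omega> (x # ys)) xs"

definition alt :: "('x list \<Rightarrow> 'v) \<Rightarrow> bool" where
  "alt \<omega> \<longleftrightarrow>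
     (\<forall>xs x y zs. \<omega> (xs @ (x + y) # zs) = \<omega> (xs @ x # zs) + \<omega> (xs @ y # zs)) \<and>
     (\<forall>xs x y zs. \<omega> (xs @ x # y # zs) = - \<omega> (xs @ y # x # zs)) \<and>
     (\<forall>xs r zs. r \<in> R \<longrightarrow> \<omega> (xs @ r # zs) = 0)"

lemma altI:
  assumes "\<And>xs x y zs. \<omega> (xs @ (x + y) # zs) = \<omega> (xs @ x # zs) + \<omega> (xs @ y # zs)"
    and "\<And>xs x y zs. \<omega> (xs @ x # y # zs) = - \<omega> (xs @ y # x # zs)"
    and "\<And>xs r zs. r \<in> R \<Longrightarrow> \<omega> (xs @ r # zs) = 0"
  shows "alt \<omega>"
  using assms unfolding alt_def by blast

lemma alt_add: "alt \<omega> \<Longrightarrow> \<omega> (xs @ (x + y) # zs) = \<omega> (xs @ x # zs) + \<omega> (xs @ y # zs)"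
  and alt_swap: "alt \<omega> \<Longrightarrow> \<omega> (xs @ x # y # zs) = - \<omega> (xs @ y # x # zs)"
  and alt_R: "alt \<omega> \<Longrightarrow> r \<in> R \<Longrightarrow> \<omega> (xs @ r # zs) = 0"
  unfolding alt_def by blast+

lemma alt_add0: "alt \<omega> \<Longrightarrow> \<omega> ((x + y) # zs) = \<omega> (x # zs) + \<omega> (y # zs)"
  and alt_swap0: "alt \<omega> \<Longrightarrow> \<omega> (x # y # zs) = - \<omega> (y # x # zs)"
  and alt_R0: "alt \<omega> \<Longrightarrow> r \<in> R \<Longrightarrow> \<omega> (r # zs) = 0"
  using alt_add[of \<omega> "[]" x y zs] alt_swap[of \<omega> "[]" x y zs] alt_R[of \<omega> r "[]" zs] by simp_all

lemma alt_zero: "alt \<omega> \<Longrightarrow> \<omega> (xs @ 0 # zs) = 0"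
  using alt_add[of \<omega> xs 0 0 zs] by simp

lemma alt_minus: "alt \<omega> \<Longrightarrow> \<omega> (xs @ (- x) # zs) = - \<omega> (xs @ x # zs)"
  using alt_add[of \<omega> xs x "- x" zs] alt_zero[of \<omega> xs zs] by (simp add: eq_neg_iff_add_eq_0 add.commute)

lemma alt_diff: "alt \<omega> \<Longrightarrow> \<omega> (xs @ (x - y) # zs) = \<omega> (xs @ x # zs) - \<omega> (xs @ y # zs)"
  using alt_add[of \<omega> xs x "- y" zs] alt_minus[of \<omega> xs y zs] by simp

lemma alt_sum: "alt \<omega> \<Longrightarrow> \<omega> (xs @ (\<Sum>i\<in>I. f i) # zs) = (\<Sum>i\<in>I. \<omega> (xs @ f i # zs))"
  by (induction I rule: infinite_finite_induct) (simp_all add: alt_zero alt_add)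

lemmas alt_diff0 = alt_diff[of _ "[]", simplified]
lemmas alt_zero0 = alt_zero[of _ "[]", simplified]
lemmas alt_sum0 = alt_sum[of _ "[]", simplified]

lemma alt_iota: "alt \<omega> \<Longrightarrow> alt (\<lambda>ys. \<omega> (x # ys))"
proof -
  assume a: "alt \<omega>"
  show ?thesis
  proof (rule altI)
    show "\<omega> (x # xs @ (u + v) # zs) = \<omega> (x # xs @ u # zs) + \<omega> (x # xs @ v # zs)" for xs u v zs
      using alt_add[OF a, of "x # xs" u v zs] by simp
    show "\<omega> (x # xs @ u # v # zs) = - \<omega> (x # xs @ v # u # zs)" for xs u v zs
      using alt_swap[OF a, of "x # xs" u v zs] by simp
    show "\<omega> (x # xs @ r # zs) = 0" if "r \<in> R" for xs r zs
      using alt_R[OF a that, of "x # xs" zs] by simp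
  qed
qed

lemma A_zero [simp]: "A x 0 = 0"
  using A_add_right[of x 0 0] by simp

lemma A_zero_left [simp]: "A 0 v = 0"
  using A_add[of 0 0 v] by simp

lemma A_minus: "A x (- v) = - A x v"
  using A_add_right[of x v "- v"] by (simp add: eq_neg_iff_add_eq_0 add.commute)

lemma lieder_zero: "lieder x (\<lambda>_. 0) zs = 0"
  by (induction zs) auto

lemma lieder_add: "lieder x (\<lambda>zs. \<omega> zs + \<eta> zs) zs = lieder x \<omega> zs + lieder x \<eta> zs"
  by (induction zs arbitrary: \<omega> \<eta>) (auto simp: A_add_right)

lemma lieder_minus: "lieder x (\<lambda>zs. - \<omega> zs) zs = - lieder x \<omega> zs"
  by (induction zs arbitrary: \<omega>) (auto simp: A_minus)

lemma lieder_diff: "lieder x (\<lambda>zs. \<omega> zs - \<eta> zs) zs = lieder x \<omega> zs - lieder x \<eta> zs"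
  using lieder_add[of x \<omega> "\<lambda>zs. - \<eta> zs" zs] by (simp add: lieder_minus)

lemma ced_zero: "ced (\<lambda>_. 0) zs = 0"
  by (induction zs) (auto simp: lieder_zero)

lemma ced_add: "ced (\<lambda>zs. \<omega> zs + \<eta> zs) zs = ced \<omega> zs + ced \<eta> zs"
  by (induction zs arbitrary: \<omega> \<eta>) (auto simp: lieder_add)

lemma ced_minus: "ced (\<lambda>zs. - \<omega> zs) zs = - ced \<omega> zs"
  by (induction zs arbitrary: \<omega>) (auto simp: lieder_minus)

lemma ced_diff: "ced (\<lambda>zs. \<omega> zs - \<eta> zs) zs = ced \<omega> zs - ced \<eta> zs"
  using ced_add[of \<omega> "\<lambda>zs. - \<eta> zs" zs] by (simp add: ced_minus)

lemma lieder_add_left: "alt \<omega> \<Longrightarrow> lieder (x + y) \<omega> zs = lieder x \<omega> zs + lieder y \<omega> zs"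
proof (induction zs arbitrary: \<omega>)
  case (Cons z zs)
  then show ?case using Cons.IH[OF alt_iota[OF Cons.prems, of z]]
    by (simp add: B_add alt_add0)
qed (simp add: A_add)

lemma lieder_R: "alt \<omega> \<Longrightarrow> r \<in> R \<Longrightarrow> lieder r \<omega> zs = 0"
proof (induction zs arbitrary: \<omega>)
  case (Cons z zs)
  then show ?case using Cons.IH[OF alt_iota[OF Cons.prems(1), of z]]
    by (simp add: B_R alt_zero0)
qed (simp add: A_R)

text \<open>All three conditions pass from \<open>\<omega>\<close> to its contractions, which
  settles the prefix \<open>xs\<close> by induction. At the head, vanishing on relations survives
  because \<open>B x\<close> maps \<open>R\<close> into itself.\<close>

lemma alt_lieder:
  assumes "alt \<omega>"
  shows "alt (lieder x \<omega>)"
proof (rule altI)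
  show "lieder x \<omega> (xs @ (a + b) # zs) = lieder x \<omega> (xs @ a # zs) + lieder x \<omega> (xs @ b # zs)" for xs a b zs
    using assms
  proof (induction xs arbitrary: \<omega>)
    case Nil
    then show ?case
      using lieder_add[of x "\<lambda>ys. \<omega> (a # ys)" "\<lambda>ys. \<omega> (b # ys)" zs]
      by (simp add: alt_add0 B_add_right)
  next
    case (Cons z xs)
    then show ?case
      using Cons.IH[OF alt_iota[OF Cons.prems, of z]] alt_add[OF Cons.prems, of "B x z # xs" a b zs]
      by simp
  qed
  show "lieder x \<omega> (xs @ a # b # zs) = - lieder x \<omega> (xs @ b # a # zs)" for xs a b zs
    using assms
  proof (induction xs arbitrary: \<omega>)
    case Nil
    have "lieder x (\<lambda>ys. \<omega> (a # b # ys)) zs = - lieder x (\<lambda>ys. \<omega> (b # a # ys)) zs"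
      using lieder_minus[of x "\<lambda>ys. \<omega> (b # a # ys)" zs] alt_swap0[OF Nil, of a b] by presburger
    then show ?case
      using alt_swap0[OF Nil, of a "B x b" zs] alt_swap0[OF Nil, of "B x a" b zs] by simp
  next
    case (Cons z xs)
    then show ?case
      using Cons.IH[OF alt_iota[OF Cons.prems, of z]] alt_swap[OF Cons.prems, of "B x z # xs" a b zs]
      by simp
  qed
  show "lieder x \<omega> (xs @ r # zs) = 0" if "r \<in> R" for xs r zs
    using assms
  proof (induction xs arbitrary: \<omega>)
    case Nil
    then show ?case by (simp add: alt_R0 that lieder_zero B_R_right)
  next
    case (Cons z xs)
    then show ?case
      using Cons.IH[OF alt_iota[OF Cons.prems, of z]] alt_R[OF Cons.prems that, of "B x z # xs" zs]
      by simp
  qed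
qed

text \<open>On the value this is the assumption \<open>A_B\<close>, on each argument the Jacobi
  identity of \<open>B\<close>. In the induction the mixed terms, with one operator on the head and
  the other on the tail, cancel in the commutator.\<close>

lemma lieder_commutator:
  assumes "alt \<omega>"
  shows "lieder x (lieder y \<omega>) zs - lieder y (lieder x \<omega>) zs = lieder (B x y) \<omega> zs"
  using assms
proof (induction zs arbitrary: \<omega>)
  case Nil
  then show ?case by (simp add: A_B)
next
  case (Cons z zs)
  have 1: "lieder u (\<lambda>ys. lieder v (\<lambda>ys. \<omega> (z # ys)) ys - \<omega> (B v z # ys)) zs =
     lieder u (lieder v (\<lambda>ys. \<omega> (z # ys))) zs - lieder u (\<lambda>ys. \<omega> (B v z # ys)) zs" for u v
    by (rule lieder_diff)
  show ?case
    using Cons.IH[OF alt_iota[OF Cons.prems, of z]]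
      alt_diff0[OF Cons.prems, of "B x (B y z)" "B y (B x z)" zs]
    by (simp add: 1 B_jacobi algebra_simps)
qed

text \<open>Two steps of the recursion at once: in this shape every term visibly changes sign when x
  and y are exchanged, up to the relation \<open>B x y + B y x\<close>.\<close>

lemma ced_lieder_aux:
  assumes "alt \<omega>"
  shows "ced \<omega> (x # y # zs) =
    lieder x (\<lambda>ys. \<omega> (y # ys)) zs - lieder y (\<lambda>ys. \<omega> (x # ys)) zs - \<omega> (B x y # zs)
     + ced (\<lambda>ys. \<omega> (x # y # ys)) zs"
  by simp

lemma alt_ced:
  assumes "alt \<omega>"
  shows "alt (ced \<omega>)"
proof (rule altI)
  show "ced \<omega> (xs @ (a + b) # zs) = ced \<omega> (xs @ a # zs) + ced \<omega> (xs @ b # zs)" for xs a b zs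
    using assms
  proof (induction xs arbitrary: \<omega>)
    case Nil
    then show ?case
      using ced_add[of "\<lambda>ys. \<omega> (a # ys)" "\<lambda>ys. \<omega> (b # ys)" zs]
      by (simp add: alt_add0 lieder_add_left)
  next
    case (Cons z xs)
    then show ?case
      using Cons.IH[OF alt_iota[OF Cons.prems, of z]] alt_add[OF alt_lieder[OF Cons.prems, of z], of xs a b zs]
      by simp
  qed
  show "ced \<omega> (xs @ a # b # zs) = - ced \<omega> (xs @ b # a # zs)" for xs a b zs
    using assms
  proof (induction xs arbitrary: \<omega>)
    case Nil
    have "ced (\<lambda>ys. \<omega> (a # b # ys)) zs = - ced (\<lambda>ys. \<omega> (b # a # ys)) zs"
      using ced_minus[of "\<lambda>ys. \<omega> (b # a # ys)" zs] alt_swap0[OF Nil, of a b] by presburger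
    \<comment> \<open>Here skewsymmetry of the bracket modulo \<open>R\<close> suffices, because
      \<open>\<omega>\<close> vanishes on \<open>R\<close>.\<close>
    moreover have "\<omega> (B a b # zs) = - \<omega> (B b a # zs)"
      using alt_R0[OF Nil B_skew[of a b], of zs] alt_add0[OF Nil] by (simp add: eq_neg_iff_add_eq_0)
    ultimately show ?case
      using ced_lieder_aux[OF Nil, of a b zs] ced_lieder_aux[OF Nil, of b a zs] by simp
  next
    case (Cons z xs)
    then show ?case
      using Cons.IH[OF alt_iota[OF Cons.prems, of z]] alt_swap[OF alt_lieder[OF Cons.prems, of z], of xs a b zs]
      by simp
  qed
  show "ced \<omega> (xs @ r # zs) = 0" if "r \<in> R" for xs r zs
    using assms
  proof (induction xs arbitrary: \<omega>)
    case Nil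
    then show ?case by (simp add: alt_R0 that lieder_R ced_zero)
  next
    case (Cons z xs)
    then show ?case
      using Cons.IH[OF alt_iota[OF Cons.prems, of z]] alt_R[OF alt_lieder[OF Cons.prems, of z] that, of xs zs]
      by simp
  qed
qed

text \<open>Contracting with the first argument y turns the claim into the commutator formula for
  \<open>lieder x\<close> and \<open>lieder y\<close>, plus the claim for the contraction of
  \<open>\<omega>\<close>.\<close>

lemma lieder_ced:
  assumes "alt \<omega>"
  shows "lieder x (ced \<omega>) zs = ced (lieder x \<omega>) zs"
  using assms
proof (induction zs arbitrary: \<omega>)
  case (Cons y zs)
  have "lieder x (ced \<omega>) (y # zs) = lieder x (lieder y \<omega>) zs - lieder x (ced (\<lambda>ys. \<omega> (y # ys))) zs
     - lieder (B x y) \<omega> zs + ced (\<lambda>ys. \<omega> (B x y # ys)) zs"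
    by (simp add: lieder_diff)
  also have "\<dots> = lieder y (lieder x \<omega>) zs - ced (lieder x (\<lambda>ys. \<omega> (y # ys))) zs + ced (\<lambda>ys. \<omega> (B x y # ys)) zs"
    using lieder_commutator[OF Cons.prems, of x y zs] Cons.IH[OF alt_iota[OF Cons.prems, of y]]
    by (simp add: algebra_simps)
  also have "\<dots> = ced (lieder x \<omega>) (y # zs)"
    by (simp add: ced_diff)
  finally show ?case .
qed simp

text \<open>Contracted with x, the square of d is L d - d (L - d \<iota>) with L the Lie derivative
  along x; the terms L d and d L cancel by \<open>lieder_ced\<close>, and d d \<iota> vanishes by
  induction.\<close>

lemma ced_ced:
  assumes "alt \<omega>"
  shows "ced (ced \<omega>) zs = 0"
  using assms
proof (induction zs arbitrary: \<omega>)
  case (Cons x zs)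
  then show ?case
    using lieder_ced[OF Cons.prems, of x zs] Cons.IH[OF alt_iota[OF Cons.prems, of x]]
    by (simp add: ced_diff)
qed simp

end

section \<open>Explicit formulas and arbitrary permutations of arguments\<close>

context lie_up_to begin

lemma alt_update:
  assumes "alt \<omega>" "j < length ys"
  shows "\<omega> (ys[j := z]) = (- 1) ^ j * \<omega> (z # del j ys)"
  using assms
proof (induction ys arbitrary: j \<omega>)
  case (Cons y ys)
  show ?case
  proof (cases j)
    case (Suc i)
    then show ?thesis
      using Cons.IH[OF alt_iota[OF Cons.prems(1), of y], of i] Cons.prems(2)
        alt_swap0[OF Cons.prems(1), of y z "del i ys"] by simp
  qed simp
qed simp

lemma lieder_closed:
  "lieder x \<omega> ys = A x (\<omega> ys) - (\<Sum>j<length ys. \<omega> (ys[j := B x (ys ! j)]))"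
  by (induction ys arbitrary: \<omega>) (simp_all add: sum.lessThan_Suc_shift del: sum.lessThan_Suc)

text \<open>Unfolds the recursion into the Chevalley-Eilenberg formula, in the shape shared by
  \<open>lie_d\<close> and \<open>pv_d\<close>. Alternation is needed to bring the bracket, which
  the recursion leaves in slot j, to the front.\<close>

lemma ced_closed:
  assumes "alt \<omega>"
  shows "ced \<omega> xs = (\<Sum>i<length xs. (- 1) ^ i * A (xs ! i) (\<omega> (del i xs)))
    + (\<Sum>j<length xs. \<Sum>i<j. (- 1) ^ (i + j) * \<omega> (B (xs ! i) (xs ! j) # del2 i j xs))"
  using assms
proof (induction xs arbitrary: \<omega>)
  case (Cons x xs)
  have 1: "lieder x \<omega> xs = A x (\<omega> xs) - (\<Sum>j<length xs. (- 1) ^ j * \<omega> (B x (xs ! j) # del j xs))"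
    by (simp add: lieder_closed alt_update[OF Cons.prems])
  have 2: "\<omega> (x # B (xs ! i) (xs ! j) # del2 i j xs) = - \<omega> (B (xs ! i) (xs ! j) # x # del2 i j xs)" for i j
    by (rule alt_swap0[OF Cons.prems])
  show ?case
    by (simp add: 1 2 Cons.IH[OF alt_iota[OF Cons.prems, of x]] sum.lessThan_Suc_shift
        sum_negf sum.distrib sum_subtractf algebra_simps del: sum.lessThan_Suc)
qed simp

lemma alt_move:
  assumes "alt \<omega>"
  shows "\<omega> (ps @ x # qs @ rs) = (- 1) ^ length qs * \<omega> (ps @ qs @ x # rs)"
proof (induction qs arbitrary: ps)
  case (Cons q qs)
  show ?case
    using Cons.IH[of "ps @ [q]"] alt_swap[OF assms, of ps x q "qs @ rs"] by simp
qed simp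

lemma alt_transpose:
  assumes "alt \<omega>" "a < b" "b < length xs"
  shows "\<omega> (permute_list (Transposition.transpose a b) xs) = - \<omega> xs"
proof -
  define ps qs rs where "ps = take a xs" and "qs = take (b - Suc a) (drop (Suc a) xs)"
    and "rs = drop (Suc b) xs"
  have xs: "xs = ps @ xs ! a # qs @ xs ! b # rs"
  proof -
    have "xs = take a xs @ xs ! a # drop (Suc a) xs"
      using assms by (simp add: id_take_nth_drop)
    moreover have "drop (Suc a) xs = qs @ xs ! b # rs"
      using assms id_take_nth_drop[of "b - Suc a" "drop (Suc a) xs"] by (simp add: qs_def rs_def)
    ultimately show ?thesis by (simp add: ps_def)
  qed
  have len: "length ps = a" "length qs = b - Suc a" using assms by (auto simp: ps_def qs_def)
  have "permute_list (Transposition.transpose a b) xs = ps @ xs ! b # qs @ xs ! a # rs"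
  proof (rule nth_equalityI)
    show "length (permute_list (Transposition.transpose a b) xs) = length (ps @ xs ! b # qs @ xs ! a # rs)"
      by (subst xs) simp
    fix i assume "i < length (permute_list (Transposition.transpose a b) xs)"
    then have i: "i < length xs" by simp
    have tr: "Transposition.transpose a b permutes {..<length xs}"
      using assms by (intro permutes_swap_id) auto
    have "permute_list (Transposition.transpose a b) xs ! i = xs ! Transposition.transpose a b i"
      using permute_list_nth[OF tr i] .
    moreover have "(ps @ xs ! b # qs @ xs ! a # rs) ! i = (if i = a then xs ! b else if i = b then xs ! a else xs ! i)"
    proof -
      have e: "xs ! i = (ps @ xs ! a # qs @ xs ! b # rs) ! i" using xs by simp
      show ?thesis
        unfolding e using assms(2) len by (auto simp: nth_append nth_Cons split: nat.split)
    qed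
    ultimately show "permute_list (Transposition.transpose a b) xs ! i = (ps @ xs ! b # qs @ xs ! a # rs) ! i"
      by (auto simp: Transposition.transpose_def)
  qed
  \<comment> \<open>The first move passes \<open>length qs + 1\<close> arguments and the second
    \<open>length qs\<close>, so the two signs are opposite.\<close>
  moreover have "\<omega> (ps @ xs ! b # qs @ xs ! a # rs) = - \<omega> (ps @ xs ! a # qs @ xs ! b # rs)"
    using alt_move[OF assms(1), of ps "xs ! b" "qs @ [xs ! a]" rs]
      alt_move[OF assms(1), of ps "xs ! a" qs "xs ! b # rs"] by simp
  ultimately show ?thesis using xs by simp
qed

lemma alt_permute:
  assumes "alt \<omega>" "\<pi> permutes {..<n}" "length xs = n"
  shows "\<omega> (permute_list \<pi> xs) = of_int (sign \<pi>) * \<omega> xs"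
  using assms(2) finite_lessThan assms(3)
proof (induction arbitrary: xs rule: permutes_induct)
  case id
  then show ?case by simp
next
  case (swap a b p)
  have tr: "\<omega> (permute_list (Transposition.transpose a b) xs) = - \<omega> xs"
  proof (cases "a < b")
    case False
    then have "b < a" using swap by auto
    then show ?thesis using alt_transpose[OF assms(1), of b a xs] swap
      by (simp add: transpose_commute)
  qed (use alt_transpose[OF assms(1), of a b xs] swap in simp)
  have "permute_list (Transposition.transpose a b \<circ> p) xs = permute_list p (permute_list (Transposition.transpose a b) xs)"
    by (rule permute_list_compose) (use swap in auto)
  moreover have "sign (Transposition.transpose a b \<circ> p) = - sign p"
    using swap by (simp add: sign_compose permutation_swap_id sign_swap_id permutes_imp_permutation[of "{..<n}"])
  ultimately show ?case using swap tr by (simp add: comp_def)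
qed

text \<open>The ring of values is arbitrary here, so that only twice the value can be shown to
  vanish; division by 2 is left to the application.\<close>

lemma alt_eq_zero_if_dup:
  assumes "alt \<omega>" "a < b" "b < length xs" "xs ! a = xs ! b"
  shows "\<omega> xs + \<omega> xs = 0"
proof -
  have "permute_list (Transposition.transpose a b) xs = xs"
    using assms by (intro nth_equalityI) (auto simp: permute_list_def Transposition.transpose_def)
  then show ?thesis using alt_transpose[OF assms(1-3)] by simp
qed

end

section \<open>Polynomials\<close>

lemma additive_0:
  fixes F :: "'a::monoid_add \<Rightarrow> 'b::ab_group_add"
  assumes "\<And>P Q. F (P + Q) = F P + F Q"
  shows "F 0 = 0"
  using assms[of 0 0] by simp

lemma additive_sum:
  fixes F :: "'a::comm_monoid_add \<Rightarrow> 'b::ab_group_add"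
  assumes "\<And>P Q. F (P + Q) = F P + F Q"
  shows "F (\<Sum>i\<in>I. g i) = (\<Sum>i\<in>I. F (g i))"
  by (induction I rule: infinite_finite_induct) (simp_all add: assms additive_0[of F])

lemma additive_uminus:
  fixes F :: "'a::ab_group_add \<Rightarrow> 'b::ab_group_add"
  assumes "\<And>P Q. F (P + Q) = F P + F Q"
  shows "F (- P) = - F P"
  using assms[of "- P" P] additive_0[of F, OF assms] by (simp add: eq_neg_iff_add_eq_0)

lemma additive_diff:
  fixes F :: "'a::ab_group_add \<Rightarrow> 'b::ab_group_add"
  assumes "\<And>P Q. F (P + Q) = F P + F Q"
  shows "F (P - Q) = F P - F Q"
  using assms[of P "- Q"] additive_uminus[of F Q, OF assms] by simp

definition additive_closed :: "'a::ab_group_add set \<Rightarrow> bool" where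
  "additive_closed B \<longleftrightarrow> 0 \<in> B \<and> (\<forall>x\<in>B. \<forall>y\<in>B. x - y \<in> B)"

lemma mem_coset: "y \<in> x +o B \<longleftrightarrow> y - x \<in> B" for x :: "'a::ab_group_add"
  by (auto simp: elt_set_plus_def intro: bexI[of _ "y - x"])

lemma coset_eq_iff:
  assumes "additive_closed B"
  shows "x +o B = y +o B \<longleftrightarrow> x - y \<in> B"
proof
  assume "x +o B = y +o B"
  then show "x - y \<in> B" using mem_coset[of x x B] mem_coset[of x y B] assms by (simp add: additive_closed_def)
next
  have d: "a - b \<in> B" if "a \<in> B" "b \<in> B" for a b using that assms by (simp add: additive_closed_def)
  assume a: "x - y \<in> B"
  have "0 \<in> B" using assms by (simp add: additive_closed_def)
  then have "y - x \<in> B" using d[of 0 "x - y"] a by simp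
  then have "z - x \<in> B \<longleftrightarrow> z - y \<in> B" for z
    using d[of "z - x" "y - x"] d[of "z - y" "x - y"] a by auto
  then show "x +o B = y +o B" by (intro set_eqI) (simp add: mem_coset)
qed

text \<open>Adding \<open>C\<close> fills up the image of \<open>B\<close>, which may be smaller
  (for instance when \<open>T\<close> is zero). This is the shape of \<open>apply_class\<close> and
  of the scalar multiples of cohomology classes.\<close>

lemma coset_image:
  assumes "\<And>x y. T (x + y) = T x + T y" "additive_closed B" "additive_closed C" "\<And>x. x \<in> B \<Longrightarrow> T x \<in> C"
  shows "T ` (x +o B) + C = T x +o C"
proof -
  have "a + b \<in> C" if "a \<in> C" "b \<in> C" for a b
  proof -
    have "a - (0 - b) \<in> C" using that assms(3) unfolding additive_closed_def by blast
    then show ?thesis by simp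
  qed
  moreover have "0 \<in> B" using assms(2) by (simp add: additive_closed_def)
  ultimately show ?thesis
    using additive_0[of T, OF assms(1)] assms(4)
    by (fastforce simp: elt_set_plus_def set_plus_def assms(1) add.assoc)
qed

lemma coset_add:
  assumes "additive_closed B"
  shows "(x +o B) + (y +o B) = (x + y) +o B"
proof -
  have "B + B = B"
    using coset_image[of "\<lambda>x. x" B B 0] assms by (simp add: elt_set_plus_def)
  then show ?thesis by (simp add: set_plus_rearrange)
qed

section \<open>Polynomials as sums of monomials\<close>

lemma poly_mapping_sum_single:
  fixes P :: "'a \<Rightarrow>\<^sub>0 'b::comm_monoid_add"
  shows "P = (\<Sum>e\<in>keys P. single e (lookup P e))"
proof (rule poly_mapping_eqI)
  fix k
  have "(\<Sum>e\<in>keys P. lookup (single e (lookup P e)) k)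
    = (\<Sum>e\<in>keys P. if e = k then lookup P k else 0)"
    by (intro sum.cong) (auto simp: lookup_single when_def)
  then show "lookup P k = lookup
      (\<Sum>e\<in>keys P. single e (lookup P e)) k"
    by (simp add: lookup_sum sum.delta in_keys_iff)
qed

text \<open>Most identities between polynomials are reduced to monomials in this way. Limiting the
  exponents to \<open>keys P\<close> lets restrictions on the variables of P reach the monomial
  case.\<close>

lemma poly_mapping_additive_eq:
  fixes F :: "('a \<Rightarrow>\<^sub>0 'c::comm_monoid_add) \<Rightarrow> 'b::ab_group_add"
  assumes F: "\<And>P Q. F (P + Q) = F P + F Q" and G: "\<And>P Q. G (P + Q) = G P + G Q"
    and "\<And>e c. e \<in> keys P \<Longrightarrow> F (single e c) = G (single e c)"
  shows "F P = G P"
proof -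
  let ?s = "\<Sum>e\<in>keys P. single e (lookup P e)"
  have "F ?s = G ?s"
    using assms(3) by (simp add: additive_sum[of F, OF F] additive_sum[of G, OF G])
  then show ?thesis using poly_mapping_sum_single[of P] by simp
qed

lemma poly_additive_eq:
  fixes F :: "'c::comm_monoid_add poly \<Rightarrow> 'b::ab_group_add"
  assumes F: "\<And>P Q. F (P + Q) = F P + F Q" and G: "\<And>P Q. G (P + Q) = G P + G Q"
    and "\<And>a m. F (monom a m) = G (monom a m)"
  shows "F p = G p"
proof -
  have "p = (\<Sum>i\<le>degree p. monom (coeff p i) i)"
    by (rule poly_eqI) (simp add: coeff_sum sum.delta coeff_eq_0 not_le)
  moreover have "F (\<Sum>i\<le>degree p. monom (coeff p i) i) = G (\<Sum>i\<le>degree p. monom (coeff p i) i)"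
    using assms(3) by (simp add: additive_sum[of F, OF F] additive_sum[of G, OF G])
  ultimately show ?thesis by simp
qed

lemma poly_additive_eq2:
  fixes F :: "'c::comm_monoid_add poly \<Rightarrow> 'd::comm_monoid_add poly \<Rightarrow> 'b::ab_group_add"
  assumes "\<And>P Q q. F (P + Q) q = F P q + F Q q" "\<And>P Q q. G (P + Q) q = G P q + G Q q"
    and "\<And>P Q q. F q (P + Q) = F q P + F q Q" "\<And>P Q q. G q (P + Q) = G q P + G q Q"
    and "\<And>a m b l. F (monom a m) (monom b l) = G (monom a m) (monom b l)"
  shows "F p q = G p q"
proof (rule poly_additive_eq[of "\<lambda>p. F p q" "\<lambda>p. G p q"])
  show "F (monom a m) q = G (monom a m) q" for a m
    by (rule poly_additive_eq[of "F (monom a m)" "G (monom a m)"]) (simp_all add: assms)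
qed (simp_all add: assms)

text \<open>The extension of a family of maps on monomials. The range of summation depends on p, so
  additivity needs \<open>f m 0 = 0\<close> in order to pad to a common bound.\<close>

definition psum :: "(nat \<Rightarrow> 'a::zero \<Rightarrow> 'b::comm_monoid_add) \<Rightarrow> 'a poly \<Rightarrow> 'b" where
  "psum f p = (\<Sum>m\<le>degree p. f m (coeff p m))"

lemma psum_bound:
  assumes "\<And>m. f m 0 = 0" "degree p \<le> N"
  shows "psum f p = (\<Sum>m\<le>N. f m (coeff p m))"
  unfolding psum_def
  by (rule sum.mono_neutral_left) (use assms in \<open>auto simp: coeff_eq_0\<close>)

lemma psum_add:
  fixes f :: "nat \<Rightarrow> 'a::comm_monoid_add \<Rightarrow> 'b::ab_group_add"
  assumes "\<And>m a b. f m (a + b) = f m a + f m b"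
  shows "psum f (p + q) = psum f p + psum f q"
proof -
  have 0: "f m 0 = 0" for m using additive_0[of "f m", OF assms] .
  let ?N = "max (degree p) (degree q)"
  have "psum f (p + q) = (\<Sum>m\<le>?N. f m (coeff (p + q) m))"
    by (rule psum_bound) (auto simp: 0 degree_add_le)
  also have "\<dots> = psum f p + psum f q"
    using psum_bound[of f p ?N, OF 0] psum_bound[of f q ?N, OF 0] by (simp add: assms sum.distrib)
  finally show ?thesis .
qed

lemma psum_monom:
  assumes "\<And>m. f m 0 = 0"
  shows "psum f (monom a m) = f m a"
proof -
  have "psum f (monom a m) = (\<Sum>i\<le>m. f i (coeff (monom a m) i))"
    by (rule psum_bound) (simp_all add: assms degree_monom_le)
  also have "\<dots> = (\<Sum>i\<le>m. if i = m then f m a else 0)"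
    by (intro sum.cong) (auto simp: assms)
  finally show ?thesis by (simp add: sum.delta)
qed

lemma psum_add_fun:
  fixes f :: "nat \<Rightarrow> 'a::zero \<Rightarrow> 'b::ab_group_add"
  shows "psum (\<lambda>m a. f m a + g m a) p = psum f p + psum g p"
  by (simp add: psum_def sum.distrib)

section \<open>Evaluation, coefficients and exponents of multivariate polynomials\<close>

definition mono_at :: "('x \<Rightarrow> 's::comm_ring_1) \<Rightarrow> ('x \<Rightarrow>\<^sub>0 nat) \<Rightarrow> 's" where
  "mono_at \<sigma> e = (\<Prod>x\<in>keys e. \<sigma> x ^ lookup e x)"

lemma mono_at_superset:
  assumes "finite S" "keys e \<subseteq> S"
  shows "mono_at \<sigma> e = (\<Prod>x\<in>S. \<sigma> x ^ lookup e x)"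
  unfolding mono_at_def
  by (rule prod.mono_neutral_left) (use assms in \<open>auto simp: in_keys_iff\<close>)

lemma mono_at_0 [simp]: "mono_at \<sigma> 0 = 1"
  by (simp add: mono_at_def)

lemma mono_at_add: "mono_at \<sigma> (e + e') = mono_at \<sigma> e * mono_at \<sigma> e'"
proof -
  let ?S = "keys e \<union> keys e'"
  have "mono_at \<sigma> (e + e') = (\<Prod>x\<in>?S. \<sigma> x ^ lookup (e + e') x)"
    by (rule mono_at_superset) (auto simp: Poly_Mapping.keys_add)
  also have "\<dots> = mono_at \<sigma> e * mono_at \<sigma> e'"
    using mono_at_superset[of ?S e \<sigma>] mono_at_superset[of ?S e' \<sigma>]
    by (simp add: lookup_add power_add prod.distrib)
  finally show ?thesis .
qed

lemma mono_at_single: "mono_at \<sigma> (single x k) = \<sigma> x ^ k"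
  by (cases "k = 0") (auto simp: mono_at_def)

lemma peval_superset:
  assumes "h 0 = 0" "finite S" "keys P \<subseteq> S"
  shows "peval h \<sigma> P = (\<Sum>e\<in>S. h (lookup P e) * mono_at \<sigma> e)"
  unfolding peval_def mono_at_def
  by (rule sum.mono_neutral_left) (use assms in \<open>auto simp: in_keys_iff\<close>)

lemma peval_add:
  fixes h :: "'r::comm_ring_1 \<Rightarrow> 's::comm_ring_1"
  assumes h: "\<And>a b. h (a + b) = h a + h b"
  shows "peval h \<sigma> (P + Q) = peval h \<sigma> P + peval h \<sigma> Q"
proof -
  have 0: "h 0 = 0" using additive_0[of h, OF h] .
  let ?S = "keys P \<union> keys Q"
  have "peval h \<sigma> (P + Q) = (\<Sum>e\<in>?S. h (lookup (P + Q) e) * mono_at \<sigma> e)"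
    by (rule peval_superset) (auto simp: 0 Poly_Mapping.keys_add)
  then show ?thesis
    using peval_superset[of h, OF 0, of ?S P \<sigma>] peval_superset[of h, OF 0, of ?S Q \<sigma>]
    by (simp add: lookup_add h algebra_simps sum.distrib)
qed

lemma peval_single:
  assumes "h 0 = 0"
  shows "peval h \<sigma> (single e c) = h c * mono_at \<sigma> e"
  using peval_superset[of h "{e}" "single e c" \<sigma>] assms by simp

lemma peval_Cst: "h 0 = 0 \<Longrightarrow> peval h \<sigma> (Cst c) = h c"
  by (simp add: Cst_def peval_single)

lemma peval_Var: "h 0 = 0 \<Longrightarrow> h 1 = 1 \<Longrightarrow> peval h \<sigma> (Var x) = \<sigma> x"
  by (simp add: Var_def peval_single mono_at_single)

lemma peval_mult:
  fixes h :: "'r::comm_ring_1 \<Rightarrow> 's::comm_ring_1"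
  assumes h: "\<And>a b. h (a + b) = h a + h b" and m: "\<And>a b. h (a * b) = h a * h b"
  shows "peval h \<sigma> (P * Q) = peval h \<sigma> P * peval h \<sigma> Q"
proof -
  have 0: "h 0 = 0" using additive_0[of h, OF h] .
  note a = peval_add[of h, OF h]
  show ?thesis
  proof (rule poly_mapping_additive_eq[of "\<lambda>P. peval h \<sigma> (P * Q)" "\<lambda>P. peval h \<sigma> P * peval h \<sigma> Q"])
    fix e c
    show "peval h \<sigma> (single e c * Q) = peval h \<sigma> (single e c) * peval h \<sigma> Q"
      by (rule poly_mapping_additive_eq[of "\<lambda>Q. peval h \<sigma> (single e c * Q)"
            "\<lambda>Q. peval h \<sigma> (single e c) * peval h \<sigma> Q"])
        (simp_all add: a algebra_simps mult_single peval_single[of h, OF 0] mono_at_add m)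
  qed (simp_all add: a algebra_simps)
qed

lemma Cst_add: "Cst (a + b) = Cst a + Cst (b::'a::comm_monoid_add)"
  and Cst_mult: "Cst (c * d) = Cst c * Cst (d :: 'b::comm_ring_1)"
  and Cst_0 [simp]: "Cst 0 = 0"
  and Cst_1 [simp]: "Cst (1::'b) = 1"
  by (simp_all add: Cst_def single_add mult_single)

lemma Cst_mult_single: "Cst c * single e d = single e (c * d :: 'r::comm_ring_1)"
  by (simp add: Cst_def mult_single)

lemma Var_power: "Var x ^ k = single (single x k) (1 :: 'r::comm_ring_1)"
  by (induction k) (simp_all add: Var_def mult_single single_add[symmetric])

lemma Cst_mult_Var_power: "Cst c * Var x ^ k = single (single x k) (c :: 'r::comm_ring_1)"
  by (simp add: Var_power Cst_mult_single)

lemma pext_add: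
  fixes f :: "'r::comm_ring_1 \<Rightarrow> ('x, 's::comm_ring_1) mpoly"
  assumes f: "\<And>a b. f (a + b) = f a + f b"
  shows "pext f (P + Q) = pext f P + pext f Q"
proof -
  have 0: "f 0 = 0" using additive_0[of f, OF f] .
  have sup: "pext f R = (\<Sum>e\<in>S. single e 1 * f (lookup R e))"
    if "finite S" "keys R \<subseteq> S" for R S
    unfolding pext_def by (rule sum.mono_neutral_left) (use that in \<open>auto simp: in_keys_iff 0\<close>)
  let ?S = "keys P \<union> keys Q"
  show ?thesis
    using sup[of ?S P] sup[of ?S Q] sup[of ?S "P + Q"]
    by (simp add: Poly_Mapping.keys_add lookup_add f algebra_simps sum.distrib)
qed

lemma pext_single:
  assumes "f 0 = 0"
  shows "pext f (single e c) = single e 1 * f c"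
  by (cases "c = 0") (auto simp: pext_def assms)

text \<open>Subtraction of exponents is truncated at zero, hence the explicit test for
  divisibility.\<close>

lemma lookup_single_mult:
  fixes P :: "('x, 'r::comm_ring_1) mpoly"
  shows "lookup (single e c * P) E =
    (if \<forall>x. lookup e x \<le> lookup E x then c * lookup P (E - e) else 0)"
proof (rule poly_mapping_additive_eq[of "\<lambda>P. lookup (single e c * P) E"
      "\<lambda>P. if \<forall>x. lookup e x \<le> lookup E x then c * lookup P (E - e) else 0"])
  fix e' d
  have "e + e' = E \<longleftrightarrow> (\<forall>x. lookup e x \<le> lookup E x) \<and> e' = E - e"
    by (auto simp: poly_mapping_eq_iff fun_eq_iff lookup_add lookup_minus) (metis le_add1, metis add_diff_cancel_left')
  then show "lookup (single e c * single e' d) E =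
    (if \<forall>x. lookup e x \<le> lookup E x
     then c * lookup (single e' d) (E - e) else 0)"
    by (auto simp: mult_single lookup_single when_def)
qed (auto simp: lookup_add algebra_simps)

lemma lookup_Cst_mult:
  fixes P :: "('x, 'r::comm_ring_1) mpoly"
  shows "lookup (Cst c * P) E = c * lookup P E"
  by (simp add: Cst_def lookup_single_mult)

lemma lookup_Var_mult:
  fixes P :: "('x, 'r::comm_ring_1) mpoly"
  shows "lookup (Var i * P) E =
    (if lookup E i = 0 then 0 else lookup P (E - single i 1))"
  by (auto simp: Var_def lookup_single_mult lookup_single when_def Suc_le_eq)

lemma lookup_sign_mult:
  fixes P :: "('x, 'r::comm_ring_1) mpoly"
  shows "lookup ((- 1) ^ k * P) E = (- 1) ^ k * lookup P E"
  by (induction k) (simp_all add: mult.assoc)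

lemma lookup_map: "f 0 = 0 \<Longrightarrow> lookup (pmap f P) E = f (lookup P E)"
  by (simp add: Poly_Mapping.map.rep_eq when_def)

lemma bracket_at_psum:
  fixes br :: "'v::comm_ring_1 \<Rightarrow> 'v \<Rightarrow> 'v poly"
  shows "bracket_at br t a b = psum (\<lambda>m c. Cst c * t ^ m) (br a b)"
proof -
  let ?p = "map_poly Cst (br a b) :: (nat, 'v) mpoly poly"
  have "poly ?p t = psum (\<lambda>m c. c * t ^ m) ?p"
    by (simp add: poly_altdef psum_def)
  also have "\<dots> = (\<Sum>m\<le>degree (br a b). coeff ?p m * t ^ m)"
    by (rule psum_bound) (simp_all add: map_poly_degree_leq)
  also have "\<dots> = psum (\<lambda>m c. Cst c * t ^ m) (br a b)"
    by (simp add: psum_def coeff_map_poly)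
  finally show ?thesis by (simp add: bracket_at_def)
qed

text \<open>Encodes an exponent in the variables 0, ..., n - 1 by a list of length n. Trailing zeros
  are invisible, so this is injective only among lists of equal length.\<close>

definition xp :: "nat list \<Rightarrow> nat \<Rightarrow>\<^sub>0 nat" where
  "xp ms = Poly_Mapping.nth ms"

lemma lookup_xp: "lookup (xp ms) i = (if i < length ms then ms ! i else 0)"
  by (simp add: xp_def nth_default_def)

lemma keys_xp: "keys (xp ms) \<subseteq> {..<length ms}"
  by (auto simp: in_keys_iff lookup_xp split: if_splits)

lemma xp_of_keys:
  assumes "keys e \<subseteq> {..<n}"
  shows "e = xp (map (lookup e) [0..<n])"
proof (rule poly_mapping_eqI)
  fix i
  show "lookup e i = lookup (xp (map (lookup e) [0..<n])) i"
    using assms by (cases "i < n") (auto simp: lookup_xp in_keys_iff)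
qed

lemma xp_inj: "length ms = length ms' \<Longrightarrow> xp ms = xp ms' \<longleftrightarrow> ms = ms'"
  using lookup_xp[of ms] lookup_xp[of ms'] by (auto intro!: nth_equalityI) (metis)

lemma mono_at_xp: "mono_at \<sigma> (xp ms) = (\<Prod>i<length ms. \<sigma> i ^ (ms ! i))"
  by (subst mono_at_superset[of "{..<length ms}"]) (use keys_xp in \<open>auto simp: lookup_xp intro!: prod.cong\<close>)

lemma mpolys_single: "length ms = n \<Longrightarrow> single (xp ms) c \<in> mpolys n"
  using keys_xp[of ms] by (auto simp: mpolys_def)

lemma mpolys_lookup: "P \<in> mpolys n \<Longrightarrow> \<not> keys e \<subseteq> {..<n} \<Longrightarrow> lookup P e = 0"
  by (auto simp: mpolys_def in_keys_iff)

lemma mpolys_eqI: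
  assumes "P \<in> mpolys n" "Q \<in> mpolys n"
    and "\<And>ms. length ms = n \<Longrightarrow> lookup P (xp ms) = lookup Q (xp ms)"
  shows "P = Q"
proof (rule poly_mapping_eqI)
  fix e
  show "lookup P e = lookup Q e"
  proof (cases "keys e \<subseteq> {..<n}")
    case True
    then show ?thesis using assms(3)[of "map (lookup e) [0..<n]"] xp_of_keys[OF True] by simp
  qed (use assms(1,2) mpolys_lookup in metis)
qed

lemma mpolys_additive_eq:
  fixes F :: "(nat, 'c::comm_monoid_add) mpoly \<Rightarrow> 'b::ab_group_add"
  assumes "\<And>P Q. F (P + Q) = F P + F Q" "\<And>P Q. G (P + Q) = G P + G Q"
    and "\<And>ms c. length ms = n \<Longrightarrow> F (single (xp ms) c) = G (single (xp ms) c)"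
    and "P \<in> mpolys n"
  shows "F P = G P"
proof (rule poly_mapping_additive_eq[of F G, OF assms(1,2)])
  fix e c assume "e \<in> keys P"
  then have "keys e \<subseteq> {..<n}" using assms(4) by (auto simp: mpolys_def)
  then show "F (single e c) = G (single e c)"
    using assms(3)[of "map (lookup e) [0..<n]" c] xp_of_keys by fastforce
qed

lemma mpolys_0 [simp]: "0 \<in> mpolys n"
  and mpolys_add: "P \<in> mpolys n \<Longrightarrow> Q \<in> mpolys n \<Longrightarrow> P + Q \<in> mpolys n"
  using Poly_Mapping.keys_add[of P Q] by (auto simp: mpolys_def)

lemma mpolys_sum: "(\<And>i. i \<in> I \<Longrightarrow> f i \<in> mpolys n) \<Longrightarrow> (\<Sum>i\<in>I. f i) \<in> mpolys n"
  by (induction I rule: infinite_finite_induct) (auto intro: mpolys_add)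

lemma mpolys_mult: "P \<in> mpolys n \<Longrightarrow> Q \<in> mpolys n \<Longrightarrow> P * Q \<in> mpolys n"
proof -
  assume a: "P \<in> mpolys n" "Q \<in> mpolys n"
  show ?thesis unfolding mpolys_def
  proof (intro CollectI ballI)
    fix e assume "e \<in> keys (P * Q)"
    then obtain x y where e: "e = x + y" "x \<in> keys P" "y \<in> keys Q"
      using Poly_Mapping.keys_mult[of P Q] by blast
    then show "keys e \<subseteq> {..<n}"
      using a Poly_Mapping.keys_add[of x y] unfolding mpolys_def by blast
  qed
qed

lemma mpolys_Cst: "Cst c \<in> mpolys n"
  by (cases "c = 0") (auto simp: mpolys_def Cst_def)

lemma mpolys_1: "1 \<in> mpolys n"
  by (simp add: mpolys_def)

lemma mpolys_Var: "i < n \<Longrightarrow> (Var i :: (nat, 'r::comm_ring_1) mpoly) \<in> mpolys n"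
  by (auto simp: mpolys_def Var_def)

lemma mpolys_power: "P \<in> mpolys n \<Longrightarrow> P ^ k \<in> mpolys n"
  by (induction k) (auto intro: mpolys_mult mpolys_1)

lemma mpolys_uminus: "P \<in> mpolys n \<Longrightarrow> - P \<in> mpolys n"
  for P :: "(nat, 'r::comm_ring_1) mpoly"
  by (auto simp: mpolys_def in_keys_iff)

lemma mpolys_induct [consumes 1, case_names zero single add]:
  assumes "P \<in> mpolys n" "Q 0" "\<And>ms c. length ms = n \<Longrightarrow> Q (single (xp ms) c)"
    and "\<And>A B. A \<in> mpolys n \<Longrightarrow> B \<in> mpolys n \<Longrightarrow> Q A \<Longrightarrow> Q B \<Longrightarrow> Q (A + B)"
  shows "Q (P :: (nat, 'r::comm_monoid_add) mpoly)"
proof -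
  have "Q (\<Sum>e\<in>S. single e (lookup P e)) \<and>
      (\<Sum>e\<in>S. single e (lookup P e)) \<in> mpolys n"
    if "finite S" "S \<subseteq> keys P" for S
    using that
  proof (induction S)
    case (insert e S)
    have "keys e \<subseteq> {..<n}" using insert assms(1) by (auto simp: mpolys_def)
    then have "Q (single e (lookup P e)) \<and>
        single e (lookup P e) \<in> mpolys n"
      using xp_of_keys[of e n] assms(3)[of "map (lookup e) [0..<n]"]
        mpolys_single[of "map (lookup e) [0..<n]" n] by simp
    then show ?case using insert by (auto intro: assms(4) mpolys_add)
  qed (auto simp: assms(2))
  then show ?thesis by (subst poly_mapping_sum_single) simp
qed

lemma mpolys_peval_Cst:
  assumes "P \<in> mpolys n" "\<And>i. i < n \<Longrightarrow> \<sigma> i \<in> mpolys m"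
  shows "peval Cst \<sigma> P \<in> (mpolys m :: (nat, 'r::comm_ring_1) mpoly set)"
  using assms(1)
proof (induction rule: mpolys_induct)
  case zero
  then show ?case by (simp add: peval_def)
next
  case (single ms c)
  have "(\<Prod>i\<in>I. \<sigma> i ^ (ms ! i)) \<in> mpolys m" if "I \<subseteq> {..<n}" for I
    using that by (induction I rule: infinite_finite_induct) (auto intro!: mpolys_mult mpolys_1 mpolys_power assms(2))
  then show ?case
    by (auto simp: peval_single mono_at_xp single intro: mpolys_mult mpolys_Cst)
qed (simp add: peval_add Cst_add mpolys_add)

section \<open>The Lie algebra of modes of a Poisson vertex algebra\<close>

lemma poly_monom_induct [case_names monom add]:
  fixes p :: "'c::comm_monoid_add poly"
  assumes "\<And>a m. Q (monom a m)" "\<And>p q. Q p \<Longrightarrow> Q q \<Longrightarrow> Q (p + q)"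
  shows "Q p"
proof -
  have "Q (\<Sum>i\<in>I. monom (coeff p i) i)" if "finite I" for I
    using that by (induction I) (use assms(1)[of 0 0] assms in auto)
  moreover have "p = (\<Sum>i\<le>degree p. monom (coeff p i) i)"
    by (rule poly_eqI) (simp add: coeff_sum sum.delta coeff_eq_0 not_le)
  ultimately show ?thesis by (metis finite_atMost)
qed

lemma of_nat_mult_monom: "of_nat n * monom x m = monom (of_nat n * x :: 'a::comm_ring_1) m"
  by (induction n) (simp_all add: algebra_simps add_monom)

lemma sum_binomial_Suc:
  fixes g :: "nat \<Rightarrow> 'a::comm_ring_1"
  shows "(\<Sum>s\<le>Suc n. of_nat (Suc n choose s) * g s) = (\<Sum>s\<le>n. of_nat (n choose s) * (g s + g (Suc s)))"
proof -
  have "(\<Sum>s\<le>Suc n. of_nat (Suc n choose s) * g s)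
      = g 0 + (\<Sum>s\<le>n. of_nat (n choose s) * g (Suc s)) + (\<Sum>s\<le>n. of_nat (n choose Suc s) * g (Suc s))"
    by (simp add: sum.atMost_Suc_shift algebra_simps sum.distrib del: sum.atMost_Suc)
  also have "(\<Sum>s\<le>n. of_nat (n choose Suc s) * g (Suc s)) = (\<Sum>s\<le>Suc n. of_nat (n choose s) * g s) - g 0"
    by (simp add: sum.atMost_Suc_shift del: sum.atMost_Suc)
  also have "(\<Sum>s\<le>Suc n. of_nat (n choose s) * g s) = (\<Sum>s\<le>n. of_nat (n choose s) * g s)"
    by (simp add: binomial_eq_0)
  finally show ?thesis by (simp add: algebra_simps sum.distrib)
qed

text \<open>Vandermonde's convolution tested against an arbitrary g, by iterating Pascal's rule in
  u.\<close>

lemma sum_binomial_add: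
  fixes g :: "nat \<Rightarrow> 'a::comm_ring_1"
  shows "(\<Sum>s\<le>u + l. of_nat (u + l choose s) * g s)
    = (\<Sum>i\<le>u. \<Sum>j\<le>l. of_nat (u choose i) * of_nat (l choose j) * g (i + j))"
proof (induction u arbitrary: g)
  case (Suc u)
  have "(\<Sum>s\<le>Suc u + l. of_nat (Suc u + l choose s) * g s)
      = (\<Sum>s\<le>u + l. of_nat (u + l choose s) * (g s + g (Suc s)))"
    using sum_binomial_Suc[of "u + l" g] by simp
  also have "\<dots> = (\<Sum>i\<le>u. \<Sum>j\<le>l. of_nat (u choose i) * of_nat (l choose j) * (g (i + j) + g (Suc (i + j))))"
    by (rule Suc.IH)
  also have "\<dots> = (\<Sum>j\<le>l. \<Sum>i\<le>u. of_nat (u choose i) * (of_nat (l choose j) * g (i + j) + of_nat (l choose j) * g (Suc i + j)))"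
    by (subst sum.swap) (simp add: algebra_simps)
  also have "\<dots> = (\<Sum>j\<le>l. \<Sum>i\<le>Suc u. of_nat (Suc u choose i) * (of_nat (l choose j) * g (i + j)))"
    by (simp only: sum_binomial_Suc)
  also have "\<dots> = (\<Sum>i\<le>Suc u. \<Sum>j\<le>l. of_nat (Suc u choose i) * of_nat (l choose j) * g (i + j))"
    by (subst sum.swap) (simp add: mult.assoc del: sum.atMost_Suc)
  finally show ?case .
qed simp

text \<open>The coefficient of t^p in ((1 + t) - t)^l (1 + t)^m = (1 + t)^m, with the power of (1 +
  t) - t expanded. It makes the bracket of modes skewsymmetric modulo relations.\<close>

lemma sum_alternating_binomial:
  "(\<Sum>j\<le>p. (- 1) ^ j * of_nat (l choose j) * of_nat (m + l - j choose (p - j))) = (of_nat (m choose p) :: 'a::comm_ring_1)"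
proof (induction l arbitrary: m p)
  case 0
  have "(\<Sum>j\<le>p. (- 1) ^ j * of_nat (0 choose j) * of_nat (m + 0 - j choose (p - j)))
      = (\<Sum>j\<le>p. if j = 0 then (of_nat (m choose p) :: 'a) else 0)"
    by (intro sum.cong) (auto simp: binomial_eq_0)
  then show ?case by simp
next
  case (Suc l)
  show ?case
  proof (cases p)
    case (Suc q)
    have "(\<Sum>j\<le>Suc q. (- 1) ^ j * of_nat (Suc l choose j) * of_nat (m + Suc l - j choose (Suc q - j)) :: 'a)
      = of_nat (m + Suc l choose Suc q)
        + (\<Sum>j\<le>q. (- 1) ^ Suc j * of_nat (l choose Suc j) * of_nat (m + l - j choose (q - j)))
        - (\<Sum>j\<le>q. (- 1) ^ j * of_nat (l choose j) * of_nat (m + l - j choose (q - j)))"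
      by (simp add: sum.atMost_Suc_shift algebra_simps sum.distrib sum_negf sum_subtractf del: sum.atMost_Suc)
    also have "of_nat (m + Suc l choose Suc q)
        + (\<Sum>j\<le>q. (- 1) ^ Suc j * of_nat (l choose Suc j) * of_nat (m + l - j choose (q - j)))
        = (\<Sum>j\<le>Suc q. (- 1) ^ j * of_nat (l choose j) * of_nat (Suc m + l - j choose (Suc q - j)) :: 'a)"
      by (simp add: sum.atMost_Suc_shift del: sum.atMost_Suc)
    finally show ?thesis using Suc.IH[of "Suc m" "Suc q"] Suc.IH[of m q] by (simp add: Suc del: sum.atMost_Suc)
  qed simp
qed

text \<open>The triangle p + q < N is completed to a square by zeros. A truncated double sum can
  then be rearranged while keeping the same cutoff N in both indices.\<close>

lemma sum_triangle_square:
  fixes f :: "nat \<Rightarrow> nat \<Rightarrow> 'a::comm_monoid_add"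
  assumes "\<And>p q. N \<le> p + q \<Longrightarrow> f p q = 0"
  shows "(\<Sum>i<N. \<Sum>p\<le>i. f p (i - p)) = (\<Sum>p<N. \<Sum>q<N. f p q)"
proof -
  have "(\<Sum>i<N. \<Sum>p\<le>i. f p (i - p)) = (\<Sum>(p, q)\<in>{(p, q). p + q < N}. f p q)"
    by (rule sum.triangle_reindex[symmetric])
  also have "\<dots> = (\<Sum>(p, q)\<in>{..<N} \<times> {..<N}. f p q)"
    by (rule sum.mono_neutral_left) (auto intro!: assms simp: not_less)
  finally show ?thesis by (simp add: sum.cartesian_product)
qed

context comm_algebra
begin

lemma scale_eq_mult: "scale c x = scale c 1 * x"
  using scale_mult[of c 1 x] by simp

lemma scale_mult_right: "scale c (x * y) = x * scale c y"
  using scale_mult[of c y x] by (simp add: mult.commute)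

lemma scale_1_add: "scale (c + d) 1 = scale c 1 + scale d 1"
  and scale_1_mult: "scale (c * d) 1 = scale c 1 * scale d 1"
  using scale_mult[of c 1 "scale d 1"] by (simp_all add: scale_left_distrib)

lemma scale_of_nat: "scale (of_nat n) x = of_nat n * x"
  by (induction n) (simp_all add: scale_left_distrib algebra_simps)

text \<open>The algebra may have zero divisors, but it is a vector space over a field of
  characteristic 0.\<close>

lemma of_nat_cancel:
  assumes "of_nat (Suc n) * x = of_nat (Suc n) * (y :: 'v)"
  shows "x = y"
proof -
  have "scale (of_nat (Suc n)) x = scale (of_nat (Suc n)) y" using assms by (simp only: scale_of_nat)
  then show ?thesis using scale_left_imp_eq[of "of_nat (Suc n)" x y] by (simp del: of_nat_Suc)
qed

end

section \<open>The axioms of a Poisson vertex algebra, coefficient by coefficient\<close>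

context pva
begin

lemma D_add: "D (x + y) = D x + D y"
  using D_linear by (simp add: Vector_Spaces.linear_iff)

lemma D_scale: "D (scale c x) = scale c (D x)"
  using D_linear by (simp add: Vector_Spaces.linear_iff)

lemma D_0 [simp]: "D 0 = 0" using D_add[of 0 0] by simp

lemma D_uminus: "D (- x) = - D x" by (rule additive_uminus[of D, OF D_add])

lemma D_sum: "D (\<Sum>i\<in>I. g i) = (\<Sum>i\<in>I. D (g i))" by (rule additive_sum[of D, OF D_add])

lemma D_1 [simp]: "D 1 = 0" using D_mult[of 1 1] by simp

lemma D_of_nat_mult: "D (of_nat n * x) = of_nat n * D x"
  by (induction n) (simp_all add: D_add algebra_simps)

lemma Dn_add: "(D ^^ l) (x + y) = (D ^^ l) x + (D ^^ l) y"
  by (induction l) (simp_all add: D_add)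

lemma Dn_scale: "(D ^^ l) (scale c x) = scale c ((D ^^ l) x)"
  by (induction l) (simp_all add: D_scale)

text \<open>Divided powers of the derivation, the coefficients of e^(t\<partial>).\<close>

definition dv :: "nat \<Rightarrow> 'v \<Rightarrow> 'v" where
  "dv l b = scale (1 / fact l) ((D ^^ l) b)"

lemma dv_add: "dv l (x + y) = dv l x + dv l y"
  by (simp add: dv_def Dn_add scale_right_distrib)

lemma dv_scale: "dv l (scale c x) = scale c (dv l x)"
  by (simp add: dv_def Dn_scale scale_left_commute)

lemma dv_0 [simp]: "dv 0 x = x" and dv_zero [simp]: "dv l 0 = 0"
  by (simp_all add: dv_def additive_0[of "D ^^ l", OF Dn_add])

lemma dv_of_nat_mult: "dv l (of_nat n * x) = of_nat n * dv l x"
  using dv_scale[of l "of_nat n" x] by (simp add: scale_of_nat)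

lemma D_dv: "D (dv l b) = of_nat (Suc l) * dv (Suc l) b"
proof -
  have "of_nat (Suc l) * dv (Suc l) b = scale (of_nat (Suc l) * (1 / fact (Suc l))) ((D ^^ Suc l) b)"
    unfolding dv_def scale_of_nat[symmetric] by simp
  also have "of_nat (Suc l) * (1 / fact (Suc l)) = (1 / fact l :: 'k)"
    by (simp add: fact_Suc field_simps del: of_nat_Suc)
  finally show ?thesis by (simp add: dv_def D_scale)
qed

lemma dv_D: "dv l (D b) = D (dv l b)"
  by (simp add: dv_def D_scale funpow_swap1)

text \<open>Applying the derivation to the case i gives i + 1 times the case i + 1: the two shifted
  sums carry the weights p and i + 1 - p, which add up.\<close>

lemma dv_mult: "dv i (x * y) = (\<Sum>p\<le>i. dv p x * dv (i - p) y)"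
proof (induction i)
  case (Suc i)
  have "of_nat (Suc i) * dv (Suc i) (x * y) = D (dv i (x * y))"
    by (simp only: D_dv)
  also have "\<dots> = (\<Sum>p\<le>i. of_nat (Suc p) * (dv (Suc p) x * dv (i - p) y))
      + (\<Sum>p\<le>i. of_nat (Suc (i - p)) * (dv p x * dv (Suc (i - p)) y))"
    unfolding Suc.IH by (simp add: D_sum D_mult D_dv sum.distrib mult_ac del: of_nat_Suc)
  also have "(\<Sum>p\<le>i. of_nat (Suc p) * (dv (Suc p) x * dv (i - p) y))
      = (\<Sum>p\<le>Suc i. of_nat p * (dv p x * dv (Suc i - p) y))"
    by (simp add: sum.atMost_Suc_shift del: sum.atMost_Suc)
  also have "(\<Sum>p\<le>i. of_nat (Suc (i - p)) * (dv p x * dv (Suc (i - p)) y))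
      = (\<Sum>p\<le>Suc i. of_nat (Suc i - p) * (dv p x * dv (Suc i - p) y))"
    by (auto intro!: sum.cong simp: Suc_diff_le simp del: of_nat_Suc of_nat_diff)
  also have "(\<Sum>p\<le>Suc i. of_nat p * (dv p x * dv (Suc i - p) y))
      + (\<Sum>p\<le>Suc i. of_nat (Suc i - p) * (dv p x * dv (Suc i - p) y))
      = of_nat (Suc i) * (\<Sum>p\<le>Suc i. dv p x * dv (Suc i - p) y)"
    unfolding sum.distrib[symmetric] sum_distrib_left
  proof (intro sum.cong refl)
    fix p assume "p \<in> {..Suc i}"
    then have "(of_nat p + of_nat (Suc i - p) :: 'v) = of_nat (Suc i)"
      by (metis atMost_iff le_add_diff_inverse of_nat_add)
    then show "of_nat p * (dv p x * dv (Suc i - p) y) + of_nat (Suc i - p) * (dv p x * dv (Suc i - p) y)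
       = of_nat (Suc i) * (dv p x * dv (Suc i - p) y)"
      by (metis distrib_right)
  qed
  finally show ?case by (rule of_nat_cancel)
qed simp

text \<open>The product \<open>a\<^sub>(\<^sub>j\<^sub>)b\<close>, so that the \<open>\<lambda>\<close>-bracket is \<open>\<Sum> \<lambda>\<^sup>j a\<^sub>(\<^sub>j\<^sub>)b / j!\<close>.\<close>

definition nprod :: "'v \<Rightarrow> nat \<Rightarrow> 'v \<Rightarrow> 'v" where
  "nprod a j b = of_nat (fact j) * coeff (br a b) j"

lemma nprod_add_left: "nprod (a + a') j b = nprod a j b + nprod a' j b"
  and nprod_add_right: "nprod a j (b + b') = nprod a j b + nprod a j b'"
  by (simp_all add: nprod_def br_add_left br_add_right algebra_simps)

lemma nprod_scale_left: "nprod (scale c a) j b = scale c (nprod a j b)"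
  and nprod_scale_right: "nprod a j (scale c b) = scale c (nprod a j b)"
  by (simp_all add: nprod_def br_scale_left br_scale_right coeff_map_poly scale_mult_right)

lemma nprod_0_left [simp]: "nprod 0 j b = 0"
  and nprod_0_right [simp]: "nprod a j 0 = 0"
  using nprod_add_left[of 0 0] nprod_add_right[of a j 0 0] by simp_all

lemma nprod_sum_right: "nprod a j (\<Sum>i\<in>I. g i) = (\<Sum>i\<in>I. nprod a j (g i))"
  by (rule additive_sum[of "nprod a j", OF nprod_add_right])

lemma nprod_of_nat_mult_right: "nprod a j (of_nat n * b) = of_nat n * nprod a j b"
  using nprod_scale_right[of a j "of_nat n" b] by (simp add: scale_of_nat)

lemma nprod_of_nat_mult_left: "nprod (of_nat n * a) j b = of_nat n * nprod a j b"
  using nprod_scale_left[of "of_nat n" a j b] by (simp add: scale_of_nat)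

lemma nprod_degree: "degree (br a b) < j \<Longrightarrow> nprod a j b = 0"
  by (simp add: nprod_def coeff_eq_0)

lemma nprod_D_left: "nprod (D a) j b = - (of_nat j * nprod a (j - 1) b)"
  by (cases j) (simp_all add: nprod_def br_D_left algebra_simps)

lemma nprod_D_right: "nprod a j (D b) = of_nat j * nprod a (j - 1) b + D (nprod a j b)"
  by (cases j) (simp_all add: nprod_def br_D_right coeff_map_poly D_of_nat_mult D_add algebra_simps)

lemma nprod_mult_right: "nprod a j (b * c) = nprod a j b * c + b * nprod a j c"
  by (simp add: nprod_def br_leibniz algebra_simps)

text \<open>Iterated right sesquilinearity: the coefficient of t^l in [a, e^(t\<partial>) b] =
  e^(t(\<lambda> + \<partial>)) [a, b], read at \<lambda>^q / q!. The induction again divides by l +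
  1.\<close>

lemma nprod_dv_right:
  "nprod a q (dv l b) = (\<Sum>i\<le>l. of_nat (q choose i) * dv (l - i) (nprod a (q - i) b))"
proof (induction l arbitrary: q)
  case (Suc l)
  have q: "of_nat q * (\<Sum>i\<le>l. of_nat (q - 1 choose i) * dv (l - i) (nprod a (q - 1 - i) b))
      = (\<Sum>i\<le>Suc l. of_nat (i * (q choose i)) * dv (Suc l - i) (nprod a (q - i) b))"
  proof (cases q)
    case (Suc r)
    have "(of_nat (Suc i * (Suc r choose Suc i)) :: 'v) = of_nat (Suc r) * of_nat (r choose i)" for i
      by (metis Suc_times_binomial_eq mult.commute of_nat_mult)
    then have F: "of_nat (Suc i * (q choose Suc i)) * dv (Suc l - Suc i) (nprod a (q - Suc i) b)
        = of_nat q * (of_nat (q - 1 choose i) * dv (l - i) (nprod a (q - 1 - i) b))" for i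
      unfolding Suc diff_Suc_Suc diff_Suc_1 by (simp only: mult.assoc)
    show ?thesis
      unfolding sum.atMost_Suc_shift F sum_distrib_left by simp
  next
    case 0
    have "i * (0 choose i) = 0" for i :: nat by (cases i) simp_all
    then show ?thesis unfolding 0 by (simp only: of_nat_0 mult_zero_left sum.neutral_const)
  qed
  have "of_nat (Suc l) * nprod a q (dv (Suc l) b) = nprod a q (D (dv l b))"
    by (simp only: nprod_of_nat_mult_right[symmetric] D_dv)
  also have "\<dots> = of_nat q * (\<Sum>i\<le>l. of_nat (q - 1 choose i) * dv (l - i) (nprod a (q - 1 - i) b))
      + (\<Sum>i\<le>l. of_nat (q choose i) * (of_nat (Suc l - i) * dv (Suc l - i) (nprod a (q - i) b)))"
    unfolding nprod_D_right Suc.IH by (simp add: D_sum D_of_nat_mult D_dv Suc_diff_le del: of_nat_Suc)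
  also have "\<dots> = (\<Sum>i\<le>Suc l. of_nat (i * (q choose i)) * dv (Suc l - i) (nprod a (q - i) b))
      + (\<Sum>i\<le>Suc l. of_nat (q choose i) * (of_nat (Suc l - i) * dv (Suc l - i) (nprod a (q - i) b)))"
    by (subst q) simp
  also have "\<dots> = of_nat (Suc l) * (\<Sum>i\<le>Suc l. of_nat (q choose i) * dv (Suc l - i) (nprod a (q - i) b))"
    unfolding sum.distrib[symmetric] sum_distrib_left
  proof (intro sum.cong refl)
    fix i assume "i \<in> {..Suc l}"
    then have "(of_nat (i * (q choose i)) + of_nat (q choose i) * of_nat (Suc l - i) :: 'v) = of_nat (Suc l) * of_nat (q choose i)"
      by (metis atMost_iff distrib_left le_add_diff_inverse mult.commute of_nat_add of_nat_mult)
    then show "of_nat (i * (q choose i)) * dv (Suc l - i) (nprod a (q - i) b)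
        + of_nat (q choose i) * (of_nat (Suc l - i) * dv (Suc l - i) (nprod a (q - i) b))
      = of_nat (Suc l) * (of_nat (q choose i) * dv (Suc l - i) (nprod a (q - i) b))"
      by (metis distrib_right mult.assoc)
  qed
  finally show ?case by (rule of_nat_cancel)
qed simp

text \<open>Binomial expansion of (-\<lambda> - \<partial>)^k, as \<lambda> and \<partial>
  commute.\<close>

lemma coeff_skew_power:
  "coeff (((\<lambda>p. - ([:0, 1:] * p) - map_poly D p) ^^ k) [:c:]) m
    = (- 1) ^ k * of_nat (k choose m) * (D ^^ (k - m)) c"
proof (induction k arbitrary: m)
  case 0
  then show ?case by (cases m) auto
next
  case (Suc k)
  let ?q = "((\<lambda>p. - ([:0, 1:] * p) - map_poly D p) ^^ k) [:c:]"
  have s: "coeff (- ([:0, 1:] * ?q) - map_poly D ?q) m = - (case m of 0 \<Rightarrow> 0 | Suc i \<Rightarrow> coeff ?q i) - D (coeff ?q m)"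
    by (cases m) (simp_all add: coeff_map_poly)
  have d: "D ((- 1) ^ k * of_nat (k choose m) * x) = (- 1) ^ k * of_nat (k choose m) * D x" for x
    by (cases "even k") (simp_all add: D_uminus D_of_nat_mult)
  have s': "coeff (((\<lambda>p. - ([:0, 1:] * p) - map_poly D p) ^^ Suc k) [:c:]) m
    = - (case m of 0 \<Rightarrow> 0 | Suc i \<Rightarrow> (- 1) ^ k * of_nat (k choose i) * (D ^^ (k - i)) c)
      - (- 1) ^ k * of_nat (k choose m) * D ((D ^^ (k - m)) c)"
    by (simp only: funpow.simps comp_apply s Suc.IH d)
  show ?case
  proof (cases m)
    case 0
    then show ?thesis by (subst s') simp
  next
    case (Suc i)
    show ?thesis
    proof (cases "m \<le> k")
      case True
      then have "D ((D ^^ (k - m)) c) = (D ^^ (k - i)) c"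
        using Suc Suc_diff_Suc[of i k] by (metis Suc_le_eq comp_apply funpow.simps(2))
      then show ?thesis by (subst s') (simp add: Suc algebra_simps)
    next
      case False
      then have "k choose m = 0" by simp
      then show ?thesis by (subst s') (simp add: Suc algebra_simps binomial_eq_0)
    qed
  qed
qed

text \<open>The axiom \<open>br_skew\<close> read off at \<lambda>^m / m!; the factorials absorb the
  binomial coefficients. The cutoff N is any bound past which the products vanish, so that one N can
  serve several pairs of elements.\<close>

lemma nprod_skew:
  assumes "\<And>i. N \<le> i \<Longrightarrow> nprod b i a = 0"
  shows "nprod a m b = - (\<Sum>i<N. (- 1) ^ (i + m) * dv i (nprod b (i + m) a))"
proof -
  let ?d = "degree (br b a)"
  have fd: "scale (of_nat (fact i)) (dv i x) = (D ^^ i) x" for i x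
    by (simp add: dv_def)
  have 1: "of_nat (fact m) * ((- 1) ^ k * of_nat (k choose m) * (D ^^ (k - m)) (coeff (br b a) k))
      = (if m \<le> k then (- 1) ^ k * dv (k - m) (nprod b k a) else 0)" for k
  proof (cases "m \<le> k")
    case True
    have "(of_nat (fact m * (k choose m) * fact (k - m)) :: 'v) = of_nat (fact k)"
      using binomial_fact_lemma[OF True] by (simp add: mult_ac)
    have Y: "(D ^^ (k - m)) (coeff (br b a) k) = of_nat (fact (k - m)) * dv (k - m) (coeff (br b a) k)"
      using fd[of "k - m" "coeff (br b a) k"] by (simp only: scale_of_nat)
    have "of_nat (fact m) * ((- 1) ^ k * of_nat (k choose m) * (D ^^ (k - m)) (coeff (br b a) k))
      = (- 1) ^ k * (of_nat (fact m * (k choose m) * fact (k - m)) * dv (k - m) (coeff (br b a) k))"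
      unfolding Y by (simp only: of_nat_mult mult_ac)
    also have "\<dots> = (- 1) ^ k * dv (k - m) (nprod b k a)"
      by (simp only: \<open>of_nat (fact m * (k choose m) * fact (k - m)) = of_nat (fact k)\<close> nprod_def dv_of_nat_mult)
    finally show ?thesis using True by simp
  qed (simp add: binomial_eq_0)
  have "nprod a m b = - (\<Sum>k\<le>?d. of_nat (fact m) * ((- 1) ^ k * of_nat (k choose m) * (D ^^ (k - m)) (coeff (br b a) k)))"
    unfolding nprod_def by (subst br_skew) (simp only: coeff_minus coeff_sum coeff_skew_power sum_distrib_left mult_minus_right)
  also have "\<dots> = - (\<Sum>k\<le>?d. if m \<le> k then (- 1) ^ k * dv (k - m) (nprod b k a) else 0)"
    by (simp only: 1)
  also have "(\<Sum>k\<le>?d. if m \<le> k then (- 1) ^ k * dv (k - m) (nprod b k a) else 0)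
      = (\<Sum>k<m + N + ?d + 1. if m \<le> k then (- 1) ^ k * dv (k - m) (nprod b k a) else 0)"
    by (rule sum.mono_neutral_left) (auto simp: nprod_degree not_le)
  also have "\<dots> = (\<Sum>k\<in>{m..<m + N}. (- 1) ^ k * dv (k - m) (nprod b k a))"
    by (rule sum.mono_neutral_cong_right) (use assms in auto)
  also have "\<dots> = (\<Sum>i<N. (- 1) ^ (i + m) * dv i (nprod b (i + m) a))"
    using sum.shift_bounds_nat_ivl[of "\<lambda>k. (- 1) ^ k * dv (k - m) (nprod b k a)" 0 m N]
    by (simp add: atLeast0LessThan add.commute)
  finally show ?thesis .
qed

text \<open>The axioms contain only the right Leibniz rule. Skewsymmetry turns the product to the
  right, \<open>dv_mult\<close> splits the divided powers, and skewsymmetry read backwards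
  reassembles the products in each factor. Stating it for all large N allows several such sums to be
  compared at one cutoff.\<close>

lemma nprod_mult_left:
  "\<forall>\<^sub>F N in sequentially. nprod (b * c) m v = (\<Sum>l<N. dv l b * nprod c (m + l) v + dv l c * nprod b (m + l) v)"
proof -
  define N0 where "N0 = Suc (max (degree (br v b)) (degree (br v c)))"
  have "nprod (b * c) m v = (\<Sum>l<N. dv l b * nprod c (m + l) v + dv l c * nprod b (m + l) v)" if N: "N \<ge> N0" for N
  proof -
    have z: "nprod v i b = 0" "nprod v i c = 0" if "i \<ge> N" for i
      using that N by (auto intro!: nprod_degree simp: N0_def)
    have *: "(\<Sum>i<N. (- 1) ^ (i + m) * dv i (x * nprod v (i + m) y)) = - (\<Sum>l<N. dv l x * nprod y (m + l) v)"
      if y: "\<And>i. i \<ge> N \<Longrightarrow> nprod v i y = 0" for x y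
    proof -
      have "(\<Sum>i<N. (- 1) ^ (i + m) * dv i (x * nprod v (i + m) y))
        = (\<Sum>i<N. \<Sum>p\<le>i. (- 1) ^ (p + (i - p) + m) * (dv p x * dv (i - p) (nprod v (p + (i - p) + m) y)))"
        by (auto simp: dv_mult sum_distrib_left intro!: sum.cong)
      also have "\<dots> = (\<Sum>p<N. \<Sum>q<N. (- 1) ^ (p + q + m) * (dv p x * dv q (nprod v (p + q + m) y)))"
        by (rule sum_triangle_square) (simp add: y)
      also have "\<dots> = (\<Sum>p<N. dv p x * (\<Sum>q<N. (- 1) ^ (q + (m + p)) * dv q (nprod v (q + (m + p)) y)))"
        by (simp add: sum_distrib_left mult_ac add_ac)
      also have "\<dots> = (\<Sum>p<N. dv p x * (- nprod y (m + p) v))"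
        using nprod_skew[OF y] by simp
      finally show ?thesis by (simp add: sum_negf)
    qed
    have "nprod (b * c) m v = - (\<Sum>i<N. (- 1) ^ (i + m) * dv i (nprod v (i + m) (b * c)))"
      by (rule nprod_skew) (simp add: nprod_mult_right z)
    also have "\<dots> = - ((\<Sum>i<N. (- 1) ^ (i + m) * dv i (c * nprod v (i + m) b)) + (\<Sum>i<N. (- 1) ^ (i + m) * dv i (b * nprod v (i + m) c)))"
      by (simp add: nprod_mult_right dv_add sum.distrib distrib_left mult.commute)
    finally show ?thesis using *[OF z(1), of c] *[OF z(2), of b] by (simp add: sum.distrib)
  qed
  then show ?thesis using eventually_sequentially by blast
qed

lemma bracket_at_add: "bracket_at br t a (b + c) = bracket_at br t a b + bracket_at br t a c"
  and bracket_at_add_left: "bracket_at br t (a + b) c = bracket_at br t a c + bracket_at br t b c"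
  by (simp_all add: bracket_at_psum br_add_right br_add_left psum_add Cst_add algebra_simps)

lemma lookup_psum_Var:
  fixes p :: "'v poly"
  shows "lookup (psum (\<lambda>m c. Cst c * Var x ^ m) p) E
    = (if E = single x (lookup E x) then coeff p (lookup E x) else 0)"
proof (rule poly_additive_eq[of "\<lambda>p. lookup (psum (\<lambda>m c. Cst c * Var x ^ m) p) E"
      "\<lambda>p. if E = single x (lookup E x) then coeff p (lookup E x) else 0"])
  fix a :: 'v and m
  show "lookup (psum (\<lambda>m c. Cst c * Var x ^ m) (monom a m)) E
    = (if E = single x (lookup E x) then coeff (monom a m) (lookup E x) else 0)"
    by (auto simp: psum_monom Cst_mult_Var_power lookup_single when_def coeff_monom)
qed (auto simp: psum_add Cst_add algebra_simps lookup_add)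

lemma lookup_psum_Var_add:
  fixes p :: "'v poly"
  assumes "x \<noteq> y"
  shows "lookup (psum (\<lambda>m c. Cst c * (Var x + Var y) ^ m) p) (single x i + single y j)
    = of_nat (i + j choose i) * coeff p (i + j)"
proof (rule poly_additive_eq[of "\<lambda>p. lookup (psum (\<lambda>m c. Cst c * (Var x + Var y) ^ m) p) (single x i + single y j)"
      "\<lambda>p. of_nat (i + j choose i) * coeff p (i + j)"])
  fix a :: 'v and m
  have "single x k + single y (m - k) = single x i + single y j
      \<longleftrightarrow> k = i \<and> m - k = j" for k
    using assms by (metis lookup_add lookup_single_eq lookup_single_not_eq add_0 add.right_neutral)
  then have "lookup (Cst a * (Var x + Var y) ^ m) (single x i + single y j)
      = a * (\<Sum>k\<le>m. if k = i \<and> m - k = j then of_nat (m choose k) else 0)"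
    unfolding lookup_Cst_mult binomial_ring lookup_sum
    by (intro arg_cong[of _ _ "(*) a"] sum.cong refl)
      (simp add: Var_power mult.assoc mult_single lookup_single when_def flip: single_of_nat)
  also have "\<dots> = of_nat (i + j choose i) * coeff (monom a m) (i + j)"
  proof (cases "m = i + j")
    case True
    then have "(\<Sum>k\<le>m. if k = i \<and> m - k = j then of_nat (m choose k) else 0 :: 'v) = (\<Sum>k\<le>m. if k = i then of_nat (m choose i) else 0)"
      by (intro sum.cong) auto
    then show ?thesis using True by (simp add: mult.commute)
  next
    case False
    then have "(\<Sum>k\<le>m. if k = i \<and> m - k = j then of_nat (m choose k) else 0 :: 'v) = 0"
      by (intro sum.neutral) auto
    then show ?thesis using False by simp
  qed
  finally show "lookup (psum (\<lambda>m c. Cst c * (Var x + Var y) ^ m) (monom a m)) (single x i + single y j)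
    = of_nat (i + j choose i) * coeff (monom a m) (i + j)"
    by (simp add: psum_monom)
qed (auto simp: psum_add Cst_add algebra_simps lookup_add)

lemma pext_psum:
  fixes f :: "'v \<Rightarrow> (nat, 'v) mpoly"
  assumes "\<And>a b. f (a + b) = f a + f b"
  shows "pext f (psum (\<lambda>m c. Cst c * Var x ^ m) p) = psum (\<lambda>m c. single (single x m) 1 * f c) p"
  unfolding psum_def additive_sum[of "pext f", OF pext_add[of f, OF assms]] Cst_mult_Var_power
  by (simp add: pext_single additive_0[of f, OF assms])

lemma sum_coeff_delta:
  fixes g :: "nat \<Rightarrow> 'v \<Rightarrow> 'v"
  assumes "\<And>m. g m 0 = 0"
  shows "(\<Sum>m\<le>degree p. if m = j then g m (coeff p m) else 0) = g j (coeff p j)"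
  using assms by (cases "j \<le> degree p") (auto simp: sum.delta coeff_eq_0)

text \<open>Compares the coefficients of \<lambda>^i \<mu>^j in the Jacobi identity, multiplied by
  i! j!. The right side involves powers of \<lambda> + \<mu>, whence the binomial
  coefficients.\<close>

lemma nprod_jacobi:
  "nprod a i (nprod b j c) - nprod b j (nprod a i c)
    = (\<Sum>p\<le>i. of_nat (i choose p) * nprod (nprod a p b) (i + j - p) c)"
proof -
  let ?E = "single (0::nat) i + single 1 j"
  have L: "lookup (pext (bracket_at br (Var x) u) (bracket_at br (Var y) w c))
        (single x r + single y s) = coeff (br u (coeff (br w c) s)) r"
    if xy: "x \<noteq> y" for x y :: nat and u w r s
  proof -
    have "lookup (single (single y m) 1 * bracket_at br (Var x) u d)
         (single x r + single y s) = (if m = s then coeff (br u d) r else 0)" for m d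
    proof -
      let ?F = "single x r + single y s"
      have 1: "(\<forall>z. lookup (single y m) z \<le> lookup ?F z) \<longleftrightarrow> m \<le> s"
        using xy by (auto simp: lookup_add lookup_single when_def split: if_splits)
      have 2: "?F - single y m = single x r + single y (s - m)" if "m \<le> s"
        using xy that by (intro poly_mapping_eqI) (auto simp: lookup_add lookup_minus lookup_single when_def)
      have 3: "lookup (single x r + single y t) x = r" for t
        using xy by (simp add: lookup_add lookup_single when_def)
      have 4: "single y t = 0 \<longleftrightarrow> t = 0" for t :: nat
        by (metis lookup_single_eq lookup_zero single_zero)
      show ?thesis
        unfolding bracket_at_psum lookup_single_mult 1
        by (auto simp: 2 3 4 lookup_psum_Var)
    qed
    moreover have "br u 0 = 0" using br_add_right[of u 0 0] by simp
    ultimately show ?thesis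
      unfolding bracket_at_psum[of br "Var y" w c] pext_psum[of "bracket_at br (Var x) u", OF bracket_at_add]
      unfolding psum_def lookup_sum
      by (simp only:) (rule sum_coeff_delta[of "\<lambda>m d. coeff (br u d) r"], simp)
  qed
  have R: "lookup (single (single 0 p) 1 * bracket_at br (Var 0 + Var 1) d c) ?E
      = (if p \<le> i then of_nat (i - p + j choose (i - p)) * coeff (br d c) (i - p + j) else 0)" for p d
  proof -
    have 1: "(\<forall>z. lookup (single 0 p) z \<le> lookup ?E z) \<longleftrightarrow> p \<le> i"
      by (auto simp: lookup_add lookup_single when_def split: if_splits)
    have 2: "?E - single 0 p = single 0 (i - p) + single 1 j" if "p \<le> i"
      using that by (intro poly_mapping_eqI) (auto simp: lookup_add lookup_minus lookup_single when_def)
    show ?thesis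
      unfolding bracket_at_psum lookup_single_mult 1
      using 2 lookup_psum_Var_add[of "0::nat" 1 "br d c" "i - p" j] by simp
  qed
  have "coeff (br a (coeff (br b c) j)) i - coeff (br b (coeff (br a c) i)) j
    = lookup (pext (\<lambda>v. bracket_at br (Var 0 + Var 1) v c) (bracket_at br (Var 0) a b)) ?E"
    unfolding br_jacobi[symmetric] lookup_minus
    using L[of 0 1 a b i j] L[of 1 0 b a j i] by (simp add: add.commute)
  also have "\<dots> = (\<Sum>p\<le>degree (br a b). if p \<le> i then of_nat (i - p + j choose (i - p)) * coeff (br (coeff (br a b) p) c) (i - p + j) else 0)"
    unfolding bracket_at_psum[of br "Var 0" a b]
      pext_psum[of "\<lambda>v. bracket_at br (Var 0 + Var 1) v c", OF bracket_at_add_left]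
    unfolding psum_def lookup_sum
    using R by simp
  also have "\<dots> = (\<Sum>p\<le>i. of_nat (i - p + j choose (i - p)) * coeff (br (coeff (br a b) p) c) (i - p + j))"
  proof -
    have "br 0 c = 0" using br_add_left[of 0 0 c] by simp
    then have "(\<Sum>p\<le>degree (br a b). if p \<le> i then of_nat (i - p + j choose (i - p)) * coeff (br (coeff (br a b) p) c) (i - p + j) else 0)
       = (\<Sum>p\<le>degree (br a b) + i. if p \<le> i then of_nat (i - p + j choose (i - p)) * coeff (br (coeff (br a b) p) c) (i - p + j) else 0)"
      by (intro sum.mono_neutral_left) (auto simp: coeff_eq_0 not_le)
    also have "\<dots> = (\<Sum>p\<le>i. of_nat (i - p + j choose (i - p)) * coeff (br (coeff (br a b) p) c) (i - p + j))"
      by (rule sum.mono_neutral_cong_right) auto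
    finally show ?thesis .
  qed
  finally have main: "coeff (br a (coeff (br b c) j)) i - coeff (br b (coeff (br a c) i)) j
    = (\<Sum>p\<le>i. of_nat (i - p + j choose (i - p)) * coeff (br (coeff (br a b) p) c) (i - p + j))" .
  \<comment> \<open>Converts the binomial coefficient from the expansion of a power of \<lambda> +
    \<mu>, together with i! j!, into the one of the commutator formula and the factorials inside the
    two products.\<close>
  have f: "fact i * fact j * (i - p + j choose (i - p)) = (i choose p) * (fact p * fact (i + j - p))" if "p \<le> i" for p
  proof -
    have 1: "fact (i - p) * fact j * (i - p + j choose (i - p)) = fact (i + j - p)"
      using binomial_fact_lemma[of "i - p" "i - p + j"] that by simp
    have 2: "fact i = fact p * fact (i - p) * (i choose p)"
      by (rule binomial_fact_lemma[OF that, symmetric])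
    have "fact i * fact j * (i - p + j choose (i - p))
        = (i choose p) * (fact p * (fact (i - p) * fact j * (i - p + j choose (i - p))))"
      unfolding 2 by (simp only: mult_ac)
    then show ?thesis unfolding 1 .
  qed
  have "nprod a i (nprod b j c) - nprod b j (nprod a i c)
      = of_nat (fact i * fact j) * (coeff (br a (coeff (br b c) j)) i - coeff (br b (coeff (br a c) i)) j)"
    unfolding nprod_def[of b j c] nprod_def[of a i c] nprod_of_nat_mult_right
    by (simp only: nprod_def of_nat_mult algebra_simps)
  also have "\<dots> = (\<Sum>p\<le>i. of_nat (fact i * fact j * (i - p + j choose (i - p))) * coeff (br (coeff (br a b) p) c) (i - p + j))"
    unfolding main sum_distrib_left by (simp only: of_nat_mult mult.assoc)
  also have "\<dots> = (\<Sum>p\<le>i. of_nat (i choose p) * nprod (nprod a p b) (i + j - p) c)"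
  proof (intro sum.cong refl)
    fix p assume "p \<in> {..i}"
    then have p: "p \<le> i" by simp
    then have e: "i - p + j = i + j - p" by simp
    show "of_nat (fact i * fact j * (i - p + j choose (i - p))) * coeff (br (coeff (br a b) p) c) (i - p + j)
       = of_nat (i choose p) * nprod (nprod a p b) (i + j - p) c"
      unfolding f[OF p] nprod_def[of a p b] nprod_of_nat_mult_left
      by (simp only: nprod_def e of_nat_mult mult.assoc)
  qed
  finally show ?thesis .
qed

end

lemma sum_triangle_swap:
  fixes f :: "nat \<Rightarrow> nat \<Rightarrow> 'a::comm_monoid_add"
  shows "(\<Sum>i\<le>m. \<Sum>p\<le>i. f i p) = (\<Sum>p\<le>m. \<Sum>i\<in>{p..m}. f i p)"
proof -
  have "(\<Sum>i\<le>m. \<Sum>p | p \<in> {..m} \<and> p \<le> i. f i p) = (\<Sum>p\<le>m. \<Sum>i | i \<in> {..m} \<and> p \<le> i. f i p)"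
    by (rule sum.swap_restrict) auto
  moreover have "{p. p \<in> {..m} \<and> p \<le> i} = {..i}" if "i \<le> m" for i using that by auto
  moreover have "{i. i \<in> {..m} \<and> p \<le> i} = {p..m}" for p by auto
  ultimately show ?thesis by simp
qed

section \<open>The bracket of modes\<close>

context pva
begin

text \<open>
  The polynomial \<open>\<Sum> a\<^sub>m x\<^sup>m\<close> stands for the sum of the modes of index \<open>m\<close> of \<open>a\<^sub>m\<close>; the map \<open>tot\<close> below is
  \<open>\<partial> + d/dx\<close>, whose image consists of the relations between modes.
\<close>

definition act :: "'v poly \<Rightarrow> 'v \<Rightarrow> 'v" where
  "act p v = psum (\<lambda>m a. nprod a m v) p"

text \<open>Borcherds' commutator formula for modes of nonnegative index.\<close>

definition brk1 :: "'v \<Rightarrow> nat \<Rightarrow> 'v \<Rightarrow> nat \<Rightarrow> 'v poly" where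
  "brk1 a m b l = (\<Sum>i\<le>m. of_nat (m choose i) * monom (nprod a i b) (m + l - i))"

definition brk :: "'v poly \<Rightarrow> 'v poly \<Rightarrow> 'v poly" where
  "brk p q = psum (\<lambda>m a. psum (\<lambda>l b. brk1 a m b l) q) p"

definition tot :: "'v poly \<Rightarrow> 'v poly" where
  "tot p = psum (\<lambda>m a. monom (D a) m + monom (of_nat m * a) (m - 1)) p"

lemma act_add: "act (p + q) v = act p v + act q v"
  and act_add_right: "act p (v + w) = act p v + act p w"
  and act_monom: "act (monom a m) v = nprod a m v"
  by (simp_all add: act_def psum_add psum_monom nprod_add_left nprod_add_right flip: psum_add_fun)

lemma brk1_add: "brk1 (a + a') m b l = brk1 a m b l + brk1 a' m b l"
  and brk1_add_right: "brk1 a m (b + b') l = brk1 a m b l + brk1 a m b' l"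
  by (simp_all add: brk1_def nprod_add_left nprod_add_right algebra_simps sum.distrib flip: add_monom)

lemma brk_add: "brk (p + q) r = brk p r + brk q r"
  unfolding brk_def by (rule psum_add) (simp add: brk1_add psum_add_fun)

lemma brk_add_right: "brk p (q + r) = brk p q + brk p r"
  unfolding brk_def by (simp add: brk1_add_right psum_add flip: psum_add_fun)

lemma brk_monom: "brk (monom a m) (monom b l) = brk1 a m b l"
proof -
  have 0: "brk1 a m 0 l = 0" "brk1 0 m b l = 0" for a m b l
    by (simp_all add: brk1_def)
  have 1: "psum (\<lambda>l b. brk1 a m b l) (monom b l) = brk1 a m b l" for a m
    by (rule psum_monom) (simp add: 0)
  have 2: "psum (\<lambda>l b. brk1 0 m b l) (monom b l) = 0" for m
    by (simp add: psum_def 0)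
  show ?thesis unfolding brk_def
    using psum_monom[of "\<lambda>m a. psum (\<lambda>l b. brk1 a m b l) (monom b l)" a m, OF 2] by (simp only: 1)
qed

lemma tot_add: "tot (p + q) = tot p + tot q"
  unfolding tot_def by (rule psum_add) (simp add: D_add algebra_simps flip: add_monom)

lemma tot_monom: "tot (monom a m) = monom (D a) m + monom (of_nat m * a) (m - 1)"
  unfolding tot_def by (rule psum_monom) simp

lemma tot_smult: "tot (smult (scale c 1) p) = smult (scale c 1) (tot p)"
proof (induction p rule: poly_monom_induct)
  case (monom a m)
  have "D (scale c 1 * a) = scale c 1 * D a" by (metis D_scale scale_eq_mult)
  then show ?case by (simp add: smult_monom tot_monom smult_add_right mult_ac)
qed (simp add: smult_add_right tot_add)

lemma rel_add: "x \<in> range tot \<Longrightarrow> y \<in> range tot \<Longrightarrow> x + y \<in> range tot"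
  by (auto simp flip: tot_add)

lemma rel_0: "0 \<in> range tot"
  using additive_0[of tot, OF tot_add] by (metis rangeI)

lemma rel_uminus: "x \<in> range tot \<Longrightarrow> - x \<in> range tot"
  by (auto simp flip: additive_uminus[of tot, OF tot_add])

lemma rel_diff: "x \<in> range tot \<Longrightarrow> y \<in> range tot \<Longrightarrow> x - y \<in> range tot"
  using rel_add[of x "- y"] rel_uminus[of y] by simp

lemma rel_smult: "x \<in> range tot \<Longrightarrow> smult (scale c 1) x \<in> range tot"
  by (auto simp flip: tot_smult)

lemma rel_sum: "(\<And>i. i \<in> I \<Longrightarrow> f i \<in> range tot) \<Longrightarrow> (\<Sum>i\<in>I. f i) \<in> range tot"
  by (induction I rule: infinite_finite_induct) (auto intro: rel_add rel_0)

lemma rel_of_nat: "x \<in> range tot \<Longrightarrow> of_nat n * x \<in> range tot"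
  by (induction n) (auto simp: algebra_simps intro: rel_add rel_0)

lemma rel_sign: "x \<in> range tot \<Longrightarrow> (- 1) ^ n * x \<in> range tot"
  by (cases "even n") (auto intro: rel_uminus)

text \<open>Integration by parts: modulo total derivatives, \<open>D\<close> may be moved to the
  power of x at the price of a sign. The step divides the relation given by \<open>tot\<close> by i
  + 1.\<close>

lemma rel_dv: "monom (dv i c) s - (- 1) ^ i * (of_nat (s choose i) * monom c (s - i)) \<in> range tot"
proof (induction i arbitrary: s)
  case 0
  then show ?case using rel_0 by simp
next
  case (Suc i)
  have "monom (dv (Suc i) c) s + smult (scale (1 / of_nat (Suc i)) 1) (of_nat s * monom (dv i c) (s - 1))
      = smult (scale (1 / of_nat (Suc i)) 1) (tot (monom (dv i c) s))"
  proof -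
    have "scale (1 / of_nat (Suc i)) 1 * D (dv i c) = dv (Suc i) c"
      unfolding D_dv scale_of_nat[symmetric] scale_eq_mult[symmetric] by (simp del: of_nat_Suc)
    then show ?thesis by (simp only: tot_monom smult_add_right smult_monom of_nat_mult_monom)
  qed
  then have 1: "monom (dv (Suc i) c) s + smult (scale (1 / of_nat (Suc i)) 1) (of_nat s * monom (dv i c) (s - 1)) \<in> range tot"
    using rel_smult by simp
  have "smult (scale (1 / of_nat (Suc i)) 1) (of_nat s * (monom (dv i c) (s - 1)
      - (- 1) ^ i * (of_nat (s - 1 choose i) * monom c (s - 1 - i)))) \<in> range tot"
    by (intro rel_smult rel_of_nat Suc.IH)
  from rel_diff[OF 1 this]
  have "monom (dv (Suc i) c) s + smult (scale (1 / of_nat (Suc i)) 1) (of_nat s * ((- 1) ^ i * (of_nat (s - 1 choose i) * monom c (s - 1 - i)))) \<in> range tot"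
    by (simp add: right_diff_distrib smult_diff_right)
  moreover have "smult (scale (1 / of_nat (Suc i)) 1) (of_nat s * ((- 1) ^ i * (of_nat (s - 1 choose i) * monom c (s - 1 - i))))
      = (- 1) ^ i * (of_nat (s choose Suc i) * monom c (s - Suc i))"
  proof -
    have "s * (s - 1 choose i) = Suc i * (s choose Suc i)"
      using Suc_times_binomial_eq[of "s - 1" i] by (cases s) (simp_all add: mult.commute)
    then have "of_nat s * ((- 1) ^ i * (of_nat (s - 1 choose i) * monom c (s - 1 - i)))
       = of_nat (Suc i) * ((- 1) ^ i * (of_nat (s choose Suc i) * monom c (s - Suc i)))"
      by (metis (no_types, lifting) diff_Suc_eq_diff_pred mult.assoc mult.left_commute of_nat_mult)
    moreover have "smult (scale (1 / of_nat (Suc i)) 1) (of_nat (Suc i) * x) = x" for x :: "'v poly"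
    proof -
      have "of_nat (Suc i) * x = smult (scale (of_nat (Suc i)) 1) x"
        by (simp only: scale_of_nat of_nat_poly mult_pCons_left mult_zero_left) simp
      then show ?thesis by (simp only: smult_smult scale_1_mult[symmetric]) (simp del: of_nat_Suc)
    qed
    ultimately show ?thesis by simp
  qed
  ultimately show ?case by simp
qed

text \<open>From i (m choose i) = m (m - 1 choose i - 1): the contribution of the differentiated
  coefficient cancels that of the differentiated power. On the left relations act by zero exactly,
  and not merely modulo relations.\<close>

lemma brk_tot_left: "brk (tot p) q = 0"
proof (rule poly_additive_eq2[of "\<lambda>p q. brk (tot p) q" "\<lambda>_ _. 0"])
  fix a m b l
  have "(\<Sum>i\<le>m. of_nat (m choose i) * monom (nprod (D a) i b) (m + l - i))
    = - (\<Sum>i\<le>m. of_nat (i * (m choose i)) * monom (nprod a (i - 1) b) (m + l - i))"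
    by (simp add: nprod_D_left sum_negf mult_ac flip: minus_monom of_nat_mult_monom)
  also have "(\<Sum>i\<le>m. of_nat (i * (m choose i)) * monom (nprod a (i - 1) b) (m + l - i))
      = brk1 (of_nat m * a) (m - 1) b l"
  proof (cases m)
    case (Suc r)
    have F: "of_nat (Suc i * (Suc r choose Suc i)) * monom (nprod a (Suc i - 1) b) (Suc r + l - Suc i)
        = of_nat (Suc r) * (of_nat (r choose i) * monom (nprod a i b) (r + l - i))" for i
      by (metis Suc_times_binomial_eq add_Suc diff_Suc_1 diff_Suc_Suc mult.assoc mult.commute of_nat_mult)
    have "(\<Sum>i\<le>Suc r. of_nat (i * (Suc r choose i)) * monom (nprod a (i - 1) b) (Suc r + l - i))
      = 0 + (\<Sum>i\<le>r. of_nat (Suc r) * (of_nat (r choose i) * monom (nprod a i b) (r + l - i)))"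
      unfolding sum.atMost_Suc_shift F by (simp only: mult_zero_left of_nat_0)
    also have "\<dots> = brk1 (of_nat (Suc r) * a) r b l"
      unfolding brk1_def nprod_of_nat_mult_left of_nat_mult_monom[symmetric] add_0
      by (intro sum.cong refl mult.left_commute)
    finally show ?thesis unfolding Suc diff_Suc_1 .
  qed (simp add: brk1_def)
  finally show "brk (tot (monom a m)) (monom b l) = 0"
    unfolding tot_monom brk_add brk_monom by (simp add: brk1_def[of "D a"])
qed (simp_all add: tot_add brk_add brk_add_right)

text \<open>The products of b with a are rewritten by \<open>nprod_skew\<close>, the divided powers
  are integrated by parts with \<open>rel_dv\<close>, and for each product of a with b the resulting
  coefficient is \<open>sum_alternating_binomial\<close>.\<close>

lemma brk_skew_monom: "brk1 b l a m + brk1 a m b l \<in> range tot"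
proof -
  \<comment> \<open>Beyond l and m, where the binomial coefficients vanish, and beyond the degree,
    where the products vanish, so every sum can be taken over the same range.\<close>
  define N where "N = l + Suc (degree (br a b)) + m"
  have z: "nprod a i b = 0" if "N \<le> i" for i
    using that by (intro nprod_degree) (simp add: N_def)
  let ?c = "\<lambda>j i. (- 1) ^ j * (of_nat (l choose j) * (of_nat (m + l - j choose i) * monom (nprod a (i + j) b) (m + l - j - i)))"
  have 1: "brk1 b l a m = (\<Sum>j<N. of_nat (l choose j) * monom (nprod b j a) (m + l - j))"
    unfolding brk1_def add.commute[of l m]
    by (rule sum.mono_neutral_left) (auto simp: N_def binomial_eq_0)
  have 2: "of_nat (l choose j) * monom (nprod b j a) (m + l - j) + (\<Sum>i<N. ?c j i) \<in> range tot" for j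
  proof -
    have e1: "of_nat (l choose j) * monom (nprod b j a) (m + l - j)
        = - (\<Sum>i<N. of_nat (l choose j) * ((- 1) ^ (i + j) * monom (dv i (nprod a (i + j) b)) (m + l - j)))"
    proof -
      have s: "monom ((- 1) ^ n * x) k = (- 1) ^ n * monom x k" for n k and x :: 'v
        by (cases "even n") (simp_all add: minus_monom)
      have m: "monom (- (\<Sum>i<N. g i)) k = - (\<Sum>i<N. monom (g i) k)" for g :: "nat \<Rightarrow> 'v" and k
        by (simp add: additive_sum[of "\<lambda>x. monom x k"] add_monom flip: minus_monom)
      have e: "nprod b j a = - (\<Sum>i<N. (- 1) ^ (i + j) * dv i (nprod a (i + j) b))"
        by (rule nprod_skew[OF z])
      show ?thesis unfolding e m[of _ "m + l - j"] s sum_distrib_left mult_minus_right by (rule refl)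
    qed
    have "of_nat (l choose j) * monom (nprod b j a) (m + l - j) + (\<Sum>i<N. ?c j i) = - (\<Sum>i<N. of_nat (l choose j) * ((- 1) ^ (i + j) *
        (monom (dv i (nprod a (i + j) b)) (m + l - j)
          - (- 1) ^ i * (of_nat (m + l - j choose i) * monom (nprod a (i + j) b) (m + l - j - i)))))"
    proof -
      have sg: "(- 1) ^ j = ((- 1) ^ (i + j) * (- 1) ^ i :: 'v poly)" for i
        unfolding power_add by (cases "even i") simp_all
      have "?c j i = of_nat (l choose j) * ((- 1) ^ (i + j) * ((- 1) ^ i * (of_nat (m + l - j choose i) * monom (nprod a (i + j) b) (m + l - j - i))))" for i
        by (subst sg[of i]) (simp only: mult_ac)
      then show ?thesis unfolding e1 by (simp only: right_diff_distrib sum_subtractf minus_diff_eq) simp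
    qed
    then show ?thesis
      by (rule ssubst) (rule rel_uminus[OF rel_sum[OF rel_of_nat[OF rel_sign[OF rel_dv]]]])
  qed
  have 3: "(\<Sum>j<N. \<Sum>i<N. ?c j i) = brk1 a m b l"
  proof -
    have "(\<Sum>j<N. \<Sum>i<N. ?c j i) = (\<Sum>p<N. \<Sum>j\<le>p. ?c j (p - j))"
      by (rule sum_triangle_square[symmetric]) (simp add: z add.commute)
    also have "\<dots> = (\<Sum>p<N. \<Sum>j\<le>p. (- 1) ^ j * of_nat (l choose j) * of_nat (m + l - j choose (p - j)) * monom (nprod a p b) (m + l - p))"
      by (intro sum.cong refl) (simp add: mult.assoc)
    also have "\<dots> = (\<Sum>p<N. of_nat (m choose p) * monom (nprod a p b) (m + l - p))"
      by (simp only: sum_distrib_right[symmetric] sum_alternating_binomial)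
    also have "\<dots> = brk1 a m b l"
      unfolding brk1_def by (rule sum.mono_neutral_right) (auto simp: N_def binomial_eq_0)
    finally show ?thesis .
  qed
  have "brk1 b l a m + brk1 a m b l = (\<Sum>j<N. of_nat (l choose j) * monom (nprod b j a) (m + l - j) + (\<Sum>i<N. ?c j i))"
    by (simp only: 1 3[symmetric] sum.distrib)
  then show ?thesis using rel_sum[OF 2] by simp
qed

lemma brk_skew: "brk p q + brk q p \<in> range tot"
proof (induction p rule: poly_monom_induct)
  case (monom a m)
  show ?case
  proof (induction q rule: poly_monom_induct)
    case (monom b l)
    then show ?case using brk_skew_monom[of a m b l] by (simp add: brk_monom add.commute)
  next
    case (add p q)
    then show ?case using rel_add[OF add] by (simp add: brk_add brk_add_right algebra_simps)
  qed
next
  case (add p q')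
  then show ?case using rel_add[OF add] by (simp add: brk_add brk_add_right algebra_simps)
qed

lemma act_tot: "act (tot p) v = 0"
  by (rule poly_additive_eq[of "\<lambda>p. act (tot p) v" "\<lambda>_. 0"])
    (simp_all add: tot_add act_add tot_monom act_monom nprod_D_left nprod_of_nat_mult_left)

lemma act_brk: "act p (act q v) - act q (act p v) = act (brk p q) v"
proof (rule poly_additive_eq2[of "\<lambda>p q. act p (act q v) - act q (act p v)" "\<lambda>p q. act (brk p q) v"])
  show "act (monom a m) (act (monom b l) v) - act (monom b l) (act (monom a m) v) = act (brk (monom a m) (monom b l)) v" for a m b l
    by (simp add: act_monom nprod_jacobi brk_monom brk1_def additive_sum[of "\<lambda>p. act p v", OF act_add]
        of_nat_mult_monom nprod_of_nat_mult_left)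
qed (simp_all add: act_add act_add_right brk_add brk_add_right algebra_simps)

text \<open>On monomials \<open>nprod_jacobi\<close> is inserted under the double sum. Then (m
  choose i)(i choose p) = (m choose p)(m - p choose i - p) separates p, and Vandermonde's
  convolution contracts the remaining two indices.\<close>

lemma brk_jacobi: "brk x (brk y z) - brk y (brk x z) = brk (brk x y) z"
proof -
  have mono: "brk (monom a m) (brk (monom b l) (monom c q)) - brk (monom b l) (brk (monom a m) (monom c q))
     = brk (brk (monom a m) (monom b l)) (monom c q)" for a m b l c q
  proof -
    let ?G = "\<lambda>p s. monom (nprod (nprod a p b) s c) (m + l + q - p - s)"
    have L: "brk (monom u r) (brk (monom w t) (monom c q))
      = (\<Sum>j\<le>t. \<Sum>i\<le>r. of_nat (t choose j) * of_nat (r choose i) * monom (nprod u i (nprod w j c)) (r + t + q - i - j))"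
      for u r w t
    proof -
      have "brk (monom u r) (brk (monom w t) (monom c q))
        = (\<Sum>j\<le>t. \<Sum>i\<le>r. of_nat (r choose i) * monom (of_nat (t choose j) * nprod u i (nprod w j c)) (r + (t + q - j) - i))"
        unfolding brk_monom brk1_def[of w t] of_nat_mult_monom[where m = "t + q - j" for j]
          additive_sum[of "brk (monom u r)", OF brk_add_right]
        unfolding brk1_def nprod_of_nat_mult_right by (rule refl)
      also have "\<dots> = (\<Sum>j\<le>t. \<Sum>i\<le>r. of_nat (t choose j) * of_nat (r choose i) * monom (nprod u i (nprod w j c)) (r + t + q - i - j))"
      proof (intro sum.cong refl)
        fix j i assume "j \<in> {..t}" "i \<in> {..r}"
        then have "r + (t + q - j) - i = r + t + q - i - j" by simp
        then show "of_nat (r choose i) * monom (of_nat (t choose j) * nprod u i (nprod w j c)) (r + (t + q - j) - i)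
          = of_nat (t choose j) * of_nat (r choose i) * monom (nprod u i (nprod w j c)) (r + t + q - i - j)"
          by (simp add: mult_ac flip: of_nat_mult_monom)
      qed
      finally show ?thesis .
    qed
    have "brk (monom a m) (brk (monom b l) (monom c q)) - brk (monom b l) (brk (monom a m) (monom c q))
      = (\<Sum>i\<le>m. \<Sum>j\<le>l. of_nat (m choose i) * of_nat (l choose j) *
          monom (nprod a i (nprod b j c) - nprod b j (nprod a i c)) (m + l + q - i - j))"
    proof -
      have "brk (monom b l) (brk (monom a m) (monom c q))
        = (\<Sum>i\<le>m. \<Sum>j\<le>l. of_nat (m choose i) * of_nat (l choose j) * monom (nprod b j (nprod a i c)) (m + l + q - i - j))"
        unfolding L by (intro sum.cong refl) (simp add: add.commute diff_commute)
      moreover have "brk (monom a m) (brk (monom b l) (monom c q))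
        = (\<Sum>i\<le>m. \<Sum>j\<le>l. of_nat (m choose i) * of_nat (l choose j) * monom (nprod a i (nprod b j c)) (m + l + q - i - j))"
        unfolding L by (subst sum.swap) (simp add: mult.commute)
      ultimately show ?thesis by (simp add: sum_subtractf right_diff_distrib flip: diff_monom)
    qed
    also have "\<dots> = (\<Sum>i\<le>m. \<Sum>j\<le>l. \<Sum>p\<le>i. of_nat (m choose i) * of_nat (l choose j) * (of_nat (i choose p) * ?G p (i + j - p)))"
    proof (intro sum.cong refl)
      fix i j
      have m: "monom (\<Sum>p\<le>i. g p) k = (\<Sum>p\<le>i. monom (g p) k)" for g :: "nat \<Rightarrow> 'v" and k
        by (simp add: additive_sum[of "\<lambda>x. monom x k"] add_monom)
      have "m + l + q - i - j = m + l + q - p - (i + j - p)" if "p \<le> i" for p using that by simp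
      then show "of_nat (m choose i) * of_nat (l choose j) * monom (nprod a i (nprod b j c) - nprod b j (nprod a i c)) (m + l + q - i - j)
        = (\<Sum>p\<le>i. of_nat (m choose i) * of_nat (l choose j) * (of_nat (i choose p) * ?G p (i + j - p)))"
        unfolding nprod_jacobi m sum_distrib_left by (intro sum.cong refl) (simp add: of_nat_mult_monom)
    qed
    also have "\<dots> = (\<Sum>i\<le>m. \<Sum>p\<le>i. \<Sum>j\<le>l. of_nat (m choose p) * (of_nat (m - p choose (i - p)) * of_nat (l choose j) * ?G p (i - p + j)))"
    proof (rule sum.cong[OF refl])
      fix i assume "i \<in> {..m}"
      then have im: "i \<le> m" by simp
      have ch: "of_nat (m choose i) * of_nat (i choose p) = (of_nat (m choose p) * of_nat (m - p choose (i - p)) :: 'v poly)" if "p \<le> i" for p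
        using choose_mult[OF that im] by (metis of_nat_mult)
      have T: "of_nat (m choose i) * of_nat (l choose j) * (of_nat (i choose p) * ?G p (i + j - p))
          = of_nat (m choose p) * (of_nat (m - p choose (i - p)) * of_nat (l choose j) * ?G p (i - p + j))"
        if p: "p \<le> i" for p j
      proof -
        have e: "i + j - p = i - p + j" using p by simp
        have "of_nat (m choose i) * of_nat (l choose j) * (of_nat (i choose p) * ?G p (i + j - p))
          = (of_nat (m choose i) * of_nat (i choose p)) * (of_nat (l choose j) * ?G p (i + j - p))"
          by (simp only: mult_ac)
        then show ?thesis unfolding ch[OF p] e by (simp only: mult_ac)
      qed
      have "(\<Sum>j\<le>l. \<Sum>p\<le>i. of_nat (m choose i) * of_nat (l choose j) * (of_nat (i choose p) * ?G p (i + j - p)))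
        = (\<Sum>p\<le>i. \<Sum>j\<le>l. of_nat (m choose i) * of_nat (l choose j) * (of_nat (i choose p) * ?G p (i + j - p)))"
        by (rule sum.swap)
      also have "\<dots> = (\<Sum>p\<le>i. \<Sum>j\<le>l. of_nat (m choose p) * (of_nat (m - p choose (i - p)) * of_nat (l choose j) * ?G p (i - p + j)))"
        using T by simp
      finally show "(\<Sum>j\<le>l. \<Sum>p\<le>i. of_nat (m choose i) * of_nat (l choose j) * (of_nat (i choose p) * ?G p (i + j - p)))
        = (\<Sum>p\<le>i. \<Sum>j\<le>l. of_nat (m choose p) * (of_nat (m - p choose (i - p)) * of_nat (l choose j) * ?G p (i - p + j)))" .
    qed
    also have "\<dots> = (\<Sum>p\<le>m. \<Sum>i\<in>{p..m}. \<Sum>j\<le>l. of_nat (m choose p) * (of_nat (m - p choose (i - p)) * of_nat (l choose j) * ?G p (i - p + j)))"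
      by (rule sum_triangle_swap)
    also have "\<dots> = (\<Sum>p\<le>m. of_nat (m choose p) * (\<Sum>s\<le>m - p + l. of_nat (m - p + l choose s) * ?G p s))"
    proof (intro sum.cong refl)
      fix p assume "p \<in> {..m}"
      then have p: "p \<le> m" by simp
      have "(\<Sum>i\<in>{p..m}. \<Sum>j\<le>l. of_nat (m choose p) * (of_nat (m - p choose (i - p)) * of_nat (l choose j) * ?G p (i - p + j)))
        = (\<Sum>i\<le>m - p. \<Sum>j\<le>l. of_nat (m choose p) * (of_nat (m - p choose i) * of_nat (l choose j) * ?G p (i + j)))"
        by (rule sum.reindex_bij_witness[of _ "\<lambda>i. i + p" "\<lambda>i. i - p"]) (use p in auto)
      then show "(\<Sum>i\<in>{p..m}. \<Sum>j\<le>l. of_nat (m choose p) * (of_nat (m - p choose (i - p)) * of_nat (l choose j) * ?G p (i - p + j)))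
        = of_nat (m choose p) * (\<Sum>s\<le>m - p + l. of_nat (m - p + l choose s) * ?G p s)"
        unfolding sum_binomial_add by (simp add: sum_distrib_left)
    qed
    also have "\<dots> = brk (brk (monom a m) (monom b l)) (monom c q)"
    proof -
      have "brk (of_nat (m choose p) * monom (nprod a p b) (m + l - p)) (monom c q)
        = of_nat (m choose p) * (\<Sum>s\<le>m - p + l. of_nat (m - p + l choose s) * ?G p s)" if "p \<le> m" for p
      proof -
        have "m + l - p = m - p + l" "\<And>s. m + l - p + q - s = m + l + q - p - s" using that by auto
        then show ?thesis
          by (simp add: of_nat_mult_monom brk_monom brk1_def nprod_of_nat_mult_left sum_distrib_left)
            (simp add: mult_ac flip: of_nat_mult_monom)
      qed
      then show ?thesis
        by (simp add: brk_monom brk1_def[of a] additive_sum[of "\<lambda>p. brk p (monom c q)", OF brk_add])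
    qed
    finally show ?thesis .
  qed
  show ?thesis
  proof (induction x rule: poly_monom_induct)
    case xm: (monom a m)
    show ?case
    proof (rule poly_additive_eq2[of "\<lambda>y z. brk (monom a m) (brk y z) - brk y (brk (monom a m) z)"
          "\<lambda>y z. brk (brk (monom a m) y) z"])
    qed (simp_all add: mono brk_add brk_add_right algebra_simps)
  qed (simp add: brk_add brk_add_right algebra_simps)
qed

sublocale modes: lie_up_to act brk "range tot"
proof
  show "brk r x = 0" if "r \<in> range tot" for r x using that brk_tot_left by auto
  \<comment> \<open>Relations vanish as left arguments, so skewsymmetry makes them an ideal on the
    right.\<close>
  then show "brk x r \<in> range tot" if "r \<in> range tot" for r x using that brk_skew[of x r] by simp
qed (auto simp: act_add act_add_right brk_add brk_add_right brk_skew brk_jacobi act_brk act_tot)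

end

section \<open>Basic cochains\<close>

lemma del_map2: "length as = length ms \<Longrightarrow> del i (map2 f as ms) = map2 f (del i as) (del i ms)"
proof (induction as ms arbitrary: i rule: list_induct2)
  case Nil then show ?case by (simp add: del_def)
next
  case (Cons a as m ms) then show ?case by (cases i) auto
qed

lemma del2_map2: "length as = length ms \<Longrightarrow> i < j \<Longrightarrow> j < length ms \<Longrightarrow> del2 i j (map2 f as ms) = map2 f (del2 i j as) (del2 i j ms)"
proof (induction as ms arbitrary: i j rule: list_induct2)
  case (Cons a as m ms) then show ?case by (cases j; cases i) (auto simp: del_map2)
qed simp

lemma sum_list_del: "i < length ms \<Longrightarrow> ms ! i + sum_list (del i ms) = sum_list (ms :: nat list)"
proof (induction ms arbitrary: i)
  case (Cons m ms) then show ?case by (cases i) auto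
qed simp

lemma sum_list_del2: "i < j \<Longrightarrow> j < length ms \<Longrightarrow> ms ! i + ms ! j + sum_list (del2 i j ms) = sum_list (ms :: nat list)"
proof (induction ms arbitrary: i j)
  case (Cons m ms)
  then show ?case using sum_list_del[of "j - 1" ms] Cons.IH[of "i - 1" "j - 1"]
    by (cases j; cases i) (auto simp: add.assoc)
qed simp

section \<open>Finiteness and Leibniz conditions, and their stability under the differential\<close>

context pva
begin

lemma act_mult: "act p (v * w) = act p v * w + v * act p w"
  by (rule poly_additive_eq[of "\<lambda>p. act p (v * w)" "\<lambda>p. act p v * w + v * act p w"])
    (simp_all add: act_add act_monom nprod_mult_right algebra_simps)

lemma act_scale: "act p (scale c v) = scale c (act p v)"
  by (rule poly_additive_eq[of "\<lambda>p. act p (scale c v)" "\<lambda>p. scale c (act p v)"])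
    (simp_all add: act_add act_monom nprod_scale_right scale_right_distrib)

lemma mult_scale_1: "scale c 1 * x = scale c x"
  by (rule scale_eq_mult[symmetric])

lemma act_smult: "act (smult (scale c 1) p) v = scale c (act p v)"
  by (rule poly_additive_eq[of "\<lambda>p. act (smult (scale c 1) p) v" "\<lambda>p. scale c (act p v)"])
    (simp_all add: act_add act_monom smult_add_right smult_monom mult_scale_1 nprod_scale_left scale_right_distrib)

lemma brk_smult: "brk (smult (scale c 1) p) q = smult (scale c 1) (brk p q)"
proof (rule poly_additive_eq2[of "\<lambda>p q. brk (smult (scale c 1) p) q" "\<lambda>p q. smult (scale c 1) (brk p q)"])
  show "brk (smult (scale c 1) (monom a m)) (monom b l) = smult (scale c 1) (brk (monom a m) (monom b l))" for a m b l
    unfolding smult_monom mult_scale_1 brk_monom brk1_def nprod_scale_left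
      additive_sum[of "smult (scale c 1)", OF smult_add_right]
    by (simp only: mult_smult_right[symmetric] smult_monom mult_scale_1)
qed (simp_all add: brk_add brk_add_right smult_add_right)

text \<open>As in \<open>slot_finite\<close> and \<open>leibniz\<close>, only the first slot is
  mentioned; alternation carries the condition to the others.\<close>

definition slot_linear :: "('v poly list \<Rightarrow> 'v) \<Rightarrow> bool" where
  "slot_linear \<omega> \<longleftrightarrow> (\<forall>c x zs. \<omega> (smult (scale c 1) x # zs) = scale c (\<omega> (x # zs)))"

definition slot_finite :: "('v poly list \<Rightarrow> 'v) \<Rightarrow> bool" where
  "slot_finite \<omega> \<longleftrightarrow> (\<forall>c zs. \<exists>N. \<forall>m\<ge>N. \<omega> (monom c m # zs) = 0)"

text \<open>For fixed vectors only finitely many multi-indices give a nonzero value, i.e. the values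
  are coefficients of a polynomial in all \<lambda>_i together. Finiteness in each slot separately
  would be too weak.\<close>

definition jointly_finite :: "('v poly list \<Rightarrow> 'v) \<Rightarrow> bool" where
  "jointly_finite \<omega> \<longleftrightarrow>
     (\<forall>as. \<exists>N. \<forall>ms. length ms = length as \<longrightarrow> N \<le> sum_list ms \<longrightarrow> \<omega> (map2 monom as ms) = 0)"

text \<open>The rule with e^(\<partial> \<partial>_\<lambda>) on coefficients: multiplying the
  coefficients by factorials removes the derivatives in \<lambda>. How far the sum extends depends
  on the other arguments.\<close>

definition leibniz :: "('v poly list \<Rightarrow> 'v) \<Rightarrow> bool" where
  "leibniz \<omega> \<longleftrightarrow> (\<forall>b c m zs. \<forall>\<^sub>F N in sequentially. \<omega> (monom (b * c) m # zs) =
     (\<Sum>l<N. dv l b * \<omega> (monom c (m + l) # zs) + dv l c * \<omega> (monom b (m + l) # zs)))"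

text \<open>The counterpart of \<open>pv_cochains\<close> before total derivatives are divided out:
  values are elements of V, not classes.\<close>

definition basic :: "nat \<Rightarrow> ('v poly list \<Rightarrow> 'v) \<Rightarrow> bool" where
  "basic n \<omega> \<longleftrightarrow> (\<forall>xs. length xs \<noteq> n \<longrightarrow> \<omega> xs = 0) \<and> modes.alt \<omega> \<and> slot_linear \<omega> \<and> jointly_finite \<omega> \<and> leibniz \<omega>"

lemma basicD:
  assumes "basic n \<omega>"
  shows "length xs \<noteq> n \<Longrightarrow> \<omega> xs = 0" "modes.alt \<omega>" "slot_linear \<omega>" "jointly_finite \<omega>" "leibniz \<omega>"
  using assms by (auto simp: basic_def)

text \<open>The arguments in \<open>zs\<close> are split into monomials one at a time; their fixed
  indices can only increase the total index, so a bound for the longer list serves for the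
  prefix.\<close>

lemma finite_prefix:
  assumes "modes.alt \<omega>" "jointly_finite \<omega>"
  shows "\<exists>N. \<forall>ms. length ms = length as \<longrightarrow> N \<le> sum_list ms \<longrightarrow> \<omega> (map2 monom as ms @ zs) = 0"
proof (induction zs arbitrary: as)
  case Nil
  then show ?case using assms(2) by (auto simp: jointly_finite_def)
next
  case (Cons z zs)
  show ?case
  proof (induction z rule: poly_monom_induct)
    case (monom b k)
    obtain N where N: "\<And>ms. length ms = length (as @ [b]) \<Longrightarrow> N \<le> sum_list ms \<Longrightarrow> \<omega> (map2 monom (as @ [b]) ms @ zs) = 0"
      using Cons[of "as @ [b]"] by blast
    show ?case
    proof (intro exI[of _ N] allI impI)
      fix ms assume "length ms = length as" "N \<le> sum_list ms"
      then show "\<omega> (map2 monom as ms @ monom b k # zs) = 0"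
        using N[of "ms @ [k]"] by simp
    qed
  next
    case (add p q)
    then obtain N1 N2 where
      "\<And>ms. length ms = length as \<Longrightarrow> N1 \<le> sum_list ms \<Longrightarrow> \<omega> (map2 monom as ms @ p # zs) = 0"
      "\<And>ms. length ms = length as \<Longrightarrow> N2 \<le> sum_list ms \<Longrightarrow> \<omega> (map2 monom as ms @ q # zs) = 0"
      by blast
    then show ?case
      by (intro exI[of _ "max N1 N2"]) (auto simp: modes.alt_add[OF assms(1)])
  qed
qed

lemma slot_finiteI:
  assumes "modes.alt \<omega>" "jointly_finite \<omega>"
  shows "slot_finite \<omega>"
  unfolding slot_finite_def
proof (intro allI)
  fix c zs
  obtain N where N: "\<And>ms. length ms = length [c] \<Longrightarrow> N \<le> sum_list ms \<Longrightarrow> \<omega> (map2 monom [c] ms @ zs) = 0"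
    using finite_prefix[OF assms, of "[c]" zs] by blast
  show "\<exists>N. \<forall>m\<ge>N. \<omega> (monom c m # zs) = 0"
    using N[of "[_]"] by (intro exI[of _ N]) simp
qed

lemma slot_finite_iota:
  assumes "modes.alt \<omega>" "slot_finite \<omega>"
  shows "slot_finite (\<lambda>ys. \<omega> (y # ys))"
  unfolding slot_finite_def
proof (intro allI)
  fix c zs
  obtain N where "\<forall>m\<ge>N. \<omega> (monom c m # y # zs) = 0" using assms(2) unfolding slot_finite_def by blast
  then show "\<exists>N. \<forall>m\<ge>N. \<omega> (y # monom c m # zs) = 0"
    using modes.alt_swap0[OF assms(1), of y _ zs] by auto
qed

lemma leibniz_iota:
  assumes "modes.alt \<omega>" "leibniz \<omega>"
  shows "leibniz (\<lambda>ys. \<omega> (y # ys))"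
  unfolding leibniz_def
proof (intro allI)
  fix b c m zs
  have "\<forall>\<^sub>F N in sequentially. \<omega> (monom (b * c) m # y # zs) =
     (\<Sum>l<N. dv l b * \<omega> (monom c (m + l) # y # zs) + dv l c * \<omega> (monom b (m + l) # y # zs))"
    using assms(2) unfolding leibniz_def by blast
  then show "\<forall>\<^sub>F N in sequentially. \<omega> (y # monom (b * c) m # zs) =
     (\<Sum>l<N. dv l b * \<omega> (y # monom c (m + l) # zs) + dv l c * \<omega> (y # monom b (m + l) # zs))"
    by eventually_elim (simp add: modes.alt_swap0[OF assms(1), of y] sum_negf[symmetric])
qed

text \<open>The exterior product df \<and> \<omega>, where df is the 1-form x \<mapsto>
  \<open>act x f\<close>; it measures the failure of \<open>ced\<close> to be linear over V (see
  \<open>ced_mult\<close>).\<close>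

fun edf :: "'v \<Rightarrow> ('v poly list \<Rightarrow> 'v) \<Rightarrow> 'v poly list \<Rightarrow> 'v" where
  "edf f \<omega> [] = 0"
| "edf f \<omega> (x # xs) = act x f * \<omega> xs - edf f (\<lambda>ys. \<omega> (x # ys)) xs"

lemma edf_minus: "edf f (\<lambda>zs. - \<omega> zs) zs = - edf f \<omega> zs"
  by (induction zs arbitrary: \<omega>) auto

lemma lieder_mult: "modes.lieder x (\<lambda>zs. f * \<omega> zs) zs = f * modes.lieder x \<omega> zs + act x f * \<omega> zs"
  by (induction zs arbitrary: \<omega>) (auto simp: act_mult algebra_simps)

lemma ced_mult: "modes.ced (\<lambda>zs. f * \<omega> zs) zs = f * modes.ced \<omega> zs + edf f \<omega> zs"
  by (induction zs arbitrary: \<omega>) (auto simp: lieder_mult algebra_simps)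

lemma lieder_scale: "modes.lieder x (\<lambda>zs. scale c (\<omega> zs)) zs = scale c (modes.lieder x \<omega> zs)"
  by (induction zs arbitrary: \<omega>) (auto simp: act_scale scale_right_diff_distrib)

lemma ced_scale: "modes.ced (\<lambda>zs. scale c (\<omega> zs)) zs = scale c (modes.ced \<omega> zs)"
  by (induction zs arbitrary: \<omega>) (auto simp: lieder_scale scale_right_diff_distrib)

lemma ced_sum: "modes.ced (\<lambda>zs. \<Sum>i\<in>I. \<omega> i zs) zs = (\<Sum>i\<in>I. modes.ced (\<omega> i) zs)"
  by (induction I rule: infinite_finite_induct) (simp_all add: modes.ced_zero modes.ced_add)

lemma eventually_lieder:
  assumes "\<And>ys. \<forall>\<^sub>F N in F. \<eta> ys = \<theta> N ys"
  shows "\<forall>\<^sub>F N in F. modes.lieder x \<eta> zs = modes.lieder x (\<theta> N) zs"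
  using assms
proof (induction zs arbitrary: \<eta> \<theta>)
  case Nil
  then show ?case using Nil[of "[]"] by eventually_elim simp
next
  case (Cons z zs)
  show ?case
    using Cons.IH[of "\<lambda>ys. \<eta> (z # ys)" "\<lambda>N ys. \<theta> N (z # ys)", OF Cons.prems] Cons.prems[of "brk x z # zs"]
    by eventually_elim simp
qed

lemma eventually_ced:
  assumes "\<And>ys. \<forall>\<^sub>F N in F. \<eta> ys = \<theta> N ys"
  shows "\<forall>\<^sub>F N in F. modes.ced \<eta> zs = modes.ced (\<theta> N) zs"
  using assms
proof (induction zs arbitrary: \<eta> \<theta>)
  case (Cons z zs)
  show ?case
    using Cons.IH[of "\<lambda>ys. \<eta> (z # ys)" "\<lambda>N ys. \<theta> N (z # ys)", OF Cons.prems]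
      eventually_lieder[of \<eta> \<theta> F z zs, OF Cons.prems]
    by eventually_elim simp
qed simp

text \<open>Expand by \<open>nprod_dv_right\<close>, exchange the sums, and put j = q - i. The
  cutoff N survives the exchange because p vanishes from index m + N on.\<close>

lemma leibniz_shift:
  assumes fin: "\<And>j. j \<ge> N \<Longrightarrow> p (m + j) = 0"
  shows "(\<Sum>l<N. nprod a q (dv l b) * p (m + l))
    = (\<Sum>j\<le>q. of_nat (q choose j) * (\<Sum>l<N. dv l (nprod a j b) * p (m + q - j + l)))"
proof -
  have "(\<Sum>l<N. nprod a q (dv l b) * p (m + l))
    = (\<Sum>l<N. \<Sum>i\<le>l. of_nat (q choose i) * dv (l - i) (nprod a (q - i) b) * p (m + (i + (l - i))))"
    by (simp add: nprod_dv_right sum_distrib_right)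
  also have "\<dots> = (\<Sum>i<N. \<Sum>l<N. of_nat (q choose i) * dv l (nprod a (q - i) b) * p (m + (i + l)))"
    by (rule sum_triangle_square) (simp add: fin)
  also have "\<dots> = (\<Sum>i<N + q + 1. \<Sum>l<N. of_nat (q choose i) * dv l (nprod a (q - i) b) * p (m + (i + l)))"
  proof (rule sum.mono_neutral_left)
    have "p (m + (i + l)) = 0" if "N \<le> i" for i l using that by (intro fin) simp
    then show "\<forall>i\<in>{..<N + q + 1} - {..<N}. (\<Sum>l<N. of_nat (q choose i) * dv l (nprod a (q - i) b) * p (m + (i + l))) = 0"
      by simp
  qed auto
  also have "\<dots> = (\<Sum>i\<le>q. \<Sum>l<N. of_nat (q choose i) * dv l (nprod a (q - i) b) * p (m + (i + l)))"
    by (rule sum.mono_neutral_right) (auto intro!: sum.neutral simp: binomial_eq_0)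
  also have "\<dots> = (\<Sum>j\<le>q. \<Sum>l<N. of_nat (q choose j) * dv l (nprod a j b) * p (m + q - j + l))"
    by (rule sum.reindex_bij_witness[of _ "\<lambda>j. q - j" "\<lambda>j. q - j"])
      (auto simp: binomial_symmetric[symmetric] add.assoc intro!: sum.cong)
  finally show ?thesis by (simp add: sum_distrib_left mult.assoc)
qed

text \<open>The Leibniz rule when the product sits inside a bracket. The bracket with y
  differentiates both factors, and each is then split by \<open>leibniz\<close>; by
  \<open>leibniz_shift\<close> the terms in which y has hit the coefficient outside
  \<open>\<omega>\<close> reassemble into \<open>act y\<close> of a divided power.\<close>

lemma leibniz_brk:
  assumes a: "modes.alt \<omega>" and l: "leibniz \<omega>" and f: "slot_finite \<omega>"
  shows "\<forall>\<^sub>F N in sequentially. \<omega> (brk y (monom (b * c) m) # ys) =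
    (\<Sum>l<N. dv l b * \<omega> (brk y (monom c (m + l)) # ys) + act y (dv l b) * \<omega> (monom c (m + l) # ys)
         + dv l c * \<omega> (brk y (monom b (m + l)) # ys) + act y (dv l c) * \<omega> (monom b (m + l) # ys))"
proof (induction y rule: poly_monom_induct)
  case (add p q)
  then show ?case
    by eventually_elim (simp add: brk_add act_add modes.alt_add0[OF a] algebra_simps sum.distrib)
next
  case (monom e q)
  have nat: "\<omega> (of_nat n * z # zs) = of_nat n * \<omega> (z # zs)" for n z zs
    by (induction n) (simp_all add: modes.alt_zero0[OF a] modes.alt_add0[OF a] algebra_simps)
  have B: "\<omega> (brk (monom e q) (monom x r) # ys) = (\<Sum>j\<le>q. of_nat (q choose j) * \<omega> (monom (nprod e j x) (q + r - j) # ys))" for x r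
    by (simp add: brk_monom brk1_def modes.alt_sum0[OF a] nat)
  obtain N1 where N1: "\<And>m. m \<ge> N1 \<Longrightarrow> \<omega> (monom b m # ys) = 0" using f unfolding slot_finite_def by blast
  obtain N2 where N2: "\<And>m. m \<ge> N2 \<Longrightarrow> \<omega> (monom c m # ys) = 0" using f unfolding slot_finite_def by blast
  have ev: "\<forall>\<^sub>F N in sequentially. \<forall>j\<in>{..q}.
      \<omega> (monom (nprod e j b * c) (q + m - j) # ys) =
        (\<Sum>l<N. dv l (nprod e j b) * \<omega> (monom c (q + m - j + l) # ys) + dv l c * \<omega> (monom (nprod e j b) (q + m - j + l) # ys)) \<and>
      \<omega> (monom (b * nprod e j c) (q + m - j) # ys) =
        (\<Sum>l<N. dv l b * \<omega> (monom (nprod e j c) (q + m - j + l) # ys) + dv l (nprod e j c) * \<omega> (monom b (q + m - j + l) # ys))"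
    using l unfolding leibniz_def by (intro eventually_ball_finite eventually_conj ballI finite_atMost) blast+
  show ?case
    using ev eventually_ge_at_top[of N1] eventually_ge_at_top[of N2]
  proof eventually_elim
    case (elim N)
    let ?s = "\<lambda>g. \<Sum>j\<le>q. of_nat (q choose j) * g j"
    have S: "(\<Sum>l<N. nprod e q (dv l x) * \<omega> (monom y (m + l) # ys))
      = ?s (\<lambda>j. \<Sum>l<N. dv l (nprod e j x) * \<omega> (monom y (q + m - j + l) # ys))"
      if "\<And>j. j \<ge> N \<Longrightarrow> \<omega> (monom y (m + j) # ys) = 0" for x y
      using leibniz_shift[of N "\<lambda>r. \<omega> (monom y r # ys)" m e q x, OF that] by (simp add: add.commute)
    have Sb: "(\<Sum>l<N. nprod e q (dv l b) * \<omega> (monom c (m + l) # ys))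
      = ?s (\<lambda>j. \<Sum>l<N. dv l (nprod e j b) * \<omega> (monom c (q + m - j + l) # ys))"
      by (rule S) (use elim N2 in auto)
    have Sc: "(\<Sum>l<N. nprod e q (dv l c) * \<omega> (monom b (m + l) # ys))
      = ?s (\<lambda>j. \<Sum>l<N. dv l (nprod e j c) * \<omega> (monom b (q + m - j + l) # ys))"
      by (rule S) (use elim N1 in auto)
    have T: "(\<Sum>l<N. dv l x * \<omega> (brk (monom e q) (monom y (m + l)) # ys))
      = ?s (\<lambda>j. \<Sum>l<N. dv l x * \<omega> (monom (nprod e j y) (q + m - j + l) # ys))" for x y
    proof -
      have "(\<Sum>l<N. dv l x * \<omega> (brk (monom e q) (monom y (m + l)) # ys))
        = (\<Sum>l<N. \<Sum>j\<le>q. of_nat (q choose j) * (dv l x * \<omega> (monom (nprod e j y) (q + m - j + l) # ys)))"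
      proof (intro sum.cong refl)
        fix l
        have "q + (m + l) - j = q + m - j + l" if "j \<le> q" for j using that by simp
        then show "dv l x * \<omega> (brk (monom e q) (monom y (m + l)) # ys)
          = (\<Sum>j\<le>q. of_nat (q choose j) * (dv l x * \<omega> (monom (nprod e j y) (q + m - j + l) # ys)))"
          unfolding B sum_distrib_left by (intro sum.cong refl) (simp add: mult_ac)
      qed
      also have "\<dots> = ?s (\<lambda>j. \<Sum>l<N. dv l x * \<omega> (monom (nprod e j y) (q + m - j + l) # ys))"
        by (subst sum.swap) (simp add: sum_distrib_left)
      finally show ?thesis .
    qed
    have "\<omega> (brk (monom e q) (monom (b * c) m) # ys)
      = ?s (\<lambda>j. \<omega> (monom (nprod e j b * c) (q + m - j) # ys) + \<omega> (monom (b * nprod e j c) (q + m - j) # ys))"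
      by (simp add: B nprod_mult_right add_monom[symmetric] modes.alt_add0[OF a])
    also have "\<dots> = ?s (\<lambda>j. \<Sum>l<N. dv l (nprod e j b) * \<omega> (monom c (q + m - j + l) # ys))
        + ?s (\<lambda>j. \<Sum>l<N. dv l c * \<omega> (monom (nprod e j b) (q + m - j + l) # ys))
        + ?s (\<lambda>j. \<Sum>l<N. dv l b * \<omega> (monom (nprod e j c) (q + m - j + l) # ys))
        + ?s (\<lambda>j. \<Sum>l<N. dv l (nprod e j c) * \<omega> (monom b (q + m - j + l) # ys))"
      using elim(1) by (simp add: sum.distrib distrib_left)
    finally show ?case
      unfolding sum.distrib act_monom T Sb Sc by (simp only: add_ac)
  qed
qed

text \<open>The Lie derivative obeys the Leibniz rule only up to terms df \<and> \<iota>\<omega>. In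
  \<open>leibniz_ced\<close> they cancel against those that \<open>ced\<close> produces from the
  products in the contracted rule.\<close>

lemma leibniz_lieder:
  assumes "modes.alt \<omega>" "leibniz \<omega>" "slot_finite \<omega>"
  shows "\<forall>\<^sub>F N in sequentially. modes.lieder (monom (b * c) m) \<omega> zs =
    (\<Sum>l<N. dv l b * modes.lieder (monom c (m + l)) \<omega> zs + edf (dv l b) (\<lambda>ys. \<omega> (monom c (m + l) # ys)) zs
        + dv l c * modes.lieder (monom b (m + l)) \<omega> zs + edf (dv l c) (\<lambda>ys. \<omega> (monom b (m + l) # ys)) zs)"
  using assms
proof (induction zs arbitrary: \<omega>)
  case Nil
  show ?case using nprod_mult_left[of b c m "\<omega> []"] by (simp add: act_monom algebra_simps)
next
  case (Cons y ys)
  note a = Cons.prems(1)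
  have sk: "\<omega> (brk x y # ys) = - \<omega> (brk y x # ys)" for x
    using modes.alt_R0[OF a brk_skew[of x y], of ys] modes.alt_add0[OF a]
    by (simp add: eq_neg_iff_add_eq_0)
  have sw: "edf f (\<lambda>zs. \<omega> (y # x # zs)) ys = - edf f (\<lambda>zs. \<omega> (x # y # zs)) ys" for f x
    by (simp only: modes.alt_swap0[OF a, of y x] edf_minus)
  show ?case
    using Cons.IH[OF modes.alt_iota[OF a, of y] leibniz_iota[OF a Cons.prems(2), of y] slot_finite_iota[OF a Cons.prems(3), of y]]
      leibniz_brk[OF Cons.prems, of y b c m ys]
  proof eventually_elim
    case (elim N)
    show ?case
      unfolding modes.lieder.simps edf.simps elim(1) sk elim(2) sw
      by (simp only: sum_subtractf[symmetric] diff_minus_eq_add sum.distrib[symmetric])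
        (intro sum.cong refl, simp add: algebra_simps)
  qed
qed

lemma leibniz_ced:
  assumes "modes.alt \<omega>" "leibniz \<omega>" "slot_finite \<omega>"
  shows "leibniz (modes.ced \<omega>)"
  unfolding leibniz_def
proof (intro allI)
  fix b c m zs
  have "\<forall>\<^sub>F N in sequentially. modes.ced (\<lambda>ys. \<omega> (monom (b * c) m # ys)) zs =
     modes.ced (\<lambda>ys. \<Sum>l<N. dv l b * \<omega> (monom c (m + l) # ys) + dv l c * \<omega> (monom b (m + l) # ys)) zs"
    by (rule eventually_ced) (use assms(2) in \<open>auto simp: leibniz_def\<close>)
  then show "\<forall>\<^sub>F N in sequentially. modes.ced \<omega> (monom (b * c) m # zs) =
     (\<Sum>l<N. dv l b * modes.ced \<omega> (monom c (m + l) # zs) + dv l c * modes.ced \<omega> (monom b (m + l) # zs))"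
    using leibniz_lieder[OF assms, of b c m zs]
  proof eventually_elim
    case (elim N)
    show ?case
      unfolding modes.ced.simps elim ced_sum modes.ced_add ced_mult sum_subtractf[symmetric]
      by (intro sum.cong refl) (simp add: algebra_simps)
  qed
qed

lemma finite_bounded_lists: "finite {ms :: nat list. length ms = n \<and> sum_list ms < N}"
proof (rule finite_subset)
  show "{ms. length ms = n \<and> sum_list ms < N} \<subseteq> {ms. set ms \<subseteq> {..<N} \<and> length ms = n}"
    using member_le_sum_list by fastforce
qed (rule finite_lists_length_eq, simp)

text \<open>In an action term either the remaining indices have large total, so that
  \<open>\<omega>\<close> vanishes, or they form one of finitely many lists, and then the index in
  front exceeds the degree of the brackets involved. In a bracket term the product of index p lowers
  the total by p, which is at most the degree of the bracket.\<close>

lemma jointly_finite_ced: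
  assumes a: "modes.alt \<omega>" and f: "jointly_finite \<omega>"
  shows "jointly_finite (modes.ced \<omega>)"
proof -
  have A: "\<exists>N. \<forall>ms. length ms = length as \<longrightarrow> N \<le> sum_list ms \<longrightarrow>
      act (monom (as ! i) (ms ! i)) (\<omega> (map2 monom (del i as) (del i ms))) = 0"
    if i: "i < length as" for as i
  proof -
    obtain N where N: "\<And>ms. length ms = length (del i as) \<Longrightarrow> N \<le> sum_list ms \<Longrightarrow> \<omega> (map2 monom (del i as) ms) = 0"
      using f unfolding jointly_finite_def by blast
    define S where "S = {ms. length ms = length (del i as) \<and> sum_list ms < N}"
    define M where "M = (\<Sum>ms\<in>S. Suc (degree (br (as ! i) (\<omega> (map2 monom (del i as) ms)))))"
    have S: "finite S" unfolding S_def by (rule finite_bounded_lists)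
    show ?thesis
    proof (intro exI[of _ "N + M"] allI impI)
      fix ms assume ms: "length ms = length as" "N + M \<le> sum_list ms"
      have len: "length (del i ms) = length (del i as)" using ms i by (simp add: length_del)
      show "act (monom (as ! i) (ms ! i)) (\<omega> (map2 monom (del i as) (del i ms))) = 0"
      proof (cases "N \<le> sum_list (del i ms)")
        case True
        then show ?thesis using N[OF len] by simp
      next
        case False
        then have "del i ms \<in> S" using len by (simp add: S_def)
        then have "Suc (degree (br (as ! i) (\<omega> (map2 monom (del i as) (del i ms))))) \<le> M"
          unfolding M_def using S by (intro member_le_sum) auto
        moreover have "M \<le> ms ! i"
          using sum_list_del[of i ms] ms i False by simp
        ultimately show ?thesis by (simp add: act_monom nprod_degree)
      qed
    qed
  qed
  have nat: "\<omega> (of_nat n * z # zs) = of_nat n * \<omega> (z # zs)" for n z zs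
    by (induction n) (simp_all add: modes.alt_zero0[OF a] modes.alt_add0[OF a] algebra_simps)
  have B: "\<exists>N. \<forall>ms. length ms = length as \<longrightarrow> N \<le> sum_list ms \<longrightarrow>
      \<omega> (brk (monom (as ! i) (ms ! i)) (monom (as ! j) (ms ! j)) # map2 monom (del2 i j as) (del2 i j ms)) = 0"
    if ij: "i < j" "j < length as" for as i j
  proof -
    define d where "d = degree (br (as ! i) (as ! j))"
    have "\<forall>p. \<exists>N. \<forall>ms. length ms = length (nprod (as ! i) p (as ! j) # del2 i j as) \<longrightarrow> N \<le> sum_list ms \<longrightarrow>
        \<omega> (map2 monom (nprod (as ! i) p (as ! j) # del2 i j as) ms) = 0"
      using f unfolding jointly_finite_def by blast
    then obtain N where N: "\<And>p ms. length ms = length (nprod (as ! i) p (as ! j) # del2 i j as) \<Longrightarrow> N p \<le> sum_list ms \<Longrightarrow>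
        \<omega> (map2 monom (nprod (as ! i) p (as ! j) # del2 i j as) ms) = 0" by metis
    show ?thesis
    proof (intro exI[of _ "(\<Sum>p\<le>d. N p) + d"] allI impI)
      fix ms assume ms: "length ms = length as" "(\<Sum>p\<le>d. N p) + d \<le> sum_list ms"
      have len: "length (del2 i j ms) = length (del2 i j as)" using ms ij by (simp add: length_del2)
      have "\<omega> (monom (nprod (as ! i) p (as ! j)) (ms ! i + ms ! j - p) # map2 monom (del2 i j as) (del2 i j ms)) = 0" for p
      proof (cases "p \<le> d")
        case True
        have "N p \<le> (\<Sum>p\<le>d. N p)" using True by (intro member_le_sum) auto
        then have "N p \<le> sum_list ((ms ! i + ms ! j - p) # del2 i j ms)"
          using ms sum_list_del2[of i j ms] ij True by simp
        then show ?thesis using N[of "(ms ! i + ms ! j - p) # del2 i j ms" p] len by simp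
      next
        case False
        then show ?thesis by (simp add: d_def nprod_degree modes.alt_zero0[OF a])
      qed
      then show "\<omega> (brk (monom (as ! i) (ms ! i)) (monom (as ! j) (ms ! j)) # map2 monom (del2 i j as) (del2 i j ms)) = 0"
        by (simp add: brk_monom brk1_def modes.alt_sum0[OF a] nat)
    qed
  qed
  show ?thesis
    unfolding jointly_finite_def
  proof
    fix as :: "'v list"
    obtain NA where NA: "\<And>i ms. i < length as \<Longrightarrow> length ms = length as \<Longrightarrow> NA i \<le> sum_list ms \<Longrightarrow>
      act (monom (as ! i) (ms ! i)) (\<omega> (map2 monom (del i as) (del i ms))) = 0"
      using A[of _ as] by metis
    obtain NB where NB: "\<And>i j ms. i < j \<Longrightarrow> j < length as \<Longrightarrow> length ms = length as \<Longrightarrow> NB i j \<le> sum_list ms \<Longrightarrow>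
      \<omega> (brk (monom (as ! i) (ms ! i)) (monom (as ! j) (ms ! j)) # map2 monom (del2 i j as) (del2 i j ms)) = 0"
      using B[of _ _ as] by metis
    define K where "K = (\<Sum>i<length as. NA i) + (\<Sum>j<length as. \<Sum>i<j. NB i j)"
    have KA: "NA i \<le> K" if "i < length as" for i
    proof -
      have "NA i \<le> (\<Sum>i<length as. NA i)" using that by (intro member_le_sum) auto
      then show ?thesis by (simp add: K_def)
    qed
    have KB: "NB i j \<le> K" if "i < j" "j < length as" for i j
    proof -
      have "NB i j \<le> (\<Sum>i<j. NB i j)" using that by (intro member_le_sum) auto
      also have "\<dots> \<le> (\<Sum>j<length as. \<Sum>i<j. NB i j)"
        using that by (intro member_le_sum[of j "{..<length as}" "\<lambda>j. \<Sum>i<j. NB i j"]) auto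
      finally show ?thesis by (simp add: K_def)
    qed
    show "\<exists>N. \<forall>ms. length ms = length as \<longrightarrow> N \<le> sum_list ms \<longrightarrow> modes.ced \<omega> (map2 monom as ms) = 0"
    proof (intro exI[of _ K] allI impI)
      fix ms assume ms: "length ms = length as" "K \<le> sum_list ms"
      show "modes.ced \<omega> (map2 monom as ms) = 0"
      proof -
        have "act (monom (as ! i) (ms ! i)) (\<omega> (map2 monom (del i as) (del i ms))) = 0" if "i < length as" for i
          using NA[OF that ms(1)] KA[OF that] ms(2) by simp
        moreover have "\<omega> (brk (monom (as ! i) (ms ! i)) (monom (as ! j) (ms ! j)) # map2 monom (del2 i j as) (del2 i j ms)) = 0"
          if "i < j" "j < length as" for i j
          using NB[OF that ms(1)] KB[OF that] ms(2) by simp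
        ultimately show ?thesis
          unfolding modes.ced_closed[OF a] using ms(1) by (simp add: del_map2 del2_map2)
      qed
    qed
  qed
qed

lemma slot_linear_iota:
  assumes "modes.alt \<omega>" "slot_linear \<omega>"
  shows "slot_linear (\<lambda>ys. \<omega> (y # ys))"
  using assms(2) modes.alt_swap0[OF assms(1), of y] unfolding slot_linear_def by simp

lemma lieder_smult:
  assumes "slot_linear \<omega>" "modes.alt \<omega>"
  shows "modes.lieder (smult (scale c 1) x) \<omega> zs = scale c (modes.lieder x \<omega> zs)"
  using assms
proof (induction zs arbitrary: \<omega>)
  case (Cons z zs)
  then show ?case using Cons.IH[OF slot_linear_iota[of \<omega> z] modes.alt_iota[of \<omega> z]]
    by (simp add: brk_smult slot_linear_def scale_right_diff_distrib)
qed (simp add: act_smult)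

lemma slot_linear_ced:
  assumes "slot_linear \<omega>" "modes.alt \<omega>"
  shows "slot_linear (modes.ced \<omega>)"
  unfolding slot_linear_def
proof (intro allI)
  fix c x zs
  have "(\<lambda>ys. \<omega> (smult (scale c 1) x # ys)) = (\<lambda>ys. scale c (\<omega> (x # ys)))"
    using assms(1) by (simp add: slot_linear_def)
  then show "modes.ced \<omega> (smult (scale c 1) x # zs) = scale c (modes.ced \<omega> (x # zs))"
    by (simp add: lieder_smult[OF assms] ced_scale scale_right_diff_distrib)
qed

lemma ced_length:
  assumes "\<And>xs. length xs \<noteq> n \<Longrightarrow> \<omega> xs = 0" "length xs \<noteq> Suc n" "modes.alt \<omega>"
  shows "modes.ced \<omega> xs = 0"
  unfolding modes.ced_closed[OF assms(3)]
  using assms(1,2) by (auto intro!: sum.neutral simp: length_del length_del2)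

lemma basic_ced: "basic n \<omega> \<Longrightarrow> basic (Suc n) (modes.ced \<omega>)"
  unfolding basic_def
  by (auto intro: modes.alt_ced slot_linear_ced jointly_finite_ced leibniz_ced slot_finiteI ced_length[of n])

lemma basic_iota:
  assumes "basic (Suc n) \<omega>"
  shows "basic n (\<lambda>ys. \<omega> (x # ys))"
proof -
  note a = basicD(2)[OF assms]
  have "jointly_finite (\<lambda>ys. \<omega> (x # ys))"
    unfolding jointly_finite_def
  proof
    fix as
    obtain N where N: "\<And>ms. length ms = length as \<Longrightarrow> N \<le> sum_list ms \<Longrightarrow> \<omega> (map2 monom as ms @ [x]) = 0"
      using finite_prefix[OF a basicD(4)[OF assms], of as "[x]"] by blast
    then show "\<exists>N. \<forall>ms. length ms = length as \<longrightarrow> N \<le> sum_list ms \<longrightarrow> \<omega> (x # map2 monom as ms) = 0"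
      using modes.alt_move[OF a, of "[]" x _ "[]"] by (intro exI[of _ N]) simp
  qed
  then show ?thesis
    using assms slot_linear_iota[OF a] leibniz_iota[OF a] modes.alt_iota[OF a]
    unfolding basic_def by auto
qed

lemma basic_add:
  assumes "basic n \<omega>" "basic n \<eta>"
  shows "basic n (\<lambda>xs. \<omega> xs + \<eta> xs)"
proof -
  have "jointly_finite (\<lambda>xs. \<omega> xs + \<eta> xs)"
    unfolding jointly_finite_def
  proof
    fix as
    obtain N where N: "\<forall>ms. length ms = length as \<longrightarrow> N \<le> sum_list ms \<longrightarrow> \<omega> (map2 monom as ms) = 0"
      using basicD(4)[OF assms(1)] unfolding jointly_finite_def by blast
    obtain N' where N': "\<forall>ms. length ms = length as \<longrightarrow> N' \<le> sum_list ms \<longrightarrow> \<eta> (map2 monom as ms) = 0"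
      using basicD(4)[OF assms(2)] unfolding jointly_finite_def by blast
    show "\<exists>N. \<forall>ms. length ms = length as \<longrightarrow> N \<le> sum_list ms \<longrightarrow> \<omega> (map2 monom as ms) + \<eta> (map2 monom as ms) = 0"
      using N N' by (intro exI[of _ "max N N'"]) simp
  qed
  moreover have "leibniz (\<lambda>xs. \<omega> xs + \<eta> xs)"
    unfolding leibniz_def
  proof (intro allI)
    fix b c m zs
    show "\<forall>\<^sub>F N in sequentially. \<omega> (monom (b * c) m # zs) + \<eta> (monom (b * c) m # zs) =
       (\<Sum>l<N. dv l b * (\<omega> (monom c (m + l) # zs) + \<eta> (monom c (m + l) # zs)) + dv l c * (\<omega> (monom b (m + l) # zs) + \<eta> (monom b (m + l) # zs)))"
      using basicD(5)[OF assms(1), unfolded leibniz_def, rule_format, of b c m zs]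
        basicD(5)[OF assms(2), unfolded leibniz_def, rule_format, of b c m zs]
      by eventually_elim (simp add: algebra_simps sum.distrib)
  qed
  moreover have "modes.alt (\<lambda>xs. \<omega> xs + \<eta> xs)"
  proof (rule modes.altI)
    fix xs x y zs
    show "\<omega> (xs @ x # y # zs) + \<eta> (xs @ x # y # zs) = - (\<omega> (xs @ y # x # zs) + \<eta> (xs @ y # x # zs))"
      using modes.alt_swap[OF basicD(2)[OF assms(1)], of xs x y zs] modes.alt_swap[OF basicD(2)[OF assms(2)], of xs x y zs] by simp
  qed (simp_all add: modes.alt_add[OF basicD(2)[OF assms(1)]] modes.alt_add[OF basicD(2)[OF assms(2)]]
      modes.alt_R[OF basicD(2)[OF assms(1)]] modes.alt_R[OF basicD(2)[OF assms(2)]])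
  ultimately show ?thesis
    using basicD(1,3)[OF assms(1)] basicD(1,3)[OF assms(2)]
    unfolding basic_def slot_linear_def by (simp add: scale_right_distrib)
qed

lemma basic_scale:
  assumes "basic n \<omega>"
  shows "basic n (\<lambda>xs. scale c (\<omega> xs))"
proof -
  have "jointly_finite (\<lambda>xs. scale c (\<omega> xs))"
    using basicD(4)[OF assms] unfolding jointly_finite_def by (metis scale_zero_right)
  moreover have "leibniz (\<lambda>xs. scale c (\<omega> xs))"
    unfolding leibniz_def
  proof (intro allI)
    fix b e m zs
    show "\<forall>\<^sub>F N in sequentially. scale c (\<omega> (monom (b * e) m # zs)) =
       (\<Sum>l<N. dv l b * scale c (\<omega> (monom e (m + l) # zs)) + dv l e * scale c (\<omega> (monom b (m + l) # zs)))"
      using basicD(5)[OF assms, unfolded leibniz_def, rule_format, of b e m zs]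
      by eventually_elim (simp add: scale_sum_right scale_right_distrib scale_mult_right)
  qed
  moreover have "modes.alt (\<lambda>xs. scale c (\<omega> xs))"
  proof (rule modes.altI)
    fix xs x y zs
    show "scale c (\<omega> (xs @ x # y # zs)) = - scale c (\<omega> (xs @ y # x # zs))"
      using modes.alt_swap[OF basicD(2)[OF assms], of xs x y zs] by simp
  qed (simp_all add: modes.alt_add[OF basicD(2)[OF assms]] modes.alt_R[OF basicD(2)[OF assms]] scale_right_distrib)
  ultimately show ?thesis
    using basicD(1,3)[OF assms] unfolding basic_def slot_linear_def
    by (simp add: scale_left_commute)
qed

lemma basic_zero: "basic n (\<lambda>_. 0)"
  unfolding basic_def by (simp add: slot_linear_def jointly_finite_def leibniz_def modes.alt_def)

lemma basic_diff: "basic n \<omega> \<Longrightarrow> basic n \<eta> \<Longrightarrow> basic n (\<lambda>xs. \<omega> xs - \<eta> xs)"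
  using basic_add[of n \<omega> "\<lambda>xs. scale (- 1) (\<eta> xs)"] basic_scale[of n \<eta> "- 1"] by simp

lemma basic_iota0: "basic 0 \<omega> \<Longrightarrow> (\<lambda>ys. \<omega> (x # ys)) = (\<lambda>_. 0)"
  by (auto simp: basic_def)

text \<open>By Cartan's formula, so that no finiteness or Leibniz condition has to be checked
  again.\<close>

lemma basic_lieder:
  assumes "basic n \<omega>"
  shows "basic n (modes.lieder x \<omega>)"
proof -
  have "modes.lieder x \<omega> = (\<lambda>zs. modes.ced \<omega> (x # zs) + modes.ced (\<lambda>ys. \<omega> (x # ys)) zs)"
    by (simp add: fun_eq_iff)
  moreover have "basic n (\<lambda>zs. modes.ced (\<lambda>ys. \<omega> (x # ys)) zs)"
  proof (cases n)
    case 0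
    then show ?thesis using assms basic_iota0[of \<omega> x] basic_zero by (simp add: modes.ced_zero)
  next
    case (Suc m)
    then show ?thesis using basic_ced[OF basic_iota[of m \<omega> x]] assms by simp
  qed
  ultimately show ?thesis
    using basic_add[OF basic_iota[OF basic_ced[OF assms], of x], of "modes.ced (\<lambda>ys. \<omega> (x # ys))"] by metis
qed

end

section \<open>Basic cochains of an affine Poisson vertex algebra are determined by generators\<close>

definition pmsum :: "('x \<Rightarrow> 'a::zero \<Rightarrow> 'b::comm_monoid_add) \<Rightarrow> ('x \<Rightarrow>\<^sub>0 'a) \<Rightarrow> 'b" where
  "pmsum f w = (\<Sum>s\<in>keys w. f s (lookup w s))"

lemma pmsum_add:
  fixes f :: "'x \<Rightarrow> 'a::comm_monoid_add \<Rightarrow> 'b::ab_group_add"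
  assumes "\<And>s a b. f s (a + b) = f s a + f s b"
  shows "pmsum f (v + w) = pmsum f v + pmsum f w"
proof -
  have 0: "f s 0 = 0" for s using additive_0[of "f s", OF assms] .
  have sup: "pmsum f u = (\<Sum>s\<in>S. f s (lookup u s))"
    if "finite S" "keys u \<subseteq> S" for u S
    unfolding pmsum_def by (rule sum.mono_neutral_left) (use that in \<open>auto simp: in_keys_iff 0\<close>)
  let ?S = "keys v \<union> keys w"
  show ?thesis
    using sup[of ?S v] sup[of ?S w] sup[of ?S "v + w"]
    by (simp add: Poly_Mapping.keys_add lookup_add assms sum.distrib)
qed

lemma pmsum_single: "f s 0 = 0 \<Longrightarrow> pmsum f (single s a) = f s a"
  by (cases "a = 0") (auto simp: pmsum_def)

section \<open>The Leibniz operator in one variable\<close>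

context pva
begin

definition lamD :: "'v poly \<Rightarrow> 'v poly" where
  "lamD p = [:0, 1:] * p + map_poly D p"

lemma map_poly_D_add: "map_poly D (p + q) = map_poly D p + map_poly D q"
  by (rule poly_eqI) (simp add: coeff_map_poly D_add)

lemma lamD_add: "lamD (p + q) = lamD p + lamD q"
  by (simp add: lamD_def map_poly_D_add algebra_simps)

lemma lamD_power_add: "(lamD ^^ k) (p + q) = (lamD ^^ k) p + (lamD ^^ k) q"
  by (induction k) (simp_all add: lamD_add)

lemma coeff_lamD: "coeff (lamD p) m = (case m of 0 \<Rightarrow> 0 | Suc i \<Rightarrow> coeff p i) + D (coeff p m)"
  by (cases m) (simp_all add: lamD_def coeff_map_poly)

lemma lamD_X: "lamD ([:0, 1:] * p) = [:0, 1:] * lamD p"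
proof (rule poly_eqI)
  fix m
  have "coeff ([:0, 1:] * q) m = (case m of 0 \<Rightarrow> 0 | Suc i \<Rightarrow> coeff q i)" for q :: "'v poly"
    by (cases m) simp_all
  then show "coeff (lamD ([:0, 1:] * p)) m = coeff ([:0, 1:] * lamD p) m"
    by (simp add: coeff_lamD split: nat.split)
qed

lemma lamD_power_X: "(lamD ^^ k) ([:0, 1:] * p) = [:0, 1:] * (lamD ^^ k) p"
  by (induction k) (simp_all only: funpow.simps comp_apply id_apply lamD_X)

lemma coeff_lamD_power: "coeff ((lamD ^^ k) [:b:]) m = of_nat (k choose m) * (D ^^ (k - m)) b"
proof (induction k arbitrary: m)
  case 0
  then show ?case by (cases m) auto
next
  case (Suc k)
  show ?case
  proof (cases m)
    case 0
    then show ?thesis by (simp add: coeff_lamD Suc.IH)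
  next
    case (Suc i)
    show ?thesis
    proof (cases "m \<le> k")
      case True
      then have "D ((D ^^ (k - m)) b) = (D ^^ (k - i)) b"
        using Suc Suc_diff_Suc[of i k] by (metis Suc_le_eq comp_apply funpow.simps(2))
      then show ?thesis using Suc by (simp add: coeff_lamD Suc.IH D_of_nat_mult algebra_simps)
    qed (use Suc in \<open>simp add: coeff_lamD Suc.IH binomial_eq_0\<close>)
  qed
qed

text \<open>\<open>star b Q\<close> is \<open>(e\<^bsup>\<partial> \<partial>\<^sub>\<lambda>\<^esup> b) Q(\<lambda>)\<close>, computed as \<open>Q(\<lambda> + \<partial>) b\<close> with \<open>\<partial>\<close> acting on \<open>b\<close> only.\<close>

definition star :: "'v \<Rightarrow> 'v poly \<Rightarrow> 'v poly" where
  "star b Q = psum (\<lambda>k q. smult q ((lamD ^^ k) [:b:])) Q"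

lemma star_add_right: "star b (P + Q) = star b P + star b Q"
  unfolding star_def by (rule psum_add) (simp add: smult_add_left)

lemma star_monom: "star b (monom q k) = smult q ((lamD ^^ k) [:b:])"
  unfolding star_def by (rule psum_monom) simp

lemma star_add: "star (b + c) Q = star b Q + star c Q"
  using lamD_power_add[of _ "[:b:]" "[:c:]"]
  by (simp add: star_def smult_add_right psum_add_fun)

text \<open>One of the k factors \<lambda> + \<partial> in front of b is split off: its \<lambda>
  comes out, its \<partial> differentiates b.\<close>

lemma star_X: "star b ([:0, 1:] * Q) = [:0, 1:] * star b Q + star (D b) Q"
proof (rule poly_additive_eq[of "\<lambda>Q. star b ([:0, 1:] * Q)" "\<lambda>Q. [:0, 1:] * star b Q + star (D b) Q"])
  fix q :: 'v and k
  have "[:0, 1:] * monom q k = monom q (Suc k)"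
    by (simp add: monom_Suc)
  moreover have "(lamD ^^ Suc k) [:b:] = [:0, 1:] * (lamD ^^ k) [:b:] + (lamD ^^ k) [:D b:]"
  proof -
    have "(lamD ^^ Suc k) [:b:] = (lamD ^^ k) (lamD [:b:])"
      by (simp only: funpow_Suc_right comp_apply)
    also have "lamD [:b:] = [:0, 1:] * [:b:] + [:D b:]"
      by (simp only: lamD_def map_poly_pCons D_0 map_poly_0)
    finally show ?thesis by (simp only: lamD_power_add lamD_power_X)
  qed
  ultimately show "star b ([:0, 1:] * monom q k) = [:0, 1:] * star b (monom q k) + star (D b) (monom q k)"
    by (simp only: star_monom smult_add_right mult_smult_right)
qed (simp_all only: star_add_right distrib_left add_ac)

lemma star_const: "star b [:q:] = [:q * b:]"
  using star_monom[of b q 0] by (simp add: monom_0)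

text \<open>With the additivity of \<open>star\<close> this turns V[\<lambda>] into a V-module, over
  which derivations of V can be formed. The induction on Q uses \<open>star_X\<close> and that
  \<open>D\<close> is a derivation.\<close>

lemma star_mult: "star (b * c) Q = star b (star c Q)"
proof (induction Q arbitrary: b c)
  case 0
  have "star b 0 = 0" for b using star_add_right[of b 0 0] by simp
  then show ?case by simp
next
  case (pCons a Q)
  have e: "pCons a Q = [:a:] + [:0, 1:] * Q" by simp
  show ?case
    unfolding e star_add_right star_X star_const D_mult star_add pCons.IH
    by (simp add: mult_ac)
qed

lemma star_uminus: "star b (- Q) = - star b Q"
  by (rule additive_uminus[of "star b", OF star_add_right])

lemma star_scale_1: "star (scale c 1) Q = smult (scale c 1) Q"
proof (induction Q)
  case 0
  show ?case using star_add_right[of _ 0 0] by simp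
next
  case (pCons a Q)
  have e: "pCons a Q = [:a:] + [:0, 1:] * Q" by simp
  have z: "star 0 Q = 0" using star_add[of 0 0] by simp
  have D: "D (scale c 1) = 0" by (simp add: D_scale)
  show ?case
    unfolding e star_add_right star_X star_const pCons.IH smult_add_right D z by (simp add: mult_ac)
qed

text \<open>Translates the operator form of the Leibniz rule into the form on modes: after
  multiplication by m! the derivatives in \<lambda> become shifts of the index.\<close>

lemma coeff_star:
  "\<forall>\<^sub>F N in sequentially. of_nat (fact m) * coeff (star b Q) m
     = (\<Sum>l<N. dv l b * (of_nat (fact (m + l)) * coeff Q (m + l)))"
proof (induction Q rule: poly_monom_induct)
  case (add p q)
  then show ?case by eventually_elim (simp add: star_add_right algebra_simps sum.distrib)
next
  case (monom q k)
  have "of_nat (fact m) * coeff (star b (monom q k)) m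
     = (\<Sum>l<N. dv l b * (of_nat (fact (m + l)) * coeff (monom q k) (m + l)))" if N: "N > k" for N
  proof (cases "m \<le> k")
    case True
    have "(\<Sum>l<N. dv l b * (of_nat (fact (m + l)) * coeff (monom q k) (m + l)))
        = (\<Sum>l<N. if l = k - m then dv l b * (of_nat (fact k) * q) else 0)"
      using True by (intro sum.cong) auto
    also have "\<dots> = of_nat (fact k) * dv (k - m) b * q"
      using N by (simp add: mult_ac)
    also have "\<dots> = of_nat (fact m * (k choose m)) * (of_nat (fact (k - m)) * dv (k - m) b) * q"
      unfolding mult.assoc[symmetric] of_nat_mult[symmetric]
      using binomial_fact_lemma[OF True] by (simp add: mult_ac)
    also have "of_nat (fact (k - m)) * dv (k - m) b = (D ^^ (k - m)) b"
      unfolding scale_of_nat[symmetric] by (simp add: dv_def)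
    finally show ?thesis by (simp add: star_monom coeff_lamD_power mult_ac)
  next
    case False
    have "(\<Sum>l<N. dv l b * (of_nat (fact (m + l)) * coeff (monom q k) (m + l))) = 0"
      using False by (intro sum.neutral) auto
    then show ?thesis using False by (simp add: star_monom coeff_lamD_power binomial_eq_0)
  qed
  then show ?case using eventually_gt_at_top[of k] by (rule eventually_mono[rotated])
qed

end

section \<open>The differential algebra of the affine Poisson vertex algebra\<close>

context affine_pva
begin

abbreviation "emb \<equiv> current_embedding D j"
abbreviation "pev \<equiv> peval (\<lambda>c. scale c 1) emb"

lemma surj_pev: "surj pev"
  and kernel_pev: "{P. pev P = 0} = module.span (*) (sym_relations (\<lambda>c. pmap (scaleg c)))"
  using symmetric_algebra by (auto simp: is_symmetric_algebra_def)

lemma pev_add: "pev (P + Q) = pev P + pev Q"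
  by (rule peval_add) (rule scale_1_add)

lemma pev_mult: "pev (P * Q) = pev P * pev Q"
  by (rule peval_mult) (rule scale_1_add scale_1_mult)+

lemma pev_Var: "pev (Var w) = emb w" and pev_Cst: "pev (Cst c) = scale c 1"
  by (simp_all add: peval_Var peval_Cst)

lemma pev_diff: "pev (P - Q) = pev P - pev Q"
  by (rule additive_diff[of pev, OF pev_add])

lemma module_mult: "module ((*) :: 'r::comm_ring_1 \<Rightarrow> 'r \<Rightarrow> 'r)"
  by unfold_locales (simp_all add: algebra_simps)

lemma relations_pev: "P \<in> sym_relations (\<lambda>c. pmap (scaleg c)) \<Longrightarrow> pev P = 0"
  using module.span_superset[OF module_mult] kernel_pev by blast

lemma emb_add: "emb (v + w) = emb v + emb w"
proof -
  have "pev (Var (v + w) - Var v - Var w) = 0"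
    by (rule relations_pev) (auto simp: sym_relations_def)
  then show ?thesis by (simp add: pev_diff pev_Var pev_add algebra_simps)
qed

lemma emb_scale: "emb (pmap (scaleg c) w) = scale c (emb w)"
proof -
  have "pev (Var (pmap (scaleg c) w) - Cst c * Var w) = 0"
    by (rule relations_pev) (auto simp: sym_relations_def)
  then show ?thesis by (simp add: pev_diff pev_Var pev_mult pev_Cst mult_scale_1)
qed

text \<open>\<open>current_embedding\<close> sums over nonzero coefficients only, so linearity of
  \<open>emb\<close> says nothing about \<open>j 0\<close>. But the zeroth product of
  \<open>j 0\<close> with itself is \<open>j (bracket 0 0) = j 0\<close>, and by skewsymmetry it
  equals its own negative.\<close>

lemma j_0: "j 0 = 0"
proof -
  have b0: "bracket 0 0 = 0" by (rule g.bracket_alternating)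
  have z: "nprod (j 0) i (j 0) = 0" if "2 \<le> i" for i
    using that by (auto simp: nprod_def br_generators coeff_pCons numeral_2_eq_2 split: nat.split)
  have 1: "nprod (j 0) 0 (j 0) = j 0" "D (nprod (j 0) 1 (j 0)) = 0"
    by (simp_all add: nprod_def br_generators b0 D_scale)
  have "j 0 = - (\<Sum>i<2. (- 1) ^ (i + 0) * dv i (nprod (j 0) (i + 0) (j 0)))"
    using nprod_skew[of 2 "j 0" "j 0" 0, OF z] 1(1) by simp
  then have "j 0 = - j 0" using 1 by (simp add: numeral_2_eq_2 dv_def)
  then have "of_nat (Suc 1) * j 0 = of_nat (Suc 1) * 0" by (simp add: algebra_simps eq_neg_iff_add_eq_0)
  then show ?thesis by (rule of_nat_cancel)
qed

lemma emb_single: "emb (single m a) = (D ^^ m) (j a)"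
proof -
  have "(D ^^ m) 0 = 0" by (rule additive_0[of "D ^^ m", OF Dn_add])
  then show ?thesis by (cases "a = 0") (auto simp: current_embedding_def j_0)
qed

lemma j_add: "j (a + b) = j a + j b"
  using emb_add[of "single 0 a" "single 0 b"]
  by (simp add: emb_single flip: single_add)

lemma j_scale: "j (scaleg c a) = scale c (j a)"
  using emb_scale[of c "single 0 a"]
  by (simp add: emb_single)

lemma V_induct [case_names one gen add mult scale]:
  assumes "Q 1" "\<And>m a. Q ((D ^^ m) (j a))" "\<And>x y. Q x \<Longrightarrow> Q y \<Longrightarrow> Q (x + y)" "\<And>x y. Q x \<Longrightarrow> Q y \<Longrightarrow> Q (x * y)"
    "\<And>c x. Q x \<Longrightarrow> Q (scale c x)"
  shows "Q (v :: 'v)"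
proof -
  have Q0: "Q 0" using assms(5)[OF assms(1), of 0] by simp
  have sum: "Q (\<Sum>i\<in>I. f i)" if "\<And>i. i \<in> I \<Longrightarrow> Q (f i)" for f :: "'i \<Rightarrow> 'v" and I
    using that by (induction I rule: infinite_finite_induct) (auto intro: assms(3) Q0)
  have sum2: "Q (\<Sum>i\<in>I. f i)" if "\<And>i. i \<in> I \<Longrightarrow> Q (f i)" for f :: "nat \<Rightarrow> 'v" and I
    using that by (induction I rule: infinite_finite_induct) (auto intro: assms(3) Q0)
  have pow: "Q (x ^ k)" if "Q x" for x k
    using that by (induction k) (auto intro: assms)
  have emb: "Q (emb w)" for w
    unfolding current_embedding_def by (rule sum2) (rule assms(2))
  have prod: "Q (\<Prod>w\<in>I. emb w ^ f w)" for f I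
    by (induction I rule: infinite_finite_induct) (auto intro: assms pow emb)
  obtain P where "v = pev P" using surj_pev by blast
  moreover have "Q (\<Sum>e\<in>I. scale (lookup P e) 1 * (\<Prod>x\<in>keys e. emb x ^ lookup e x))" for I
    by (induction I rule: infinite_finite_induct) (auto intro!: assms prod Q0)
  ultimately show ?thesis unfolding peval_def by simp
qed

text \<open>Universal property of the symmetric algebra: \<open>peval h \<sigma>\<close> kills the
  relations, hence the ideal which they span; that ideal is the kernel of \<open>pev\<close>, so the
  evaluation descends.\<close>

lemma extension_exists:
  fixes h :: "'k \<Rightarrow> 's::comm_ring_1" and \<sigma> :: "(nat \<Rightarrow>\<^sub>0 'g) \<Rightarrow> 's"
  assumes h: "\<And>a b. h (a + b) = h a + h b" "\<And>a b. h (a * b) = h a * h b" "h 1 = 1"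
    and \<sigma>: "\<And>v w. \<sigma> (v + w) = \<sigma> v + \<sigma> w" "\<And>c w. \<sigma> (pmap (scaleg c) w) = h c * \<sigma> w"
  obtains \<tau> where "\<And>x y. \<tau> (x + y) = \<tau> x + \<tau> y" "\<And>x y. \<tau> (x * y) = \<tau> x * \<tau> y"
    "\<And>c. \<tau> (scale c 1) = h c" "\<And>w. \<tau> (emb w) = \<sigma> w"
proof -
  have h0: "h 0 = 0" using additive_0[of h, OF h(1)] .
  let ?p = "peval h \<sigma>"
  have add: "?p (P + Q) = ?p P + ?p Q" for P Q by (rule peval_add[OF h(1)])
  have mult: "?p (P * Q) = ?p P * ?p Q" for P Q by (rule peval_mult[OF h(1,2)])
  have var: "?p (Var w) = \<sigma> w" and cst: "?p (Cst c) = h c" for w c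
    by (simp_all add: peval_Var peval_Cst h0 h(3))
  have diff: "?p (P - Q) = ?p P - ?p Q" for P Q by (rule additive_diff[of ?p, OF add])
  have "module.span (*) (sym_relations (\<lambda>c. pmap (scaleg c))) \<subseteq> {P. ?p P = 0}"
  proof (rule module.span_minimal[OF module_mult])
    show "sym_relations (\<lambda>c. pmap (scaleg c)) \<subseteq> {P. ?p P = 0}"
      by (auto simp: sym_relations_def diff mult var cst \<sigma>)
    show "module.subspace (*) {P. ?p P = 0}"
      using additive_0[of ?p, OF add] by (auto simp: module.subspace_def[OF module_mult] add mult)
  qed
  then have ker: "?p P = 0" if "pev P = 0" for P
    using that kernel_pev by blast
  have wd: "?p P = ?p Q" if "pev P = pev Q" for P Q
    using ker[of "P - Q"] that by (simp add: diff pev_diff)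
  define \<tau> where "\<tau> v = ?p (SOME P. pev P = v)" for v
  have \<tau>: "\<tau> (pev P) = ?p P" for P
    unfolding \<tau>_def by (rule wd) (rule someI[of "\<lambda>Q. pev Q = pev P" P], rule refl)
  show ?thesis
  proof (rule that[of \<tau>])
    fix x y
    obtain P Q where "x = pev P" "y = pev Q" using surj_pev by (meson surjE)
    then show "\<tau> (x + y) = \<tau> x + \<tau> y" "\<tau> (x * y) = \<tau> x * \<tau> y"
      using \<tau>[of "P + Q"] \<tau>[of "P * Q"] by (simp_all add: \<tau> pev_add pev_mult add mult)
  next
    show "\<tau> (scale c 1) = h c" for c using \<tau>[of "Cst c"] by (simp add: pev_Cst cst)
    show "\<tau> (emb w) = \<sigma> w" for w using \<tau>[of "Var w"] by (simp add: pev_Var var)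
  qed
qed

text \<open>
  The symbol \<open>\<Sum> (\<partial>v/\<partial>x\<^sub>m) (-\<lambda>)\<^sup>m\<close> of the derivative of \<open>v\<close> in the directions \<open>x\<^sub>m = \<partial>\<^sup>m a\<close> weighted
  by the functional \<open>\<chi>\<close>; it is read off from the ring homomorphism which shifts the generators by
  a first order parameter.
\<close>

lemma symbol_exists:
  assumes \<chi>: "\<And>a b. \<chi> (a + b) = \<chi> a + \<chi> b" "\<And>c a. \<chi> (scaleg c a) = c * \<chi> a"
  shows "\<exists>fr :: 'v \<Rightarrow> 'v poly. (\<forall>x y. fr (x + y) = fr x + fr y) \<and> (\<forall>x y. fr (x * y) = smult x (fr y) + smult y (fr x))
    \<and> (\<forall>c. fr (scale c 1) = 0) \<and> (\<forall>m a. fr ((D ^^ m) (j a)) = monom ((- 1) ^ m * scale (\<chi> a) 1) m)"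
proof -
  let ?X = "pmsum (\<lambda>s a. monom ((- 1) ^ s * scale (\<chi> a) 1) s) :: (nat \<Rightarrow>\<^sub>0 'g) \<Rightarrow> 'v poly"
  have X: "?X (v + w) = ?X v + ?X w" for v w
    by (rule pmsum_add) (simp add: \<chi> scale_left_distrib distrib_left add_monom)
  have \<chi>0: "\<chi> 0 = 0" using \<chi>(1)[of 0 0] by simp
  have X1: "?X (single m a) = monom ((- 1) ^ m * scale (\<chi> a) 1) m" for m a
    by (rule pmsum_single) (simp add: \<chi>0)
  have Xs: "?X (pmap (scaleg c) w) = smult (scale c 1) (?X w)" for c w
  proof (rule poly_mapping_additive_eq[of "\<lambda>w. ?X (pmap (scaleg c) w)" "\<lambda>w. smult (scale c 1) (?X w)"])
    have "pmap (scaleg c) (v + w) = pmap (scaleg c) v + pmap (scaleg c) w" for v w :: "nat \<Rightarrow>\<^sub>0 'g"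
      by (rule poly_mapping_eqI) (simp add: lookup_map lookup_add g.scale_right_distrib)
    then show "?X (pmap (scaleg c) (v + w)) = ?X (pmap (scaleg c) v) + ?X (pmap (scaleg c) w)" for v w
      by (simp add: X)
  qed (simp_all add: X smult_add_right X1 \<chi> smult_monom scale_1_mult mult_ac)
  have es: "emb (pmap (scaleg c) w) = scale c 1 * emb w" for c w
    by (simp only: emb_scale mult_scale_1)
  \<comment> \<open>The inner variable is \<lambda>, the outer one the first order parameter. Since
    the coefficient at 0 is the identity, the coefficient at 1 is a derivation.\<close>
  obtain \<tau> :: "'v \<Rightarrow> 'v poly poly" where \<tau>: "\<And>x y. \<tau> (x + y) = \<tau> x + \<tau> y" "\<And>x y. \<tau> (x * y) = \<tau> x * \<tau> y"
    "\<And>c. \<tau> (scale c 1) = [:[:scale c 1:]:]" "\<And>w. \<tau> (emb w) = [:[:emb w:], ?X w:]"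
    by (rule extension_exists[of "\<lambda>c. [:[:scale c 1:]:]" "\<lambda>w. [:[:emb w:], ?X w:]"])
      ((simp add: scale_1_add scale_1_mult emb_add X Xs es mult.commute one_pCons; fail)+, blast)
  have 0: "coeff (\<tau> v) 0 = [:v:]" for v
  proof (induction v rule: V_induct)
    case one then show ?case using \<tau>(3)[of 1] by simp
  next
    case (gen m a) then show ?case using \<tau>(4)[of "single m a"] by (simp add: emb_single)
  next
    case (scale c x)
    then show ?case unfolding scale_eq_mult[of c x] by (simp add: \<tau> coeff_mult)
  qed (simp_all add: \<tau> coeff_mult mult.commute)
  show ?thesis
  proof (intro exI[of _ "\<lambda>v. coeff (\<tau> v) 1"] conjI allI)
    show "coeff (\<tau> (x * y)) 1 = smult x (coeff (\<tau> y) 1) + smult y (coeff (\<tau> x) 1)" for x y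
      by (simp add: \<tau> coeff_mult 0 mult.commute)
    show "coeff (\<tau> ((D ^^ m) (j a))) 1 = monom ((- 1) ^ m * scale (\<chi> a) 1) m" for m a
      using \<tau>(4)[of "single m a"] by (simp add: emb_single X1)
  qed (simp_all add: \<tau>)
qed

text \<open>The basic 1-cochain dual to the mode \<open>a\<^sub>(\<^sub>q\<^sub>)\<close> of the generators.\<close>

lemma dual_form_exists:
  assumes \<chi>: "\<And>a b. \<chi> (a + b) = \<chi> a + \<chi> b" "\<And>c a. \<chi> (scaleg c a) = c * \<chi> a"
  shows "\<exists>\<xi> :: 'v poly \<Rightarrow> 'v.
     (\<forall>x y. \<xi> (x + y) = \<xi> x + \<xi> y) \<and> (\<forall>c x. \<xi> (smult (scale c 1) x) = scale c (\<xi> x)) \<and> (\<forall>r\<in>range tot. \<xi> r = 0) \<and>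
     (\<forall>a. \<exists>N. \<forall>m\<ge>N. \<xi> (monom a m) = 0) \<and>
     (\<forall>b c m. \<forall>\<^sub>F N in sequentially. \<xi> (monom (b * c) m) = (\<Sum>l<N. dv l b * \<xi> (monom c (m + l)) + dv l c * \<xi> (monom b (m + l)))) \<and>
     (\<forall>a m. \<xi> (monom (j a) m) = (if m = q then scale (\<chi> a) 1 else 0))"
proof -
  obtain fr :: "'v \<Rightarrow> 'v poly" where fr: "\<And>x y. fr (x + y) = fr x + fr y" "\<And>x y. fr (x * y) = smult x (fr y) + smult y (fr x)"
    "\<And>c. fr (scale c 1) = 0" "\<And>m a. fr ((D ^^ m) (j a)) = monom ((- 1) ^ m * scale (\<chi> a) 1) m"
    using symbol_exists[of \<chi>, OF \<chi>] by blast
  \<comment> \<open>The factor 1/q! cancels the factorial in the definition of \<open>\<xi>\<close>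
    below.\<close>
  define Q :: "'v poly" where "Q = monom (scale (1 / fact q) 1) q"
  define op where "op F = psum (\<lambda>s p. star p (monom 1 s * Q)) F" for F
  \<comment> \<open>A derivation of V with values in V[\<lambda>], a module through
    \<open>star\<close>. It sends \<partial>^m a to \<chi>(a) (-\<lambda>)^m Q, as sesquilinearity
    requires of a 1-cochain with value \<chi>(a) Q at a.\<close>
  define \<delta> where "\<delta> v = op (fr v)" for v
  have op_add: "op (F + G) = op F + op G" for F G
    unfolding op_def by (rule psum_add) (rule star_add)
  have s0: "star 0 R = 0" for R using star_add[of 0 0 R] by simp
  have op_monom: "op (monom p s) = star p (monom 1 s * Q)" for p s
    unfolding op_def by (rule psum_monom) (rule s0)
  have op_smult: "op (smult v F) = star v (op F)" for v F
    by (rule poly_additive_eq[of "\<lambda>F. op (smult v F)" "\<lambda>F. star v (op F)"])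
      (simp_all add: op_add smult_add_right star_add_right smult_monom op_monom star_mult)
  have \<delta>_add: "\<delta> (x + y) = \<delta> x + \<delta> y" for x y by (simp add: \<delta>_def fr op_add)
  have \<delta>_mult: "\<delta> (x * y) = star x (\<delta> y) + star y (\<delta> x)" for x y
    by (simp add: \<delta>_def fr op_add op_smult)
  have op0: "op 0 = 0" using op_add[of 0 0] by simp
  have \<delta>_scale: "\<delta> (scale c x) = smult (scale c 1) (\<delta> x)" for c x
  proof -
    have "\<delta> (scale c 1 * x) = star (scale c 1) (\<delta> x) + star x (\<delta> (scale c 1))" by (rule \<delta>_mult)
    moreover have "star x 0 = 0" using star_add_right[of x 0 0] by simp
    ultimately show ?thesis by (simp add: \<delta>_def fr op0 mult_scale_1 star_scale_1)
  qed
  have \<delta>_gen: "\<delta> ((D ^^ m) (j a)) = smult ((- 1) ^ m * scale (\<chi> a) 1) (monom 1 m * Q)" for m a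
  proof -
    have "(- 1) ^ m * scale (\<chi> a) 1 = scale ((- 1) ^ m * \<chi> a) 1" by (cases "even m") simp_all
    then show ?thesis by (simp add: \<delta>_def fr op_monom star_scale_1)
  qed
  have \<delta>_D: "\<delta> (D v) = - ([:0, 1:] * \<delta> v)" for v
  proof (induction v rule: V_induct)
    case one
    show ?case using \<delta>_scale[of 0 1] fr(3)[of 1] by (simp add: \<delta>_def op0)
  next
    case (gen m a)
    have "\<delta> (D ((D ^^ m) (j a))) = smult ((- 1) ^ Suc m * scale (\<chi> a) 1) (monom 1 (Suc m) * Q)"
      using \<delta>_gen[of "Suc m" a] by simp
    also have "monom 1 (Suc m) * Q = [:0, 1:] * (monom 1 m * Q)"
      by (simp add: monom_Suc mult_pCons_left)
    finally show ?case by (simp only: \<delta>_gen mult_smult_right power_Suc) (simp only: mult_minus_left mult_1_left smult_minus_left)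
  next
    case (add x y) then show ?case by (simp add: D_add \<delta>_add)
  next
    case (mult x y)
    then show ?case
      unfolding D_mult \<delta>_add \<delta>_mult mult star_uminus star_X
      by (simp add: algebra_simps del: mult_pCons_left mult_pCons_right)
  next
    case (scale c x)
    then show ?case by (simp add: D_scale \<delta>_scale)
  qed
  define \<xi> where "\<xi> p = psum (\<lambda>m v. of_nat (fact m) * coeff (\<delta> v) m) p" for p
  have \<xi>_add: "\<xi> (x + y) = \<xi> x + \<xi> y" for x y
    unfolding \<xi>_def by (rule psum_add) (simp add: \<delta>_add algebra_simps)
  have \<delta>0: "\<delta> 0 = 0" using \<delta>_add[of 0 0] by simp
  have \<xi>_monom: "\<xi> (monom v m) = of_nat (fact m) * coeff (\<delta> v) m" for v m
    unfolding \<xi>_def by (rule psum_monom) (simp add: \<delta>0)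
  show ?thesis
  proof (intro exI[of _ \<xi>] conjI allI ballI)
    show "\<xi> (x + y) = \<xi> x + \<xi> y" for x y by (rule \<xi>_add)
    show "\<xi> (smult (scale c 1) x) = scale c (\<xi> x)" for c x
      by (rule poly_additive_eq[of "\<lambda>x. \<xi> (smult (scale c 1) x)" "\<lambda>x. scale c (\<xi> x)"])
        (simp_all add: smult_add_right \<xi>_add scale_right_distrib smult_monom mult_scale_1 \<xi>_monom \<delta>_scale scale_mult_right)
    show "\<xi> r = 0" if r: "r \<in> range tot" for r
    proof -
      obtain p where r: "r = tot p" using r by blast
      have "\<xi> (tot p) = 0"
      proof (rule poly_additive_eq[of "\<lambda>p. \<xi> (tot p)" "\<lambda>_. 0"])
        fix a m
        have "of_nat m * a = scale (of_nat m) a" by (simp add: scale_of_nat)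
        then have "\<delta> (of_nat m * a) = smult (of_nat m) (\<delta> a)" using \<delta>_scale[of "of_nat m" a] by (simp add: scale_of_nat)
        then show "\<xi> (tot (monom a m)) = 0"
          unfolding tot_monom \<xi>_add \<xi>_monom \<delta>_D by (cases m) (simp_all add: algebra_simps)
      qed (simp_all add: tot_add \<xi>_add)
      then show ?thesis using r by simp
    qed
    show "\<exists>N. \<forall>m\<ge>N. \<xi> (monom a m) = 0" for a
      by (intro exI[of _ "Suc (degree (\<delta> a))"]) (auto simp: \<xi>_monom coeff_eq_0)
    show "\<forall>\<^sub>F N in sequentially. \<xi> (monom (b * c) m) = (\<Sum>l<N. dv l b * \<xi> (monom c (m + l)) + dv l c * \<xi> (monom b (m + l)))" for b c m
      using coeff_star[of m b "\<delta> c"] coeff_star[of m c "\<delta> b"]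
      by eventually_elim (simp add: \<xi>_monom \<delta>_mult sum.distrib distrib_left)
    show "\<xi> (monom (j a) m) = (if m = q then scale (\<chi> a) 1 else 0)" for a m
    proof -
      have "\<delta> (j a) = smult (scale (\<chi> a) 1) Q" using \<delta>_gen[of 0 a] by simp
      moreover have "of_nat (fact q) * (scale (\<chi> a) 1 * scale (1 / fact q) 1) = scale (\<chi> a) 1"
        unfolding scale_of_nat[symmetric] scale_1_mult[symmetric] by simp
      ultimately show ?thesis by (simp add: \<xi>_monom Q_def)
    qed
  qed
qed

text \<open>One further argument at a time is freed from being a generator: it is moved to the front
  and built up by \<open>V_induct\<close>. Derivatives are removed by the relation between modes,
  products by the Leibniz rule.\<close>

lemma basic_zeroI:
  assumes b: "basic n \<omega>"
    and gen: "\<And>as ms. length as = n \<Longrightarrow> length ms = n \<Longrightarrow> \<omega> (map2 monom (map j as) ms) = 0"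
  shows "\<omega> xs = 0"
proof -
  note a = basicD(2)[OF b]
  have "\<omega> (map2 monom (map j as) ms @ zs) = 0" if "length ms = length as" for as ms zs
    using that
  proof (induction zs arbitrary: as ms)
    case Nil
    show ?case
    proof (cases "length as = n")
      case False
      then show ?thesis using basicD(1)[OF b] Nil by simp
    qed (use gen[of as ms] Nil in simp)
  next
    case (Cons z zs)
    let ?xs = "map2 monom (map j as) ms"
    have sw: "\<omega> (?xs @ z # zs) = 0 \<longleftrightarrow> \<omega> (z # ?xs @ zs) = 0" for z
      using modes.alt_move[OF a, of "[]" z ?xs zs] by (cases "even (length ?xs)") simp_all
    have 1: "\<omega> (monom v m # ?xs @ zs) = 0" for v m
    proof (induction v arbitrary: m rule: V_induct)
      \<comment> \<open>The positive divided powers of 1 vanish, so the Leibniz rule for 1 = 1 * 1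
        says that the value is twice itself.\<close>
      case one
      have "\<forall>\<^sub>F N in sequentially. \<omega> (monom (1 * 1) m # ?xs @ zs) =
         (\<Sum>l<N. dv l 1 * \<omega> (monom 1 (m + l) # ?xs @ zs) + dv l 1 * \<omega> (monom 1 (m + l) # ?xs @ zs))"
        using basicD(5)[OF b] unfolding leibniz_def by blast
      then have "\<forall>\<^sub>F N in sequentially. \<omega> (monom 1 m # ?xs @ zs) = \<omega> (monom 1 m # ?xs @ zs) + \<omega> (monom 1 m # ?xs @ zs)"
        using eventually_gt_at_top[of 0]
      proof eventually_elim
        case (elim N)
        have "dv l 1 = 0" if l: "l \<noteq> 0" for l
        proof -
          obtain r where "l = Suc r" using l by (cases l) auto
          then show ?thesis
            by (simp add: dv_def funpow_Suc_right additive_0[of "D ^^ r", OF Dn_add] del: funpow.simps)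
        qed
        then have "(\<Sum>l<N. dv l 1 * \<omega> (monom 1 (m + l) # ?xs @ zs) + dv l 1 * \<omega> (monom 1 (m + l) # ?xs @ zs))
          = (\<Sum>l\<in>{0}. dv l 1 * \<omega> (monom 1 (m + l) # ?xs @ zs) + dv l 1 * \<omega> (monom 1 (m + l) # ?xs @ zs))"
          using elim(2) by (intro sum.mono_neutral_right) auto
        then show ?case using elim(1) by simp
      qed
      then show ?case by (simp add: eventually_const_iff)
    next
      case (gen r c)
      show ?case
      proof (induction r arbitrary: m)
        case 0
        then show ?case using Cons.IH[of "ms @ [m]" "as @ [c]"] Cons.prems sw[of "monom (j c) m"] by simp
      next
        case (Suc r)
        have "monom ((D ^^ Suc r) (j c)) m = tot (monom ((D ^^ r) (j c)) m) - of_nat m * monom ((D ^^ r) (j c)) (m - 1)"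
          by (simp add: tot_monom of_nat_mult_monom)
        moreover have "\<omega> (of_nat k * monom ((D ^^ r) (j c)) (m - 1) # ?xs @ zs) = 0" for k
          by (induction k) (simp_all add: modes.alt_zero0[OF a] modes.alt_add0[OF a] algebra_simps Suc)
        ultimately show ?case by (simp add: modes.alt_diff0[OF a] modes.alt_R0[OF a])
      qed
    next
      case (add x y) then show ?case by (simp add: modes.alt_add0[OF a] flip: add_monom)
    next
      case (mult x y)
      have "\<forall>\<^sub>F N in sequentially. \<omega> (monom (x * y) m # ?xs @ zs) = 0"
        using basicD(5)[OF b, unfolded leibniz_def, rule_format, of x y m "?xs @ zs"]
        by eventually_elim (simp add: mult)
      then show ?case by (simp add: eventually_const_iff)
    next
      case (scale c x)
      then show ?case using basicD(3)[OF b] unfolding slot_linear_def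
        by (metis mult_scale_1 scale_zero_right smult_monom)
    qed
    show ?case unfolding sw
      by (induction z rule: poly_monom_induct) (simp_all add: 1 modes.alt_add0[OF a])
  qed
  from this[of "[]" "[]" xs] show ?thesis by simp
qed

lemma basic_eqI:
  assumes "basic n \<omega>" "basic n \<eta>"
    and "\<And>as ms. length as = n \<Longrightarrow> length ms = n \<Longrightarrow> \<omega> (map2 monom (map j as) ms) = \<eta> (map2 monom (map j as) ms)"
  shows "\<omega> = \<eta>"
  using basic_zeroI[OF basic_diff[OF assms(1,2)]] assms(3) by (auto simp: fun_eq_iff)

text \<open>The exterior form with coefficients f in the 1-forms \<open>\<xi>\<close>. All tuples
  are summed, not just increasing ones, so on the dual modes it returns f itself, and skewsymmetry
  is inherited from f.\<close>

fun gen_ext :: "'c set \<Rightarrow> ('c \<Rightarrow> 'v poly \<Rightarrow> 'v) \<Rightarrow> ('c list \<Rightarrow> 'v) \<Rightarrow> 'v poly list \<Rightarrow> 'v" where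
  "gen_ext I \<xi> f [] = f []"
| "gen_ext I \<xi> f (x # xs) = (\<Sum>c\<in>I. \<xi> c x * gen_ext I \<xi> (\<lambda>cs. f (c # cs)) xs)"

lemma gen_ext_uminus: "gen_ext I \<xi> (\<lambda>cs. - f cs) xs = - gen_ext I \<xi> f xs"
  by (induction xs arbitrary: f) (simp_all add: sum_negf)

lemma basic_gen_ext:
  fixes \<xi> :: "'c \<Rightarrow> 'v poly \<Rightarrow> 'v"
  assumes I: "finite I"
    and add: "\<And>c x y. \<xi> c (x + y) = \<xi> c x + \<xi> c y" and lin: "\<And>c s x. \<xi> c (smult (scale s 1) x) = scale s (\<xi> c x)"
    and rel: "\<And>c r. r \<in> range tot \<Longrightarrow> \<xi> c r = 0" and fin: "\<And>c a. \<exists>N. \<forall>m\<ge>N. \<xi> c (monom a m) = 0"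
    and lei: "\<And>c x y m. \<forall>\<^sub>F N in sequentially. \<xi> c (monom (x * y) m) =
      (\<Sum>l<N. dv l x * \<xi> c (monom y (m + l)) + dv l y * \<xi> c (monom x (m + l)))"
    and len: "\<And>cs. length cs \<noteq> n \<Longrightarrow> f cs = 0"
    and swap: "\<And>cs c c' ds. f (cs @ c # c' # ds) = - f (cs @ c' # c # ds)"
  shows "basic n (gen_ext I \<xi> f)"
  unfolding basic_def
proof (intro conjI allI impI)
  show "gen_ext I \<xi> f xs = 0" if "length xs \<noteq> n" for xs
    using that len
  proof (induction xs arbitrary: f n)
    case (Cons x xs)
    have "gen_ext I \<xi> (\<lambda>cs. f (c # cs)) xs = 0" for c
    proof (cases n)
      case 0
      show ?thesis by (rule Cons.IH[of "Suc (length xs)"]) (use Cons.prems 0 in auto)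
    next
      case (Suc m)
      show ?thesis by (rule Cons.IH[of m]) (use Cons.prems Suc in auto)
    qed
    then show ?case by simp
  qed simp
  show "modes.alt (gen_ext I \<xi> f)"
  proof (rule modes.altI)
    show "gen_ext I \<xi> f (xs @ (x + y) # zs) = gen_ext I \<xi> f (xs @ x # zs) + gen_ext I \<xi> f (xs @ y # zs)" for xs x y zs
      by (induction xs arbitrary: f) (simp_all add: add algebra_simps sum.distrib)
    show "gen_ext I \<xi> f (xs @ r # zs) = 0" if "r \<in> range tot" for xs r zs
      by (induction xs arbitrary: f) (simp_all add: rel[OF that])
    show "gen_ext I \<xi> f (xs @ x # y # zs) = - gen_ext I \<xi> f (xs @ y # x # zs)" for xs x y zs
      using swap
    proof (induction xs arbitrary: f)
      case Nil
      have "(\<lambda>cs. f (c # d # cs)) = (\<lambda>cs. - f (d # c # cs))" for c d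
        using Nil[of "[]" c d] by (auto simp: fun_eq_iff)
      then have G: "gen_ext I \<xi> (\<lambda>cs. f (c # d # cs)) zs = - gen_ext I \<xi> (\<lambda>cs. f (d # c # cs)) zs" for c d
        using gen_ext_uminus[of I \<xi> "\<lambda>cs. f (d # c # cs)" zs] by simp
      have "(\<Sum>c\<in>I. \<Sum>d\<in>I. \<xi> c x * (\<xi> d y * gen_ext I \<xi> (\<lambda>cs. f (c # d # cs)) zs))
          = - (\<Sum>c\<in>I. \<Sum>d\<in>I. \<xi> d y * (\<xi> c x * gen_ext I \<xi> (\<lambda>cs. f (d # c # cs)) zs))"
        unfolding sum_negf[symmetric]
        by (intro sum.cong refl) (subst G, simp add: mult.left_commute)
      also have "\<dots> = - (\<Sum>d\<in>I. \<Sum>c\<in>I. \<xi> d y * (\<xi> c x * gen_ext I \<xi> (\<lambda>cs. f (d # c # cs)) zs))"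
        by (subst sum.swap) (rule refl)
      finally show ?case by (simp add: sum_distrib_left)
    next
      case (Cons z xs)
      have "gen_ext I \<xi> (\<lambda>cs. f (c # cs)) (xs @ x # y # zs) = - gen_ext I \<xi> (\<lambda>cs. f (c # cs)) (xs @ y # x # zs)" for c
      proof (rule Cons.IH)
        show "f (c # cs @ c1 # c2 # ds) = - f (c # cs @ c2 # c1 # ds)" for cs c1 c2 ds
          using Cons.prems[of "c # cs" c1 c2 ds] by simp
      qed
      then show ?case by (simp add: sum_negf)
    qed
  qed
  show "slot_linear (gen_ext I \<xi> f)"
    by (simp add: slot_linear_def lin scale_sum_right scale_mult)
  show "leibniz (gen_ext I \<xi> f)"
    unfolding leibniz_def
  proof (intro allI)
    fix x y m zs
    have "\<forall>\<^sub>F N in sequentially. \<forall>c\<in>I. \<xi> c (monom (x * y) m) =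
      (\<Sum>l<N. dv l x * \<xi> c (monom y (m + l)) + dv l y * \<xi> c (monom x (m + l)))"
      by (intro eventually_ball_finite I ballI lei)
    then show "\<forall>\<^sub>F N in sequentially. gen_ext I \<xi> f (monom (x * y) m # zs) =
      (\<Sum>l<N. dv l x * gen_ext I \<xi> f (monom y (m + l) # zs) + dv l y * gen_ext I \<xi> f (monom x (m + l) # zs))"
    proof eventually_elim
      case (elim N)
      have "gen_ext I \<xi> f (monom (x * y) m # zs) = (\<Sum>c\<in>I. \<Sum>l<N. (dv l x * \<xi> c (monom y (m + l)) + dv l y * \<xi> c (monom x (m + l)))
          * gen_ext I \<xi> (\<lambda>cs. f (c # cs)) zs)"
        using elim by (simp add: sum_distrib_right)
      also have "\<dots> = (\<Sum>l<N. \<Sum>c\<in>I. (dv l x * \<xi> c (monom y (m + l)) + dv l y * \<xi> c (monom x (m + l)))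
          * gen_ext I \<xi> (\<lambda>cs. f (c # cs)) zs)"
        by (rule sum.swap)
      finally show ?case by (simp add: sum_distrib_left distrib_right sum.distrib mult.assoc)
    qed
  qed
  show "jointly_finite (gen_ext I \<xi> f)"
    unfolding jointly_finite_def
  proof
    fix as
    have "\<forall>a. \<exists>N. \<forall>c\<in>I. \<forall>m\<ge>N. \<xi> c (monom a m) = 0"
    proof
      fix a
      have "\<forall>c. \<exists>N. \<forall>m\<ge>N. \<xi> c (monom a m) = 0" using fin by blast
      from choice[OF this] obtain N where N: "\<forall>c. \<forall>m\<ge>N c. \<xi> c (monom a m) = 0" by (rule exE)
      have "N c \<le> (\<Sum>c\<in>I. N c)" if "c \<in> I" for c using that I by (intro member_le_sum) auto
      then show "\<exists>N. \<forall>c\<in>I. \<forall>m\<ge>N. \<xi> c (monom a m) = 0"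
        using N by (intro exI[of _ "\<Sum>c\<in>I. N c"]) (meson le_trans)
    qed
    from choice[OF this] obtain N where "\<forall>a. \<forall>c\<in>I. \<forall>m\<ge>N a. \<xi> c (monom a m) = 0" by (rule exE)
    then have N: "\<And>a c m. c \<in> I \<Longrightarrow> m \<ge> N a \<Longrightarrow> \<xi> c (monom a m) = 0" by blast
    \<comment> \<open>If the total index reaches the sum of the bounds, some slot reaches its own
      bound: when the first one does not, the surplus passes to the rest of the list.\<close>
    have "gen_ext I \<xi> f (map2 monom as ms) = 0" if "length ms = length as" "sum_list (map (\<lambda>a. Suc (N a)) as) \<le> sum_list ms" "as \<noteq> []" for ms
      using that
    proof (induction as arbitrary: ms f)
      case (Cons a as)
      then obtain m ms' where ms: "ms = m # ms'" by (cases ms) auto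
      show ?case
      proof (cases "N a \<le> m")
        case True
        then show ?thesis by (simp add: ms N)
      next
        case False
        then have le: "sum_list (map (\<lambda>a. Suc (N a)) as) < sum_list ms'" using Cons.prems ms by simp
        then have "as \<noteq> []" using Cons.prems ms by (cases as) auto
        then have "gen_ext I \<xi> (\<lambda>cs. f (c # cs)) (map2 monom as ms') = 0" for c
          using Cons.IH[of ms' "\<lambda>cs. f (c # cs)"] Cons.prems ms le by simp
        then show ?thesis by (simp add: ms)
      qed
    qed simp
    then show "\<exists>N. \<forall>ms. length ms = length as \<longrightarrow> N \<le> sum_list ms \<longrightarrow> gen_ext I \<xi> f (map2 monom as ms) = 0"
      by (intro exI[of _ "Suc (sum_list (map (\<lambda>a. Suc (N a)) as))"] allI impI) (cases "as = []", auto)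
  qed
qed

text \<open>Complements \<open>basic_zeroI\<close>: any skewsymmetric multilinear finite data on
  modes of generators is attained. Finite dimension of g leaves finitely many relevant modes of
  basis vectors, so a finite sum of products of dual 1-forms does it.\<close>

lemma basic_extension_exists:
  fixes F :: "('g \<times> nat) list \<Rightarrow> 'v"
  assumes len: "\<And>cs. length cs \<noteq> n \<Longrightarrow> F cs = 0"
    and add: "\<And>cs a b m ds. F (cs @ (a + b, m) # ds) = F (cs @ (a, m) # ds) + F (cs @ (b, m) # ds)"
    and sc: "\<And>cs s a m ds. F (cs @ (scaleg s a, m) # ds) = scale s (F (cs @ (a, m) # ds))"
    and swap: "\<And>cs c d ds. F (cs @ c # d # ds) = - F (cs @ d # c # ds)"
    and fin: "\<And>as. \<exists>N. \<forall>ms. length ms = length as \<longrightarrow> N \<le> sum_list ms \<longrightarrow> F (zip as ms) = 0"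
  shows "\<exists>\<omega>. basic n \<omega> \<and> (\<forall>as ms. length as = n \<longrightarrow> length ms = n \<longrightarrow> \<omega> (map2 monom (map j as) ms) = F (zip as ms))"
proof -
  obtain B0 where B0: "finite B0" "g.span B0 = UNIV" using g.finite_dimensional by blast
  obtain B where B: "B \<subseteq> B0" "g.independent B" "B0 \<subseteq> g.span B"
    using g.maximal_independent_subset[of B0] by blast
  have Bfin: "finite B" using B(1) B0(1) by (rule finite_subset)
  have Bspan: "g.span B = UNIV" using B(3) B0(2) by (metis g.span_minimal g.subspace_span top.extremum_unique)
  define \<chi> where "\<chi> b a = g.representation B a b" for b a
  have \<chi>: "\<chi> b (a + a') = \<chi> b a + \<chi> b a'" "\<chi> b (scaleg s a) = s * \<chi> b a" for b a a' s
    using B(2) Bspan by (simp_all add: \<chi>_def g.representation_add g.representation_scale)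
  have dec: "(\<Sum>b\<in>B. scaleg (\<chi> b a) b) = a" for a
    using g.sum_representation_eq[OF B(2), of a B] Bfin Bspan by (simp add: \<chi>_def)
  have F0: "F (cs @ (0, m) # ds) = 0" for cs m ds using add[of cs 0 0 m ds] by simp
  have Fsum: "F (cs @ (\<Sum>b\<in>S. f b, m) # ds) = (\<Sum>b\<in>S. F (cs @ (f b, m) # ds))" for cs m ds f and S :: "'g set"
    by (induction S rule: infinite_finite_induct) (simp_all add: F0 add)
  have expand: "F (cs @ (a, m) # ds) = (\<Sum>b\<in>B. scale (\<chi> b a) (F (cs @ (b, m) # ds)))" for cs a m ds
    using Fsum[of cs "\<lambda>b. scaleg (\<chi> b a) b" B m ds] by (simp add: dec sc)
  have van: "F (cs @ zip as ms) = 0"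
    if "\<And>bs. set bs \<subseteq> B \<Longrightarrow> length bs = length ms \<Longrightarrow> F (cs @ zip bs ms) = 0" "length as = length ms" for cs as ms
    using that(2,1)
  proof (induction as ms arbitrary: cs rule: list_induct2)
    case Nil
    then show ?case using Nil[of "[]"] by simp
  next
    case (Cons a as m ms)
    have "F (cs @ (b, m) # zip as ms) = 0" if "b \<in> B" for b
      using Cons.IH[of "cs @ [(b, m)]"] Cons.prems[of "b # _"] that by simp
    then show ?case by (simp add: expand[of cs a])
  qed
  obtain Nf where Nf: "\<And>as ms. length ms = length as \<Longrightarrow> Nf as \<le> sum_list ms \<Longrightarrow> F (zip as ms) = 0"
    using fin by metis
  define S where "S = {bs. set bs \<subseteq> B \<and> length bs = n}"
  have S: "finite S" unfolding S_def by (rule finite_lists_length_eq[OF Bfin])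
  \<comment> \<open>One bound for all tuples of basis vectors; by multilinearity it is valid for all
    arguments, and in particular it bounds each single index.\<close>
  define Q where "Q = (\<Sum>bs\<in>S. Nf bs)"
  have big: "F (zip as ms) = 0" if "length as = n" "length ms = n" "Q \<le> sum_list ms" for as ms
  proof -
    have "F ([] @ zip as ms) = 0"
    proof (rule van)
      fix bs assume bs: "set bs \<subseteq> B" "length bs = length ms"
      then have "Nf bs \<le> Q" unfolding Q_def using S that by (intro member_le_sum) (auto simp: S_def)
      then show "F ([] @ zip bs ms) = 0" using Nf[of ms bs] bs that by simp
    qed (use that in simp)
    then show ?thesis by simp
  qed
  have Z: "F (cs @ (a, m) # ds) = 0" if "Q \<le> m" for cs a m ds
  proof (cases "length (cs @ (a, m) # ds) = n")
    case True
    let ?l = "cs @ (a, m) # ds"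
    have "F (zip (map fst ?l) (map snd ?l)) = 0"
      by (rule big) (use True that in auto)
    then show ?thesis by (simp add: zip_map_fst_snd)
  qed (use len in blast)
  have "\<forall>c :: 'g \<times> nat. \<exists>\<xi> :: 'v poly \<Rightarrow> 'v.
     (\<forall>x y. \<xi> (x + y) = \<xi> x + \<xi> y) \<and> (\<forall>s x. \<xi> (smult (scale s 1) x) = scale s (\<xi> x)) \<and> (\<forall>r\<in>range tot. \<xi> r = 0) \<and>
     (\<forall>a. \<exists>N. \<forall>m\<ge>N. \<xi> (monom a m) = 0) \<and>
     (\<forall>b c m. \<forall>\<^sub>F N in sequentially. \<xi> (monom (b * c) m) = (\<Sum>l<N. dv l b * \<xi> (monom c (m + l)) + dv l c * \<xi> (monom b (m + l)))) \<and>
     (\<forall>a m. \<xi> (monom (j a) m) = (if m = snd c then scale (\<chi> (fst c) a) 1 else 0))"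
    using dual_form_exists[of "\<chi> (fst _)", OF \<chi>] by blast
  from choice[OF this] obtain \<xi> :: "'g \<times> nat \<Rightarrow> 'v poly \<Rightarrow> 'v" where \<xi>: "\<forall>c.
     (\<forall>x y. \<xi> c (x + y) = \<xi> c x + \<xi> c y) \<and> (\<forall>s x. \<xi> c (smult (scale s 1) x) = scale s (\<xi> c x)) \<and> (\<forall>r\<in>range tot. \<xi> c r = 0) \<and>
     (\<forall>a. \<exists>N. \<forall>m\<ge>N. \<xi> c (monom a m) = 0) \<and>
     (\<forall>b e m. \<forall>\<^sub>F N in sequentially. \<xi> c (monom (b * e) m) = (\<Sum>l<N. dv l b * \<xi> c (monom e (m + l)) + dv l e * \<xi> c (monom b (m + l)))) \<and>
     (\<forall>a m. \<xi> c (monom (j a) m) = (if m = snd c then scale (\<chi> (fst c) a) 1 else 0))"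
    by (rule exE)
  let ?I = "B \<times> {..<Q}"
  let ?\<omega> = "gen_ext ?I \<xi> F"
  have "basic n ?\<omega>"
    by (rule basic_gen_ext) (use \<xi> Bfin len swap in blast)+
  moreover have "?\<omega> (map2 monom (map j as) ms) = F (zip as ms)" if "length as = length ms" for as ms
  proof -
    have "gen_ext ?I \<xi> (\<lambda>ds. F (cs @ ds)) (map2 monom (map j as) ms) = F (cs @ zip as ms)" for cs
      using that
    proof (induction as ms arbitrary: cs rule: list_induct2)
      case (Cons a as m ms)
      let ?r = "map2 monom (map j as) ms"
      have IH: "gen_ext ?I \<xi> (\<lambda>ds. F (cs @ c # ds)) ?r = F (cs @ c # zip as ms)" for c
        using Cons.IH[of "cs @ [c]"] by simp
      have "gen_ext ?I \<xi> (\<lambda>ds. F (cs @ ds)) (map2 monom (map j (a # as)) (m # ms))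
        = (\<Sum>c\<in>?I. \<xi> c (monom (j a) m) * F (cs @ c # zip as ms))"
        by (simp add: IH)
      also have "\<dots> = (\<Sum>b\<in>B. \<Sum>q<Q. if q = m then scale (\<chi> b a) (F (cs @ (b, m) # zip as ms)) else 0)"
        unfolding sum.cartesian_product
        by (rule sum.cong) (auto simp: \<xi> mult_scale_1)
      also have "\<dots> = F (cs @ zip (a # as) (m # ms))"
        using Z[of m cs _ "zip as ms"] by (cases "m < Q") (simp_all add: expand[of cs a])
      finally show ?case .
    qed simp
    from this[of "[]"] show ?thesis by simp
  qed
  ultimately show ?thesis by metis
qed

end

section \<open>The conformal vector and weights\<close>

text \<open>The product of the operators W - w over w < N. An element killed by it is a sum of
  eigenvectors with eigenvalues below N.\<close>

fun annih :: "('k::ring_1 \<Rightarrow> 'b \<Rightarrow> 'b) \<Rightarrow> ('b \<Rightarrow> 'b) \<Rightarrow> nat \<Rightarrow> 'b::ab_group_add \<Rightarrow> 'b" where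
  "annih sc W 0 x = x"
| "annih sc W (Suc N) x = annih sc W N (W x - sc (of_nat N) x)"

context vector_space
begin

text \<open>Applying W - N to the relation removes the eigenvalue N and multiplies the other
  summands by w - N, which is invertible by the assumption \<open>char\<close>.\<close>

lemma eigenvectors_independent:
  fixes W :: "'b \<Rightarrow> 'b"
  assumes W: "\<And>x y. W (x + y) = W x + W y" and char: "\<And>m. of_nat (Suc m) \<noteq> (0 :: 'a)"
    and "(\<Sum>w<N. f w) = 0" "\<And>w. w < N \<Longrightarrow> W (f w) = scale (of_nat w) (f w)" "\<And>c x. W (scale c x) = scale c (W x)" "w < N"
  shows "f w = 0"
  using assms(3,4,6)
proof (induction N arbitrary: f w)
  case (Suc N)
  have "(\<Sum>w<N. scale (of_nat w - of_nat N) (f w)) = 0"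
  proof -
    have "0 = W (\<Sum>w<Suc N. f w) - scale (of_nat N) (\<Sum>w<Suc N. f w)"
      using Suc.prems(1) additive_0[of W, OF W] by simp
    also have "\<dots> = (\<Sum>w<Suc N. scale (of_nat w - of_nat N) (f w))"
      unfolding additive_sum[of W, OF W] scale_sum_right sum_subtractf[symmetric] scale_left_diff_distrib
      using Suc.prems(2) by (intro sum.cong) auto
    finally show ?thesis by simp
  qed
  then have "scale (of_nat w - of_nat N) (f w) = 0" if "w < N" for w
    by (rule Suc.IH[of "\<lambda>w. scale (of_nat w - of_nat N) (f w)"])
      (use Suc.prems(2) that in \<open>simp_all add: assms(5) scale_left_commute\<close>)
  moreover have "(of_nat w - of_nat N :: 'a) \<noteq> 0" if "w < N" for w
  proof -
    have "of_nat N - of_nat w = (of_nat (Suc (N - Suc w)) :: 'a)"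
      using that by (metis Suc_diff_Suc add_diff_cancel_left' le_add_diff_inverse less_imp_le of_nat_add)
    then show ?thesis using char[of "N - Suc w"] by (metis eq_iff_diff_eq_0)
  qed
  ultimately have z: "f w = 0" if "w < N" for w using that by (metis scale_eq_0_iff)
  then have "f N = 0" using Suc.prems(1) by simp
  then show ?case using z Suc.prems(3) by (cases "w = N") auto
qed simp

text \<open>The subspace \<open>S\<close> will consist of the basic cochains of a given degree;
  carrying it along ensures that all components are basic again.\<close>

lemma eigenvector_decomposition:
  fixes W :: "'b \<Rightarrow> 'b"
  assumes W: "\<And>x y. W (x + y) = W x + W y" and char: "\<And>m. of_nat (Suc m) \<noteq> (0 :: 'a)"
    and Wc: "\<And>c x. W (scale c x) = scale c (W x)"
    and S: "\<And>x. x \<in> S \<Longrightarrow> W x \<in> S" "\<And>x y. x \<in> S \<Longrightarrow> y \<in> S \<Longrightarrow> x + y \<in> S" "\<And>c x. x \<in> S \<Longrightarrow> scale c x \<in> S"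
    and "x \<in> S" "annih scale W N x = 0"
  shows "\<exists>f. x = (\<Sum>w<N. f w) \<and> (\<forall>w<N. W (f w) = scale (of_nat w) (f w) \<and> f w \<in> S)"
  using assms(7,8)
proof (induction N arbitrary: x)
  case (Suc N)
  have Sd: "y - z \<in> S" if "y \<in> S" "z \<in> S" for y z
    using S(2)[OF that(1) S(3)[OF that(2), of "- 1"]] by simp
  let ?x = "W x - scale (of_nat N) x"
  have "?x \<in> S" using Suc.prems by (intro Sd S)
  then obtain f where f: "?x = (\<Sum>w<N. f w)" "\<And>w. w < N \<Longrightarrow> W (f w) = scale (of_nat w) (f w) \<and> f w \<in> S"
    using Suc.IH[of ?x] Suc.prems by auto
  have ne: "(of_nat w - of_nat N :: 'a) \<noteq> 0" if "w < N" for w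
  proof -
    have "of_nat N - of_nat w = (of_nat (Suc (N - Suc w)) :: 'a)"
      using that by (metis Suc_diff_Suc add_diff_cancel_left' le_add_diff_inverse less_imp_le of_nat_add)
    then show ?thesis using char[of "N - Suc w"] by (metis eq_iff_diff_eq_0)
  qed
  define g where "g w = scale (1 / (of_nat w - of_nat N)) (f w)" for w
  have g: "W (g w) = scale (of_nat w) (g w)" "g w \<in> S" "scale (of_nat w - of_nat N) (g w) = f w" if "w < N" for w
    using f(2)[OF that] ne[OF that] by (simp_all add: g_def Wc scale_left_commute S)
  \<comment> \<open>The components of (W - N) x, divided by w - N, account for all of x except an
    eigenvector with eigenvalue N.\<close>
  define h where "h w = (if w < N then g w else x - (\<Sum>w<N. g w))" for w
  have sumS: "(\<Sum>w\<in>I. g w) \<in> S" if "I \<subseteq> {..<N}" for I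
    using that
  proof (induction I rule: infinite_finite_induct)
    case empty
    show ?case using S(3)[OF Suc.prems(1), of 0] by simp
  qed (use S(3)[OF Suc.prems(1), of 0] g S(2) in auto)
  have "W (h N) - scale (of_nat N) (h N) = ?x - (\<Sum>w<N. scale (of_nat w - of_nat N) (g w))"
    using g(1) by (simp add: h_def additive_diff[of W, OF W] additive_sum[of W, OF W] scale_right_diff_distrib
        scale_sum_right scale_left_diff_distrib sum_subtractf)
  then have "W (h N) = scale (of_nat N) (h N)" using g(3) f(1) by simp
  moreover have "h N \<in> S" using Suc.prems(1) sumS[of "{..<N}"] by (simp add: h_def Sd)
  moreover have "x = (\<Sum>w<Suc N. h w)" by (simp add: h_def)
  moreover have "h w = g w" if "w < N" for w using that by (simp add: h_def)
  ultimately show ?case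
    using g(1,2) by (intro exI[of _ h] conjI allI impI) (metis less_Suc_eq)+
qed simp

end

section \<open>The invariant form and dual bases\<close>

context affine_pva
begin

lemma form_add: "form a (b + c) = form a b + form a c" and form_scale: "form a (scaleg s b) = s * form a b"
  using g.form_linear[of a] by (simp_all add: Vector_Spaces.linear_iff)

lemma form_add_left: "form (b + c) a = form b a + form c a" and form_scale_left: "form (scaleg s b) a = s * form b a"
  using form_add[of a b c] form_scale[of a s b] by (simp_all add: g.form_symmetric[of _ a])

lemma form_sum: "form a (\<Sum>i\<in>I. f i) = (\<Sum>i\<in>I. form a (f i))"
  by (rule additive_sum[of "form a", OF form_add])

lemma form_sum_left: "form (\<Sum>i\<in>I. f i) a = (\<Sum>i\<in>I. form (f i) a)"
  by (rule additive_sum[of "\<lambda>x. form x a", OF form_add_left])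

lemma form_eqI:
  assumes "\<And>b. form x b = form y b"
  shows "x = y"
proof -
  have "form (x - y) b = 0" for b
    using assms[of b] additive_diff[of "\<lambda>x. form x b" x y, OF form_add_left] by simp
  then show ?thesis using g.form_nondegenerate[of "x - y"] by simp
qed

lemma bracket_add: "bracket a (b + c) = bracket a b + bracket a c"
  and bracket_add_left: "bracket (a + b) c = bracket a c + bracket b c"
  using g.bracket_linear_right[of a] g.bracket_linear_left[of c] by (simp_all add: Vector_Spaces.linear_iff)

lemma bracket_skew: "bracket a b = - bracket b a"
proof -
  have "bracket (a + b) (a + b) = bracket a b + bracket b a"
    by (simp only: bracket_add bracket_add_left) (simp add: g.bracket_alternating)
  then show ?thesis by (simp add: g.bracket_alternating eq_neg_iff_add_eq_0)
qed

lemma dual_basisD: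
  assumes "g.is_basis_with_dual N u u'"
  shows "i \<in> {1..N} \<Longrightarrow> l \<in> {1..N} \<Longrightarrow> form (u i) (u' l) = (if i = l then 1 else 0)"
    and "\<exists>c. a = (\<Sum>i=1..N. scaleg (c i) (u i))"
proof -
  note d = assms[unfolded g.is_basis_with_dual_def]
  show "i \<in> {1..N} \<Longrightarrow> l \<in> {1..N} \<Longrightarrow> form (u i) (u' l) = (if i = l then 1 else 0)" using d by blast
  have "a \<in> g.span (u ` {1..N})" using d by simp
  then obtain f where "a = (\<Sum>v\<in>u ` {1..N}. scaleg (f v) v)"
    using g.span_finite[of "u ` {1..N}"] by auto
  then show "\<exists>c. a = (\<Sum>i=1..N. scaleg (c i) (u i))"
    using d by (intro exI[of _ "\<lambda>i. f (u i)"]) (simp add: sum.reindex)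
qed

lemma dual_basis_expand:
  assumes "g.is_basis_with_dual N u u'"
  shows "a = (\<Sum>i=1..N. scaleg (form a (u' i)) (u i))" "a = (\<Sum>i=1..N. scaleg (form a (u i)) (u' i))"
proof -
  have 1: "x = (\<Sum>i=1..N. scaleg (form x (u' i)) (u i))" for x
  proof -
    obtain c where c: "x = (\<Sum>i=1..N. scaleg (c i) (u i))" using dual_basisD(2)[OF assms] by blast
    have "form x (u' l) = c l" if l: "l \<in> {1..N}" for l
    proof -
      have "form x (u' l) = (\<Sum>i=1..N. c i * form (u i) (u' l))"
        by (simp add: c form_sum_left form_scale_left)
      also have "\<dots> = (\<Sum>i=1..N. if i = l then c l else 0)"
        using dual_basisD(1)[OF assms _ l] by (intro sum.cong) auto
      finally show ?thesis using l by simp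
    qed
    then show ?thesis using c by simp
  qed
  show "a = (\<Sum>i=1..N. scaleg (form a (u' i)) (u i))" by (rule 1)
  show "a = (\<Sum>i=1..N. scaleg (form a (u i)) (u' i))"
  proof (rule form_eqI)
    fix b
    have "form a b = (\<Sum>i=1..N. form b (u' i) * form a (u i))"
      by (subst (1) 1[of b]) (simp add: form_sum form_scale)
    then show "form a b = form (\<Sum>i=1..N. scaleg (form a (u i)) (u' i)) b"
      by (simp add: form_sum_left form_scale_left g.form_symmetric[of b] mult.commute)
  qed
qed

text \<open>The map sending a to the sum of (a|b) b over the basis is injective by nondegeneracy,
  hence onto by finite dimension; the preimages of the basis vectors form the dual basis.\<close>

lemma dual_basis_exists: "\<exists>N u u'. g.is_basis_with_dual N u u'"
proof -
  obtain B0 where B0: "finite B0" "g.span B0 = UNIV" using g.finite_dimensional by blast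
  obtain B where B: "B \<subseteq> B0" "g.independent B" "B0 \<subseteq> g.span B"
    using g.maximal_independent_subset[of B0] by blast
  have Bfin: "finite B" using B(1) B0(1) by (rule finite_subset)
  have Bspan: "g.span B = UNIV" using B(3) B0(2) by (metis g.span_minimal g.subspace_span top.extremum_unique)
  interpret fd: finite_dimensional_vector_space scaleg B
    by unfold_locales (use Bfin B(2) Bspan in auto)
  obtain u :: "nat \<Rightarrow> 'g" where u: "bij_betw u {1..card B} B"
    using ex_bij_betw_nat_finite_1[OF Bfin] by blast
  let ?T = "\<lambda>a. \<Sum>b\<in>B. scaleg (form a b) b"
  have coord: "c b = 0" if "(\<Sum>b\<in>B. scaleg (c b) b) = 0" "b \<in> B" for c b
    using g.independentD[OF B(2) Bfin subset_refl that] .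
  have lin: "Vector_Spaces.linear scaleg scaleg ?T"
    unfolding Vector_Spaces.linear_iff
    using g.vector_space_axioms
    by (simp add: form_add_left form_scale_left g.scale_left_distrib sum.distrib g.scale_sum_right)
  have inj: "inj ?T"
  proof (rule injI)
    fix x y assume "?T x = ?T y"
    then have "(\<Sum>b\<in>B. scaleg (form x b - form y b) b) = 0"
      by (simp add: g.scale_left_diff_distrib sum_subtractf)
    then have b: "form x b = form y b" if "b \<in> B" for b
      using coord[of "\<lambda>b. form x b - form y b" b] that by simp
    show "x = y"
    proof (rule form_eqI)
      fix c
      have "c \<in> g.span B" by (simp add: Bspan)
      then obtain f where "c = (\<Sum>v\<in>B. scaleg (f v) v)" using g.span_finite[OF Bfin] by auto
      then show "form x c = form y c" using b by (simp add: form_sum form_scale)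
    qed
  qed
  have "surj ?T" by (rule fd.linear_inj_imp_surj[OF lin inj])
  have "\<forall>b. \<exists>a. ?T a = b"
  proof
    fix b
    obtain a where "b = ?T a" using surjD[OF \<open>surj ?T\<close>, of b] by (rule exE)
    then show "\<exists>a. ?T a = b" by (intro exI[of _ a]) (rule sym)
  qed
  from choice[OF this] obtain d where d: "\<forall>b. ?T (d b) = b" by (rule exE)
  have dual: "form (d b) c = (if b = c then 1 else 0)" if "b \<in> B" "c \<in> B" for b c
  proof -
    have "(\<Sum>c\<in>B. scaleg (form (d b) c - (if b = c then 1 else 0)) c) = ?T (d b) - (\<Sum>c\<in>B. if b = c then c else 0)"
      unfolding g.scale_left_diff_distrib sum_subtractf by (intro arg_cong2[of _ _ _ _ "(-)"] sum.cong) auto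
    also have "\<dots> = 0" using d that Bfin by (simp add: sum.delta)
    finally show ?thesis using coord[of "\<lambda>c. form (d b) c - (if b = c then 1 else 0)" c] that(2) by simp
  qed
  have "g.is_basis_with_dual (card B) u (\<lambda>i. d (u i))"
    unfolding g.is_basis_with_dual_def
  proof (intro conjI ballI)
    show "inj_on u {1..card B}" using u by (rule bij_betw_imp_inj_on)
    have im: "u ` {1..card B} = B" using u by (rule bij_betw_imp_surj_on)
    show "g.independent (u ` {1..card B})" "g.span (u ` {1..card B}) = UNIV"
      using im B(2) Bspan by simp_all
    fix i l assume il: "i \<in> {1..card B}" "l \<in> {1..card B}"
    then have "u i \<in> B" "u l \<in> B" using im by auto
    moreover have "u l = u i \<longleftrightarrow> i = l" using il \<open>inj_on u {1..card B}\<close> by (metis inj_on_eq_iff)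
    ultimately show "form (u i) (d (u l)) = (if i = l then 1 else 0)"
      using dual[of "u l" "u i"] by (simp add: g.form_symmetric[of "u i"])
  qed
  then show ?thesis by blast
qed

lemma dual_basis_contract:
  assumes N: "g.is_basis_with_dual N u u'"
    and \<gamma>: "\<And>a b. \<gamma> (a + b) = \<gamma> a + \<gamma> b" "\<And>s a. \<gamma> (scaleg s a) = s * \<gamma> a"
  shows "form (\<Sum>i=1..N. scaleg (\<gamma> (u' i)) (u i)) b = \<gamma> b" "form (\<Sum>i=1..N. scaleg (\<gamma> (u i)) (u' i)) b = \<gamma> b"
proof -
  have s: "\<gamma> (\<Sum>i\<in>I. f i) = (\<Sum>i\<in>I. \<gamma> (f i))" for I :: "nat set" and f
    by (rule additive_sum[of \<gamma>, OF \<gamma>(1)])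
  show "form (\<Sum>i=1..N. scaleg (\<gamma> (u' i)) (u i)) b = \<gamma> b"
    by (subst (2) dual_basis_expand(2)[OF N, of b])
      (simp add: form_sum_left form_scale_left s \<gamma> g.form_symmetric[of b] mult.commute)
  show "form (\<Sum>i=1..N. scaleg (\<gamma> (u i)) (u' i)) b = \<gamma> b"
    by (subst (2) dual_basis_expand(1)[OF N, of b])
      (simp add: form_sum_left form_scale_left s \<gamma> g.form_symmetric[of b] mult.commute)
qed

text \<open>Each sum represents the functional \<gamma> under the form. Thus the bases fixed inside
  \<open>conf\<close> can be exchanged for the arbitrary ones of the theorem.\<close>

lemma dual_basis_contract_eq:
  assumes "g.is_basis_with_dual N u u'" "g.is_basis_with_dual M v v'"
    and \<gamma>: "\<And>a b. \<gamma> (a + b) = \<gamma> a + \<gamma> b" "\<And>s a. \<gamma> (scaleg s a) = s * \<gamma> a"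
  shows "(\<Sum>i=1..N. scaleg (\<gamma> (u' i)) (u i)) = (\<Sum>i=1..M. scaleg (\<gamma> (v' i)) (v i))"
    "(\<Sum>i=1..N. scaleg (\<gamma> (u i)) (u' i)) = (\<Sum>i=1..M. scaleg (\<gamma> (v' i)) (v i))"
  by (rule form_eqI, simp only: dual_basis_contract[OF assms(1) \<gamma>] dual_basis_contract[OF assms(2) \<gamma>])+

lemma j_sum: "j (\<Sum>i\<in>I. f i) = (\<Sum>i\<in>I. j (f i))"
  by (rule additive_sum[of j, OF j_add])

lemma nprod_j: "nprod (j a) 0 (j b) = j (bracket a b)" "nprod (j a) 1 (j b) = scale (k * form a b) 1"
  "2 \<le> i \<Longrightarrow> nprod (j a) i (j b) = 0"
  by (auto simp: nprod_def br_generators coeff_pCons numeral_2_eq_2 split: nat.split)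

lemma nprod_1_right: "nprod a i 1 = 0"
  using nprod_mult_right[of a i 1 1] by simp

end

section \<open>The conformal vector and conformal weight at nonzero level\<close>

locale affine_pva_nonzero = affine_pva scaleg bracket form k scale D br j
  for scaleg :: "'k::field_char_0 \<Rightarrow> 'g::ab_group_add \<Rightarrow> 'g" and bracket and form and k :: 'k
    and scale :: "'k \<Rightarrow> 'v::comm_ring_1 \<Rightarrow> 'v" and D and br and j +
  assumes k_nonzero: "k \<noteq> 0"
begin

definition dual_bases :: "nat \<times> (nat \<Rightarrow> 'g) \<times> (nat \<Rightarrow> 'g)" where
  "dual_bases = (SOME B. case B of (N, u, u') \<Rightarrow> g.is_basis_with_dual N u u')"

definition "dimg = fst dual_bases"
definition "bas = fst (snd dual_bases)"
definition "dua = snd (snd dual_bases)"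

lemma dual_bases: "g.is_basis_with_dual dimg bas dua"
proof -
  obtain N u u' where "g.is_basis_with_dual N u u'" using dual_basis_exists by blast
  then have "case (N, u, u') of (N, u, u') \<Rightarrow> g.is_basis_with_dual N u u'" by simp
  then have "case dual_bases of (N, u, u') \<Rightarrow> g.is_basis_with_dual N u u'"
    unfolding dual_bases_def by (rule someI)
  then show ?thesis by (simp add: dimg_def bas_def dua_def split_beta)
qed

text \<open>
  The element \<open>\<Sum> u\<^sub>i u\<^sup>i / 2k\<close> generates \<open>\<partial>\<close> and the conformal weight:
  \<open>[L\<^sub>\<lambda> a] = (\<partial> + \<lambda>) a\<close> for \<open>a\<close> in \<open>g\<close>.
\<close>

definition conf :: 'v where
  "conf = scale (1 / (2 * k)) (\<Sum>i=1..dimg. j (bas i) * j (dua i))"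

lemma nprod_gen_conf_sum:
  "nprod (j a) m conf = scale (1 / (2 * k)) ((\<Sum>i=1..dimg. nprod (j a) m (j (bas i)) * j (dua i))
     + (\<Sum>i=1..dimg. j (bas i) * nprod (j a) m (j (dua i))))"
  by (simp add: conf_def nprod_scale_right nprod_sum_right nprod_mult_right sum.distrib)

text \<open>At index 0 the two brackets cancel after expansion in the dual bases, by invariance of
  the form. At index 1 each of the two factors contributes k a, which explains the normalisation by
  2k.\<close>

lemma nprod_gen_conf: "nprod (j a) 0 conf = 0" "nprod (j a) 1 conf = j a" "2 \<le> m \<Longrightarrow> nprod (j a) m conf = 0"
proof -
  have inv: "form (bracket a b) c = - form (bracket a c) b" for b c
  proof -
    have "form (bracket a b) c = - form (bracket b a) c"
      by (subst bracket_skew) (simp add: additive_uminus[of "\<lambda>x. form x c", OF form_add_left])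
    then show ?thesis by (simp add: g.form_invariant g.form_symmetric[of b])
  qed
  have b1: "j (bracket a (bas i)) = (\<Sum>l=1..dimg. scale (form (bracket a (bas i)) (dua l)) (j (bas l)))" for i
    by (subst dual_basis_expand(1)[OF dual_bases, of "bracket a (bas i)"]) (simp add: j_sum j_scale)
  have b2: "j (bracket a (dua i)) = (\<Sum>l=1..dimg. scale (form (bracket a (dua i)) (bas l)) (j (dua l)))" for i
    by (subst dual_basis_expand(2)[OF dual_bases, of "bracket a (dua i)"]) (simp add: j_sum j_scale)
  have "(\<Sum>i=1..dimg. j (bas i) * j (bracket a (dua i)))
    = (\<Sum>i=1..dimg. \<Sum>l=1..dimg. scale (form (bracket a (dua i)) (bas l)) (j (bas i) * j (dua l)))"
    by (simp add: b2 sum_distrib_left scale_mult_right)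
  also have "\<dots> = (\<Sum>l=1..dimg. \<Sum>i=1..dimg. scale (form (bracket a (dua i)) (bas l)) (j (bas i) * j (dua l)))"
    by (rule sum.swap)
  also have "\<dots> = - (\<Sum>l=1..dimg. \<Sum>i=1..dimg. scale (form (bracket a (bas l)) (dua i)) (j (bas i) * j (dua l)))"
    unfolding sum_negf[symmetric] by (intro sum.cong refl) (subst inv, simp)
  also have "\<dots> = - (\<Sum>l=1..dimg. j (bracket a (bas l)) * j (dua l))"
    by (simp add: b1 sum_distrib_right scale_mult)
  finally show "nprod (j a) 0 conf = 0"
    by (simp add: nprod_gen_conf_sum nprod_j)
  have e: "j a = (\<Sum>i=1..dimg. scale (form a (bas i)) (j (dua i)))" "j a = (\<Sum>i=1..dimg. scale (form a (dua i)) (j (bas i)))"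
    by (subst dual_basis_expand(2)[OF dual_bases, of a], simp add: j_sum j_scale)
      (subst dual_basis_expand(1)[OF dual_bases, of a], simp add: j_sum j_scale)
  have f: "(\<Sum>i=1..dimg. nprod (j a) 1 (j (bas i)) * j (dua i)) = scale k (j a)"
    by (subst e(1)) (simp add: nprod_j scale_sum_right mult_scale_1 mult.commute[of k] del: One_nat_def)
  have f': "(\<Sum>i=1..dimg. j (bas i) * nprod (j a) 1 (j (dua i))) = scale k (j a)"
    by (subst e(2)) (simp add: nprod_j scale_sum_right mult_scale_1 mult.commute[of "j _"] mult.commute[of k] del: One_nat_def)
  show "nprod (j a) 1 conf = j a"
  proof -
    have "scale k (j a) + scale k (j a) = scale (2 * k) (j a)"
      by (simp only: mult_2 scale_left_distrib)
    then show ?thesis unfolding nprod_gen_conf_sum f f' using k_nonzero by simp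
  qed
  show "2 \<le> m \<Longrightarrow> nprod (j a) m conf = 0"
    by (simp add: nprod_gen_conf_sum nprod_j)
qed

lemma nprod_conf_gen: "nprod conf 0 (j a) = D (j a)" "nprod conf 1 (j a) = j a"
proof -
  have "nprod conf m (j a) = - (\<Sum>i<2. (- 1) ^ (i + m) * dv i (nprod (j a) (i + m) conf))" for m
    by (rule nprod_skew) (rule nprod_gen_conf(3))
  note s = this
  show "nprod conf 0 (j a) = D (j a)"
    unfolding s[of 0] by (simp add: numeral_2_eq_2 nprod_gen_conf[unfolded One_nat_def] dv_def)
  have z: "nprod (j a) (Suc (Suc 0)) conf = 0" using nprod_gen_conf(3)[of 2] by (simp add: numeral_2_eq_2)
  show "nprod conf 1 (j a) = j a"
    unfolding s[of 1] by (simp add: numeral_2_eq_2 nprod_gen_conf[unfolded One_nat_def] z)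
qed

text \<open>Both sides are derivations, agree on g, and commute with \<open>D\<close>.\<close>

lemma nprod_conf_0: "nprod conf 0 v = D v"
proof (induction v rule: V_induct)
  case one then show ?case by (simp add: nprod_1_right)
next
  case (gen m a)
  show ?case by (induction m) (simp_all add: nprod_conf_gen nprod_D_right)
qed (simp_all add: nprod_add_right D_add nprod_mult_right D_mult nprod_scale_right D_scale)

definition wt :: "'v \<Rightarrow> 'v" where "wt v = nprod conf 1 v"

lemma wt_add: "wt (x + y) = wt x + wt y" and wt_scale: "wt (scale c x) = scale c (wt x)"
  and wt_mult: "wt (x * y) = wt x * y + x * wt y" and wt_1: "wt 1 = 0" and wt_j: "wt (j a) = j a"
  and wt_D: "wt (D x) = D x + D (wt x)"
  by (simp_all add: wt_def nprod_add_right nprod_scale_right nprod_mult_right nprod_1_right nprod_conf_gen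
      nprod_D_right nprod_conf_0 del: One_nat_def)

lemma wt_gen: "wt ((D ^^ m) (j a)) = of_nat (Suc m) * (D ^^ m) (j a)"
  by (induction m) (simp_all add: wt_j wt_D D_of_nat_mult D_add algebra_simps)

lemma wt_conf: "wt conf = of_nat 2 * conf"
proof -
  have "wt (\<Sum>i=1..dimg. j (bas i) * j (dua i)) = (\<Sum>i=1..dimg. j (bas i) * j (dua i)) + (\<Sum>i=1..dimg. j (bas i) * j (dua i))"
    by (simp only: additive_sum[of wt, OF wt_add] wt_mult wt_j sum.distrib)
  then show ?thesis by (simp add: conf_def wt_scale scale_mult_right flip: mult_2)
qed

text \<open>The generators have positive weight, so that weight zero consists of the constants. This
  is recorded together with the decomposition since it later identifies the cochains of weight zero
  with forms on g.\<close>

lemma weight_decomposition: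
  "\<exists>N f. v = (\<Sum>w<N. f w) \<and> (\<forall>w\<ge>N. f w = 0) \<and> (\<forall>w. wt (f w) = of_nat w * f w) \<and> (\<exists>c. f 0 = scale c 1)"
proof (induction v rule: V_induct)
  case one
  show ?case
    by (intro exI[of _ 1] exI[of _ "\<lambda>w. if w = 0 then 1 else 0"]) (auto simp: wt_1 additive_0[of wt, OF wt_add] intro: exI[of _ 1])
next
  case (gen m a)
  show ?case
    by (intro exI[of _ "Suc (Suc m)"] exI[of _ "\<lambda>w. if w = Suc m then (D ^^ m) (j a) else 0"])
      (auto simp: wt_gen additive_0[of wt, OF wt_add] sum.delta intro: exI[of _ 0])
next
  case (add x y)
  then obtain N f M h c d where f: "x = (\<Sum>w<N. f w)" "\<forall>w\<ge>N. f w = 0" "\<forall>w. wt (f w) = of_nat w * f w" "f 0 = scale c 1"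
    and h: "y = (\<Sum>w<M. h w)" "\<forall>w\<ge>M. h w = 0" "\<forall>w. wt (h w) = of_nat w * h w" "h 0 = scale d 1"
    by blast
  have "x = (\<Sum>w<N + M. f w)" "y = (\<Sum>w<N + M. h w)"
    unfolding f(1) h(1) by (rule sum.mono_neutral_left; use f(2) h(2) in auto)+
  then show ?case
    using f(2-) h(2-)
    by (intro exI[of _ "N + M"] exI[of _ "\<lambda>w. f w + h w"])
      (auto simp: wt_add sum.distrib algebra_simps intro: exI[of _ "c + d"])
next
  case (mult x y)
  then obtain N f M h c d where f: "x = (\<Sum>w<N. f w)" "\<forall>w\<ge>N. f w = 0" "\<forall>w. wt (f w) = of_nat w * f w" "f 0 = scale c 1"
    and h: "y = (\<Sum>w<M. h w)" "\<forall>w\<ge>M. h w = 0" "\<forall>w. wt (h w) = of_nat w * h w" "h 0 = scale d 1"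
    by blast
  have z: "f p * h q = 0" if "N + M \<le> p + q" for p q
    using f(2) h(2) that by (cases "N \<le> p") auto
  have e: "x = (\<Sum>w<N + M. f w)" "y = (\<Sum>w<N + M. h w)"
    unfolding f(1) h(1) by (rule sum.mono_neutral_left; use f(2) h(2) in auto)+
  have "x * y = (\<Sum>i<N + M. \<Sum>p\<le>i. f p * h (i - p))"
  proof -
    have "(\<Sum>i<N + M. \<Sum>p\<le>i. f p * h (i - p)) = (\<Sum>p<N + M. \<Sum>q<N + M. f p * h q)"
      by (rule sum_triangle_square) (rule z)
    then show ?thesis by (simp only: e sum_product)
  qed
  moreover have "wt (\<Sum>p\<le>i. f p * h (i - p)) = of_nat i * (\<Sum>p\<le>i. f p * h (i - p))" for i
    unfolding additive_sum[of wt, OF wt_add] sum_distrib_left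
  proof (intro sum.cong refl)
    fix p assume "p \<in> {..i}"
    then have "of_nat i = (of_nat p + of_nat (i - p) :: 'v)" by (metis atMost_iff le_add_diff_inverse of_nat_add)
    then show "wt (f p * h (i - p)) = of_nat i * (f p * h (i - p))"
      using f(3) h(3) by (simp add: wt_mult algebra_simps)
  qed
  moreover have "(\<Sum>p\<le>i. f p * h (i - p)) = 0" if "N + M \<le> i" for i
    by (rule sum.neutral) (use that z in auto)
  ultimately show ?case
    using f(4) h(4)
    by (intro exI[of _ "N + M"] exI[of _ "\<lambda>i. \<Sum>p\<le>i. f p * h (i - p)"])
      (auto intro: exI[of _ "c * d"] simp: scale_1_mult)
next
  case (scale c x)
  then obtain N f d where f: "x = (\<Sum>w<N. f w)" "\<forall>w\<ge>N. f w = 0" "\<forall>w. wt (f w) = of_nat w * f w" "f 0 = scale d 1"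
    by blast
  then show ?case
    by (intro exI[of _ N] exI[of _ "\<lambda>w. scale c (f w)"])
      (auto simp: wt_scale scale_sum_right scale_mult_right intro: exI[of _ "c * d"])
qed

lemma of_nat_Suc_nonzero: "of_nat (Suc m) \<noteq> (0 :: 'k)"
  by (rule of_nat_neq_0)

text \<open>The eigenvalues of \<open>wt\<close> are nonnegative integers: adding s > 0 makes the
  operator injective, and for s = 0 its kernel is the component of weight zero.\<close>

lemma weight_zero:
  assumes "wt v + of_nat s * v = 0"
  shows "s \<noteq> 0 \<Longrightarrow> v = 0" "s = 0 \<Longrightarrow> \<exists>c. v = scale c 1"
proof -
  obtain N f c where f: "v = (\<Sum>w<N. f w)" "\<And>w. w \<ge> N \<Longrightarrow> f w = 0" "\<And>w. wt (f w) = of_nat w * f w" "f 0 = scale c 1"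
    using weight_decomposition[of v] by blast
  have f3: "wt (f w) = scale (of_nat w) (f w)" for w by (simp add: f(3) scale_of_nat)
  have sum0: "(\<Sum>w<N. scale (of_nat (w + s)) (f w)) = 0"
  proof -
    have "wt v = (\<Sum>w<N. scale (of_nat w) (f w))"
      unfolding f(1) additive_sum[of wt, OF wt_add] f3 by (rule refl)
    moreover have "of_nat s * v = (\<Sum>w<N. scale (of_nat s) (f w))"
      unfolding scale_of_nat[symmetric] f(1) scale_sum_right by (rule refl)
    ultimately show ?thesis using assms by (simp add: sum.distrib scale_left_distrib)
  qed
  have ev: "wt (scale (of_nat (w + s)) (f w)) = scale (of_nat w) (scale (of_nat (w + s)) (f w))" for w
    by (simp only: wt_scale f3 scale_left_commute)
  have "of_nat (w + s) * f w = 0" if "w < N" for w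
    unfolding scale_of_nat[symmetric]
    by (rule eigenvectors_independent[where W = wt and N = N and f = "\<lambda>w. scale (of_nat (w + s)) (f w)" and w = w])
      (rule wt_add of_nat_Suc_nonzero sum0 ev wt_scale that)+
  then have z: "f w = 0" if ws: "w + s \<noteq> 0" for w
  proof (cases "w < N")
    case True
    obtain r where "w + s = Suc r" using ws by (cases "w + s") auto
    then show ?thesis
      using \<open>\<And>w. w < N \<Longrightarrow> of_nat (w + s) * f w = 0\<close>[OF True] of_nat_cancel[of r "f w" 0] by simp
  qed (use f(2) in simp)
  show "v = 0" if "s \<noteq> 0" unfolding f(1) using z that by simp
  show "\<exists>c. v = scale c 1" if "s = 0"
  proof (cases N)
    case 0
    then show ?thesis using f(1) by (intro exI[of _ 0]) simp
  next
    case (Suc M)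
    have "v = f 0" unfolding f(1) Suc sum.lessThan_Suc_shift using z that by simp
    then show ?thesis using f(4) by auto
  qed
qed

text \<open>Stated for all large N, so that finitely many elements, each with its own shift s, can
  be annihilated at once.\<close>

lemma weight_annihilator:
  "\<exists>N0. \<forall>N\<ge>N0. annih scale (\<lambda>v. wt v + scale (of_nat s) v) N v = 0"
proof -
  let ?W = "\<lambda>v. wt v + scale (of_nat s) v"
  obtain N f c where f: "v = (\<Sum>w<N. f w)" "\<And>w. wt (f w) = of_nat w * f w"
    using weight_decomposition[of v] by blast
  have add: "annih scale ?W M (x + y) = annih scale ?W M x + annih scale ?W M y" for M x y
  proof (induction M arbitrary: x y)
    case (Suc M)
    have e: "?W (x + y) - scale (of_nat M) (x + y) = (?W x - scale (of_nat M) x) + (?W y - scale (of_nat M) y)"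
      by (simp add: wt_add scale_right_distrib)
    show ?case by (simp only: annih.simps e Suc.IH)
  qed simp
  have z: "annih scale ?W M 0 = 0" for M using add[of M 0 0] by simp
  have ev: "annih scale ?W M x = 0" if "wt x = scale (of_nat w) x" "w + s < M" for M w x
    using that
  proof (induction M arbitrary: x)
    case (Suc M)
    let ?c = "of_nat w + of_nat s - of_nat M :: 'k"
    have e: "?W x - scale (of_nat M) x = scale ?c x"
      using Suc.prems(1) by (simp add: scale_left_distrib scale_left_diff_distrib)
    show ?case
    proof (cases "w + s = M")
      case True
      then have "?c = 0" by (metis eq_iff_diff_eq_0 of_nat_add)
      then show ?thesis using z by (simp add: e del: diff_conv_add_uminus)
    next
      case False
      then show ?thesis
        using Suc.IH[of "scale ?c x"] Suc.prems e by (simp add: wt_scale scale_left_commute)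
    qed
  qed simp
  show ?thesis
  proof (intro exI[of _ "N + s"] allI impI)
    fix M assume "N + s \<le> M"
    then have "annih scale ?W M (f w) = 0" if "w < N" for w
      using ev[of "f w" w M] f(2) that by (simp add: scale_of_nat)
    then show "annih scale ?W M v = 0"
      unfolding f(1) additive_sum[of "annih scale ?W M", OF add] by simp
  qed
qed

end

section \<open>The basic complex\<close>

declare sum_list_eq_0_iff [simp del]

lemma map2_update:
  "length as = length ms \<Longrightarrow> i < length ms \<Longrightarrow> (map2 f as ms)[i := f (as ! i) m] = map2 f as (ms[i := m])"
  by (intro nth_equalityI) (auto simp: nth_list_update)

section \<open>Alternating forms on the Lie algebra\<close>

context lie_algebra
begin

lemma lie_cochains_length: "\<alpha> \<in> lie_cochains n \<Longrightarrow> length as \<noteq> n \<Longrightarrow> \<alpha> as = 0"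
  by (simp add: lie_cochains_def)

lemma lie_cochains_add: "\<alpha> \<in> lie_cochains n \<Longrightarrow> \<alpha> (xs @ (x + y) # zs) = \<alpha> (xs @ x # zs) + \<alpha> (xs @ y # zs)"
proof (cases "length (xs @ x # zs) = n")
  case True
  assume "\<alpha> \<in> lie_cochains n"
  then have "\<forall>as i x y. length as = n \<longrightarrow> i < n \<longrightarrow> \<alpha> (as[i := x + y]) = \<alpha> (as[i := x]) + \<alpha> (as[i := y])"
    by (simp add: lie_cochains_def)
  from this[rule_format, of "xs @ x # zs" "length xs" x y] True show ?thesis by simp
qed (simp add: lie_cochains_def)

lemma lie_cochains_scale: "\<alpha> \<in> lie_cochains n \<Longrightarrow> \<alpha> (xs @ scale c x # zs) = c * \<alpha> (xs @ x # zs)"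
proof (cases "length (xs @ x # zs) = n")
  case True
  assume "\<alpha> \<in> lie_cochains n"
  then have "\<forall>as i c x. length as = n \<longrightarrow> i < n \<longrightarrow> \<alpha> (as[i := scale c x]) = c * \<alpha> (as[i := x])"
    by (simp add: lie_cochains_def)
  from this[rule_format, of "xs @ x # zs" "length xs" c x] True show ?thesis by simp
qed (simp add: lie_cochains_def)

lemma lie_cochains_dup: "\<alpha> \<in> lie_cochains n \<Longrightarrow> \<alpha> (xs @ x # x # zs) = 0"
proof (cases "length (xs @ x # x # zs) = n")
  case True
  assume a: "\<alpha> \<in> lie_cochains n"
  have "(xs @ x # x # zs) ! length xs = (xs @ x # x # zs) ! Suc (length xs)"
    by (simp add: nth_append)
  moreover have "length xs < Suc (length xs)" "Suc (length xs) < n" using True by auto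
  ultimately show ?thesis using a True unfolding lie_cochains_def by blast
qed (simp add: lie_cochains_def)

lemma lie_cochains_swap:
  assumes "\<alpha> \<in> lie_cochains n"
  shows "\<alpha> (xs @ x # y # zs) = - \<alpha> (xs @ y # x # zs)"
proof -
  have "\<alpha> (xs @ (x + y) # (x + y) # zs) = 0" by (rule lie_cochains_dup[OF assms])
  then show ?thesis
    using lie_cochains_add[OF assms, of xs x y "(x + y) # zs"] lie_cochains_add[OF assms, of "xs @ [x]" x y zs]
      lie_cochains_add[OF assms, of "xs @ [y]" x y zs] lie_cochains_dup[OF assms, of xs x zs] lie_cochains_dup[OF assms, of xs y zs]
    by (simp add: eq_neg_iff_add_eq_0)
qed

lemma lie_cochains_move:
  assumes "\<alpha> \<in> lie_cochains n"
  shows "\<alpha> (ps @ x # qs) = (- 1) ^ length qs * \<alpha> (ps @ qs @ [x])"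
proof (induction qs arbitrary: ps)
  case (Cons q qs)
  show ?case using Cons.IH[of "ps @ [q]"] lie_cochains_swap[OF assms, of ps x q qs] by simp
qed simp

lemma lie_cochainsI:
  assumes "\<And>as. length as \<noteq> n \<Longrightarrow> \<alpha> as = 0"
    and "\<And>xs x y zs. Suc (length xs + length zs) = n \<Longrightarrow> \<alpha> (xs @ (x + y) # zs) = \<alpha> (xs @ x # zs) + \<alpha> (xs @ y # zs)"
    and "\<And>xs c x zs. Suc (length xs + length zs) = n \<Longrightarrow> \<alpha> (xs @ scale c x # zs) = c * \<alpha> (xs @ x # zs)"
    and "\<And>as i j. length as = n \<Longrightarrow> i < j \<Longrightarrow> j < n \<Longrightarrow> as ! i = as ! j \<Longrightarrow> \<alpha> as = 0"
  shows "\<alpha> \<in> lie_cochains n"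
  unfolding lie_cochains_def
proof (intro CollectI conjI allI impI)
  fix as :: "'g list" and i x y and c assume i: "length as = n" "i < n"
  then show "\<alpha> (as[i := x + y]) = \<alpha> (as[i := x]) + \<alpha> (as[i := y])"
    using assms(2)[of "take i as" "drop (Suc i) as"] by (simp add: upd_conv_take_nth_drop)
  show "\<alpha> (as[i := scale c x]) = c * \<alpha> (as[i := x])"
    using assms(3)[of "take i as" "drop (Suc i) as"] i by (simp add: upd_conv_take_nth_drop)
qed (use assms(1,4) in blast)+

lemma lie_cochains_add_fun: "\<alpha> \<in> lie_cochains n \<Longrightarrow> \<beta> \<in> lie_cochains n \<Longrightarrow> \<alpha> + \<beta> \<in> lie_cochains n"
  by (rule lie_cochainsI)
    (auto simp: lie_cochains_length lie_cochains_add lie_cochains_scale algebra_simps, auto simp: lie_cochains_def)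

lemma lie_cochains_scale_fun: "\<alpha> \<in> lie_cochains n \<Longrightarrow> (\<lambda>as. c * \<alpha> as) \<in> lie_cochains n"
  by (rule lie_cochainsI)
    (auto simp: lie_cochains_length lie_cochains_add lie_cochains_scale algebra_simps, auto simp: lie_cochains_def)

lemma lie_d_add: "lie_d n (\<alpha> + \<beta>) = lie_d n \<alpha> + lie_d n \<beta>"
  by (auto simp: lie_d_def fun_eq_iff algebra_simps sum.distrib)

lemma lie_d_scale: "lie_d n (\<lambda>as. c * \<alpha> as) = (\<lambda>as. c * lie_d n \<alpha> as)"
  by (auto simp: lie_d_def fun_eq_iff sum_distrib_left mult_ac simp del: sum.lessThan_Suc upt_Suc)

end

section \<open>Operators on basic cochains\<close>

context affine_pva
begin

abbreviation gens :: "'g list \<Rightarrow> nat list \<Rightarrow> 'v poly list" where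
  "gens as ms \<equiv> map2 monom (map j as) ms"

lemma basic_plus: "basic n \<omega> \<Longrightarrow> basic n \<eta> \<Longrightarrow> basic n (\<omega> + \<eta>)"
  and basic_minus: "basic n \<omega> \<Longrightarrow> basic n \<eta> \<Longrightarrow> basic n (\<omega> - \<eta>)"
  and basic_0: "basic n 0"
  using basic_add[of n \<omega> \<eta>] basic_diff[of n \<omega> \<eta>] basic_zero[of n]
  by (simp_all add: plus_fun_def fun_diff_def zero_fun_def)

definition fsc :: "'k \<Rightarrow> ('v poly list \<Rightarrow> 'v) \<Rightarrow> 'v poly list \<Rightarrow> 'v" where
  "fsc c \<omega> = (\<lambda>xs. scale c (\<omega> xs))"

lemma basic_fsc: "basic n \<omega> \<Longrightarrow> basic n (fsc c \<omega>)"
  unfolding fsc_def by (rule basic_scale)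

lemma vector_space_fsc: "vector_space fsc"
  by unfold_locales (auto simp: fsc_def fun_eq_iff scale_right_distrib scale_left_distrib)

lemma lieder_plus: "modes.lieder x (\<omega> + \<eta>) = modes.lieder x \<omega> + modes.lieder x \<eta>"
  and ced_plus: "modes.ced (\<omega> + \<eta>) = modes.ced \<omega> + modes.ced \<eta>"
  using modes.lieder_add[of x \<omega> \<eta>] modes.ced_add[of \<omega> \<eta>] by (simp_all add: plus_fun_def fun_eq_iff)

lemma lieder_fsc: "modes.lieder x (fsc c \<omega>) = fsc c (modes.lieder x \<omega>)"
  and ced_fsc: "modes.ced (fsc c \<omega>) = fsc c (modes.ced \<omega>)"
  by (simp_all add: fsc_def fun_eq_iff lieder_scale ced_scale)

lemmas lieder_sum = additive_sum[of "modes.lieder x" for x, OF lieder_plus]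
lemmas ced_sum' = additive_sum[of modes.ced, OF ced_plus]
lemmas ced_minus' = additive_diff[of modes.ced, OF ced_plus]
lemmas lieder_minus' = additive_diff[of "modes.lieder x" for x, OF lieder_plus]
lemmas lieder_0 = additive_0[of "modes.lieder x" for x, OF lieder_plus]
lemmas ced_0 = additive_0[of modes.ced, OF ced_plus]

definition iota :: "'v poly \<Rightarrow> ('v poly list \<Rightarrow> 'v) \<Rightarrow> 'v poly list \<Rightarrow> 'v" where
  "iota x \<omega> = (\<lambda>zs. \<omega> (x # zs))"

lemma iota_plus: "iota x (\<omega> + \<eta>) = iota x \<omega> + iota x \<eta>"
  and iota_fsc: "iota x (fsc c \<omega>) = fsc c (iota x \<omega>)"
  by (simp_all add: iota_def fsc_def fun_eq_iff)

lemmas iota_0 = additive_0[of "iota x" for x, OF iota_plus]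

lemma cartan: "modes.lieder x \<omega> = iota x (modes.ced \<omega>) + modes.ced (iota x \<omega>)"
  by (simp add: iota_def fun_eq_iff)

lemma ced_lieder_comm: "basic n \<omega> \<Longrightarrow> modes.ced (modes.lieder x \<omega>) = modes.lieder x (modes.ced \<omega>)"
  by (simp add: fun_eq_iff modes.lieder_ced basicD(2))

lemma ced_ced_0: "basic n \<omega> \<Longrightarrow> modes.ced (modes.ced \<omega>) = 0"
  by (simp add: fun_eq_iff modes.ced_ced basicD(2))

text \<open>Basic cochains of degree \<open>n - 1\<close>; those of degree \<open>-1\<close> vanish.\<close>

definition basic_pred :: "nat \<Rightarrow> ('v poly list \<Rightarrow> 'v) \<Rightarrow> bool" where
  "basic_pred n \<omega> = (case n of 0 \<Rightarrow> \<omega> = 0 | Suc m \<Rightarrow> basic m \<omega>)"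

lemma basic_pred_iota: "basic n \<omega> \<Longrightarrow> basic_pred n (iota x \<omega>)"
  using basic_iota[of _ \<omega> x] basic_iota0[of \<omega> x]
  by (auto simp: basic_pred_def iota_def zero_fun_def split: nat.split)

lemma basic_pred_0: "basic_pred n 0"
  and basic_pred_plus: "basic_pred n \<omega> \<Longrightarrow> basic_pred n \<eta> \<Longrightarrow> basic_pred n (\<omega> + \<eta>)"
  and basic_pred_fsc: "basic_pred n \<omega> \<Longrightarrow> basic_pred n (fsc c \<omega>)"
  by (auto simp: basic_pred_def basic_0 basic_plus basic_fsc split: nat.splits) (simp add: fsc_def fun_eq_iff)

lemma basic_ced_pred: "basic_pred n \<eta> \<Longrightarrow> basic n (modes.ced \<eta>)"
  by (auto simp: basic_pred_def basic_ced ced_0 basic_0 split: nat.splits)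

lemma ced_lieder_comm_pred: "basic_pred n \<omega> \<Longrightarrow> modes.ced (modes.lieder x \<omega>) = modes.lieder x (modes.ced \<omega>)"
  by (auto simp: basic_pred_def ced_0 lieder_0 ced_lieder_comm split: nat.splits)

lemma ced_ced_pred: "basic_pred n \<omega> \<Longrightarrow> modes.ced (modes.ced \<omega>) = 0"
  by (auto simp: basic_pred_def ced_0 ced_ced_0 split: nat.splits)

lemma alt_of_nat: "modes.alt \<omega> \<Longrightarrow> \<omega> (ps @ (of_nat n * z) # qs) = of_nat n * \<omega> (ps @ z # qs)"
  by (induction n) (simp_all add: modes.alt_zero modes.alt_add algebra_simps)

lemma alt_update_D:
  assumes a: "modes.alt \<omega>" and "length as = length ms" "i < length ms"
  shows "\<omega> ((map2 monom as ms)[i := monom (D (as ! i)) (ms ! i)])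
    = - (of_nat (ms ! i) * \<omega> (map2 monom as (ms[i := ms ! i - 1])))"
proof -
  let ?xs = "map2 monom as ms"
  have i: "i < length ?xs" using assms by simp
  have "monom (D (as ! i)) (ms ! i) = tot (monom (as ! i) (ms ! i)) - of_nat (ms ! i) * monom (as ! i) (ms ! i - 1)"
    by (simp add: tot_monom of_nat_mult_monom)
  then have "\<omega> (?xs[i := monom (D (as ! i)) (ms ! i)]) = - (of_nat (ms ! i) * \<omega> (?xs[i := monom (as ! i) (ms ! i - 1)]))"
    unfolding upd_conv_take_nth_drop[OF i] by (simp add: modes.alt_diff[OF a] modes.alt_R[OF a] alt_of_nat[OF a])
  then show ?thesis using map2_update[OF assms(2,3), of monom "ms ! i - 1"] by simp
qed

end

section \<open>Cartan calculus along the two modes of the conformal vector\<close>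

context affine_pva_nonzero
begin

abbreviation "y0 \<equiv> monom conf 0"
abbreviation "y1 \<equiv> monom conf 1"
abbreviation "TT \<equiv> modes.lieder y0"
abbreviation "WW \<equiv> modes.lieder y1"

lemma act_y0: "act y0 v = D v" and act_y1: "act y1 v = wt v"
  by (simp_all only: act_monom nprod_conf_0 wt_def)

lemma brk_y0: "brk y0 (monom a m) = monom (D a) m"
  by (simp add: brk_monom brk1_def nprod_conf_0)

text \<open>Modulo relations, the mode of index m of a generator is an eigenvector with eigenvalue
  -m. Its contribution to the weight of a cochain is therefore +m.\<close>

lemma brk_y1_gen: "brk y1 (monom (j a) m) = tot (monom (j a) (Suc m)) - of_nat m * monom (j a) m"
proof -
  have "brk y1 (monom (j a) m) = monom (D (j a)) (Suc m) + monom (j a) m"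
    using nprod_conf_gen(2) by (simp add: brk_monom brk1_def nprod_conf_0)
  moreover have "tot (monom (j a) (Suc m)) = monom (D (j a)) (Suc m) + monom (j a) m + of_nat m * monom (j a) m"
    by (simp add: tot_monom algebra_simps of_nat_mult_monom flip: add_monom)
  ultimately show ?thesis by simp
qed

text \<open>The vector \<open>conf\<close> has weight 2, and the relation \<open>tot y1\<close>
  removes one copy of it. Modulo relations the two modes thus span the nonabelian Lie algebra of
  dimension two, which makes \<open>TT\<close> raise the weight by one.\<close>

lemma brk_y1_y0: "brk y1 y0 = tot y1 + y0"
proof -
  have "wt conf = conf + conf" using wt_conf by simp
  then have "brk y1 y0 = monom (D conf) 1 + monom (conf + conf) 0"
    by (simp add: brk_monom brk1_def nprod_conf_0 wt_def)
  then show ?thesis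
    by (simp only: tot_monom add_monom[symmetric] of_nat_1 mult_1_left diff_self_eq_0 add.assoc)
qed

text \<open>In terms of the polynomial whose coefficients are the values divided by factorials, this
  is \<partial> + \<lambda>_1 + ... + \<lambda>_n; see \<open>tmap_pol\<close>.\<close>

lemma TT_mono:
  assumes a: "modes.alt \<omega>" and "length as = length ms"
  shows "TT \<omega> (map2 monom as ms) = D (\<omega> (map2 monom as ms))
    + (\<Sum>i<length ms. of_nat (ms ! i) * \<omega> (map2 monom as (ms[i := ms ! i - 1])))"
  unfolding modes.lieder_closed act_y0
  using assms(2) by (simp add: brk_y0 alt_update_D[OF a] sum_negf)

text \<open>The weight of a cochain is the weight of its value plus the total index. Both are
  nonnegative, so weight zero forces constants concentrated at index zero.\<close>

lemma WW_gens:
  assumes a: "modes.alt \<omega>" and l: "length as = length ms"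
  shows "WW \<omega> (gens as ms) = wt (\<omega> (gens as ms)) + of_nat (sum_list ms) * \<omega> (gens as ms)"
proof -
  let ?xs = "gens as ms"
  have "\<omega> (?xs[i := brk y1 (?xs ! i)]) = - (of_nat (ms ! i) * \<omega> ?xs)" if i: "i < length ms" for i
  proof -
    have i': "i < length ?xs" using i l by simp
    have x: "?xs ! i = monom (j (as ! i)) (ms ! i)" using i l by simp
    have "\<omega> (?xs[i := brk y1 (?xs ! i)]) = - (of_nat (ms ! i) * \<omega> (?xs[i := ?xs ! i]))"
      unfolding upd_conv_take_nth_drop[OF i'] x brk_y1_gen
      by (simp add: modes.alt_diff[OF a] modes.alt_R[OF a] alt_of_nat[OF a])
    then show ?thesis by simp
  qed
  then show ?thesis
    unfolding modes.lieder_closed act_y1 sum_list_sum_nth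
    using l by (simp add: sum_negf sum_distrib_right atLeast0LessThan)
qed

text \<open>Descending induction on the index r of the first slot, all other indices being free: in
  T\<theta> evaluated at first index r + 1, all terms still have first index r + 1 except r + 1
  times the wanted value. A first slot is indispensable, as in degree 0 constants are
  killed.\<close>

lemma TT_injective:
  assumes b: "basic (Suc n) \<theta>" and T: "TT \<theta> = 0"
  shows "\<theta> = 0"
proof -
  note a = basicD(2)[OF b]
  have "\<theta> (map2 monom as ms) = 0" if len: "length as = Suc n" "length ms = Suc n" for as ms
  proof -
    obtain e es m ns where e: "as = e # es" "ms = m # ns" using len by (metis length_Suc_conv)
    obtain N where N: "\<And>ms. length ms = length as \<Longrightarrow> N \<le> sum_list ms \<Longrightarrow> \<theta> (map2 monom as ms) = 0"
      using basicD(4)[OF b] unfolding jointly_finite_def by blast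
    have "\<theta> (monom e r # map2 monom es ns) = 0" if "length ns = length es" for r ns
      using that
    proof (induction "N - r" arbitrary: r ns)
      case 0
      then show ?case using N[of "r # ns"] by (simp add: e)
    next
      case (Suc d)
      have z: "\<theta> (monom e (Suc r) # map2 monom es ns') = 0" if "length ns' = length es" for ns'
        using Suc.hyps(1)[of "Suc r" ns'] Suc.hyps(2) that by simp
      have "0 = TT \<theta> (map2 monom (e # es) (Suc r # ns))" using T by simp
      also have "\<dots> = of_nat (Suc r) * \<theta> (monom e r # map2 monom es ns)"
      proof -
        have "TT \<theta> (map2 monom (e # es) (Suc r # ns)) = D (\<theta> (map2 monom (e # es) (Suc r # ns)))
          + (\<Sum>i<Suc (length ns). of_nat ((Suc r # ns) ! i) * \<theta> (map2 monom (e # es) ((Suc r # ns)[i := (Suc r # ns) ! i - 1])))"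
          using TT_mono[OF a, of "e # es" "Suc r # ns"] Suc.prems by (simp only: length_Cons)
        also have "\<dots> = of_nat (Suc r) * \<theta> (monom e r # map2 monom es ns)"
          unfolding sum.lessThan_Suc_shift using z Suc.prems by (simp del: of_nat_Suc)
        finally show ?thesis .
      qed
      finally show ?case using of_nat_cancel[of r "\<theta> (monom e r # map2 monom es ns)" 0] by simp
    qed
    then show ?thesis using len e by simp
  qed
  then show ?thesis using basic_zeroI[OF b] by (auto simp: fun_eq_iff)
qed

lemma WW_TT:
  assumes "basic n \<omega>"
  shows "WW (TT \<omega>) = TT (WW \<omega>) + TT \<omega>"
proof
  fix zs
  have "WW (TT \<omega>) zs - TT (WW \<omega>) zs = modes.lieder (tot y1 + y0) \<omega> zs"
    using modes.lieder_commutator[OF basicD(2)[OF assms], of y1 y0 zs] brk_y1_y0 by simp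
  also have "\<dots> = TT \<omega> zs"
    by (simp add: modes.lieder_add_left[OF basicD(2)[OF assms]] modes.lieder_R[OF basicD(2)[OF assms]])
  finally show "WW (TT \<omega>) zs = (TT (WW \<omega>) + TT \<omega>) zs" by (simp add: algebra_simps)
qed

lemma WW_iota1:
  assumes "basic n \<omega>"
  shows "WW (iota y1 \<omega>) = iota y1 (WW \<omega>)"
proof
  fix zs
  note a = basicD(2)[OF assms]
  \<comment> \<open>Skewsymmetry shows only that twice \<open>brk y1 y1\<close> is a relation, so
    the factor 2 is cancelled in V.\<close>
  have "\<omega> (brk y1 y1 # zs) + \<omega> (brk y1 y1 # zs) = 0"
    unfolding modes.alt_add0[OF a, symmetric] by (rule modes.alt_R0[OF a brk_skew])
  moreover have "of_nat (Suc 1) * \<omega> (brk y1 y1 # zs) = \<omega> (brk y1 y1 # zs) + \<omega> (brk y1 y1 # zs)"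
    by (simp add: algebra_simps)
  ultimately have "of_nat (Suc 1) * \<omega> (brk y1 y1 # zs) = of_nat (Suc 1) * 0" by simp
  then have "\<omega> (brk y1 y1 # zs) = 0" by (rule of_nat_cancel)
  then show "WW (iota y1 \<omega>) zs = iota y1 (WW \<omega>) zs" by (simp add: iota_def)
qed

lemma WW_iota0:
  assumes "basic n \<omega>"
  shows "WW (iota y0 \<omega>) = iota y0 (WW \<omega>) + iota y0 \<omega>"
  by (simp add: fun_eq_iff iota_def brk_y1_y0 modes.alt_add0[OF basicD(2)[OF assms]] modes.alt_R0[OF basicD(2)[OF assms]] del: One_nat_def)

text \<open>Reduces the test to finitely many tuples of basis vectors, so that one annihilating
  polynomial can be found for a whole cochain.\<close>

lemma basic_zeroI_bas:
  assumes b: "basic n \<omega>"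
    and "\<And>as ms. set as \<subseteq> bas ` {1..dimg} \<Longrightarrow> length as = n \<Longrightarrow> length ms = n \<Longrightarrow> \<omega> (gens as ms) = 0"
  shows "\<omega> = 0"
proof -
  note a = basicD(2)[OF b]
  have expand: "\<omega> (xs @ monom (j c) m # ys) = (\<Sum>i=1..dimg. scale (form c (dua i)) (\<omega> (xs @ monom (j (bas i)) m # ys)))" for xs c m ys
  proof -
    have sl: "\<omega> (xs @ monom (scale s v) m # ys) = scale s (\<omega> (xs @ monom v m # ys))" for s v
    proof -
      have "\<omega> (monom (scale s v) m # xs @ ys) = scale s (\<omega> (monom v m # xs @ ys))"
        using basicD(3)[OF b] unfolding slot_linear_def by (metis mult_scale_1 smult_monom)
      moreover have "\<omega> (z # xs @ ys) = (- 1) ^ length xs * \<omega> (xs @ z # ys)" for z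
        using modes.alt_move[OF a, of "[]" z xs ys] by simp
      ultimately show ?thesis by (cases "even (length xs)") simp_all
    qed
    have "monom (j c) m = (\<Sum>i=1..dimg. monom (scale (form c (dua i)) (j (bas i))) m)"
      by (subst dual_basis_expand(1)[OF dual_bases, of c])
        (simp add: j_sum j_scale additive_sum[of "\<lambda>x. monom x m"] add_monom)
    then show ?thesis by (simp add: modes.alt_sum[OF a] sl)
  qed
  have V: "\<omega> (xs @ gens as ms) = 0"
    if "\<And>bs. set bs \<subseteq> bas ` {1..dimg} \<Longrightarrow> length bs = length ms \<Longrightarrow> \<omega> (xs @ gens bs ms) = 0" "length as = length ms" for xs as ms
    using that(2,1)
  proof (induction as ms arbitrary: xs rule: list_induct2)
    case Nil
    then show ?case using Nil[of "[]"] by simp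
  next
    case (Cons c as m ms)
    have "\<omega> (xs @ monom (j (bas i)) m # gens as ms) = 0" if "i \<in> {1..dimg}" for i
      using Cons.IH[of "xs @ [monom (j (bas i)) m]"] Cons.prems[of "bas i # _"] that by simp
    then show ?case by (simp add: expand[of xs c])
  qed
  have "\<omega> (gens as ms) = 0" if "length as = n" "length ms = n" for as ms
  proof -
    have "\<omega> ([] @ gens as ms) = 0" by (rule V) (use assms(2) that in auto)
    then show ?thesis by simp
  qed
  then show ?thesis using basic_zeroI[OF b] by (auto simp: fun_eq_iff)
qed

text \<open>Evaluated on generators, \<open>WW\<close> acts as \<open>wt\<close> shifted by the
  total index. Only finitely many basis tuples and indices give nonzero values, so some
  \<open>annih\<close> kills the cochain. The components vanish from N on; any larger K may be used,
  which permits a common range for two cochains.\<close>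

lemma basic_weight_decomposition:
  assumes b: "basic n \<omega>"
  obtains N f where "\<And>K. N \<le> K \<Longrightarrow> \<omega> = (\<Sum>w<K. f w)" "\<And>w. basic n (f w)" "\<And>w. WW (f w) = fsc (of_nat w) (f w)"
proof -
  interpret fvs: vector_space fsc by (rule vector_space_fsc)
  let ?U = "\<lambda>s v. wt v + scale (of_nat s) v"
  have pt: "annih fsc WW N \<eta> (gens as ms) = annih scale (?U (sum_list ms)) N (\<eta> (gens as ms)) \<and> basic n (annih fsc WW N \<eta>)"
    if "basic n \<eta>" "length as = length ms" for N \<eta> as ms
    using that
  proof (induction N arbitrary: \<eta>)
    case (Suc N)
    have b': "basic n (WW \<eta> - fsc (of_nat N) \<eta>)"
      by (intro basic_minus basic_lieder basic_fsc Suc.prems)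
    have e: "(WW \<eta> - fsc (of_nat N) \<eta>) (gens as ms) = ?U (sum_list ms) (\<eta> (gens as ms)) - scale (of_nat N) (\<eta> (gens as ms))"
      using WW_gens[OF basicD(2)[OF Suc.prems(1)] Suc.prems(2)] by (simp add: fsc_def scale_of_nat)
    show ?case using Suc.IH[OF b' Suc.prems(2)] by (simp only: annih.simps e)
  qed simp
  have U0: "annih scale (?U s) N 0 = 0" for s N
    by (induction N) (simp_all add: additive_0[of wt, OF wt_add])
  define S where "S = {as. set as \<subseteq> bas ` {1..dimg} \<and> length as = n}"
  have S: "finite S" unfolding S_def by (intro finite_lists_length_eq) simp
  have "\<forall>\<^sub>F N in sequentially. \<forall>as\<in>S. \<forall>ms. length ms = n \<longrightarrow> annih scale (?U (sum_list ms)) N (\<omega> (gens as ms)) = 0"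
  proof (intro eventually_ball_finite S ballI)
    fix as assume as: "as \<in> S"
    obtain M where M: "\<And>ms. length ms = length (map j as) \<Longrightarrow> M \<le> sum_list ms \<Longrightarrow> \<omega> (gens as ms) = 0"
      using basicD(4)[OF b] unfolding jointly_finite_def by blast
    have "\<forall>\<^sub>F N in sequentially. \<forall>ms\<in>{ms. length ms = n \<and> sum_list ms < M}.
        annih scale (?U (sum_list ms)) N (\<omega> (gens as ms)) = 0"
      using weight_annihilator unfolding eventually_sequentially[symmetric]
      by (intro eventually_ball_finite finite_bounded_lists ballI) blast
    then show "\<forall>\<^sub>F N in sequentially. \<forall>ms. length ms = n \<longrightarrow> annih scale (?U (sum_list ms)) N (\<omega> (gens as ms)) = 0"
    proof eventually_elim
      case (elim N)
      show ?case
      proof (intro allI impI)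
        fix ms :: "nat list" assume ms: "length ms = n"
        show "annih scale (?U (sum_list ms)) N (\<omega> (gens as ms)) = 0"
        proof (cases "sum_list ms < M")
          case True
          then show ?thesis using elim ms by blast
        next
          case False
          then have "\<omega> (gens as ms) = 0" using M ms as by (simp add: S_def)
          then show ?thesis by (simp add: U0)
        qed
      qed
    qed
  qed
  then have "\<exists>N. \<forall>as\<in>S. \<forall>ms. length ms = n \<longrightarrow> annih scale (?U (sum_list ms)) N (\<omega> (gens as ms)) = 0"
    by (rule eventually_happens'[rotated]) simp
  then obtain N where N: "\<forall>as\<in>S. \<forall>ms. length ms = n \<longrightarrow> annih scale (?U (sum_list ms)) N (\<omega> (gens as ms)) = 0"
    by (rule exE)
  have "annih fsc WW N \<omega> = 0"
  proof (rule basic_zeroI_bas[of n])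
    show "basic n (annih fsc WW N \<omega>)" using pt[OF b, of "[]" "[]"] by simp
    fix as and ms :: "nat list" assume "set as \<subseteq> bas ` {1..dimg}" "length as = n" "length ms = n"
    then show "annih fsc WW N \<omega> (gens as ms) = 0" using pt[OF b, of as ms N] N by (simp add: S_def)
  qed
  then obtain f where f: "\<omega> = (\<Sum>w<N. f w)" "\<forall>w<N. WW (f w) = fsc (of_nat w) (f w) \<and> f w \<in> Collect (basic n)"
    using fvs.eigenvector_decomposition[of WW "Collect (basic n)" \<omega> N] b
      lieder_plus lieder_fsc basic_lieder basic_plus basic_fsc of_nat_Suc_nonzero by auto
  define h where "h w = (if w < N then f w else 0)" for w
  show ?thesis
  proof (rule that[of N h])
    fix K assume K: "N \<le> K"
    have "(\<Sum>w<K. h w) = (\<Sum>w<N. h w)" by (rule sum.mono_neutral_right) (use K in \<open>auto simp: h_def\<close>)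
    then show "\<omega> = (\<Sum>w<K. h w)" by (simp add: f(1) h_def)
  next
    show "basic n (h w)" "WW (h w) = fsc (of_nat w) (h w)" for w
      using f(2) by (auto simp: h_def basic_0 lieder_0)
  qed
qed

lemma WW_independent:
  assumes "(\<Sum>w<N. f w) = 0" "\<And>w. w < N \<Longrightarrow> WW (f w) = fsc (of_nat w) (f w)" "w < N"
  shows "f w = 0"
proof -
  interpret fvs: vector_space fsc by (rule vector_space_fsc)
  show ?thesis
    by (rule fvs.eigenvectors_independent[where W = WW and N = N and f = f and w = w]) (use lieder_plus lieder_fsc of_nat_Suc_nonzero assms in blast)+
qed

text \<open>For a closed form Cartan's formula along \<open>y1\<close> reads W\<omega> =
  d\<iota>\<omega>, and W is multiplication by the nonzero number w.\<close>

lemma cocycle_exact: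
  assumes b: "basic n \<omega>" and "modes.ced \<omega> = 0" "WW \<omega> = fsc (of_nat w) \<omega>" "w \<noteq> 0"
  shows "\<omega> = modes.ced (fsc (1 / of_nat w) (iota y1 \<omega>))"
proof -
  have "fsc (of_nat w) \<omega> = modes.ced (iota y1 \<omega>)"
    using cartan[of y1 \<omega>] assms(2,3) by (simp add: iota_0)
  then have "fsc (1 / of_nat w) (fsc (of_nat w) \<omega>) = modes.ced (fsc (1 / of_nat w) (iota y1 \<omega>))"
    by (simp only: ced_fsc)
  moreover have "fsc (1 / of_nat w) (fsc (of_nat w) \<omega>) = \<omega>"
    using assms(4) by (simp add: fsc_def)
  ultimately show ?thesis by (rule trans[OF sym, rotated])
qed

lemma scale_1_inject: "scale c 1 = scale d 1 \<longleftrightarrow> c = d"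
  by simp

lemma constant_form_exists:
  assumes "\<alpha> \<in> g.lie_cochains n"
  shows "\<exists>\<omega>. basic n \<omega> \<and> (\<forall>as ms. length as = n \<longrightarrow> length ms = n \<longrightarrow>
    \<omega> (gens as ms) = (if sum_list ms = 0 then scale (\<alpha> as) 1 else 0))"
proof -
  define F :: "('g \<times> nat) list \<Rightarrow> 'v" where "F cs = (if length cs = n \<and> sum_list (map snd cs) = 0 then scale (\<alpha> (map fst cs)) 1 else 0)" for cs
  have "\<exists>\<omega>. basic n \<omega> \<and> (\<forall>as ms. length as = n \<longrightarrow> length ms = n \<longrightarrow> \<omega> (gens as ms) = F (zip as ms))"
  proof (rule basic_extension_exists)
    show "F cs = 0" if "length cs \<noteq> n" for cs using that by (simp add: F_def)
    show "F (cs @ (a + b, m) # ds) = F (cs @ (a, m) # ds) + F (cs @ (b, m) # ds)" for cs a b m ds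
      by (auto simp: F_def g.lie_cochains_add[OF assms] scale_left_distrib)
    show "F (cs @ (scaleg s a, m) # ds) = scale s (F (cs @ (a, m) # ds))" for cs s a m ds
      by (auto simp: F_def g.lie_cochains_scale[OF assms])
    show "F (cs @ c # d # ds) = - F (cs @ d # c # ds)" for cs c d ds
      using g.lie_cochains_swap[OF assms, of "map fst cs" "fst c" "fst d" "map fst ds"]
      by (auto simp: F_def)
    show "\<exists>N. \<forall>ms. length ms = length as \<longrightarrow> N \<le> sum_list ms \<longrightarrow> F (zip as ms) = 0" for as
      by (intro exI[of _ 1]) (auto simp: F_def )
  qed
  then obtain \<omega> where \<omega>: "basic n \<omega>"
    "\<forall>as ms. length as = n \<longrightarrow> length ms = n \<longrightarrow> \<omega> (gens as ms) = F (zip as ms)" by blast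
  show ?thesis
  proof (intro exI[of _ \<omega>] conjI allI impI \<omega>(1))
    fix as :: "'g list" and ms :: "nat list" assume "length as = n" "length ms = n"
    then show "\<omega> (gens as ms) = (if sum_list ms = 0 then scale (\<alpha> as) 1 else 0)"
      using \<omega>(2) by (simp add: F_def)
  qed
qed

text \<open>Identifies forms on g with the basic cochains of weight zero; surjectivity is
  \<open>weight_0_cform\<close>, compatibility with the differentials
  \<open>ced_cform\<close>.\<close>

definition cform :: "nat \<Rightarrow> ('g list \<Rightarrow> 'k) \<Rightarrow> 'v poly list \<Rightarrow> 'v" where
  "cform n \<alpha> = (SOME \<omega>. basic n \<omega> \<and> (\<forall>as ms. length as = n \<longrightarrow> length ms = n \<longrightarrow>
    \<omega> (gens as ms) = (if sum_list ms = 0 then scale (\<alpha> as) 1 else 0)))"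

lemma cform:
  assumes "\<alpha> \<in> g.lie_cochains n"
  shows "basic n (cform n \<alpha>)"
    "length as = n \<Longrightarrow> length ms = n \<Longrightarrow> cform n \<alpha> (gens as ms) = (if sum_list ms = 0 then scale (\<alpha> as) 1 else 0)"
  using someI_ex[OF constant_form_exists[OF assms]] unfolding cform_def[symmetric] by blast+

lemma cform_add:
  assumes "\<alpha> \<in> g.lie_cochains n" "\<beta> \<in> g.lie_cochains n"
  shows "cform n (\<alpha> + \<beta>) = cform n \<alpha> + cform n \<beta>"
  by (rule basic_eqI[of n])
    (use assms in \<open>auto simp: cform g.lie_cochains_add_fun scale_left_distrib intro!: cform basic_plus\<close>)

lemma cform_scale:
  assumes "\<alpha> \<in> g.lie_cochains n"
  shows "cform n (\<lambda>as. c * \<alpha> as) = fsc c (cform n \<alpha>)"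
  by (rule basic_eqI[of n])
    (use assms in \<open>auto simp: cform g.lie_cochains_scale_fun fsc_def[of c "cform n \<alpha>"] intro!: cform basic_scale\<close>)

lemma cform_inject:
  assumes "\<alpha> \<in> g.lie_cochains n" "\<beta> \<in> g.lie_cochains n" "cform n \<alpha> = cform n \<beta>"
  shows "\<alpha> = \<beta>"
proof
  fix as
  show "\<alpha> as = \<beta> as"
  proof (cases "length as = n")
    case True
    then show ?thesis
      using cform(2)[OF assms(1) True, of "replicate n 0"] cform(2)[OF assms(2) True, of "replicate n 0"] assms(3)
      by (simp add: sum_list_replicate)
  qed (use assms g.lie_cochains_length in metis)
qed

lemma WW_cform:
  assumes "\<alpha> \<in> g.lie_cochains n"
  shows "WW (cform n \<alpha>) = 0"
proof (rule basic_eqI[of n])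
  show "basic n (WW (cform n \<alpha>))" by (intro basic_lieder cform assms)
  fix as :: "'g list" and ms :: "nat list" assume "length as = n" "length ms = n"
  then show "WW (cform n \<alpha>) (gens as ms) = 0 (gens as ms)"
    using WW_gens[OF basicD(2)[OF cform(1)[OF assms]], of as ms] cform(2)[OF assms, of as ms]
    by (simp add: wt_scale wt_1 additive_0[of wt, OF wt_add])
qed (rule basic_0)

text \<open>By \<open>WW_gens\<close> and \<open>weight_zero\<close>, the value on generators
  vanishes at positive total index and is a constant at index zero; these constants define the form
  on g.\<close>

lemma weight_0_cform:
  assumes b: "basic n \<omega>" and W: "WW \<omega> = 0"
  obtains \<alpha> where "\<alpha> \<in> g.lie_cochains n" "\<omega> = cform n \<alpha>"
proof -
  note a = basicD(2)[OF b]
  have w: "wt (\<omega> (gens as ms)) + of_nat (sum_list ms) * \<omega> (gens as ms) = 0" if "length as = length ms" for as ms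
    using WW_gens[OF a that] W by simp
  let ?z = "\<lambda>as :: 'g list. gens as (replicate (length as) 0)"
  have "\<exists>c. \<omega> (?z as) = scale c 1" for as
    by (rule weight_zero(2)[OF w]) (simp_all add: sum_list_replicate)
  then have "\<forall>as. \<exists>c. \<omega> (?z as) = scale c 1" by blast
  from choice[OF this] obtain \<alpha> where \<alpha>: "\<forall>as. \<omega> (?z as) = scale (\<alpha> as) 1" by (rule exE)
  have z_app: "?z (xs @ x # zs) = ?z xs @ monom (j x) 0 # ?z zs" for xs x zs
  proof -
    have "replicate (length (xs @ x # zs)) (0 :: nat) = replicate (length xs) 0 @ 0 # replicate (length zs) 0"
      by (rule sym, rule replicate_eqI) auto
    then show ?thesis by (simp only: map_append list.map) (simp del: replicate_app_Cons_same)
  qed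
  have sl: "\<omega> (xs @ monom (scale s v) 0 # ys) = scale s (\<omega> (xs @ monom v 0 # ys))" for s v xs ys
  proof -
    have "\<omega> (monom (scale s v) 0 # xs @ ys) = scale s (\<omega> (monom v 0 # xs @ ys))"
      using basicD(3)[OF b] unfolding slot_linear_def by (metis mult_scale_1 smult_monom)
    moreover have "\<omega> (z # xs @ ys) = (- 1) ^ length xs * \<omega> (xs @ z # ys)" for z
      using modes.alt_move[OF a, of "[]" z xs ys] by simp
    ultimately show ?thesis by (cases "even (length xs)") simp_all
  qed
  have "\<alpha> \<in> g.lie_cochains n"
  proof (rule g.lie_cochainsI)
    show "\<alpha> as = 0" if "length as \<noteq> n" for as
    proof -
      have "\<omega> (?z as) = 0" by (rule basicD(1)[OF b]) (use that in simp)
      then show ?thesis using \<alpha> by simp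
    qed
    show "\<alpha> (xs @ (x + y) # zs) = \<alpha> (xs @ x # zs) + \<alpha> (xs @ y # zs)" for xs x y zs
    proof -
      have "\<omega> (?z (xs @ (x + y) # zs)) = \<omega> (?z (xs @ x # zs)) + \<omega> (?z (xs @ y # zs))"
        unfolding z_app by (simp add: j_add modes.alt_add[OF a] flip: add_monom)
      then have "scale (\<alpha> (xs @ (x + y) # zs)) 1 = scale (\<alpha> (xs @ x # zs) + \<alpha> (xs @ y # zs)) 1"
        using \<alpha> by (simp only: scale_left_distrib)
      then show ?thesis by (simp only: scale_1_inject)
    qed
    show "\<alpha> (xs @ scaleg c x # zs) = c * \<alpha> (xs @ x # zs)" for xs c x zs
    proof -
      have "\<omega> (?z (xs @ scaleg c x # zs)) = scale c (\<omega> (?z (xs @ x # zs)))"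
        unfolding z_app by (simp only: j_scale sl)
      then have "scale (\<alpha> (xs @ scaleg c x # zs)) 1 = scale (c * \<alpha> (xs @ x # zs)) 1"
        using \<alpha> by (simp only: scale_scale)
      then show ?thesis by (simp only: scale_1_inject)
    qed
    show "\<alpha> as = 0" if "length as = n" "i < l" "l < n" "as ! i = as ! l" for as i l
    proof -
      have "\<omega> (?z as) + \<omega> (?z as) = 0"
        by (rule modes.alt_eq_zero_if_dup[OF a that(2)]) (use that in simp_all)
      then have "scale (\<alpha> as + \<alpha> as) 1 = scale 0 1" using \<alpha> by (simp only: scale_left_distrib scale_zero_left)
      then have "\<alpha> as + \<alpha> as = 0" by (simp only: scale_1_inject)
      then show ?thesis by (simp flip: mult_2)
    qed
  qed
  moreover have "\<omega> = cform n \<alpha>"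
  proof (rule basic_eqI[OF b cform(1)[OF calculation]])
    fix as :: "'g list" and ms :: "nat list" assume len: "length as = n" "length ms = n"
    show "\<omega> (gens as ms) = cform n \<alpha> (gens as ms)"
    proof (cases "sum_list ms = 0")
      case True
      then have "ms = replicate (length as) 0" using len by (metis replicate_eqI sum_list_eq_0_iff)
      then show ?thesis using \<alpha> cform(2)[OF calculation len] True by simp
    next
      case False
      then have "\<omega> (gens as ms) = 0" using weight_zero(1)[OF w] len by simp
      then show ?thesis using cform(2)[OF calculation len] False by simp
    qed
  qed
  ultimately show ?thesis using that by blast
qed

text \<open>The differential preserves weight zero, so it suffices to compare values at index zero.
  There the action terms vanish, as products with constants do, and the bracket involves only zeroth
  products, to which the level does not contribute. That \<open>lie_d n \<alpha>\<close> is
  alternating comes for free.\<close>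

lemma ced_cform:
  assumes \<alpha>: "\<alpha> \<in> g.lie_cochains n"
  shows "g.lie_d n \<alpha> \<in> g.lie_cochains (Suc n)" "modes.ced (cform n \<alpha>) = cform (Suc n) (g.lie_d n \<alpha>)"
proof -
  note b = cform(1)[OF \<alpha>]
  note a = basicD(2)[OF b]
  have "WW (modes.ced (cform n \<alpha>)) = 0"
    using ced_lieder_comm[OF b, of y1] WW_cform[OF \<alpha>] by (simp add: ced_0)
  then obtain \<beta> where \<beta>: "\<beta> \<in> g.lie_cochains (Suc n)" "modes.ced (cform n \<alpha>) = cform (Suc n) \<beta>"
    using weight_0_cform[OF basic_ced[OF b]] by blast
  have "\<beta> = g.lie_d n \<alpha>"
  proof
    fix as
    show "\<beta> as = g.lie_d n \<alpha> as"
    proof (cases "length as = Suc n")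
      case len: True
      let ?ms = "replicate (Suc n) (0 :: nat)"
      have m: "length ?ms = Suc n" by simp
      have g_i: "gens as ?ms ! i = monom (j (as ! i)) 0" if "i < Suc n" for i
        using that len by (simp del: replicate_Suc)
      have A: "act (gens as ?ms ! i) (cform n \<alpha> (del i (gens as ?ms))) = 0" if i: "i < Suc n" for i
      proof -
        have "del i (gens as ?ms) = gens (del i as) (del i ?ms)"
          using len by (simp add: del_map2 map_del del: replicate_Suc)
        moreover have "length (del i as) = n" "length (del i ?ms) = n" using len i by (simp_all add: length_del del: replicate_Suc)
        ultimately show ?thesis
          unfolding g_i[OF i] act_monom using cform(2)[OF \<alpha>, of "del i as" "del i ?ms"]
          by (simp add: nprod_scale_right nprod_1_right)
      qed
      have Bt: "cform n \<alpha> (brk (gens as ?ms ! i) (gens as ?ms ! l) # del2 i l (gens as ?ms))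
          = scale (\<alpha> (bracket (as ! i) (as ! l) # del2 i l as)) 1" if il: "i < l" "l < Suc n" for i l
      proof -
        have d: "del2 i l (gens as ?ms) = gens (del2 i l as) (del2 i l ?ms)"
          using len il by (simp add: del2_map2 map_del2 del: replicate_Suc)
        have r: "del2 i l ?ms = replicate (length (del2 i l as)) 0"
        proof (rule replicate_eqI)
          show "length (del2 i l ?ms) = length (del2 i l as)" using len il by (simp add: length_del2 del: replicate_Suc)
          show "x = 0" if "x \<in> set (del2 i l ?ms)" for x using that len by (auto simp: del2_def simp del: replicate_Suc upt_Suc)
        qed
        have "brk (monom (j (as ! i)) 0) (monom (j (as ! l)) 0) = monom (j (bracket (as ! i) (as ! l))) 0"
          by (simp add: brk_monom brk1_def nprod_j)
        then show ?thesis
          using cform(2)[OF \<alpha>, of "bracket (as ! i) (as ! l) # del2 i l as" "0 # del2 i l ?ms"] len il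
          unfolding d r by (simp add: g_i length_del2 sum_list_replicate del: replicate_Suc)
      qed
      have s: "(- 1) ^ r * scale c 1 = scale ((- 1) ^ r * c) 1" for r c
        by (cases "even r") simp_all
      have "modes.ced (cform n \<alpha>) (gens as ?ms) = scale (g.lie_d n \<alpha> as) 1"
        unfolding modes.ced_closed[OF a] g.lie_d_def
        using len A Bt by (simp add: scale_sum_left s del2_def del: replicate_Suc upt_Suc sum.lessThan_Suc)
      moreover have "cform (Suc n) \<beta> (gens as ?ms) = scale (\<beta> as) 1"
        using cform(2)[OF \<beta>(1) len m] by (simp add: sum_list_replicate)
      ultimately show ?thesis using \<beta>(2) by simp
    next
      case False
      then show ?thesis using g.lie_cochains_length[OF \<beta>(1)] by (simp add: g.lie_d_def)
    qed
  qed
  then show "g.lie_d n \<alpha> \<in> g.lie_cochains (Suc n)" "modes.ced (cform n \<alpha>) = cform (Suc n) (g.lie_d n \<alpha>)"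
    using \<beta> by auto
qed

text \<open>The Leibniz rule for each product in \<open>conf\<close> keeps only its summands with l
  = 0, since the form vanishes at positive index. The two halves agree by
  \<open>dual_basis_contract_eq\<close>, and their sum cancels the 2 in the normalisation of
  \<open>conf\<close>.\<close>

lemma iota_cform:
  assumes \<beta>: "\<beta> \<in> g.lie_cochains (Suc n)" and N: "g.is_basis_with_dual N u u'"
    and len: "length as = n" "length ms = n"
  shows "iota y0 (cform (Suc n) \<beta>) (gens as ms) =
    (if sum_list ms = 0 then scale (1 / k) (\<Sum>i=1..N. scale (\<beta> (u' i # as)) (j (u i))) else 0)"
proof -
  let ?\<omega> = "cform (Suc n) \<beta>"
  note b = cform(1)[OF \<beta>]
  note a = basicD(2)[OF b]
  have val: "?\<omega> (monom (j x) l # gens as ms) = (if l = 0 \<and> sum_list ms = 0 then scale (\<beta> (x # as)) 1 else 0)" for x l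
    using cform(2)[OF \<beta>, of "x # as" "l # ms"] len by simp
  have prod: "?\<omega> (monom (j x * j y) 0 # gens as ms)
    = j x * ?\<omega> (monom (j y) 0 # gens as ms) + j y * ?\<omega> (monom (j x) 0 # gens as ms)" for x y
  proof -
    have "\<forall>\<^sub>F M in sequentially. ?\<omega> (monom (j x * j y) 0 # gens as ms)
      = j x * ?\<omega> (monom (j y) 0 # gens as ms) + j y * ?\<omega> (monom (j x) 0 # gens as ms)"
      using basicD(5)[OF b, unfolded leibniz_def, rule_format, of "j x" "j y" 0 "gens as ms"] eventually_gt_at_top[of 0]
    proof eventually_elim
      case (elim M)
      have "(\<Sum>l<M. dv l (j x) * ?\<omega> (monom (j y) (0 + l) # gens as ms) + dv l (j y) * ?\<omega> (monom (j x) (0 + l) # gens as ms))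
        = (\<Sum>l\<in>{0}. dv l (j x) * ?\<omega> (monom (j y) (0 + l) # gens as ms) + dv l (j y) * ?\<omega> (monom (j x) (0 + l) # gens as ms))"
        using elim(2) by (intro sum.mono_neutral_right) (auto simp: val)
      then show ?case using elim(1) by simp
    qed
    then show ?thesis by (simp add: eventually_const_iff)
  qed
  have sl: "?\<omega> (monom (scale s v) m # zs) = scale s (?\<omega> (monom v m # zs))" for s v m zs
    using basicD(3)[OF b] unfolding slot_linear_def by (metis mult_scale_1 smult_monom)
  have "?\<omega> (y0 # gens as ms) = scale (1 / (2 * k)) (\<Sum>i=1..dimg. ?\<omega> (monom (j (bas i) * j (dua i)) 0 # gens as ms))"
    unfolding conf_def sl additive_sum[of "\<lambda>x. monom x 0", OF add_monom[symmetric]] modes.alt_sum0[OF a] by (rule refl)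
  also have "\<dots> = (if sum_list ms = 0 then scale (1 / k) (\<Sum>i=1..N. scale (\<beta> (u' i # as)) (j (u i))) else 0)"
  proof (cases "sum_list ms = 0")
    case True
    let ?\<gamma> = "\<lambda>x. \<beta> (x # as)"
    have \<gamma>: "?\<gamma> (x + y) = ?\<gamma> x + ?\<gamma> y" "?\<gamma> (scaleg s x) = s * ?\<gamma> x" for x y s
      using g.lie_cochains_add[OF \<beta>, of "[]"] g.lie_cochains_scale[OF \<beta>, of "[]"] by simp_all
    let ?S = "\<Sum>i=1..N. scale (\<beta> (u' i # as)) (j (u i))"
    have S1: "(\<Sum>i=1..dimg. scale (\<beta> (dua i # as)) (j (bas i))) = ?S"
      using arg_cong[OF dual_basis_contract_eq(1)[OF dual_bases N, of ?\<gamma>, OF \<gamma>], of j] by (simp add: j_sum j_scale)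
    have S2: "(\<Sum>i=1..dimg. scale (\<beta> (bas i # as)) (j (dua i))) = ?S"
      using arg_cong[OF dual_basis_contract_eq(2)[OF dual_bases N, of ?\<gamma>, OF \<gamma>], of j] by (simp add: j_sum j_scale)
    have "(\<Sum>i=1..dimg. ?\<omega> (monom (j (bas i) * j (dua i)) 0 # gens as ms)) = ?S + ?S"
    proof -
      have c: "x * scale s 1 = scale s x" for x s by (metis mult.commute mult_scale_1)
      show ?thesis by (simp only: prod val True simp_thms if_True c sum.distrib S1 S2)
    qed
    also have "\<dots> = scale 2 ?S"
      using scale_left_distrib[of 1 1 ?S] by simp
    finally show ?thesis using True k_nonzero by simp
  next
    case False
    then show ?thesis by (simp add: prod val)
  qed
  finally show ?thesis by (simp add: iota_def)
qed

text \<open>Coboundaries of the complex of basic cochains modulo the image of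
  \<open>TT\<close>.\<close>

definition exact_mod :: "nat \<Rightarrow> ('v poly list \<Rightarrow> 'v) \<Rightarrow> bool" where
  "exact_mod n \<omega> \<longleftrightarrow> (\<exists>\<eta> \<zeta>. basic_pred n \<eta> \<and> basic n \<zeta> \<and> \<omega> = modes.ced \<eta> + TT \<zeta>)"

lemma exact_mod_0: "exact_mod n 0"
  unfolding exact_mod_def by (intro exI[of _ 0]) (simp add: basic_pred_0 basic_0 ced_0 lieder_0)

lemma exact_mod_plus: "exact_mod n \<omega> \<Longrightarrow> exact_mod n \<eta> \<Longrightarrow> exact_mod n (\<omega> + \<eta>)"
  unfolding exact_mod_def
proof (elim exE conjE)
  fix a b c d assume "basic_pred n a" "basic n b" "\<omega> = modes.ced a + TT b" "basic_pred n c" "basic n d" "\<eta> = modes.ced c + TT d"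
  then show "\<exists>a b. basic_pred n a \<and> basic n b \<and> \<omega> + \<eta> = modes.ced a + TT b"
    by (intro exI[of _ "a + c"] exI[of _ "b + d"]) (simp add: basic_pred_plus basic_plus ced_plus lieder_plus)
qed

lemma exact_mod_sum: "(\<And>i. i \<in> I \<Longrightarrow> exact_mod n (f i)) \<Longrightarrow> exact_mod n (\<Sum>i\<in>I. f i)"
  by (induction I rule: infinite_finite_induct) (auto intro: exact_mod_0 exact_mod_plus)

text \<open>Cartan's formula along \<open>y0\<close>; it makes the contraction of a closed form
  closed modulo the image of \<open>TT\<close>.\<close>

lemma ced_iota0_cform:
  assumes "\<beta> \<in> g.lie_cochains n" "g.lie_d n \<beta> = 0"
  shows "modes.ced (iota y0 (cform n \<beta>)) = TT (cform n \<beta>)"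
proof -
  have "cform (Suc n) 0 = 0"
  proof -
    have z: "0 \<in> g.lie_cochains (Suc n)" by (rule g.lie_cochainsI) simp_all
    show ?thesis by (rule basic_eqI[OF cform(1)[OF z] basic_0]) (simp add: cform(2)[OF z])
  qed
  then show ?thesis using cartan[of y0 "cform n \<beta>"] ced_cform(2)[OF assms(1)] assms(2) by (simp add: iota_0)
qed

text \<open>In weight w the hypothesis reads d f_w = T h_(w-1), and injectivity of T makes every h_r
  closed. Weight 0 of \<omega> gives \<alpha>, weight 0 of \<theta> gives \<beta>, and the rest is
  exact: components of \<omega> of positive weight can be corrected to closed ones.\<close>

theorem basic_cocycle_decomposition:
  assumes b: "basic n \<omega>" and t: "basic (Suc n) \<theta>" and d: "modes.ced \<omega> = TT \<theta>"
  obtains \<alpha> \<beta> where "\<alpha> \<in> g.lie_cochains n" "g.lie_d n \<alpha> = 0" "\<beta> \<in> g.lie_cochains (Suc n)" "g.lie_d (Suc n) \<beta> = 0"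
    "exact_mod n (\<omega> - (cform n \<alpha> + iota y0 (cform (Suc n) \<beta>)))"
proof -
  obtain N f where f: "\<And>K. N \<le> K \<Longrightarrow> \<omega> = (\<Sum>w<K. f w)" "\<And>w. basic n (f w)" "\<And>w. WW (f w) = fsc (of_nat w) (f w)"
    using basic_weight_decomposition[OF b] by blast
  obtain M h where h: "\<And>K. M \<le> K \<Longrightarrow> \<theta> = (\<Sum>w<K. h w)" "\<And>w. basic (Suc n) (h w)" "\<And>w. WW (h w) = fsc (of_nat w) (h w)"
    using basic_weight_decomposition[OF t] by blast
  \<comment> \<open>At least 2, so that weights 0 and 1 can be split off, and one more than needed
    for \<theta>, whose weights are shifted by T.\<close>
  define K where "K = Suc (Suc (N + M))"
  \<comment> \<open>The component of weight w of d\<omega> - T\<theta>; the shift in the second term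
    is the weight of T.\<close>
  define e where "e w = modes.ced (f w) - (case w of 0 \<Rightarrow> 0 | Suc r \<Rightarrow> TT (h r))" for w
  have WT: "WW (TT (h r)) = fsc (of_nat (Suc r)) (TT (h r))" for r
    unfolding WW_TT[OF h(2)] h(3) lieder_fsc by (simp add: fsc_def fun_eq_iff scale_left_distrib add.commute)
  have fdiff: "fsc c (x - y) = fsc c x - fsc c y" "fsc c 0 = 0" for c x y
    by (simp_all add: fsc_def fun_eq_iff scale_right_diff_distrib)
  have "e w = 0" if "w < K" for w
  proof (rule WW_independent[of e K])
    have "(\<Sum>w<K. e w) = modes.ced (\<Sum>w<K. f w) - (\<Sum>w<K. case w of 0 \<Rightarrow> 0 | Suc r \<Rightarrow> TT (h r))"
      by (simp add: e_def sum_subtractf ced_sum')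
    also have "(\<Sum>w<K. f w) = \<omega>" by (rule f(1)[symmetric]) (simp add: K_def)
    also have "(\<Sum>w<K. case w of 0 \<Rightarrow> 0 | Suc r \<Rightarrow> TT (h r)) = TT (\<Sum>w<Suc (N + M). h w)"
      unfolding K_def sum.lessThan_Suc_shift[of _ "Suc (N + M)"] lieder_sum by simp
    also have "(\<Sum>w<Suc (N + M). h w) = \<theta>" by (rule h(1)[symmetric]) simp
    finally show "(\<Sum>w<K. e w) = 0" unfolding d diff_self .
    show "WW (e w) = fsc (of_nat w) (e w)" for w
      by (cases w) (simp_all only: e_def nat.case lieder_minus' ced_lieder_comm[OF f(2), symmetric] f(3) ced_fsc WT fdiff lieder_0)
  qed (rule that)
  then have ce: "modes.ced (f 0) = 0" "\<And>r. Suc r < K \<Longrightarrow> modes.ced (f (Suc r)) = TT (h r)"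
    by (force simp: e_def K_def)+
  have hc: "modes.ced (h r) = 0" if "Suc r < K" for r
  proof -
    have "TT (modes.ced (h r)) = modes.ced (TT (h r))" using ced_lieder_comm[OF h(2)] by simp
    also have "\<dots> = 0" using ced_ced_0[OF f(2)] ce(2)[OF that] by metis
    finally show ?thesis using TT_injective[OF basic_ced[OF h(2)]] by blast
  qed
  have fsc0: "fsc 0 x = 0" for x by (simp add: fsc_def fun_eq_iff)
  obtain \<alpha> where \<alpha>: "\<alpha> \<in> g.lie_cochains n" "f 0 = cform n \<alpha>"
    using weight_0_cform[OF f(2)[of 0]] f(3)[of 0] fsc0 by auto
  obtain \<beta> where \<beta>: "\<beta> \<in> g.lie_cochains (Suc n)" "h 0 = cform (Suc n) \<beta>"
    using weight_0_cform[OF h(2)[of 0]] h(3)[of 0] fsc0 by auto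
  have zero: "cform m 0 = 0" "0 \<in> g.lie_cochains m" for m
  proof -
    show z: "0 \<in> g.lie_cochains m" by (rule g.lie_cochainsI) simp_all
    show "cform m 0 = 0" by (rule basic_eqI[OF cform(1)[OF z] basic_0]) (simp add: cform(2)[OF z])
  qed
  have d\<alpha>: "g.lie_d n \<alpha> = 0"
    by (rule cform_inject[OF ced_cform(1)[OF \<alpha>(1)] zero(2)])
      (use ce(1) \<alpha> ced_cform(2)[OF \<alpha>(1)] zero(1) in metis)
  have d\<beta>: "g.lie_d (Suc n) \<beta> = 0"
    by (rule cform_inject[OF ced_cform(1)[OF \<beta>(1)] zero(2)])
      (use hc[of 0] \<beta> ced_cform(2)[OF \<beta>(1)] zero(1) in \<open>simp add: K_def\<close>)
  have ex: "exact_mod n x" if "basic n x" "modes.ced x = 0" "WW x = fsc (of_nat w) x" "w \<noteq> 0" for x w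
    unfolding exact_mod_def
    using cocycle_exact[OF that] basic_pred_fsc[OF basic_pred_iota[OF that(1)]]
    by (intro exI[of _ "fsc (1 / of_nat w) (iota y1 x)"] exI[of _ 0]) (simp add: basic_0 lieder_0)
  \<comment> \<open>Both terms have the same differential T h_0, so their difference is closed, of
    weight 1, hence exact.\<close>
  have one: "exact_mod n (f 1 - iota y0 (cform (Suc n) \<beta>))"
  proof (rule ex[of _ 1])
    have "basic_pred (Suc n) (iota y0 (cform (Suc n) \<beta>))" by (intro basic_pred_iota cform \<beta>)
    then show "basic n (f 1 - iota y0 (cform (Suc n) \<beta>))" by (intro basic_minus f) (simp add: basic_pred_def)
    show "modes.ced (f 1 - iota y0 (cform (Suc n) \<beta>)) = 0"
      using ce(2)[of 0] ced_iota0_cform[OF \<beta>(1) d\<beta>] \<beta>(2) by (simp add: ced_minus' K_def)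
    show "WW (f 1 - iota y0 (cform (Suc n) \<beta>)) = fsc (of_nat 1) (f 1 - iota y0 (cform (Suc n) \<beta>))"
      using f(3)[of 1] WW_iota0[OF cform(1)[OF \<beta>(1)]] WW_cform[OF \<beta>(1)]
      by (simp add: lieder_minus' fdiff iota_0) (simp add: fsc_def)
  qed simp
  \<comment> \<open>Here h_(r+1) is closed of positive weight, hence equal to d\<zeta> with \<zeta>
    of the same weight. Subtracting T\<zeta> makes the component closed, of positive weight.\<close>
  have many: "exact_mod n (f (Suc (Suc r)))" if r: "Suc (Suc r) < K" for r
  proof -
    define \<zeta> where "\<zeta> = fsc (1 / of_nat (Suc r)) (iota y1 (h (Suc r)))"
    have b\<zeta>: "basic n \<zeta>"
      using basic_pred_fsc[OF basic_pred_iota[OF h(2)]] by (simp add: basic_pred_def \<zeta>_def)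
    have h\<zeta>: "h (Suc r) = modes.ced \<zeta>"
      unfolding \<zeta>_def by (rule cocycle_exact[OF h(2) hc h(3)]) (use r in auto)
    have W\<zeta>: "WW \<zeta> = fsc (of_nat (Suc r)) \<zeta>"
      unfolding \<zeta>_def lieder_fsc WW_iota1[OF h(2)] h(3) iota_fsc by (simp add: fsc_def mult.commute)
    have "exact_mod n (f (Suc (Suc r)) - TT \<zeta>)"
    proof (rule ex[of _ "Suc (Suc r)"])
      show "basic n (f (Suc (Suc r)) - TT \<zeta>)" by (intro basic_minus f basic_lieder b\<zeta>)
      show "modes.ced (f (Suc (Suc r)) - TT \<zeta>) = 0"
        unfolding ced_minus' ced_lieder_comm[OF b\<zeta>] h\<zeta>[symmetric] ce(2)[OF r] by simp
      show "WW (f (Suc (Suc r)) - TT \<zeta>) = fsc (of_nat (Suc (Suc r))) (f (Suc (Suc r)) - TT \<zeta>)"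
      proof -
        have "fsc (of_nat (Suc m)) x = fsc (of_nat m) x + x" for m x
          by (simp add: fsc_def fun_eq_iff scale_left_distrib)
        from this[of "Suc r" "TT \<zeta>"] show ?thesis
          unfolding lieder_minus' f(3) WW_TT[OF b\<zeta>] W\<zeta> lieder_fsc fdiff by (simp only:)
      qed
    qed simp
    moreover have "exact_mod n (TT \<zeta>)"
      unfolding exact_mod_def by (intro exI[of _ 0] exI[of _ \<zeta>]) (simp add: basic_pred_0 b\<zeta> ced_0)
    ultimately have "exact_mod n ((f (Suc (Suc r)) - TT \<zeta>) + TT \<zeta>)" by (rule exact_mod_plus)
    then show ?thesis by (simp only: diff_add_cancel)
  qed
  have "\<omega> = f 0 + (f 1 + (\<Sum>r<N + M. f (Suc (Suc r))))"
    using f(1)[of K] unfolding K_def sum.lessThan_Suc_shift by (simp add: add.assoc)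
  then have "\<omega> - (cform n \<alpha> + iota y0 (cform (Suc n) \<beta>))
    = (f 1 - iota y0 (cform (Suc n) \<beta>)) + (\<Sum>r<N + M. f (Suc (Suc r)))"
    using \<alpha>(2) by (simp add: algebra_simps)
  moreover have "exact_mod n \<dots>"
    by (intro exact_mod_plus one exact_mod_sum many) (simp add: K_def)
  ultimately have "exact_mod n (\<omega> - (cform n \<alpha> + iota y0 (cform (Suc n) \<beta>)))" by (simp only:)
  then show ?thesis using that \<alpha>(1) d\<alpha> \<beta>(1) d\<beta> by blast
qed

text \<open>Weight 0 says that \<alpha> is the differential of a cochain of weight zero. In weight 1
  one has \<iota>\<beta> = d f_1 + T h_0; applying d gives T\<beta> = T d h_0, and T is injective
  because \<beta> has degree n + 1 > 0.\<close>

theorem basic_exact_coboundary: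
  assumes \<alpha>: "\<alpha> \<in> g.lie_cochains n" and \<beta>: "\<beta> \<in> g.lie_cochains (Suc n)" "g.lie_d (Suc n) \<beta> = 0"
    and ex: "exact_mod n (cform n \<alpha> + iota y0 (cform (Suc n) \<beta>))"
  shows "\<alpha> \<in> g.lie_coboundaries n" "\<beta> \<in> g.lie_coboundaries (Suc n)"
proof -
  obtain \<eta> \<psi> where e: "basic_pred n \<eta>" "basic n \<psi>" "cform n \<alpha> + iota y0 (cform (Suc n) \<beta>) = modes.ced \<eta> + TT \<psi>"
    using ex unfolding exact_mod_def by blast
  obtain N f where f: "\<And>K. N \<le> K \<Longrightarrow> \<eta> = (\<Sum>w<K. f w)" "\<And>w. basic_pred n (f w)" "\<And>w. WW (f w) = fsc (of_nat w) (f w)"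
  proof (cases n)
    case 0
    show ?thesis
      by (rule that[of 0 "\<lambda>_. 0"]) (use e(1) 0 in \<open>auto simp: basic_pred_def lieder_0 fsc_def fun_eq_iff\<close>)
  next
    case (Suc m)
    then have "basic m \<eta>" using e(1) by (simp add: basic_pred_def)
    from basic_weight_decomposition[OF this] show ?thesis
      using that Suc by (auto simp: basic_pred_def)
  qed
  obtain M h where h: "\<And>K. M \<le> K \<Longrightarrow> \<psi> = (\<Sum>w<K. h w)" "\<And>w. basic n (h w)" "\<And>w. WW (h w) = fsc (of_nat w) (h w)"
    using basic_weight_decomposition[OF e(2)] by blast
  define K where "K = Suc (Suc (N + M))"
  define l where "l w = (if w = 0 then cform n \<alpha> else if w = 1 then iota y0 (cform (Suc n) \<beta>) else 0)" for w :: nat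
  define r where "r w = modes.ced (f w) + (case w of 0 \<Rightarrow> 0 | Suc r \<Rightarrow> TT (h r))" for w
  have WT: "WW (TT (h r)) = fsc (of_nat (Suc r)) (TT (h r))" for r
    unfolding WW_TT[OF h(2)] h(3) lieder_fsc by (simp add: fsc_def fun_eq_iff scale_left_distrib add.commute)
  have fdiff: "fsc c (x - y) = fsc c x - fsc c y" "fsc c (x + y) = fsc c x + fsc c y" "fsc c 0 = 0" "fsc 1 x = x" "fsc 0 x = 0" for c x y
    by (simp_all add: fsc_def fun_eq_iff scale_right_diff_distrib scale_right_distrib)
  have eq: "l w - r w = 0" if "w < K" for w
  proof (rule WW_independent[of "\<lambda>w. l w - r w" K])
    have "(\<Sum>w<K. l w) = cform n \<alpha> + iota y0 (cform (Suc n) \<beta>)"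
      unfolding K_def sum.lessThan_Suc_shift by (simp add: l_def)
    moreover have "(\<Sum>w<K. r w) = modes.ced \<eta> + TT \<psi>"
    proof -
      have "(\<Sum>w<K. r w) = modes.ced (\<Sum>w<K. f w) + (\<Sum>w<K. case w of 0 \<Rightarrow> 0 | Suc r \<Rightarrow> TT (h r))"
        by (simp add: r_def sum.distrib ced_sum')
      also have "(\<Sum>w<K. f w) = \<eta>" by (rule f(1)[symmetric]) (simp add: K_def)
      also have "(\<Sum>w<K. case w of 0 \<Rightarrow> 0 | Suc r \<Rightarrow> TT (h r)) = TT (\<Sum>w<Suc (N + M). h w)"
        unfolding K_def sum.lessThan_Suc_shift[of _ "Suc (N + M)"] lieder_sum by simp
      also have "(\<Sum>w<Suc (N + M). h w) = \<psi>" by (rule h(1)[symmetric]) simp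
      finally show ?thesis .
    qed
    ultimately show "(\<Sum>w<K. l w - r w) = 0" using e(3) by (simp add: sum_subtractf)
    show "WW (l w - r w) = fsc (of_nat w) (l w - r w)" for w
    proof -
      have "WW (l w) = fsc (of_nat w) (l w)"
        using WW_cform[OF \<alpha>] WW_iota0[OF cform(1)[OF \<beta>(1)]] WW_cform[OF \<beta>(1)]
        by (auto simp: l_def fdiff lieder_0 iota_0)
      moreover have "WW (r w) = fsc (of_nat w) (r w)"
        by (cases w) (simp_all only: r_def nat.case lieder_plus ced_lieder_comm_pred[OF f(2), symmetric] f(3) ced_fsc WT fdiff lieder_0)
      ultimately show ?thesis by (simp only: lieder_minus' fdiff)
    qed
  qed (rule that)
  have e0: "cform n \<alpha> = modes.ced (f 0)"
    using eq[of 0] by (simp add: l_def r_def K_def)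
  have e1: "iota y0 (cform (Suc n) \<beta>) = modes.ced (f 1) + TT (h 0)"
    using eq[of 1] by (simp add: l_def r_def K_def)
  show "\<alpha> \<in> g.lie_coboundaries n"
  proof (cases n)
    case 0
    then have "cform n \<alpha> = 0" using e0 f(2)[of 0] by (simp add: basic_pred_def ced_0)
    moreover have z: "0 \<in> g.lie_cochains n" by (rule g.lie_cochainsI) simp_all
    moreover have "cform n 0 = 0" by (rule basic_eqI[OF cform(1)[OF z] basic_0]) (simp add: cform(2)[OF z])
    ultimately have "\<alpha> = 0" using cform_inject[OF \<alpha> z] by simp
    then show ?thesis by (simp add: 0 g.lie_coboundaries_def zero_fun_def)
  next
    case (Suc m)
    obtain \<gamma> where \<gamma>: "\<gamma> \<in> g.lie_cochains m" "f 0 = cform m \<gamma>"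
      using weight_0_cform[of m "f 0"] f(2,3)[of 0] Suc by (auto simp: basic_pred_def fdiff)
    have "\<alpha> = g.lie_d m \<gamma>"
      by (rule cform_inject[OF \<alpha>]) (use ced_cform[OF \<gamma>(1)] e0 \<gamma>(2) Suc in simp_all)
    then show ?thesis using \<gamma>(1) by (simp add: Suc g.lie_coboundaries_def)
  qed
  obtain \<gamma> where \<gamma>: "\<gamma> \<in> g.lie_cochains n" "h 0 = cform n \<gamma>"
    using weight_0_cform[OF h(2)[of 0]] h(3)[of 0] by (auto simp: fdiff)
  have "TT (cform (Suc n) \<beta>) = modes.ced (modes.ced (f 1) + TT (h 0))"
    using ced_iota0_cform[OF \<beta>] e1 by simp
  also have "\<dots> = TT (modes.ced (h 0))"
    by (simp add: ced_plus ced_ced_pred[OF f(2)] ced_lieder_comm[OF h(2)])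
  finally have T0: "TT (cform (Suc n) \<beta> - modes.ced (h 0)) = 0" by (simp add: lieder_minus')
  have "basic (Suc n) (cform (Suc n) \<beta> - modes.ced (h 0))"
    by (intro basic_minus cform(1)[OF \<beta>(1)] basic_ced h(2))
  then have "cform (Suc n) \<beta> - modes.ced (h 0) = 0"
    by (rule TT_injective[OF _ T0])
  then have "\<beta> = g.lie_d n \<gamma>"
    using cform_inject[OF \<beta>(1) ced_cform(1)[OF \<gamma>(1)]] ced_cform(2)[OF \<gamma>(1)] \<gamma>(2) by simp
  then show "\<beta> \<in> g.lie_coboundaries (Suc n)" using \<gamma>(1) by (simp add: g.lie_coboundaries_def)
qed

end

section \<open>Polynomial cochains modulo total derivatives\<close>

lemma sum_nth_distinct:
  assumes "distinct xs"
  shows "(\<Sum>r<length xs. f (xs ! r)) = (\<Sum>x\<in>set xs. f x)"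
  by (rule sum.reindex_bij_betw[OF bij_betw_nth[OF assms refl refl]])

lemma prod_Var_power:
  fixes n :: nat
  shows "(\<Prod>r<n. Var (g r) ^ k r) = single (\<Sum>r<n. single (g r) (k r)) (1 :: 'r::comm_ring_1)"
  by (induction n) (simp_all add: Var_power mult_single)

lemma lookup_sum_nth_notin:
  assumes "x \<notin> set xs"
  shows "lookup (\<Sum>r<length xs. single (xs ! r) (ks ! r :: nat)) x = 0"
  unfolding lookup_sum using assms by (intro sum.neutral) (auto simp: lookup_single when_def)

lemma lookup_sum_nth:
  assumes "distinct xs" "r < length xs"
  shows "lookup (\<Sum>r<length xs. single (xs ! r) (ks ! r)) (xs ! r) = (ks ! r :: nat)"
proof -
  have "(\<Sum>s<length xs. lookup (single (xs ! s) (ks ! s)) (xs ! r)) = (\<Sum>s<length xs. if s = r then ks ! r else 0)"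
    using assms by (intro sum.cong refl) (auto simp: lookup_single when_def nth_eq_iff_index_eq)
  then show ?thesis using assms(2) by (simp add: lookup_sum)
qed

section \<open>Operators on polynomials and their descent modulo total derivatives\<close>

context pva
begin

definition tmap :: "nat \<Rightarrow> (nat, 'v) mpoly \<Rightarrow> (nat, 'v) mpoly" where
  "tmap n P = pmap D P + (\<Sum>i<n. Var i) * P"

lemma tot_image_tmap: "tot_image n = tmap n ` mpolys n"
  by (simp add: tot_image_def tmap_def)

lemma lookup_mapD: "lookup (pmap D P) E = D (lookup P E)"
  by (rule lookup_map) simp

lemma mapD_add: "pmap D (P + Q) = pmap D P + pmap D Q"
  by (rule poly_mapping_eqI) (simp add: lookup_mapD lookup_add D_add)

lemma mapD_single: "pmap D (single e c) = single e (D c)"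
  by (rule poly_mapping_eqI) (simp add: lookup_mapD lookup_single when_def)

lemma mapD_mult: "pmap D (P * Q) = pmap D P * Q + P * pmap D Q"
proof (rule poly_mapping_additive_eq[of "\<lambda>P. pmap D (P * Q)" "\<lambda>P. pmap D P * Q + P * pmap D Q"])
  fix e c
  show "pmap D (single e c * Q)
    = pmap D (single e c) * Q + single e c * pmap D Q"
    by (rule poly_mapping_additive_eq[of "\<lambda>Q. pmap D (single e c * Q)"
          "\<lambda>Q. pmap D (single e c) * Q + single e c * pmap D Q"])
      (simp_all add: mapD_add algebra_simps mapD_single mult_single D_mult single_add)
qed (simp_all add: mapD_add algebra_simps)

lemma mapD_1: "pmap D 1 = 0"
  using mapD_single[of 0 1] by (simp add: single_one)

lemma mapD_Var: "pmap D (Var i) = 0"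
  by (simp add: Var_def mapD_single)

lemma mapD_power: "pmap D P = 0 \<Longrightarrow> pmap D (P ^ m) = 0"
  by (induction m) (simp_all add: mapD_1 mapD_mult)

lemma mapD_prod: "(\<And>i. i \<in> I \<Longrightarrow> pmap D (f i) = 0) \<Longrightarrow> pmap D (\<Prod>i\<in>I. f i) = 0"
  by (induction I rule: infinite_finite_induct) (simp_all add: mapD_1 mapD_mult)

lemma mapD_mpolys: "P \<in> mpolys n \<Longrightarrow> pmap D P \<in> mpolys n"
  unfolding mpolys_def by (auto simp: in_keys_iff lookup_mapD)

lemma tmap_add: "tmap n (P + Q) = tmap n P + tmap n Q"
  by (simp add: tmap_def mapD_add algebra_simps)

lemma tmap_mpolys: "P \<in> mpolys n \<Longrightarrow> tmap n P \<in> mpolys n"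
  unfolding tmap_def by (intro mpolys_add mapD_mpolys mpolys_mult mpolys_sum mpolys_Var) auto

lemma tmap_mult: "pmap D Q = 0 \<Longrightarrow> tmap n (Q * P) = Q * tmap n P"
  by (simp add: tmap_def mapD_mult algebra_simps)

lemma tot_image_closed: "additive_closed (tot_image n)"
  unfolding additive_closed_def tot_image_tmap
proof (intro conjI ballI)
  have "tmap n 0 = 0" by (rule additive_0[of "tmap n", OF tmap_add])
  then show "0 \<in> tmap n ` mpolys n" using mpolys_0 by (metis imageI)
  fix P Q assume "P \<in> tmap n ` mpolys n" "Q \<in> tmap n ` mpolys n"
  then obtain A B where "P = tmap n A" "Q = tmap n B" "A \<in> mpolys n" "B \<in> mpolys n" by blast
  then have "P - Q = tmap n (A - B)" "A - B \<in> mpolys n"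
    using additive_diff[of "tmap n", OF tmap_add] mpolys_add[OF _ mpolys_uminus, of A n B] by simp_all
  then show "P - Q \<in> tmap n ` mpolys n" by blast
qed

lemma tot_image_0: "0 \<in> tot_image n"
  and tot_image_diff: "P \<in> tot_image n \<Longrightarrow> Q \<in> tot_image n \<Longrightarrow> P - Q \<in> tot_image n"
  using tot_image_closed[of n] by (simp_all add: additive_closed_def)

lemma tot_image_uminus: "P \<in> tot_image n \<Longrightarrow> - P \<in> tot_image n"
  using tot_image_diff[OF tot_image_0, of P n] by simp

lemma tot_image_add: "P \<in> tot_image n \<Longrightarrow> Q \<in> tot_image n \<Longrightarrow> P + Q \<in> tot_image n"
  using tot_image_diff[of P n "- Q"] tot_image_uminus[of Q n] by simp

lemma tot_class_eq: "tot_class n P = tot_class n Q \<longleftrightarrow> P - Q \<in> tot_image n"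
  unfolding tot_class_def by (rule coset_eq_iff[OF tot_image_closed])

lemma tot_class_add: "tot_class n P + tot_class n Q = tot_class n (P + Q)"
  unfolding tot_class_def by (rule coset_add[OF tot_image_closed])

lemma tot_class_0_absorb: "tot_class n P + tot_class n 0 = tot_class n P"
  by (simp add: tot_class_add)

text \<open>An empty sum of cosets is the set \<open>{0}\<close> and not the zero coset. Adding the
  zero coset once repairs this, also for the nested sums in \<open>pv_d\<close>.\<close>

lemma sum_absorb:
  assumes "\<And>i. i \<in> I \<Longrightarrow> f i + tot_class n 0 = tot_class n (g i)"
  shows "(\<Sum>i\<in>I. f i) + tot_class n 0 = tot_class n (\<Sum>i\<in>I. g i)"
  using assms
proof (induction I rule: infinite_finite_induct)
  case (insert i I)
  have z: "tot_class n 0 = tot_class n 0 + tot_class n 0" using tot_class_add[of n 0 0] by simp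
  have "(f i + (\<Sum>i\<in>I. f i)) + tot_class n 0 = (f i + tot_class n 0) + ((\<Sum>i\<in>I. f i) + tot_class n 0)"
    by (subst z) (simp only: ac_simps)
  then show ?case using insert by (simp add: tot_class_add)
qed simp_all

lemma sum_tot_class: "(\<Sum>i<Suc n. tot_class m (P i)) = tot_class m (\<Sum>i<Suc n. P i)"
  by (induction n) (simp_all add: tot_class_add)

text \<open>Commuting with the total derivative is what makes an operator descend. All operations in
  \<open>pv_cochains\<close> and \<open>pv_d\<close> are transferred to representatives in this
  way.\<close>

lemma apply_class_tot_classI:
  assumes "\<And>P Q. T (P + Q) = T P + T Q"
    and "\<And>P. P \<in> mpolys n \<Longrightarrow> T (tmap n P) = tmap m (T P)" "\<And>P. P \<in> mpolys n \<Longrightarrow> T P \<in> mpolys m"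
  shows "apply_class m T (tot_class n P) = tot_class m (T P)"
  unfolding apply_class_def tot_class_def
  by (rule coset_image[OF _ tot_image_closed tot_image_closed]) (use assms in \<open>auto simp: tot_image_tmap\<close>)

lemma map_scale_add: "pmap (scale c) (P + Q) = pmap (scale c) P + pmap (scale c) Q"
  by (rule poly_mapping_eqI) (simp add: lookup_map lookup_add scale_right_distrib)

lemma map_scale_eq: "pmap (scale c) P = Cst (scale c 1) * P"
  by (rule poly_mapping_eqI) (simp add: lookup_map lookup_Cst_mult mult_scale_1)

lemma mapD_Cst_scale: "pmap D (Cst (scale c 1)) = 0"
  by (simp add: Cst_def mapD_single D_scale)

lemma apply_scale: "apply_class n (pmap (scale c)) (tot_class n P) = tot_class n (pmap (scale c) P)"
  by (rule apply_class_tot_classI[OF map_scale_add])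
    (simp_all add: map_scale_eq tmap_mult mapD_Cst_scale mpolys_mult mpolys_Cst)

lemma mapD_uminus: "pmap D (- P) = - pmap D P"
  by (rule additive_uminus[of "pmap D", OF mapD_add])

lemma apply_mult:
  assumes "pmap D Q = 0" "Q \<in> mpolys n"
  shows "apply_class n ((*) Q) (tot_class n P) = tot_class n (Q * P)"
  by (rule apply_class_tot_classI)
    (simp_all add: distrib_left assms tmap_mult mpolys_mult)

lemma apply_Var: "i < n \<Longrightarrow> apply_class n ((*) (- Var i)) (tot_class n P) = tot_class n (- Var i * P)"
  by (intro apply_mult mpolys_uminus mpolys_Var) (simp_all add: mapD_uminus mapD_Var)

lemma of_int_Cst: "(of_int s :: (nat, 'v) mpoly) = Cst (scale (of_int s) 1)"
proof -
  have n: "(of_nat m :: (nat, 'v) mpoly) = Cst (scale (of_nat m) 1)" for m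
    by (induction m) (simp_all add: scale_left_distrib Cst_add)
  have "(Cst (- x) :: (nat, 'v) mpoly) = - Cst x" for x by (simp add: Cst_def single_uminus)
  then show ?thesis by (cases s) (simp_all add: n del: of_nat_Suc)
qed

lemma apply_sign: "apply_class n ((*) (of_int s)) (tot_class n P) = tot_class n (of_int s * P)"
  by (intro apply_mult) (simp_all add: of_int_Cst mapD_Cst_scale mpolys_Cst)

lemma peval_Cst_add: "peval Cst \<sigma> (P + Q) = peval Cst \<sigma> P + peval Cst \<sigma> Q"
  and peval_Cst_mult: "peval Cst \<sigma> (P * Q) = peval Cst \<sigma> P * peval Cst \<sigma> Q"
  for P Q :: "(nat, 'v) mpoly" and \<sigma> :: "nat \<Rightarrow> (nat, 'v) mpoly"
  by (rule peval_add peval_mult; simp add: Cst_add Cst_mult)+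

lemma subst_add: "subst \<sigma> (P + Q) = subst \<sigma> P + subst \<sigma> Q"
  and subst_mult: "subst \<sigma> (P * Q) = subst \<sigma> P * subst \<sigma> Q"
  and subst_Var: "subst \<sigma> (Var i) = \<sigma> i"
  by (simp_all add: subst_def peval_Cst_add peval_Cst_mult peval_Var)

lemma subst_single: "subst \<sigma> (single e c) = Cst c * mono_at \<sigma> e"
  by (simp add: subst_def peval_single)

lemma subst_sum: "subst \<sigma> (\<Sum>i\<in>I. f i) = (\<Sum>i\<in>I. subst \<sigma> (f i))"
  by (rule additive_sum[of "subst \<sigma>", OF subst_add])

lemma subst_mpolys:
  assumes "P \<in> mpolys n" "\<And>i. i < n \<Longrightarrow> \<sigma> i \<in> mpolys m"
  shows "subst \<sigma> P \<in> mpolys m"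
  unfolding subst_def using assms by (rule mpolys_peval_Cst)

lemma subst_mapD:
  assumes "P \<in> mpolys n" "\<And>i. i < n \<Longrightarrow> pmap D (\<sigma> i) = 0"
  shows "subst \<sigma> (pmap D P) = pmap D (subst \<sigma> P)"
proof (rule mpolys_additive_eq[of "\<lambda>P. subst \<sigma> (pmap D P)" "\<lambda>P. pmap D (subst \<sigma> P)" n])
  fix ms :: "nat list" and c assume "length ms = n"
  then have "pmap D (mono_at \<sigma> (xp ms)) = 0"
    unfolding mono_at_xp by (intro mapD_prod mapD_power assms) auto
  then show "subst \<sigma> (pmap D (single (xp ms) c)) = pmap D (subst \<sigma> (single (xp ms) c))"
    by (simp add: mapD_single subst_single mapD_mult) (simp add: Cst_def mapD_single)
qed (simp_all add: mapD_add subst_add assms)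

lemma tmap_subst_perm:
  assumes \<pi>: "\<pi> permutes {..<n}" and P: "P \<in> mpolys n"
  shows "tmap n (subst (\<lambda>i. Var (\<pi> i)) P) = subst (\<lambda>i. Var (\<pi> i)) (tmap n P)"
proof -
  have "(\<Sum>i<n. Var (\<pi> i)) = (\<Sum>i<n. Var i :: (nat, 'v) mpoly)"
    using sum.permute[OF \<pi>, of "Var :: nat \<Rightarrow> (nat, 'v) mpoly"] by (simp add: comp_def)
  then show ?thesis
    unfolding tmap_def subst_add subst_mult subst_sum subst_Var
    using subst_mapD[OF P, of "\<lambda>i. Var (\<pi> i)"] by (simp add: mapD_Var)
qed

lemma subst_perm_mpolys: "\<pi> permutes {..<n} \<Longrightarrow> P \<in> mpolys n \<Longrightarrow> subst (\<lambda>i. Var (\<pi> i)) P \<in> mpolys n"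
  by (rule subst_mpolys) (auto intro: mpolys_Var simp: permutes_in_image[of _ "{..<n}", unfolded lessThan_iff])

lemma apply_permute:
  assumes "\<pi> permutes {..<n}"
  shows "apply_class n (subst (\<lambda>i. Var (\<pi> i))) (tot_class n P) = tot_class n (subst (\<lambda>i. Var (\<pi> i)) P)"
  by (rule apply_class_tot_classI[OF subst_add]) (simp_all add: tmap_subst_perm[OF assms] subst_perm_mpolys[OF assms])

lemma pdiff_add: "pdiff x (P + Q) = pdiff x P + pdiff x (Q :: (nat, 'v) mpoly)"
proof -
  have sup: "pdiff x R = (\<Sum>e\<in>S. single (e - single x 1)
        (of_nat (lookup e x) * lookup R e))"
    if "finite S" "keys R \<subseteq> S" for R :: "(nat, 'v) mpoly" and S
    unfolding pdiff_def by (rule sum.mono_neutral_left) (use that in \<open>auto simp: in_keys_iff\<close>)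
  let ?S = "keys P \<union> keys Q"
  show ?thesis
    using sup[of ?S P] sup[of ?S Q] sup[of ?S "P + Q"]
    by (simp add: Poly_Mapping.keys_add lookup_add distrib_left single_add sum.distrib)
qed

lemma pdiff_single: "pdiff x (single e c)
    = single (e - single x 1) (of_nat (lookup e x) * c :: 'v)"
  by (cases "c = 0") (auto simp: pdiff_def)

lemma pdiff_power_add: "(pdiff x ^^ l) (P + Q) = (pdiff x ^^ l) P + (pdiff x ^^ l) (Q :: (nat, 'v) mpoly)"
  by (induction l) (simp_all add: pdiff_add)

lemma lookup_pdiff: "lookup (pdiff x P) E
    = of_nat (Suc (lookup E x)) * lookup P (E + single x 1 :: nat \<Rightarrow>\<^sub>0 nat)"
  for P :: "(nat, 'v) mpoly"
proof (rule poly_mapping_additive_eq[of "\<lambda>P. lookup (pdiff x P) E"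
      "\<lambda>P. of_nat (Suc (lookup E x)) * lookup P (E + single x 1)"])
  fix e :: "nat \<Rightarrow>\<^sub>0 nat" and c :: 'v
  show "lookup (pdiff x (single e c)) E
      = of_nat (Suc (lookup E x)) * lookup (single e c) (E + single x 1)"
  proof (cases "lookup e x = 0")
    case True
    then have "e \<noteq> E + single x 1" by (auto simp: lookup_add)
    then show ?thesis using True by (simp add: pdiff_single lookup_single when_def)
  next
    case False
    then have "e - single x 1 = E \<longleftrightarrow> e = E + single x 1"
      by (auto simp: poly_mapping_eq_iff fun_eq_iff lookup_add lookup_minus lookup_single when_def)
    then show ?thesis by (auto simp: pdiff_single lookup_single when_def lookup_add)
  qed
qed (simp_all add: pdiff_add lookup_add distrib_left)

lemma lookup_pdiff_power: "of_nat (fact (lookup E x)) * lookup ((pdiff x ^^ l) P) E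
    = of_nat (fact (lookup E x + l)) * lookup P (E + single x l)"
  for P :: "(nat, 'v) mpoly"
proof (induction l arbitrary: E)
  case (Suc l)
  let ?m = "lookup E x"
  have "of_nat (fact ?m) * lookup ((pdiff x ^^ Suc l) P) E
    = of_nat (fact (Suc ?m)) * lookup ((pdiff x ^^ l) P) (E + single x 1)"
    by (simp add: lookup_pdiff algebra_simps)
  also have "\<dots> = of_nat (fact (?m + Suc l)) * lookup P (E + single x (Suc l))"
    using Suc.IH[of "E + single x 1"]
    by (simp add: lookup_add add.assoc flip: single_add)
  finally show ?case .
qed simp

lemma pdiff_Var_same: "pdiff x (Var x * P) = P + Var x * pdiff x P" for P :: "(nat, 'v) mpoly"
proof (rule poly_mapping_additive_eq[of "\<lambda>P. pdiff x (Var x * P)" "\<lambda>P. P + Var x * pdiff x P"])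
  fix e :: "nat \<Rightarrow>\<^sub>0 nat" and c :: 'v
  have 1: "single x 1 + e - single x 1 = e" by simp
  have 2: "single x 1 + (e - single x 1) = e" if "lookup e x \<noteq> 0"
    using that by (intro poly_mapping_eqI) (auto simp: lookup_add lookup_minus lookup_single when_def)
  show "pdiff x (Var x * single e c) = single e c + Var x * pdiff x (single e c)"
  proof (cases "lookup e x = 0")
    case True
    then show ?thesis by (simp add: Var_def mult_single pdiff_single lookup_add)
  next
    case False
    show ?thesis
      unfolding Var_def mult_single pdiff_single 1 2[OF False]
      by (simp add: lookup_add distrib_right flip: single_add)
  qed
qed (simp_all add: pdiff_add algebra_simps)

lemma pdiff_Var_other: "x \<noteq> y \<Longrightarrow> pdiff x (Var y * P) = Var y * pdiff x P" for P :: "(nat, 'v) mpoly"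
proof (rule poly_mapping_additive_eq[of "\<lambda>P. pdiff x (Var y * P)" "\<lambda>P. Var y * pdiff x P"])
  fix e :: "nat \<Rightarrow>\<^sub>0 nat" and c :: 'v assume xy: "x \<noteq> y"
  have 1: "lookup (single y 1 + e) x = lookup e x"
    using xy by (simp add: lookup_add lookup_single when_def)
  have 2: "single y 1 + e - single x 1 = single y 1 + (e - single x 1)"
    using xy by (intro poly_mapping_eqI) (auto simp: lookup_add lookup_minus lookup_single when_def)
  show "pdiff x (Var y * single e c) = Var y * pdiff x (single e c)"
    unfolding Var_def mult_single pdiff_single 1 2 by simp
qed (simp_all add: pdiff_add algebra_simps)

lemma pdiff_power_Var_other: "x \<noteq> y \<Longrightarrow> (pdiff x ^^ l) (Var y * P) = Var y * (pdiff x ^^ l) P" for P :: "(nat, 'v) mpoly"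
  by (induction l) (simp_all add: pdiff_Var_other)

lemma pdiff_of_nat: "pdiff x (of_nat l * P) = of_nat l * pdiff x P" for P :: "(nat, 'v) mpoly"
  by (induction l) (simp_all add: distrib_right pdiff_add additive_0[of "pdiff x", OF pdiff_add])

lemma pdiff_power_Var_same: "(pdiff x ^^ Suc l) (Var x * P) = Var x * (pdiff x ^^ Suc l) P + of_nat (Suc l) * (pdiff x ^^ l) P" for P :: "(nat, 'v) mpoly"
proof (induction l)
  case 0
  then show ?case by (simp add: pdiff_Var_same)
next
  case (Suc l)
  have "(pdiff x ^^ Suc (Suc l)) (Var x * P) = pdiff x (Var x * (pdiff x ^^ Suc l) P + of_nat (Suc l) * (pdiff x ^^ l) P)"
    using Suc.IH by simp
  then show ?case
    by (simp add: pdiff_add pdiff_Var_same pdiff_of_nat algebra_simps del: of_nat_Suc) (simp add: algebra_simps)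
qed

lemma mapD_pdiff: "pmap D (pdiff x P) = pdiff x (pmap D P)" for P :: "(nat, 'v) mpoly"
  by (rule poly_mapping_eqI) (simp add: lookup_pdiff lookup_mapD D_of_nat_mult D_add algebra_simps)

lemma mapD_pdiff_power: "pmap D ((pdiff x ^^ l) P) = (pdiff x ^^ l) (pmap D P)" for P :: "(nat, 'v) mpoly"
  by (induction l) (simp_all add: mapD_pdiff)

lemma pdiff_mpolys: "P \<in> mpolys n \<Longrightarrow> pdiff x P \<in> mpolys n" for P :: "(nat, 'v) mpoly"
proof -
  assume P: "P \<in> mpolys n"
  have "keys e \<subseteq> {..<n}" if "e \<in> keys (pdiff x P)" for e
  proof -
    have "e + single x 1 \<in> keys P"
      using that by (auto simp: in_keys_iff lookup_pdiff)
    then have "keys (e + single x 1) \<subseteq> {..<n}" using P by (auto simp: mpolys_def)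
    moreover have "keys e \<subseteq> keys (e + single x 1)"
      by (auto simp: in_keys_iff lookup_add)
    ultimately show ?thesis by blast
  qed
  then show ?thesis by (auto simp: mpolys_def)
qed

lemma pdiff_power_mpolys: "P \<in> mpolys n \<Longrightarrow> (pdiff x ^^ l) P \<in> mpolys n" for P :: "(nat, 'v) mpoly"
  by (induction l) (auto intro: pdiff_mpolys)

lemma pdiff_power_eventually_0: "\<forall>\<^sub>F N in sequentially. \<forall>l\<ge>N. (pdiff x ^^ l) P = 0" for P :: "(nat, 'v) mpoly"
proof -
  define M where "M = (\<Sum>e\<in>keys P. Suc (lookup e x))"
  have "(pdiff x ^^ l) P = 0" if "l \<ge> M" for l
  proof (rule poly_mapping_eqI)
    fix E
    have "E + single x l \<notin> keys P"
    proof
      assume e: "E + single x l \<in> keys P"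
      have "Suc (lookup (E + single x l) x) \<le> M"
        unfolding M_def by (rule member_le_sum[OF e]) auto
      then show False using that by (simp add: lookup_add)
    qed
    then have "of_nat (fact (lookup E x)) * lookup ((pdiff x ^^ l) P) E = 0"
      unfolding lookup_pdiff_power by (simp add: in_keys_iff)
    then have "scale (fact (lookup E x)) (lookup ((pdiff x ^^ l) P) E) = 0"
      unfolding scale_of_nat[symmetric] by simp
    then show "lookup ((pdiff x ^^ l) P) E = lookup 0 E" by simp
  qed
  then show ?thesis unfolding eventually_sequentially by (meson le_trans)
qed

lemma exp_mult_eventually: "\<forall>\<^sub>F N in sequentially. exp_mult x b P = (\<Sum>l<N. Cst (dv l b) * (pdiff x ^^ l) P)"
  using pdiff_power_eventually_0[of x P]
proof eventually_elim
  case (elim N)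
  have "exp_mult x b P = (\<Sum>l\<in>{l. Cst (dv l b) * (pdiff x ^^ l) P \<noteq> 0}. Cst (dv l b) * (pdiff x ^^ l) P)"
    by (simp add: exp_mult_def Sum_any.expand_set dv_def)
  also have "\<dots> = (\<Sum>l<N. Cst (dv l b) * (pdiff x ^^ l) P)"
    by (rule sum.mono_neutral_left) (use elim in \<open>auto simp: not_less intro: ccontr\<close>)
  finally show ?case .
qed

lemma eventually_const_eqD: "\<forall>\<^sub>F N in sequentially. P \<Longrightarrow> P"
  by (simp add: eventually_const_iff)

lemma exp_mult_add: "exp_mult x b (P + Q) = exp_mult x b P + exp_mult x b Q"
proof (rule eventually_const_eqD)
  show "\<forall>\<^sub>F N in sequentially. exp_mult x b (P + Q) = exp_mult x b P + exp_mult x b Q"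
    using exp_mult_eventually[of x b "P + Q"] exp_mult_eventually[of x b P] exp_mult_eventually[of x b Q]
    by eventually_elim (simp only: pdiff_power_add distrib_left sum.distrib)
qed

lemma exp_mult_mapD: "pmap D (exp_mult x b P) = exp_mult x (D b) P + exp_mult x b (pmap D P)"
proof (rule eventually_const_eqD)
  have c: "pmap D (Cst (dv l b) * Q) = Cst (dv l (D b)) * Q + Cst (dv l b) * pmap D Q" for l Q
    unfolding mapD_mult dv_D by (simp add: Cst_def mapD_single)
  show "\<forall>\<^sub>F N in sequentially. pmap D (exp_mult x b P) = exp_mult x (D b) P + exp_mult x b (pmap D P)"
    using exp_mult_eventually[of x b P] exp_mult_eventually[of x "D b" P] exp_mult_eventually[of x b "pmap D P"]
    by eventually_elim
      (simp only: additive_sum[of "pmap D", OF mapD_add] c sum.distrib mapD_pdiff_power)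
qed

lemma exp_mult_Var_other: "x \<noteq> y \<Longrightarrow> exp_mult x b (Var y * P) = Var y * exp_mult x b P"
proof (rule eventually_const_eqD)
  assume xy: "x \<noteq> y"
  show "\<forall>\<^sub>F N in sequentially. exp_mult x b (Var y * P) = Var y * exp_mult x b P"
    using exp_mult_eventually[of x b P] exp_mult_eventually[of x b "Var y * P"]
    by eventually_elim (simp only: pdiff_power_Var_other[OF xy] sum_distrib_left mult.left_commute)
qed

text \<open>The commutator of the l-th power of \<open>pdiff x\<close> with its variable is l times
  the power l - 1, and l times the l-th divided power of \<open>D\<close> at b is the (l - 1)-st at
  \<open>D b\<close>. The extra term is opposite to the one coming from
  \<open>exp_mult_mapD\<close>, so \<open>exp_mult\<close> commutes with the total
  derivative.\<close>

lemma exp_mult_Var_same: "exp_mult x b (Var x * P) = Var x * exp_mult x b P + exp_mult x (D b) P"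
proof (rule eventually_const_eqD)
  \<comment> \<open>The range is lengthened by one because the extra term arises by shifting l to l
    + 1.\<close>
  have ev: "\<forall>\<^sub>F N in sequentially. exp_mult x b Q = (\<Sum>l<Suc N. Cst (dv l b) * (pdiff x ^^ l) Q)" for Q
    using exp_mult_eventually[of x b Q] unfolding eventually_sequentially by (meson le_SucI)
  show "\<forall>\<^sub>F N in sequentially. exp_mult x b (Var x * P) = Var x * exp_mult x b P + exp_mult x (D b) P"
    using ev[of P] ev[of "Var x * P"] exp_mult_eventually[of x "D b" P]
  proof eventually_elim
    case (elim N)
    have c: "Cst (dv (Suc l) b) * (of_nat (Suc l) * Q) = Cst (dv l (D b)) * Q" for l and Q :: "(nat, 'v) mpoly"
    proof -
      have "(of_nat (Suc l) :: (nat, 'v) mpoly) = Cst (of_nat (Suc l))"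
        by (simp only: Cst_def single_of_nat)
      then show ?thesis unfolding dv_D D_dv Cst_mult by (simp only: mult_ac)
    qed
    show ?case
      unfolding elim sum.lessThan_Suc_shift pdiff_power_Var_same distrib_left sum.distrib c
      by (simp add: sum_distrib_left mult_ac del: funpow.simps)
  qed
qed

lemma exp_mult_mpolys: "P \<in> mpolys n \<Longrightarrow> exp_mult x b P \<in> mpolys n"
proof (rule eventually_const_eqD)
  assume P: "P \<in> mpolys n"
  show "\<forall>\<^sub>F N in sequentially. exp_mult x b P \<in> mpolys n"
    using exp_mult_eventually[of x b P]
    by eventually_elim (auto intro!: mpolys_sum mpolys_mult mpolys_Cst pdiff_power_mpolys P)
qed

lemma apply_exp_mult:
  assumes "i < n"
  shows "apply_class n (exp_mult i b) (tot_class n P) = tot_class n (exp_mult i b P)"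
proof (rule apply_class_tot_classI[OF exp_mult_add])
  fix P :: "(nat, 'v) mpoly" assume "P \<in> mpolys n"
  then show "exp_mult i b P \<in> mpolys n" by (rule exp_mult_mpolys)
  have "exp_mult i b ((\<Sum>y<n. Var y) * P) = (\<Sum>y<n. exp_mult i b (Var y * P))"
    by (simp add: sum_distrib_right additive_sum[of "exp_mult i b", OF exp_mult_add])
  also have "\<dots> = (\<Sum>y<n. Var y * exp_mult i b P + (if y = i then exp_mult i (D b) P else 0))"
    by (intro sum.cong refl) (auto simp: exp_mult_Var_same exp_mult_Var_other)
  also have "\<dots> = (\<Sum>y<n. Var y) * exp_mult i b P + exp_mult i (D b) P"
    using assms by (simp add: sum.distrib sum_distrib_right)
  finally show "exp_mult i b (tmap n P) = tmap n (exp_mult i b P)"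
    by (simp add: tmap_def exp_mult_add exp_mult_mapD)
qed

lemma lookup_exp_mult:
  "\<forall>\<^sub>F N in sequentially. of_nat (fact (lookup E x)) * lookup (exp_mult x b P) E
    = (\<Sum>l<N. dv l b * (of_nat (fact (lookup E x + l)) * lookup P (E + single x l)))"
  using exp_mult_eventually[of x b P]
  by eventually_elim
    (simp add: lookup_sum lookup_Cst_mult sum_distrib_left mult.left_commute[of "of_nat (fact _)"] lookup_pdiff_power)

lemma bracket_at_D: "bracket_at br (Var i) a (D v) = Var i * bracket_at br (Var i) a v + pmap D (bracket_at br (Var i) a v)"
proof -
  have X: "psum (\<lambda>m c. Cst c * Var i ^ m) ([:0, 1:] * p) = Var i * psum (\<lambda>m c. Cst c * Var i ^ m) p" for p :: "'v poly"
  proof (rule poly_additive_eq[of "\<lambda>p. psum (\<lambda>m c. Cst c * Var i ^ m) ([:0, 1:] * p)" "\<lambda>p. Var i * psum (\<lambda>m c. Cst c * Var i ^ m) p"])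
    fix c :: 'v and m
    have "[:0, 1:] * monom c m = monom c (Suc m)" by (simp add: monom_Suc)
    then show "psum (\<lambda>m c. Cst c * Var i ^ m) ([:0, 1:] * monom c m) = Var i * psum (\<lambda>m c. Cst c * Var i ^ m) (monom c m)"
      by (simp only: psum_monom Cst_0 mult_zero_left power_Suc mult_ac)
  qed (simp_all only: distrib_left psum_add Cst_add distrib_right)
  have M: "psum (\<lambda>m c. Cst c * Var i ^ m) (map_poly D p) = pmap D (psum (\<lambda>m c. Cst c * Var i ^ m) p)" for p :: "'v poly"
  proof (rule poly_additive_eq[of "\<lambda>p. psum (\<lambda>m c. Cst c * Var i ^ m) (map_poly D p)" "\<lambda>p. pmap D (psum (\<lambda>m c. Cst c * Var i ^ m) p)"])
    show "psum (\<lambda>m c. Cst c * Var i ^ m) (map_poly D (monom c m)) = pmap D (psum (\<lambda>m c. Cst c * Var i ^ m) (monom c m))" for c :: 'v and m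
      by (simp add: map_poly_monom psum_monom Cst_mult_Var_power mapD_single)
  qed (simp_all only: map_poly_D_add psum_add Cst_add distrib_right mapD_add)
  have "bracket_at br (Var i) a (D v) = psum (\<lambda>m c. Cst c * Var i ^ m) ([:0, 1:] * br a v + map_poly D (br a v))"
    by (simp only: bracket_at_psum br_D_right)
  also have "\<dots> = psum (\<lambda>m c. Cst c * Var i ^ m) ([:0, 1:] * br a v) + psum (\<lambda>m c. Cst c * Var i ^ m) (map_poly D (br a v))"
    by (rule psum_add) (simp add: Cst_add distrib_right)
  finally show ?thesis by (simp only: X M bracket_at_psum)
qed

lemma pext_bracket_add: "pext (bracket_at br t a) (P + Q) = pext (bracket_at br t a) P + pext (bracket_at br t a) Q"
  by (rule pext_add) (rule bracket_at_add)

lemma bracket_at_0: "bracket_at br t a 0 = 0"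
  by (rule additive_0[of "bracket_at br t a", OF bracket_at_add])

lemma pext_bracket_single: "pext (bracket_at br t a) (single e c) = single e 1 * bracket_at br t a c"
  by (rule pext_single) (rule bracket_at_0)

lemma pext_bracket_Var: "pext (bracket_at br t a) (Var y * P) = Var y * pext (bracket_at br t a) P"
proof (rule poly_mapping_additive_eq[of "\<lambda>P. pext (bracket_at br t a) (Var y * P)" "\<lambda>P. Var y * pext (bracket_at br t a) P"])
  fix e :: "nat \<Rightarrow>\<^sub>0 nat" and c :: 'v
  have "Var y * single e c = single (single y 1 + e) c"
    by (simp add: Var_def mult_single)
  moreover have "single (single y 1 + e) 1 = Var y * single e (1::'v)"
    by (simp add: Var_def mult_single)
  ultimately show "pext (bracket_at br t a) (Var y * single e c) = Var y * pext (bracket_at br t a) (single e c)"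
    by (simp only: pext_bracket_single mult.assoc)
qed (simp_all add: pext_bracket_add algebra_simps)

lemma pext_bracket_mapD: "pext (bracket_at br (Var i) a) (pmap D P)
  = Var i * pext (bracket_at br (Var i) a) P + pmap D (pext (bracket_at br (Var i) a) P)"
proof (rule poly_mapping_additive_eq[of "\<lambda>P. pext (bracket_at br (Var i) a) (pmap D P)"
      "\<lambda>P. Var i * pext (bracket_at br (Var i) a) P + pmap D (pext (bracket_at br (Var i) a) P)"])
  fix e :: "nat \<Rightarrow>\<^sub>0 nat" and c :: 'v
  have "pmap D (single e 1) = 0" by (simp add: mapD_single)
  then show "pext (bracket_at br (Var i) a) (pmap D (single e c))
      = Var i * pext (bracket_at br (Var i) a) (single e c) + pmap D (pext (bracket_at br (Var i) a) (single e c))"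
    by (simp add: mapD_single pext_bracket_single bracket_at_D mapD_mult algebra_simps)
qed (simp_all add: pext_bracket_add mapD_add algebra_simps)

lemma bracket_at_mpolys: "i < n \<Longrightarrow> bracket_at br (Var i) a c \<in> mpolys n"
  unfolding bracket_at_psum psum_def by (intro mpolys_sum mpolys_mult mpolys_Cst mpolys_power mpolys_Var)

lemma pext_bracket_mpolys:
  assumes "i < n" "P \<in> mpolys n"
  shows "pext (bracket_at br (Var i) a) P \<in> mpolys n"
  using assms(2)
proof (induction rule: mpolys_induct)
  case zero
  then show ?case using additive_0[of "pext (bracket_at br (Var i) a)", OF pext_bracket_add] by simp
next
  case (single ms c)
  then show ?case by (simp add: pext_bracket_single mpolys_mult mpolys_single bracket_at_mpolys[OF assms(1)])
qed (simp add: pext_bracket_add mpolys_add)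

text \<open>This and \<open>opB\<close> are the two kinds of summand of \<open>pv_d\<close> on
  representatives, without their signs.\<close>

definition opA :: "nat \<Rightarrow> nat \<Rightarrow> 'v \<Rightarrow> (nat, 'v) mpoly \<Rightarrow> (nat, 'v) mpoly" where
  "opA n i a P = pext (bracket_at br (Var i) a) (subst ((!) (map Var (filter (\<lambda>m. m \<noteq> i) [0..<Suc n]))) P)"

definition opB :: "nat \<Rightarrow> nat \<Rightarrow> nat \<Rightarrow> nat \<Rightarrow> (nat, 'v) mpoly \<Rightarrow> (nat, 'v) mpoly" where
  "opB n i l k P = Var i ^ k * subst ((!) ((Var i + Var l) # map Var (filter (\<lambda>m. m \<noteq> i \<and> m \<noteq> l) [0..<Suc n]))) P"

lemma length_filter_neq: "i < Suc n \<Longrightarrow> length (filter (\<lambda>m. m \<noteq> i) [0..<Suc n]) = n"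
  using length_del[of i "replicate (Suc n) ()"] by (simp add: del_def del: upt_Suc)

lemma length_filter_neq2: "i < l \<Longrightarrow> l < Suc n \<Longrightarrow> length (filter (\<lambda>m. m \<noteq> i \<and> m \<noteq> l) [0..<Suc n]) = n - 1"
  using length_del2[of i l "replicate (Suc n) ()"] by (simp add: del2_def del: upt_Suc)

lemma opA_add: "opA n i a (P + Q) = opA n i a P + opA n i a Q"
  and opB_add: "opB n i l k (P + Q) = opB n i l k P + opB n i l k Q"
  by (simp_all add: opA_def opB_def subst_add pext_bracket_add distrib_left)

lemma mapD_nth_Var: "r < length I \<Longrightarrow> pmap D (map Var I ! r) = 0"
  by (simp add: mapD_Var)

lemma opA_mpolys:
  assumes "i < Suc n" "P \<in> mpolys n"
  shows "opA n i a P \<in> mpolys (Suc n)"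
  unfolding opA_def
proof (intro pext_bracket_mpolys subst_mpolys[OF assms(2)] assms(1))
  fix r assume "r < n"
  then have "filter (\<lambda>m. m \<noteq> i) [0..<Suc n] ! r \<in> set (filter (\<lambda>m. m \<noteq> i) [0..<Suc n])"
    using length_filter_neq[OF assms(1)] by (intro nth_mem) simp
  then show "(map Var (filter (\<lambda>m. m \<noteq> i) [0..<Suc n]) ! r :: (nat, 'v) mpoly) \<in> mpolys (Suc n)"
    using length_filter_neq[OF assms(1)] \<open>r < n\<close> by (auto simp del: upt_Suc intro: mpolys_Var)
qed

lemma opB_mpolys:
  assumes "i < l" "l < Suc n" "P \<in> mpolys n"
  shows "opB n i l k P \<in> mpolys (Suc n)"
  unfolding opB_def
proof (intro mpolys_mult mpolys_power subst_mpolys[OF assms(3)])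
  show "(Var i :: (nat, 'v) mpoly) \<in> mpolys (Suc n)" by (rule mpolys_Var) (use assms in simp)
  fix r assume r: "r < n"
  show "(((Var i + Var l) # map Var (filter (\<lambda>m. m \<noteq> i \<and> m \<noteq> l) [0..<Suc n])) ! r :: (nat, 'v) mpoly) \<in> mpolys (Suc n)"
  proof (cases r)
    case 0
    then show ?thesis using assms by (simp add: mpolys_add mpolys_Var)
  next
    case (Suc s)
    then have s: "s < length (filter (\<lambda>m. m \<noteq> i \<and> m \<noteq> l) [0..<Suc n])"
      using r length_filter_neq2[OF assms(1,2)] by simp
    then have "filter (\<lambda>m. m \<noteq> i \<and> m \<noteq> l) [0..<Suc n] ! s \<in> set (filter (\<lambda>m. m \<noteq> i \<and> m \<noteq> l) [0..<Suc n])"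
      by (rule nth_mem)
    then show ?thesis using s Suc by (auto simp del: upt_Suc intro: mpolys_Var)
  qed
qed

lemma sum_filter_neq:
  assumes "i < Suc n"
  shows "(\<Sum>r<n. map Var (filter (\<lambda>m. m \<noteq> i) [0..<Suc n]) ! r) + Var i = (\<Sum>r<Suc n. Var r :: (nat, 'v) mpoly)"
proof -
  let ?I = "filter (\<lambda>m. m \<noteq> i) [0..<Suc n]"
  have "(\<Sum>r<n. map Var ?I ! r) = (\<Sum>r<length ?I. Var (?I ! r) :: (nat, 'v) mpoly)"
    unfolding length_filter_neq[OF assms] by (intro sum.cong refl) (simp add: length_filter_neq[OF assms] del: upt_Suc)
  also have "\<dots> = (\<Sum>x\<in>{..<Suc n} - {i}. Var x)"
    by (subst sum_nth_distinct) (auto intro!: sum.cong simp del: upt_Suc)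
  finally show ?thesis
    using assms by (simp add: sum.remove[of "{..<Suc n}" i] add.commute del: sum.lessThan_Suc)
qed

lemma sum_filter_neq2:
  assumes "i < l" "l < Suc n"
  shows "(\<Sum>r<n. ((Var i + Var l) # map Var (filter (\<lambda>m. m \<noteq> i \<and> m \<noteq> l) [0..<Suc n])) ! r) = (\<Sum>r<Suc n. Var r :: (nat, 'v) mpoly)"
proof -
  let ?I = "filter (\<lambda>m. m \<noteq> i \<and> m \<noteq> l) [0..<Suc n]"
  obtain m where m: "n = Suc m" using assms by (cases n) auto
  have len: "length ?I = m" using length_filter_neq2[OF assms] m by simp
  have "(\<Sum>r<n. ((Var i + Var l) # map Var ?I) ! r) = (Var i + Var l) + (\<Sum>r<length ?I. Var (?I ! r) :: (nat, 'v) mpoly)"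
    unfolding len unfolding m sum.lessThan_Suc_shift using len[unfolded m] by (simp del: upt_Suc)
  also have "(\<Sum>r<length ?I. Var (?I ! r)) = (\<Sum>x\<in>{..<Suc n} - {i} - {l}. Var x :: (nat, 'v) mpoly)"
    by (subst sum_nth_distinct) (auto intro!: sum.cong simp del: upt_Suc)
  finally show ?thesis
    using assms by (simp add: sum.remove[of "{..<Suc n}" i] sum.remove[of "{..<Suc n} - {i}" l] add.assoc del: sum.lessThan_Suc)
qed

text \<open>After renaming, the variable i is missing from the total derivative; right
  sesquilinearity of the \<lambda>-bracket supplies it.\<close>

lemma opA_tmap:
  assumes i: "i < Suc n" and P: "P \<in> mpolys n"
  shows "opA n i a (tmap n P) = tmap (Suc n) (opA n i a P)"
proof -
  let ?\<sigma> = "(!) (map Var (filter (\<lambda>m. m \<noteq> i) [0..<Suc n])) :: nat \<Rightarrow> (nat, 'v) mpoly"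
  let ?f = "pext (bracket_at br (Var i) a)"
  have mD: "subst ?\<sigma> (pmap D P) = pmap D (subst ?\<sigma> P)"
    by (rule subst_mapD[OF P]) (rule mapD_nth_Var, simp add: length_filter_neq[OF i] del: upt_Suc)
  have s: "?f ((\<Sum>r<n. ?\<sigma> r) * Q) = (\<Sum>r<n. ?\<sigma> r) * ?f Q" for Q
    unfolding sum_distrib_right additive_sum[of ?f, OF pext_bracket_add]
    by (intro sum.cong refl) (simp add: pext_bracket_Var length_filter_neq[OF i] del: upt_Suc)
  have "opA n i a (tmap n P) = ?f (pmap D (subst ?\<sigma> P)) + ?f ((\<Sum>r<n. ?\<sigma> r) * subst ?\<sigma> P)"
    by (simp only: opA_def tmap_def subst_add subst_mult subst_sum subst_Var mD pext_bracket_add)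
  also have "\<dots> = pmap D (opA n i a P) + ((\<Sum>r<n. ?\<sigma> r) + Var i) * opA n i a P"
    unfolding s pext_bracket_mapD by (simp add: opA_def algebra_simps del: upt_Suc)
  finally show ?thesis unfolding sum_filter_neq[OF i] tmap_def .
qed

text \<open>The merged variable \<lambda>_i + \<lambda>_l together with the remaining ones again
  adds up to all n + 1 variables.\<close>

lemma opB_tmap:
  assumes il: "i < l" "l < Suc n" and P: "P \<in> mpolys n"
  shows "opB n i l k (tmap n P) = tmap (Suc n) (opB n i l k P)"
proof -
  let ?\<sigma> = "(!) ((Var i + Var l) # map Var (filter (\<lambda>m. m \<noteq> i \<and> m \<noteq> l) [0..<Suc n])) :: nat \<Rightarrow> (nat, 'v) mpoly"
  have mD: "subst ?\<sigma> (pmap D P) = pmap D (subst ?\<sigma> P)"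
  proof (rule subst_mapD[OF P])
    fix r assume "r < n"
    then show "pmap D (?\<sigma> r) = 0"
      using length_filter_neq2[OF il] by (cases r) (simp_all add: mapD_add mapD_Var del: upt_Suc)
  qed
  have "opB n i l k (tmap n P) = Var i ^ k * tmap (Suc n) (subst ?\<sigma> P)"
    by (simp only: opB_def tmap_def subst_add subst_mult subst_sum subst_Var mD sum_filter_neq2[OF il])
  also have "\<dots> = tmap (Suc n) (opB n i l k P)"
    unfolding opB_def by (rule tmap_mult[symmetric]) (intro mapD_power mapD_Var)
  finally show ?thesis .
qed

lemma sign_Cst: "((- 1) ^ e :: (nat, 'v) mpoly) = Cst (scale ((- 1) ^ e) 1)"
proof (induction e)
  case (Suc e)
  have "(Cst (- x) :: (nat, 'v) mpoly) = - Cst x" for x by (simp add: Cst_def single_uminus)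
  then show ?case using Suc by simp
qed simp

lemma tmap_sign: "tmap n ((- 1) ^ e * P) = (- 1) ^ e * tmap n P"
  unfolding sign_Cst by (rule tmap_mult) (rule mapD_Cst_scale)

lemma mpolys_sign: "P \<in> mpolys n \<Longrightarrow> (- 1) ^ e * P \<in> mpolys n" for P :: "(nat, 'v) mpoly"
  unfolding sign_Cst by (intro mpolys_mult mpolys_Cst)

lemma apply_opA:
  assumes "i < Suc n"
  shows "apply_class (Suc n) (\<lambda>P. (- 1) ^ e * opA n i a P) (tot_class n P) = tot_class (Suc n) ((- 1) ^ e * opA n i a P)"
  by (rule apply_class_tot_classI)
    (simp_all add: opA_add distrib_left opA_tmap[OF assms] tmap_sign mpolys_sign opA_mpolys[OF assms])

lemma apply_opB:
  assumes "i < l" "l < Suc n"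
  shows "apply_class (Suc n) (\<lambda>P. (- 1) ^ e * opB n i l k P) (tot_class n P) = tot_class (Suc n) ((- 1) ^ e * opB n i l k P)"
  by (rule apply_class_tot_classI)
    (simp_all add: opB_add distrib_left opB_tmap[OF assms] tmap_sign mpolys_sign opB_mpolys[OF assms])

text \<open>The variable i enters only through the bracket and the others only through P, so each
  monomial of the result splits uniquely.\<close>

lemma lookup_opA:
  assumes i: "i < Suc n" and P: "P \<in> mpolys n" and Ms: "length Ms = Suc n"
  shows "lookup (opA n i a P) (xp Ms) = coeff (br a (lookup P (xp (del i Ms)))) (Ms ! i)"
proof (rule mpolys_additive_eq[of "\<lambda>P. lookup (opA n i a P) (xp Ms)"
      "\<lambda>P. coeff (br a (lookup P (xp (del i Ms)))) (Ms ! i)" n, OF _ _ _ P])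
  fix ms :: "nat list" and c :: 'v assume ms: "length ms = n"
  define I where "I = filter (\<lambda>m. m \<noteq> i) [0..<Suc n]"
  have len: "length I = n" unfolding I_def by (rule length_filter_neq[OF i])
  have dist: "distinct I" by (simp add: I_def del: upt_Suc)
  have setI: "set I = {..<Suc n} - {i}" by (auto simp: I_def simp del: upt_Suc)
  have del: "del i Ms = map ((!) Ms) I" using Ms by (simp add: del_def I_def del: upt_Suc)
  define E where "E = (\<Sum>r<length I. single (I ! r) (ms ! r))"
  have mono: "mono_at ((!) (map Var I)) (xp ms) = single E (1::'v)"
  proof -
    have "mono_at ((!) (map Var I)) (xp ms) = (\<Prod>r<n. Var (I ! r) ^ (ms ! r) :: (nat, 'v) mpoly)"
      unfolding mono_at_xp ms by (intro prod.cong refl) (simp add: len del: upt_Suc)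
    then show ?thesis unfolding prod_Var_power E_def len by simp
  qed
  have E1: "lookup E (I ! r) = ms ! r" if "r < n" for r
    unfolding E_def by (rule lookup_sum_nth[OF dist]) (use that len in simp)
  have E0: "lookup E x = 0" if "x \<notin> set I" for x
    unfolding E_def by (rule lookup_sum_nth_notin[OF that])
  have iff: "((\<forall>x. lookup E x \<le> lookup (xp Ms) x) \<and> xp Ms - E = single i (Ms ! i))
      \<longleftrightarrow> ms = del i Ms"
  proof
    assume a: "(\<forall>x. lookup E x \<le> lookup (xp Ms) x) \<and> xp Ms - E = single i (Ms ! i)"
    show "ms = del i Ms"
    proof (rule nth_equalityI)
      show "length ms = length (del i Ms)" using ms Ms i by (simp add: length_del)
      fix r assume "r < length ms"
      then have r: "r < n" using ms by simp
      then have "I ! r \<in> set I" using len by (intro nth_mem) simp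
      then have x: "I ! r \<noteq> i" "I ! r < Suc n" using setI by auto
      have "lookup (xp Ms - E) (I ! r) = 0"
        using a x by (simp add: lookup_single when_def del: upt_Suc)
      then have "Ms ! (I ! r) \<le> ms ! r" using x Ms E1[OF r] by (simp add: lookup_minus lookup_xp del: upt_Suc)
      moreover have "ms ! r \<le> Ms ! (I ! r)" using a x Ms E1[OF r] by (metis lookup_xp)
      ultimately show "ms ! r = del i Ms ! r" using r len by (simp add: del del: upt_Suc)
    qed
  next
    assume a: "ms = del i Ms"
    have e: "lookup E x = (if x = i then 0 else lookup (xp Ms) x)" for x
    proof (cases "x \<in> set I")
      case True
      then obtain r where r: "r < n" "x = I ! r" using len by (auto simp: in_set_conv_nth simp del: upt_Suc)
      have "x \<noteq> i" "x < Suc n" using True setI by auto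
      moreover have "ms ! r = Ms ! x" using a r len by (simp add: del del: upt_Suc)
      ultimately show ?thesis using E1[OF r(1)] r Ms by (simp add: lookup_xp del: upt_Suc)
    next
      case False
      then show ?thesis using E0[OF False] setI Ms by (auto simp: lookup_xp)
    qed
    have "xp Ms - E = single i (Ms ! i)"
      using i Ms by (intro poly_mapping_eqI) (auto simp: lookup_minus e lookup_single when_def lookup_xp)
    then show "(\<forall>x. lookup E x \<le> lookup (xp Ms) x) \<and> xp Ms - E = single i (Ms ! i)"
      by (simp add: e)
  qed
  have Ei: "lookup (xp Ms - E) i = Ms ! i"
    using E0[of i] setI i Ms by (simp add: lookup_minus lookup_xp)
  have b0: "br a 0 = 0" using br_add_right[of a 0 0] by simp
  have "opA n i a (single (xp ms) c) = single E 1 * psum (\<lambda>m c. Cst c * Var i ^ m) (br a c)"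
    unfolding opA_def I_def[symmetric] subst_single mono Cst_mult_single mult_1_right pext_bracket_single bracket_at_psum by (rule refl)
  then have "lookup (opA n i a (single (xp ms) c)) (xp Ms) = (if ms = del i Ms then coeff (br a c) (Ms ! i) else 0)"
    unfolding iff[symmetric] by (simp add: lookup_single_mult lookup_psum_Var Ei)
  moreover have "xp ms = xp (del i Ms) \<longleftrightarrow> ms = del i Ms"
    using ms Ms i by (intro xp_inj) (simp add: length_del)
  ultimately show "lookup (opA n i a (single (xp ms) c)) (xp Ms)
    = coeff (br a (lookup (single (xp ms) c) (xp (del i Ms)))) (Ms ! i)"
    by (simp add: lookup_single when_def b0)
qed (simp_all add: opA_add lookup_add br_add_right)

text \<open>Expand the power s of \<lambda>_i + \<lambda>_l: a term with exponents
  \<open>Ms ! i\<close> and \<open>Ms ! l\<close> arises exactly when s is their sum less k, with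
  the binomial coefficient shown.\<close>

lemma lookup_opB:
  assumes il: "i < l" "l < Suc n" and P: "P \<in> mpolys n" and Ms: "length Ms = Suc n"
  shows "lookup (opB n i l k P) (xp Ms) = (if k \<le> Ms ! i
    then of_nat (Ms ! i - k + Ms ! l choose (Ms ! i - k)) * lookup P (xp ((Ms ! i - k + Ms ! l) # del2 i l Ms)) else 0)"
proof (rule mpolys_additive_eq[of "\<lambda>P. lookup (opB n i l k P) (xp Ms)"
      "\<lambda>P. if k \<le> Ms ! i then of_nat (Ms ! i - k + Ms ! l choose (Ms ! i - k)) * lookup P (xp ((Ms ! i - k + Ms ! l) # del2 i l Ms)) else 0"
      n, OF _ _ _ P])
  fix sms :: "nat list" and c :: 'v assume sms: "length sms = n"
  define I where "I = filter (\<lambda>m. m \<noteq> i \<and> m \<noteq> l) [0..<Suc n]"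
  obtain m where m: "n = Suc m" using il by (cases n) auto
  obtain s ms where s: "sms = s # ms" and ms: "length ms = m" using sms m by (cases sms) auto
  have len: "length I = m" unfolding I_def using length_filter_neq2[OF il] m by simp
  have dist: "distinct I" by (simp add: I_def del: upt_Suc)
  have setI: "set I = {..<Suc n} - {i, l}" by (auto simp: I_def simp del: upt_Suc)
  have del: "del2 i l Ms = map ((!) Ms) I" using Ms by (simp add: del2_def I_def del: upt_Suc)
  define E where "E = (\<Sum>r<length I. single (I ! r) (ms ! r))"
  have mono: "mono_at ((!) ((Var i + Var l) # map Var I)) (xp sms) = (Var i + Var l) ^ s * single E (1::'v)"
  proof -
    have "mono_at ((!) ((Var i + Var l) # map Var I)) (xp sms)
      = (Var i + Var l) ^ s * (\<Prod>r<m. (map Var I ! r) ^ (ms ! r) :: (nat, 'v) mpoly)"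
      by (simp only: mono_at_xp s length_Cons ms prod.lessThan_Suc_shift nth_Cons_0 nth_Cons_Suc)
    also have "(\<Prod>r<m. (map Var I ! r) ^ (ms ! r) :: (nat, 'v) mpoly) = (\<Prod>r<m. Var (I ! r) ^ (ms ! r))"
      by (intro prod.cong refl) (simp add: len del: upt_Suc)
    finally have "mono_at ((!) ((Var i + Var l) # map Var I)) (xp sms) = (Var i + Var l) ^ s * (\<Prod>r<m. Var (I ! r) ^ (ms ! r) :: (nat, 'v) mpoly)" .
    then show ?thesis unfolding prod_Var_power E_def len by simp
  qed
  have E1: "lookup E (I ! r) = ms ! r" if "r < m" for r
    unfolding E_def by (rule lookup_sum_nth[OF dist]) (use that len in simp)
  have E0: "lookup E x = 0" if "x \<notin> set I" for x
    unfolding E_def by (rule lookup_sum_nth_notin[OF that])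
  have iff: "single i k + (single i p + single l q + E) = xp Ms
      \<longleftrightarrow> ms = del2 i l Ms \<and> Ms ! i = k + p \<and> Ms ! l = q" for p q
  proof
    assume a: "single i k + (single i p + single l q + E) = xp Ms"
    have lk: "lookup (xp Ms) x = (if x = i then k + p else 0) + (if x = l then q else 0) + lookup E x" for x
      using il by (simp add: a[symmetric] lookup_add lookup_single when_def)
    have "Ms ! i = k + p" "Ms ! l = q"
      using lk[of i] lk[of l] E0[of i] E0[of l] setI il Ms by (auto simp: lookup_xp)
    moreover have "ms = del2 i l Ms"
    proof (rule nth_equalityI)
      show "length ms = length (del2 i l Ms)" using ms Ms il m by (simp add: length_del2)
      fix r assume "r < length ms"
      then have r: "r < m" using ms by simp
      then have "I ! r \<in> set I" using len by (intro nth_mem) simp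
      then have x: "I ! r \<noteq> i" "I ! r \<noteq> l" "I ! r < Suc n" using setI by auto
      then show "ms ! r = del2 i l Ms ! r"
        using lk[of "I ! r"] E1[OF r] r len Ms by (simp add: del lookup_xp del: upt_Suc)
    qed
    ultimately show "ms = del2 i l Ms \<and> Ms ! i = k + p \<and> Ms ! l = q" by simp
  next
    assume a: "ms = del2 i l Ms \<and> Ms ! i = k + p \<and> Ms ! l = q"
    show "single i k + (single i p + single l q + E) = xp Ms"
    proof (rule poly_mapping_eqI)
      fix x
      have "lookup E x = (if x = i \<or> x = l then 0 else lookup (xp Ms) x)"
      proof (cases "x \<in> set I")
        case True
        then obtain r where r: "r < m" "x = I ! r" using len by (auto simp: in_set_conv_nth simp del: upt_Suc)
        have "x \<noteq> i" "x \<noteq> l" "x < Suc n" using True setI by auto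
        moreover have "ms ! r = Ms ! x" using a r len by (simp add: del del: upt_Suc)
        ultimately show ?thesis using E1[OF r(1)] r Ms by (simp add: lookup_xp del: upt_Suc)
      next
        case False
        then show ?thesis using E0[OF False] setI Ms by (auto simp: lookup_xp)
      qed
      then show "lookup (single i k + (single i p + single l q + E)) x = lookup (xp Ms) x"
        using a il Ms by (auto simp: lookup_add lookup_single when_def lookup_xp)
    qed
  qed
  have "opB n i l k (single (xp sms) c) = (\<Sum>p\<le>s. single
      (single i k + (single i p + single l (s - p) + E)) (of_nat (s choose p) * c))"
    unfolding opB_def I_def[symmetric] subst_single mono binomial_ring sum_distrib_right sum_distrib_left
    by (intro sum.cong refl)
      (simp add: Var_power Cst_def mult_single mult.assoc mult.commute[of c] flip: single_of_nat)
  then have "lookup (opB n i l k (single (xp sms) c)) (xp Ms)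
    = (\<Sum>p\<le>s. if ms = del2 i l Ms \<and> Ms ! i = k + p \<and> Ms ! l = s - p then of_nat (s choose p) * c else 0)"
    by (simp add: lookup_sum lookup_single when_def iff)
  also have "\<dots> = (if k \<le> Ms ! i \<and> s = Ms ! i - k + Ms ! l \<and> ms = del2 i l Ms then of_nat (s choose (Ms ! i - k)) * c else 0)"
  proof (cases "k \<le> Ms ! i \<and> s = Ms ! i - k + Ms ! l \<and> ms = del2 i l Ms")
    case True
    then have "(\<Sum>p\<le>s. if ms = del2 i l Ms \<and> Ms ! i = k + p \<and> Ms ! l = s - p then of_nat (s choose p) * c else 0)
      = (\<Sum>p\<le>s. if p = Ms ! i - k then of_nat (s choose (Ms ! i - k)) * c else 0)"
      by (intro sum.cong refl) auto
    then show ?thesis using True by (simp add: sum.delta)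
  next
    case False
    then have "(\<Sum>p\<le>s. if ms = del2 i l Ms \<and> Ms ! i = k + p \<and> Ms ! l = s - p then of_nat (s choose p) * c else 0) = 0"
      by (intro sum.neutral) auto
    then show ?thesis using False by auto
  qed
  finally have main: "lookup (opB n i l k (single (xp sms) c)) (xp Ms)
    = (if k \<le> Ms ! i \<and> s = Ms ! i - k + Ms ! l \<and> ms = del2 i l Ms then of_nat (s choose (Ms ! i - k)) * c else 0)" .
  have "xp sms = xp ((Ms ! i - k + Ms ! l) # del2 i l Ms) \<longleftrightarrow> s = Ms ! i - k + Ms ! l \<and> ms = del2 i l Ms"
    using xp_inj[of sms "(Ms ! i - k + Ms ! l) # del2 i l Ms"] s ms Ms il m by (simp add: length_del2)
  then show "lookup (opB n i l k (single (xp sms) c)) (xp Ms) = (if k \<le> Ms ! i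
    then of_nat (Ms ! i - k + Ms ! l choose (Ms ! i - k)) * lookup (single (xp sms) c) (xp ((Ms ! i - k + Ms ! l) # del2 i l Ms)) else 0)"
    unfolding main by (auto simp: lookup_single when_def)
qed (auto simp: opB_add lookup_add distrib_left)

lemma lookup_permute:
  assumes \<pi>: "\<pi> permutes {..<n}" and P: "P \<in> mpolys n" and ms: "length ms = n"
  shows "lookup (subst (\<lambda>i. Var (\<pi> i)) P) (xp ms) = lookup P (xp (permute_list \<pi> ms))"
proof (rule mpolys_additive_eq[of "\<lambda>P. lookup (subst (\<lambda>i. Var (\<pi> i)) P) (xp ms)"
      "\<lambda>P. lookup P (xp (permute_list \<pi> ms))" n, OF _ _ _ P])
  fix ks :: "nat list" and c :: 'v assume ks: "length ks = n"
  have im: "\<pi> i < n" if "i < n" for i using permutes_in_image[OF \<pi>, of i] that by simp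
  define I where "I = map \<pi> [0..<n]"
  have I: "length I = n" "\<And>r. r < n \<Longrightarrow> I ! r = \<pi> r" "distinct I"
    using permutes_inj[OF \<pi>] by (auto simp: I_def distinct_map intro: inj_on_subset)
  have setI: "set I = {..<n}" using permutes_image[OF \<pi>] by (simp add: I_def atLeast0LessThan)
  define E where "E = (\<Sum>r<length I. single (I ! r) (ks ! r))"
  have mono: "mono_at (\<lambda>i. Var (\<pi> i)) (xp ks) = single E (1::'v)"
    unfolding mono_at_xp prod_Var_power E_def ks I(1) using I(2) by simp
  have "E = xp ms \<longleftrightarrow> ks = permute_list \<pi> ms"
  proof
    assume a: "E = xp ms"
    show "ks = permute_list \<pi> ms"
    proof (rule nth_equalityI)
      fix r assume "r < length ks"
      then have r: "r < n" using ks by simp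
      have "ks ! r = lookup E (I ! r)"
        unfolding E_def by (rule lookup_sum_nth[OF I(3), symmetric]) (use I r in simp)
      then show "ks ! r = permute_list \<pi> ms ! r"
        using a I(2)[OF r] im[OF r] ms r \<pi> by (simp add: lookup_xp permute_list_nth)
    qed (use ks ms in simp)
  next
    assume a: "ks = permute_list \<pi> ms"
    show "E = xp ms"
    proof (rule poly_mapping_eqI)
      fix x
      show "lookup E x = lookup (xp ms) x"
      proof (cases "x < n")
        case True
        then obtain r where r: "r < n" "x = I ! r" using setI I(1) by (metis in_set_conv_nth lessThan_iff)
        have "lookup E (I ! r) = ks ! r"
          unfolding E_def by (rule lookup_sum_nth[OF I(3)]) (use I r in simp)
        then show ?thesis using r a I(2)[OF r(1)] im[OF r(1)] ms \<pi> by (simp add: lookup_xp permute_list_nth)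
      next
        case False
        then show ?thesis
          unfolding E_def using setI ms by (subst lookup_sum_nth_notin) (simp_all add: lookup_xp)
      qed
    qed
  qed
  moreover have "xp ks = xp (permute_list \<pi> ms) \<longleftrightarrow> ks = permute_list \<pi> ms"
    using ks ms by (intro xp_inj) simp
  ultimately show "lookup (subst (\<lambda>i. Var (\<pi> i)) (single (xp ks) c)) (xp ms)
    = lookup (single (xp ks) c) (xp (permute_list \<pi> ms))"
    by (simp add: subst_single mono Cst_mult_single lookup_single when_def)
qed (simp_all add: subst_add lookup_add)

end

section \<open>Cochains as polynomials\<close>

definition mfact :: "nat list \<Rightarrow> nat" where
  "mfact ms = prod_list (map fact ms)"

lemma mfact_eq_prod: "mfact ms = (\<Prod>i<length ms. fact (ms ! i))"
  by (simp add: mfact_def prod.list_conv_set_nth atLeast0LessThan)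

lemma mfact_pos: "mfact ms > 0"
  by (simp add: mfact_eq_prod)

lemma mfact_Cons [simp]: "mfact (m # ms) = fact m * mfact ms"
  by (simp add: mfact_def)

lemma mfact_del: "i < length ms \<Longrightarrow> mfact ms = fact (ms ! i) * mfact (del i ms)"
proof (induction ms arbitrary: i)
  case (Cons m ms)
  then show ?case by (cases i) simp_all
qed simp

lemma mfact_del2: "i < l \<Longrightarrow> l < length ms \<Longrightarrow> mfact ms = fact (ms ! i) * (fact (ms ! l) * mfact (del2 i l ms))"
proof (induction ms arbitrary: i l)
  case (Cons m ms)
  obtain l' where l: "l = Suc l'" using Cons.prems by (cases l) auto
  show ?case using Cons l mfact_del[of l' ms] by (cases i) simp_all
qed simp

lemma del_update: "del i (xs[i := x]) = del i xs"
  by (auto simp: del_def)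

lemma mfact_update: "i < length ms \<Longrightarrow> mfact (ms[i := m]) = fact m * mfact (del i ms)"
  using mfact_del[of i "ms[i := m]"] by (simp add: del_update)

lemma mfact_permute: "\<pi> permutes {..<length ms} \<Longrightarrow> mfact (permute_list \<pi> ms) = mfact ms"
  by (simp add: mfact_def mset_permute_list flip: prod_mset_prod_list)

lemma xp_update_add: "i < length ms \<Longrightarrow> xp ms + single i l = xp (ms[i := ms ! i + l])"
  by (rule poly_mapping_eqI) (auto simp: lookup_add lookup_xp lookup_single when_def nth_list_update)

lemma xp_update_diff: "i < length ms \<Longrightarrow> xp ms - single i l = xp (ms[i := ms ! i - l])"
  by (rule poly_mapping_eqI) (auto simp: lookup_minus lookup_xp lookup_single when_def nth_list_update)

lemma map2_list_update: "length as = length ms \<Longrightarrow> i < length ms \<Longrightarrow>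
    map2 f (as[i := a]) ms = (map2 f as ms)[i := f a (ms ! i)]"
  by (rule nth_equalityI) (auto simp: nth_list_update)

section \<open>From basic cochains to variational cochains\<close>

context affine_pva
begin

lemma mfact_cancel: "of_nat (mfact ms) * x = of_nat (mfact ms) * (y :: 'v) \<Longrightarrow> x = y"
  using mfact_pos[of ms] of_nat_cancel[of "mfact ms - 1" x y] by simp

text \<open>The coefficient at \<open>\<lambda>\<^sup>m\<close> is the value of \<open>\<omega>\<close> at the modes of indices \<open>m\<close>, divided by \<open>m!\<close>.\<close>

definition pol :: "nat \<Rightarrow> ('v poly list \<Rightarrow> 'v) \<Rightarrow> 'v list \<Rightarrow> (nat, 'v) mpoly" where
  "pol n \<omega> as = (\<Sum>ms\<in>{ms. length ms = n \<and> \<omega> (map2 monom as ms) \<noteq> 0}.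
     single (xp ms) (scale (1 / of_nat (mfact ms)) (\<omega> (map2 monom as ms))))"

lemma pol_mpolys: "pol n \<omega> as \<in> mpolys n"
  unfolding pol_def by (intro mpolys_sum mpolys_single) simp

lemma lookup_pol:
  assumes b: "basic n \<omega>" and as: "length as = n" and ms: "length ms = n"
  shows "of_nat (mfact ms) * lookup (pol n \<omega> as) (xp ms) = \<omega> (map2 monom as ms)"
proof -
  let ?S = "{ms. length ms = n \<and> \<omega> (map2 monom as ms) \<noteq> 0}"
  obtain N where N: "\<And>ms. length ms = length as \<Longrightarrow> N \<le> sum_list ms \<Longrightarrow> \<omega> (map2 monom as ms) = 0"
    using basicD(4)[OF b] unfolding jointly_finite_def by blast
  have fin: "finite ?S"
    by (rule finite_subset[OF _ finite_bounded_lists[of n N]]) (use N as in \<open>auto simp: not_le[symmetric]\<close>)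
  have "lookup (pol n \<omega> as) (xp ms)
    = (\<Sum>ks\<in>?S. if ks = ms then scale (1 / of_nat (mfact ms)) (\<omega> (map2 monom as ms)) else 0)"
    unfolding pol_def lookup_sum
    by (rule sum.cong[OF refl]) (use ms in \<open>auto simp: lookup_single when_def xp_inj\<close>)
  also have "\<dots> = scale (1 / of_nat (mfact ms)) (\<omega> (map2 monom as ms))"
    using fin ms by (simp add: sum.delta)
  finally have "lookup (pol n \<omega> as) (xp ms) = scale (1 / of_nat (mfact ms)) (\<omega> (map2 monom as ms))" .
  then show ?thesis using mfact_pos[of ms] by (simp flip: scale_of_nat)
qed

lemma pol_eqI:
  assumes "basic n \<omega>" "length as = n" "P \<in> mpolys n"
    and "\<And>ms. length ms = n \<Longrightarrow> of_nat (mfact ms) * lookup P (xp ms) = \<omega> (map2 monom as ms)"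
  shows "pol n \<omega> as = P"
proof (rule mpolys_eqI[OF pol_mpolys assms(3)])
  fix ms :: "nat list" assume "length ms = n"
  then show "lookup (pol n \<omega> as) (xp ms) = lookup P (xp ms)"
    using mfact_cancel[of ms] lookup_pol[OF assms(1,2)] assms(4) by simp
qed

lemma lookup_pol_update:
  assumes b: "basic n \<omega>" and as: "length as = n" and ms: "length ms = n" and i: "i < n"
  shows "of_nat (mfact ms) * lookup (pol n \<omega> (as[i := z])) (xp ms)
    = (- 1) ^ i * \<omega> (monom z (ms ! i) # map2 monom (del i as) (del i ms))"
  using lookup_pol[OF b, of "as[i := z]" ms] modes.alt_update[OF basicD(2)[OF b], of i "map2 monom as ms"] as ms i
  by (simp add: map2_list_update del_map2)

lemma pol_add_slot:
  assumes b: "basic n \<omega>" and as: "length as = n" "i < n"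
  shows "pol n \<omega> (as[i := x + y]) = pol n \<omega> (as[i := x]) + pol n \<omega> (as[i := y])"
proof (rule mpolys_eqI[OF pol_mpolys mpolys_add[OF pol_mpolys pol_mpolys]], rule mfact_cancel)
  fix ms :: "nat list" assume ms: "length ms = n"
  show "of_nat (mfact ms) * lookup (pol n \<omega> (as[i := x + y])) (xp ms)
    = of_nat (mfact ms) * lookup (pol n \<omega> (as[i := x]) + pol n \<omega> (as[i := y])) (xp ms)"
    by (simp add: lookup_add distrib_left lookup_pol_update[OF b as(1) ms as(2)] add_monom[symmetric]
        modes.alt_add0[OF basicD(2)[OF b]])
qed

lemma map_scale_mpolys: "P \<in> mpolys n \<Longrightarrow> pmap (scale c) P \<in> mpolys n"
  by (simp add: map_scale_eq mpolys_mult mpolys_Cst)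

lemma lookup_map_scale: "lookup (pmap (scale c) P) e = scale c (lookup P e)"
  by (rule lookup_map) simp

lemma monom_scale: "monom (scale c x) m = smult (scale c 1) (monom x m)"
  by (simp add: smult_monom mult_scale_1)

lemma pol_scale_slot:
  assumes b: "basic n \<omega>" and as: "length as = n" "i < n"
  shows "pol n \<omega> (as[i := scale c x]) = pmap (scale c) (pol n \<omega> (as[i := x]))"
proof (rule mpolys_eqI[OF pol_mpolys map_scale_mpolys[OF pol_mpolys]], rule mfact_cancel)
  fix ms :: "nat list" assume ms: "length ms = n"
  have "\<omega> (smult (scale c 1) z # zs) = scale c (\<omega> (z # zs))" for z zs
    using basicD(3)[OF b] by (simp add: slot_linear_def)
  then show "of_nat (mfact ms) * lookup (pol n \<omega> (as[i := scale c x])) (xp ms)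
    = of_nat (mfact ms) * lookup (pmap (scale c) (pol n \<omega> (as[i := x]))) (xp ms)"
    by (simp add: lookup_map_scale lookup_pol_update[OF b as(1) ms as(2)] monom_scale flip: scale_mult_right)
qed

lemma pol_D_slot:
  assumes b: "basic n \<omega>" and as: "length as = n" "i < n"
  shows "pol n \<omega> (as[i := D x]) = - Var i * pol n \<omega> (as[i := x])"
proof (rule pol_eqI[OF b])
  show "length (as[i := D x]) = n" using as by simp
  show "- Var i * pol n \<omega> (as[i := x]) \<in> mpolys n"
    by (intro mpolys_mult mpolys_uminus mpolys_Var pol_mpolys as)
  fix ms :: "nat list" assume ms: "length ms = n"
  let ?as = "as[i := x]"
  have "\<omega> (map2 monom (as[i := D x]) ms) = \<omega> ((map2 monom ?as ms)[i := monom (D (?as ! i)) (ms ! i)])"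
    using as ms by (simp add: map2_list_update)
  also have "\<dots> = - (of_nat (ms ! i) * \<omega> (map2 monom ?as (ms[i := ms ! i - 1])))"
    by (rule alt_update_D[OF basicD(2)[OF b]]) (use as ms in simp_all)
  also have "\<dots> = of_nat (mfact ms) * lookup (- Var i * pol n \<omega> ?as) (xp ms)"
  proof (cases "ms ! i = 0")
    case True
    then show ?thesis using as ms by (simp add: lookup_Var_mult lookup_xp)
  next
    case False
    have "mfact ms = ms ! i * mfact (ms[i := ms ! i - 1])"
      using False as ms mfact_del[of i ms] by (simp add: mfact_update fact_reduce)
    then show ?thesis
      using False as ms lookup_pol[OF b, of ?as "ms[i := ms ! i - 1]"] xp_update_diff[of i ms 1]
      by (simp add: lookup_Var_mult lookup_xp mult.assoc)
  qed
  finally show "of_nat (mfact ms) * lookup (- Var i * pol n \<omega> ?as) (xp ms) = \<omega> (map2 monom (as[i := D x]) ms)" ..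
qed

lemma lookup_of_int_mult: "lookup (of_int s * P) e = of_int s * lookup P e"
  for P :: "(nat, 'v) mpoly"
proof -
  have "scale (of_int s) 1 = (of_int s :: 'v)"
  proof (cases s)
    case (nonneg m)
    then show ?thesis using scale_of_nat[of m 1] by simp
  next
    case (neg m)
    then show ?thesis using scale_of_nat[of "Suc m" 1] by (simp del: of_nat_Suc)
  qed
  then show ?thesis by (simp add: of_int_Cst lookup_Cst_mult)
qed

lemma of_int_mult_mpolys: "P \<in> mpolys n \<Longrightarrow> of_int s * P \<in> mpolys n" for P :: "(nat, 'v) mpoly"
  by (simp add: of_int_Cst mpolys_mult mpolys_Cst)

lemma pol_permute:
  assumes b: "basic n \<omega>" and as: "length as = n" and \<pi>: "\<pi> permutes {..<n}"
  shows "subst (\<lambda>i. Var (\<pi> i)) (pol n \<omega> (permute_list \<pi> as)) = of_int (sign \<pi>) * pol n \<omega> as"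
proof (rule mpolys_eqI[OF subst_perm_mpolys[OF \<pi> pol_mpolys] of_int_mult_mpolys[OF pol_mpolys]], rule mfact_cancel)
  fix ms :: "nat list" assume ms: "length ms = n"
  have "map2 monom (permute_list \<pi> as) (permute_list \<pi> ms) = permute_list \<pi> (map2 monom as ms)"
    using \<pi> as ms by (simp add: permute_list_map permute_list_zip[OF \<pi>])
  then have "of_nat (mfact ms) * lookup (subst (\<lambda>i. Var (\<pi> i)) (pol n \<omega> (permute_list \<pi> as))) (xp ms)
    = \<omega> (permute_list \<pi> (map2 monom as ms))"
    using lookup_pol[OF b, of "permute_list \<pi> as" "permute_list \<pi> ms"] as ms \<pi>
    by (simp add: lookup_permute[OF \<pi> pol_mpolys ms] mfact_permute)
  also have "\<dots> = of_int (sign \<pi>) * \<omega> (map2 monom as ms)"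
    by (rule modes.alt_permute[OF basicD(2)[OF b] \<pi>]) (use as ms in simp)
  finally show "of_nat (mfact ms) * lookup (subst (\<lambda>i. Var (\<pi> i)) (pol n \<omega> (permute_list \<pi> as))) (xp ms)
    = of_nat (mfact ms) * lookup (of_int (sign \<pi>) * pol n \<omega> as) (xp ms)"
    by (simp add: lookup_of_int_mult mult.left_commute[of "of_nat _"] lookup_pol[OF b as ms])
qed

lemma pol_leibniz:
  assumes b: "basic n \<omega>" and as: "length as = n" "i < n"
  shows "pol n \<omega> (as[i := x * y]) = exp_mult i x (pol n \<omega> (as[i := y])) + exp_mult i y (pol n \<omega> (as[i := x]))"
proof (rule mpolys_eqI[OF pol_mpolys mpolys_add[OF exp_mult_mpolys[OF pol_mpolys] exp_mult_mpolys[OF pol_mpolys]]], rule mfact_cancel)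
  fix ms :: "nat list" assume ms: "length ms = n"
  let ?zs = "map2 monom (del i as) (del i ms)"
  have E: "lookup (xp ms) i = ms ! i" using as ms by (simp add: lookup_xp)
  have mf: "of_nat (mfact ms) = of_nat (mfact (del i ms)) * (of_nat (fact (ms ! i)) :: 'v)"
    using mfact_del[of i ms] as ms by (simp add: mult.commute)
  \<comment> \<open>Raising slot i by l replaces the factorial of \<open>ms ! i\<close> by that of
    \<open>ms ! i + l\<close>, so the factorials in \<open>lookup_exp_mult\<close> match the
    normalisation of \<open>pol\<close>.\<close>
  have summand: "of_nat (mfact (del i ms)) * (dv l u * (of_nat (fact (ms ! i + l)) * lookup (pol n \<omega> (as[i := w])) (xp ms + single i l)))
      = (- 1) ^ i * (dv l u * \<omega> (monom w (ms ! i + l) # ?zs))" for l u w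
  proof -
    let ?ms = "ms[i := ms ! i + l]"
    have "of_nat (mfact (del i ms)) * (dv l u * (of_nat (fact (ms ! i + l)) * lookup (pol n \<omega> (as[i := w])) (xp ?ms)))
      = dv l u * (of_nat (mfact ?ms) * lookup (pol n \<omega> (as[i := w])) (xp ?ms))"
      using as ms by (simp add: mfact_update mult_ac)
    also have "\<dots> = (- 1) ^ i * (dv l u * \<omega> (monom w (ms ! i + l) # ?zs))"
      using lookup_pol_update[OF b as(1), of ?ms i w] as ms by (simp add: del_update mult.left_commute)
    finally show ?thesis using as ms by (simp add: xp_update_add)
  qed
  show "of_nat (mfact ms) * lookup (pol n \<omega> (as[i := x * y])) (xp ms)
    = of_nat (mfact ms) * lookup (exp_mult i x (pol n \<omega> (as[i := y])) + exp_mult i y (pol n \<omega> (as[i := x]))) (xp ms)"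
  proof (rule eventually_const_eqD)
    have "\<forall>\<^sub>F N in sequentially. \<omega> (monom (x * y) (ms ! i) # ?zs) =
        (\<Sum>l<N. dv l x * \<omega> (monom y (ms ! i + l) # ?zs) + dv l y * \<omega> (monom x (ms ! i + l) # ?zs))"
      using basicD(5)[OF b] by (simp add: leibniz_def)
    then show "\<forall>\<^sub>F N in sequentially. of_nat (mfact ms) * lookup (pol n \<omega> (as[i := x * y])) (xp ms)
      = of_nat (mfact ms) * lookup (exp_mult i x (pol n \<omega> (as[i := y])) + exp_mult i y (pol n \<omega> (as[i := x]))) (xp ms)"
      using lookup_exp_mult[of "xp ms" i x "pol n \<omega> (as[i := y])"] lookup_exp_mult[of "xp ms" i y "pol n \<omega> (as[i := x])"]
    proof eventually_elim
      case (elim N)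
      show ?case
        unfolding lookup_pol_update[OF b as(1) ms as(2)] elim(1)
        unfolding mf lookup_add distrib_left mult.assoc elim(2,3)[unfolded E]
        unfolding sum_distrib_left summand sum.distrib distrib_left ..
    qed
  qed
qed

lemma pol_plus:
  assumes "basic n \<omega>" "basic n \<eta>" "length as = n"
  shows "pol n (\<omega> + \<eta>) as = pol n \<omega> as + pol n \<eta> as"
  by (rule pol_eqI[OF basic_plus[OF assms(1,2)] assms(3) mpolys_add[OF pol_mpolys pol_mpolys]])
    (simp add: lookup_add distrib_left lookup_pol assms)

lemma pol_fsc:
  assumes "basic n \<omega>" "length as = n"
  shows "pol n (fsc c \<omega>) as = pmap (scale c) (pol n \<omega> as)"
  by (rule pol_eqI[OF basic_fsc[OF assms(1)] assms(2) map_scale_mpolys[OF pol_mpolys]])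
    (simp add: lookup_map_scale fsc_def lookup_pol assms flip: scale_mult_right)

lemma pol_0: "pol n 0 as = 0"
  by (simp add: pol_def)

text \<open>The comparison map. It is onto by \<open>pvc_surj\<close>, and its fibres are the cosets
  of the image of \<open>TT\<close> by \<open>pvc_eq\<close>.\<close>

definition pvc :: "nat \<Rightarrow> ('v poly list \<Rightarrow> 'v) \<Rightarrow> 'v list \<Rightarrow> (nat, 'v) mpoly set" where
  "pvc n \<omega> as = (if length as = n then tot_class n (pol n \<omega> as) else 0)"

lemma pvc_cochain:
  assumes b: "basic n \<omega>"
  shows "pvc n \<omega> \<in> pv_cochains n"
  unfolding pv_cochains_def pvc_def
  by (auto simp: pol_mpolys pol_add_slot[OF b] pol_scale_slot[OF b] pol_D_slot[OF b] pol_leibniz[OF b] pol_permute[OF b]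
      tot_class_add apply_scale apply_Var[simplified] apply_permute apply_sign apply_exp_mult)

lemma pvc_plus: "basic n \<omega> \<Longrightarrow> basic n \<eta> \<Longrightarrow> pvc n (\<omega> + \<eta>) = pvc n \<omega> + pvc n \<eta>"
  by (auto simp: pvc_def fun_eq_iff pol_plus tot_class_add)

lemma pvc_fsc: "basic n \<omega> \<Longrightarrow> pvc n (fsc c \<omega>) = pv_scale n c (pvc n \<omega>)"
  by (auto simp: pvc_def pv_scale_def fun_eq_iff pol_fsc apply_scale)

lemma pvc_0: "pvc n 0 = pv_zero n"
  by (auto simp: pvc_def pv_zero_def fun_eq_iff pol_0)

lemma act_opA:
  assumes b: "basic n \<omega>" and as: "length as = Suc n" and ms: "length ms = Suc n" and i: "i < Suc n"
  shows "of_nat (mfact ms) * lookup (opA n i (as ! i) (pol n \<omega> (del i as))) (xp ms)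
    = act (map2 monom as ms ! i) (\<omega> (del i (map2 monom as ms)))"
proof -
  let ?m = "ms ! i" and ?c = "lookup (pol n \<omega> (del i as)) (xp (del i ms))"
  have "of_nat (mfact ms) * coeff (br (as ! i) ?c) ?m = of_nat (mfact (del i ms)) * nprod (as ! i) ?m ?c"
    using mfact_del[of i ms] i ms by (simp add: nprod_def mult_ac)
  also have "\<dots> = nprod (as ! i) ?m (\<omega> (map2 monom (del i as) (del i ms)))"
    unfolding nprod_of_nat_mult_right[symmetric]
    by (subst lookup_pol[OF b]) (use as ms i in \<open>simp_all add: length_del\<close>)
  finally show ?thesis
    using as ms i by (simp add: lookup_opA[OF i pol_mpolys ms] act_monom del_map2)
qed

text \<open>After multiplication by the factorials, the binomial coefficient from the power of
  \<lambda>_i + \<lambda>_l becomes that of the commutator formula, and the coefficient of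
  \<lambda>^q becomes the q-th product; the sum over q is then the bracket of modes.\<close>

lemma sum_opB:
  assumes b: "basic n \<omega>" and as: "length as = Suc n" and ms: "length ms = Suc n" and il: "i < l" "l < Suc n"
  shows "of_nat (mfact ms) * (\<Sum>q\<le>degree (br (as ! i) (as ! l)).
      lookup (opB n i l q (pol n \<omega> (coeff (br (as ! i) (as ! l)) q # del2 i l as))) (xp ms))
    = \<omega> (brk (map2 monom as ms ! i) (map2 monom as ms ! l) # del2 i l (map2 monom as ms))"
proof -
  let ?B = "br (as ! i) (as ! l)" and ?m = "ms ! i" and ?p = "ms ! l"
  let ?zs = "map2 monom (del2 i l as) (del2 i l ms)"
  have a: "modes.alt \<omega>" by (rule basicD(2)[OF b])
  have n: "n = Suc (n - 1)" using il by simp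
  have t: "of_nat (mfact ms) * lookup (opB n i l q (pol n \<omega> (coeff ?B q # del2 i l as))) (xp ms)
      = (if q \<le> ?m then of_nat (?m choose q) * \<omega> (monom (nprod (as ! i) q (as ! l)) (?m + ?p - q) # ?zs) else 0)" for q
  proof (cases "q \<le> ?m")
    case True
    let ?s = "?m - q + ?p"
    have 1: "mfact ms * (?s choose (?m - q)) = (?m choose q) * fact q * mfact (?s # del2 i l ms)"
    proof -
      have "fact ?s = fact (?m - q) * fact ?p * (?s choose (?m - q))"
        using binomial_fact_lemma[of "?m - q" ?s] by simp
      moreover have "fact ?m = fact q * fact (?m - q) * (?m choose q)"
        by (rule binomial_fact_lemma[OF True, symmetric])
      moreover have "mfact ms = fact ?m * (fact ?p * mfact (del2 i l ms))"
        using il ms by (intro mfact_del2) simp_all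
      ultimately show ?thesis by (simp only: mfact_Cons mult_ac)
    qed
    have "of_nat (mfact ms) * lookup (opB n i l q (pol n \<omega> (coeff ?B q # del2 i l as))) (xp ms)
      = of_nat (mfact ms * (?s choose (?m - q))) * lookup (pol n \<omega> (coeff ?B q # del2 i l as)) (xp (?s # del2 i l ms))"
      using True by (simp add: lookup_opB[OF il pol_mpolys ms] mult.assoc)
    also have "\<dots> = of_nat ((?m choose q) * fact q) * \<omega> (map2 monom (coeff ?B q # del2 i l as) (?s # del2 i l ms))"
    proof -
      have "length (coeff ?B q # del2 i l as) = n" "length (?s # del2 i l ms) = n"
        using as ms il n by (simp_all add: length_del2)
      from lookup_pol[OF b this] show ?thesis unfolding 1 of_nat_mult mult.assoc by (simp only:)
    qed
    also have "\<dots> = of_nat (?m choose q) * \<omega> ((of_nat (fact q) * monom (coeff ?B q) ?s) # ?zs)"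
      using alt_of_nat[OF a, of "[]" "fact q" "monom (coeff ?B q) ?s" ?zs] by (simp add: mult.assoc)
    also have "of_nat (fact q) * monom (coeff ?B q) ?s = monom (nprod (as ! i) q (as ! l)) (?m + ?p - q)"
      using True by (simp add: of_nat_mult_monom nprod_def)
    finally show ?thesis using True by simp
  next
    case False
    then show ?thesis by (simp add: lookup_opB[OF il pol_mpolys ms])
  qed
  let ?f = "\<lambda>q. of_nat (?m choose q) * \<omega> (monom (nprod (as ! i) q (as ! l)) (?m + ?p - q) # ?zs)"
  have "(\<Sum>q\<le>degree ?B. if q \<le> ?m then ?f q else 0) = (\<Sum>q\<le>degree ?B + ?m. if q \<le> ?m then ?f q else 0)"
    by (rule sum.mono_neutral_left) (auto simp: nprod_degree not_le modes.alt_zero0[OF a])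
  also have "\<dots> = (\<Sum>q\<le>?m. ?f q)"
    by (rule sum.mono_neutral_cong_right) auto
  also have "\<dots> = \<omega> (brk1 (as ! i) ?m (as ! l) ?p # ?zs)"
    unfolding brk1_def modes.alt_sum0[OF a]
    using alt_of_nat[OF a, of "[]"] by simp
  finally show ?thesis
    unfolding sum_distrib_left t using as ms il by (simp add: brk_monom del2_map2)
qed

text \<open>Term by term, by \<open>act_opA\<close> and \<open>sum_opB\<close>; all signs of
  \<open>pv_d\<close> differ from those of \<open>ced_closed\<close> by the common factor (-1)^(n +
  1).\<close>

lemma pv_d_pvc:
  assumes b: "basic n \<omega>"
  shows "pv_d n (pvc n \<omega>) = pvc (Suc n) (fsc ((- 1) ^ Suc n) (modes.ced \<omega>))"
proof
  fix as :: "'v list"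
  show "pv_d n (pvc n \<omega>) as = pvc (Suc n) (fsc ((- 1) ^ Suc n) (modes.ced \<omega>)) as"
  proof (cases "length as = Suc n")
    case False
    then show ?thesis by (simp add: pv_d_def pvc_def)
  next
    case as: True
    define A where "A i = (- 1) ^ (n + i + 1) * opA n i (as ! i) (pol n \<omega> (del i as))" for i
    define B where "B i l q = (- 1) ^ (n + i + l + 1) * opB n i l q (pol n \<omega> (coeff (br (as ! i) (as ! l)) q # del2 i l as))" for i l q
    let ?d = "\<lambda>i l. degree (br (as ! i) (as ! l))"
    define P where "P = (\<Sum>i<Suc n. A i) + (\<Sum>l<Suc n. \<Sum>i<l. \<Sum>q\<le>?d i l. B i l q)"
    have d1: "map ((!) as) (filter (\<lambda>m. m \<noteq> i) [0..<Suc n]) = del i as" for i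
      using as by (simp add: del_def)
    have d2: "map ((!) as) (filter (\<lambda>m. m \<noteq> i \<and> m \<noteq> l) [0..<Suc n]) = del2 i l as" for i l
      using as by (simp add: del2_def)
    have p1: "pvc n \<omega> (del i as) = tot_class n (pol n \<omega> (del i as))" if "i < Suc n" for i
      using that as by (simp add: pvc_def length_del)
    have p2: "pvc n \<omega> (c # del2 i l as) = tot_class n (pol n \<omega> (c # del2 i l as))" if "i < l" "l < Suc n" for c i l
      using that as by (simp add: pvc_def length_del2)
    have sA: "(\<Sum>i<Suc n. apply_class (Suc n) (\<lambda>P. (- 1) ^ (n + i + 1) * opA n i (as ! i) P) (pvc n \<omega> (del i as)))
        = (\<Sum>i<Suc n. tot_class (Suc n) (A i))"
      by (rule sum.cong[OF refl]) (simp only: p1 apply_opA A_def lessThan_iff)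
    have sB: "(\<Sum>l<Suc n. \<Sum>i<l. \<Sum>q\<le>?d i l. apply_class (Suc n) (\<lambda>P. (- 1) ^ (n + i + l + 1) * opB n i l q P)
          (pvc n \<omega> (coeff (br (as ! i) (as ! l)) q # del2 i l as)))
        = (\<Sum>l<Suc n. \<Sum>i<l. \<Sum>q\<le>?d i l. tot_class (Suc n) (B i l q))"
      by (rule sum.cong[OF refl], rule sum.cong[OF refl], rule sum.cong[OF refl]) (simp only: p2 apply_opB B_def lessThan_iff)
    have "pv_d n (pvc n \<omega>) as = (\<Sum>i<Suc n. tot_class (Suc n) (A i)) + (\<Sum>l<Suc n. \<Sum>i<l. \<Sum>q\<le>?d i l. tot_class (Suc n) (B i l q))"
      unfolding pv_d_def Let_def d1 d2 opA_def[symmetric] opB_def[symmetric] sA sB using as by (simp only: if_True simp_thms)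
    \<comment> \<open>The first sum is nonempty and can spare a zero coset, which the second sum
      needs where its inner ranges are empty.\<close>
    also have "\<dots> = (\<Sum>i<Suc n. tot_class (Suc n) (A i)) + tot_class (Suc n) 0 + (\<Sum>l<Suc n. \<Sum>i<l. \<Sum>q\<le>?d i l. tot_class (Suc n) (B i l q))"
      unfolding sum_tot_class tot_class_0_absorb ..
    also have "\<dots> = (\<Sum>i<Suc n. tot_class (Suc n) (A i)) + ((\<Sum>l<Suc n. \<Sum>i<l. \<Sum>q\<le>?d i l. tot_class (Suc n) (B i l q)) + tot_class (Suc n) 0)"
      by (simp only: ac_simps)
    also have "\<dots> = tot_class (Suc n) P"
    proof -
      have "(\<Sum>l<Suc n. \<Sum>i<l. \<Sum>q\<le>?d i l. tot_class (Suc n) (B i l q)) + tot_class (Suc n) 0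
        = tot_class (Suc n) (\<Sum>l<Suc n. \<Sum>i<l. \<Sum>q\<le>?d i l. B i l q)"
        by (intro sum_absorb tot_class_0_absorb)
      then show ?thesis unfolding P_def by (simp only: sum_tot_class tot_class_add)
    qed
    also have "P = pol (Suc n) (fsc ((- 1) ^ Suc n) (modes.ced \<omega>)) as"
    proof (rule pol_eqI[OF basic_fsc[OF basic_ced[OF b]] as, symmetric])
      show "P \<in> mpolys (Suc n)"
        unfolding P_def A_def B_def
        by (intro mpolys_add mpolys_sum mpolys_sign opA_mpolys opB_mpolys pol_mpolys) simp_all
      fix ms :: "nat list" assume ms: "length ms = Suc n"
      let ?xs = "map2 monom as ms"
      have sg: "(- 1) ^ (n + i + 1) = (- 1) ^ Suc n * (- 1 :: 'v) ^ i" for i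
        by (simp add: power_add)
      have "of_nat (mfact ms) * lookup P (xp ms)
        = (\<Sum>i<Suc n. (- 1) ^ (n + i + 1) * act (?xs ! i) (\<omega> (del i ?xs)))
          + (\<Sum>l<Suc n. \<Sum>i<l. (- 1) ^ (n + (i + l) + 1) * \<omega> (brk (?xs ! i) (?xs ! l) # del2 i l ?xs))"
      proof -
        have a: "of_nat (mfact ms) * lookup (A i) (xp ms) = (- 1) ^ (n + i + 1) * act (?xs ! i) (\<omega> (del i ?xs))"
          if "i < Suc n" for i
          unfolding A_def lookup_sign_mult mult.left_commute[of "of_nat _"] act_opA[OF b as ms that] ..
        have c: "of_nat (mfact ms) * (\<Sum>q\<le>?d i l. lookup (B i l q) (xp ms))
            = (- 1) ^ (n + (i + l) + 1) * \<omega> (brk (?xs ! i) (?xs ! l) # del2 i l ?xs)" if "i < l" "l < Suc n" for i l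
          unfolding B_def lookup_sign_mult sum_distrib_left[symmetric] mult.left_commute[of "of_nat _"]
            sum_opB[OF b as ms that] by (simp only: add.assoc)
        have "(\<Sum>i<Suc n. of_nat (mfact ms) * lookup (A i) (xp ms)) = (\<Sum>i<Suc n. (- 1) ^ (n + i + 1) * act (?xs ! i) (\<omega> (del i ?xs)))"
          by (rule sum.cong[OF refl]) (simp only: a lessThan_iff)
        moreover have "(\<Sum>l<Suc n. \<Sum>i<l. of_nat (mfact ms) * (\<Sum>q\<le>?d i l. lookup (B i l q) (xp ms)))
          = (\<Sum>l<Suc n. \<Sum>i<l. (- 1) ^ (n + (i + l) + 1) * \<omega> (brk (?xs ! i) (?xs ! l) # del2 i l ?xs))"
          by (rule sum.cong[OF refl], rule sum.cong[OF refl]) (simp only: c lessThan_iff)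
        ultimately show ?thesis
          unfolding P_def lookup_add lookup_sum distrib_left by (simp only: sum_distrib_left)
      qed
      also have "\<dots> = (- 1) ^ Suc n * modes.ced \<omega> ?xs"
      proof -
        have len: "length ?xs = Suc n" using as ms by simp
        show ?thesis
          unfolding modes.ced_closed[OF basicD(2)[OF b]] len sg distrib_left sum_distrib_left mult.assoc ..
      qed
      also have "\<dots> = fsc ((- 1) ^ Suc n) (modes.ced \<omega>) ?xs"
      proof -
        have "scale ((- 1) ^ e) x = (- 1) ^ e * x" for e x by (induction e) simp_all
        then show ?thesis by (simp only: fsc_def)
      qed
      finally show "of_nat (mfact ms) * lookup P (xp ms) = fsc ((- 1) ^ Suc n) (modes.ced \<omega>) ?xs" .
    qed
    finally show ?thesis using as by (simp add: pvc_def[of "Suc n"])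
  qed
qed

end

section \<open>Lifting variational cochains to basic ones\<close>

context affine_pva
begin

text \<open>Induction on the number of leading slots that may be arbitrary, the others holding
  generators; the slot freed last is handled by \<open>V_induct\<close>.\<close>

lemma V_induct_generators [consumes 1, case_names gen one D add scale mult]:
  assumes "length as = n"
    and gen: "\<And>cs. length cs = n \<Longrightarrow> Q (map j cs)"
    and one: "\<And>as i. length as = n \<Longrightarrow> i < n \<Longrightarrow> Q (as[i := 1])"
    and D: "\<And>as i x. length as = n \<Longrightarrow> i < n \<Longrightarrow> Q (as[i := x]) \<Longrightarrow> Q (as[i := D x])"
    and add: "\<And>as i x y. length as = n \<Longrightarrow> i < n \<Longrightarrow> Q (as[i := x]) \<Longrightarrow> Q (as[i := y]) \<Longrightarrow> Q (as[i := x + y])"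
    and scale: "\<And>as i c x. length as = n \<Longrightarrow> i < n \<Longrightarrow> Q (as[i := x]) \<Longrightarrow> Q (as[i := scale c x])"
    and mult: "\<And>as i x y. length as = n \<Longrightarrow> i < n \<Longrightarrow> Q (as[i := x]) \<Longrightarrow> Q (as[i := y]) \<Longrightarrow> Q (as[i := x * y])"
  shows "Q as"
proof -
  have "\<forall>as. length as = n \<and> (\<forall>i<n. m \<le> i \<longrightarrow> as ! i \<in> range j) \<longrightarrow> Q as" if "m \<le> n" for m
    using that
  proof (induction m)
    case 0
    show ?case
    proof (intro allI impI)
      fix as assume as: "length as = n \<and> (\<forall>i<n. 0 \<le> i \<longrightarrow> as ! i \<in> range j)"
      then have "set as \<subseteq> range j" by (auto simp: in_set_conv_nth)
      then obtain cs where "as = map j cs" by (metis ex_map_conv subset_iff rangeE)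
      then show "Q as" using gen[of cs] as by simp
    qed
  next
    case (Suc m)
    then have m: "m < n" by simp
    show ?case
    proof (intro allI impI)
      fix as assume as: "length as = n \<and> (\<forall>i<n. Suc m \<le> i \<longrightarrow> as ! i \<in> range j)"
      have "Q (as[m := v])" for v
      proof (induction v rule: V_induct)
        case (gen l a)
        show ?case
        proof (induction l)
          case 0
          have "\<forall>i<n. m \<le> i \<longrightarrow> as[m := j a] ! i \<in> range j"
            using as by (auto simp: nth_list_update)
          then show ?case using Suc.IH m as by simp
        next
          case (Suc l)
          then show ?case using D[of as m "(D ^^ l) (j a)"] as m by simp
        qed
      qed (use as m one add mult scale in auto)
      from this[of "as ! m"] show "Q as" by simp
    qed
  qed
  from this[of n] show ?thesis using assms(1) by simp
qed

lemma exp_mult_1: "exp_mult i 1 P = P"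
proof (rule eventually_const_eqD)
  have z: "dv (Suc l) 1 = 0" for l
  proof -
    have "(D ^^ Suc l) 1 = 0" by (induction l) simp_all
    then show ?thesis unfolding dv_def by simp
  qed
  have "\<forall>\<^sub>F N in sequentially. 0 < (N :: nat)" by (rule eventually_gt_at_top)
  then show "\<forall>\<^sub>F N in sequentially. exp_mult i 1 P = P"
    using exp_mult_eventually[of i 1 P]
  proof eventually_elim
    case (elim N)
    then obtain M where "N = Suc M" by (cases N) auto
    then show ?case using elim by (simp add: sum.lessThan_Suc_shift z del: sum.lessThan_Suc)
  qed
qed

lemma pv_cochainsD:
  assumes "Y \<in> pv_cochains n"
  shows "length as \<noteq> n \<Longrightarrow> Y as = 0"
    and "length as = n \<Longrightarrow> \<exists>P\<in>mpolys n. Y as = tot_class n P"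
    and "length as = n \<Longrightarrow> i < n \<Longrightarrow> Y (as[i := x + y]) = Y (as[i := x]) + Y (as[i := y])"
    and "length as = n \<Longrightarrow> i < n \<Longrightarrow> Y (as[i := scale c x]) = apply_class n (pmap (scale c)) (Y (as[i := x]))"
    and "length as = n \<Longrightarrow> i < n \<Longrightarrow> Y (as[i := D x]) = apply_class n ((*) (- Var i)) (Y (as[i := x]))"
    and "length as = n \<Longrightarrow> \<pi> permutes {..<n} \<Longrightarrow>
        apply_class n (subst (\<lambda>i. Var (\<pi> i))) (Y (permute_list \<pi> as)) = apply_class n ((*) (of_int (sign \<pi>))) (Y as)"
    and "length as = n \<Longrightarrow> i < n \<Longrightarrow> Y (as[i := x * y]) =
          apply_class n (exp_mult i x) (Y (as[i := y])) + apply_class n (exp_mult i y) (Y (as[i := x]))"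
  using assms by (simp_all add: pv_cochains_def image_iff)

lemma pv_cochain_one:
  assumes Y: "Y \<in> pv_cochains n" and as: "length as = n" "i < n"
  shows "Y (as[i := 1]) = tot_class n 0"
proof -
  obtain P where P: "Y (as[i := 1]) = tot_class n P"
    using pv_cochainsD(2)[OF Y, of "as[i := 1]"] as by auto
  have "tot_class n P = tot_class n (P + P)"
    using pv_cochainsD(7)[OF Y as, of 1 1] by (simp add: P apply_exp_mult[OF as(2)] exp_mult_1 tot_class_add)
  then have "- P \<in> tot_image n" by (simp add: tot_class_eq)
  then show ?thesis using tot_image_uminus[of "- P" n] by (simp add: P tot_class_eq)
qed

text \<open>The reason for uniqueness of the cocycle in the theorem. The induction works on classes
  directly and needs no representatives.\<close>

lemma pv_cochains_eqI:
  assumes Y: "Y \<in> pv_cochains n" and Z: "Z \<in> pv_cochains n"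
    and gen: "\<And>cs. length cs = n \<Longrightarrow> Y (map j cs) = Z (map j cs)"
  shows "Y = Z"
proof
  fix as
  show "Y as = Z as"
  proof (cases "length as = n")
    case True
    then show ?thesis
      by (induction as rule: V_induct_generators[where n = n])
        (simp_all add: gen pv_cochain_one[OF Y] pv_cochain_one[OF Z] pv_cochainsD(3,4,5,7)[OF Y] pv_cochainsD(3,4,5,7)[OF Z])
  next
    case False
    then show ?thesis by (simp add: pv_cochainsD(1)[OF Y] pv_cochainsD(1)[OF Z])
  qed
qed

lemma subst_subst:
  assumes "\<tau> permutes {..<n}" "\<pi> permutes {..<n}" "P \<in> mpolys n"
  shows "subst (\<lambda>i. Var (\<tau> i)) (subst (\<lambda>i. Var (\<pi> i)) P) = subst (\<lambda>i. Var ((\<tau> \<circ> \<pi>) i)) P"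
proof (rule mpolys_eqI[where n = n])
  have \<tau>\<pi>: "\<tau> \<circ> \<pi> permutes {..<n}" by (rule permutes_compose[OF assms(2,1)])
  show "subst (\<lambda>i. Var (\<tau> i)) (subst (\<lambda>i. Var (\<pi> i)) P) \<in> mpolys n" "subst (\<lambda>i. Var ((\<tau> \<circ> \<pi>) i)) P \<in> mpolys n"
    using assms \<tau>\<pi> by (auto intro!: subst_perm_mpolys simp del: comp_apply)
  fix ms :: "nat list" assume ms: "length ms = n"
  then show "lookup (subst (\<lambda>i. Var (\<tau> i)) (subst (\<lambda>i. Var (\<pi> i)) P)) (xp ms)
    = lookup (subst (\<lambda>i. Var ((\<tau> \<circ> \<pi>) i)) P) (xp ms)"
    using assms by (simp add: lookup_permute[OF \<tau>\<pi>] lookup_permute subst_perm_mpolys permute_list_compose del: comp_apply)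
qed

text \<open>Projection onto the polynomials which are skewsymmetric under simultaneous permutations of
  the arguments and of the variables.\<close>

definition skew_part :: "nat \<Rightarrow> ('g list \<Rightarrow> (nat, 'v) mpoly) \<Rightarrow> 'g list \<Rightarrow> (nat, 'v) mpoly" where
  "skew_part n f as = pmap (scale (1 / fact n))
     (\<Sum>\<pi>\<in>{\<pi>. \<pi> permutes {..<n}}. of_int (sign \<pi>) * subst (\<lambda>i. Var (\<pi> i)) (f (permute_list \<pi> as)))"

lemma subst_map_scale: "P \<in> mpolys n \<Longrightarrow> \<pi> permutes {..<n} \<Longrightarrow>
    subst (\<lambda>i. Var (\<pi> i)) (pmap (scale c) P) = pmap (scale c) (subst (\<lambda>i. Var (\<pi> i)) P)"
  by (rule mpolys_eqI[where n = n])
    (simp_all add: subst_perm_mpolys map_scale_mpolys lookup_permute lookup_map_scale)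

lemma subst_of_int: "subst \<sigma> (of_int s * P) = of_int s * subst \<sigma> P"
  unfolding subst_mult of_int_Cst by (simp add: subst_def peval_Cst)

lemma skew_part_mpolys:
  assumes "\<And>as. length as = n \<Longrightarrow> f as \<in> mpolys n" "length as = n"
  shows "skew_part n f as \<in> mpolys n"
  unfolding skew_part_def using assms
  by (intro map_scale_mpolys mpolys_sum of_int_mult_mpolys subst_perm_mpolys) auto

lemma skew_part_permute:
  assumes f: "\<And>as. length as = n \<Longrightarrow> f as \<in> mpolys n" and as: "length as = n" and \<tau>: "\<tau> permutes {..<n}"
  shows "subst (\<lambda>i. Var (\<tau> i)) (skew_part n f (permute_list \<tau> as)) = of_int (sign \<tau>) * skew_part n f as"
proof -
  let ?S = "{\<pi>. \<pi> permutes {..<n}}"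
  let ?t = "\<lambda>\<pi>. of_int (sign \<pi>) * subst (\<lambda>i. Var (\<pi> i)) (f (permute_list \<pi> as))"
  have m: "of_int s * pmap (scale c) P = pmap (scale c) (of_int s * P)" for s c and P :: "(nat, 'v) mpoly"
    by (simp add: map_scale_eq mult.left_commute)
  have mem: "(\<Sum>\<pi>\<in>?S. of_int (sign \<pi>) * subst (\<lambda>i. Var (\<pi> i)) (f (permute_list \<pi> (permute_list \<tau> as)))) \<in> mpolys n"
    by (intro mpolys_sum of_int_mult_mpolys subst_perm_mpolys f) (auto simp: as)
  have "subst (\<lambda>i. Var (\<tau> i)) (\<Sum>\<pi>\<in>?S. of_int (sign \<pi>) * subst (\<lambda>i. Var (\<pi> i)) (f (permute_list \<pi> (permute_list \<tau> as))))
    = (\<Sum>\<pi>\<in>?S. of_int (sign \<tau>) * ?t (\<tau> \<circ> \<pi>))"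
    unfolding subst_sum subst_of_int
  proof (rule sum.cong[OF refl])
    fix \<pi> assume "\<pi> \<in> ?S"
    then have \<pi>: "\<pi> permutes {..<n}" by simp
    have "sign (\<tau> \<circ> \<pi>) = sign \<tau> * sign \<pi>"
      by (rule sign_compose) (use \<pi> \<tau> in \<open>auto intro: permutes_imp_permutation[of "{..<n}"]\<close>)
    then have "of_int (sign \<pi>) = of_int (sign \<tau>) * (of_int (sign (\<tau> \<circ> \<pi>)) :: (nat, 'v) mpoly)"
      by (simp flip: of_int_mult mult.assoc)
    moreover have "permute_list (\<tau> \<circ> \<pi>) as = permute_list \<pi> (permute_list \<tau> as)"
      using \<pi> as by (simp add: permute_list_compose)
    ultimately show "of_int (sign \<pi>) * subst (\<lambda>i. Var (\<tau> i)) (subst (\<lambda>i. Var (\<pi> i)) (f (permute_list \<pi> (permute_list \<tau> as))))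
        = of_int (sign \<tau>) * ?t (\<tau> \<circ> \<pi>)"
      using subst_subst[OF \<tau> \<pi>, of "f (permute_list \<pi> (permute_list \<tau> as))"] f as by (simp add: mult.assoc)
  qed
  also have "\<dots> = of_int (sign \<tau>) * (\<Sum>\<pi>\<in>?S. ?t \<pi>)"
    unfolding sum_distrib_left[symmetric] by (rule arg_cong[OF setum_permutations_compose_left[OF \<tau>, symmetric]])
  finally show ?thesis
    unfolding skew_part_def m by (simp only: subst_map_scale[OF mem \<tau>])
qed

lemma tmap_map_scale: "tmap n (pmap (scale c) P) = pmap (scale c) (tmap n P)"
  unfolding map_scale_eq by (rule tmap_mult) (rule mapD_Cst_scale)

lemma tmap_asym:
  assumes "\<And>as. length as = n \<Longrightarrow> f as \<in> mpolys n" "length as = n"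
  shows "tmap n (skew_part n f as) = skew_part n (\<lambda>as. tmap n (f as)) as"
proof -
  have s: "tmap n (of_int s * P) = of_int s * tmap n P" for s P
    unfolding of_int_Cst by (rule tmap_mult) (rule mapD_Cst_scale)
  have "tmap n (\<Sum>\<pi>\<in>{\<pi>. \<pi> permutes {..<n}}. of_int (sign \<pi>) * subst (\<lambda>i. Var (\<pi> i)) (f (permute_list \<pi> as)))
    = (\<Sum>\<pi>\<in>{\<pi>. \<pi> permutes {..<n}}. of_int (sign \<pi>) * subst (\<lambda>i. Var (\<pi> i)) (tmap n (f (permute_list \<pi> as))))"
    unfolding additive_sum[of "tmap n", OF tmap_add] s
    by (rule sum.cong[OF refl]) (simp add: tmap_subst_perm assms)
  then show ?thesis unfolding skew_part_def by (simp add: tmap_map_scale)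
qed

text \<open>Averages n! elements congruent to \<open>f as\<close> modulo \<open>S\<close>, which
  uses characteristic 0. The subspace is \<open>{0}\<close> for polynomials that are already
  skewsymmetric and \<open>tot_image n\<close> for representatives of skewsymmetric classes.\<close>

lemma skew_part_absorb:
  assumes f: "\<And>\<pi>. \<pi> permutes {..<n} \<Longrightarrow> subst (\<lambda>i. Var (\<pi> i)) (f (permute_list \<pi> as)) - of_int (sign \<pi>) * f as \<in> S"
    and S: "0 \<in> S" "\<And>x y. x \<in> S \<Longrightarrow> y \<in> S \<Longrightarrow> x + y \<in> S" "\<And>c x. x \<in> S \<Longrightarrow> Cst (scale c 1) * x \<in> S"
  shows "skew_part n f as - f as \<in> S"
proof -
  let ?S = "{\<pi>. \<pi> permutes {..<n}}"
  have fin: "finite ?S" by (simp add: finite_permutations)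
  have card: "card ?S = fact n" by (simp add: card_permutations)
  have sq: "of_int (sign \<pi>) * (of_int (sign \<pi>) * P) = P" for \<pi> :: "nat \<Rightarrow> nat" and P :: "(nat, 'v) mpoly"
    unfolding mult.assoc[symmetric] of_int_mult[symmetric] by simp
  have sum: "(\<Sum>x\<in>I. g x) \<in> S" if "\<And>x. x \<in> I \<Longrightarrow> g x \<in> S" for I :: "(nat \<Rightarrow> nat) set" and g
    using that by (induction I rule: infinite_finite_induct) (auto simp: S)
  have cn: "pmap (scale c) (of_nat m * P) = pmap (scale (c * of_nat m)) P" for c m and P :: "(nat, 'v) mpoly"
  proof (rule poly_mapping_eqI)
    have "lookup (of_nat m * P) e = of_nat m * lookup P e" for e
      using lookup_of_int_mult[of "int m" P e] by simp
    then show "lookup (pmap (scale c) (of_nat m * P)) e = lookup (pmap (scale (c * of_nat m)) P) e" for e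
      by (simp add: lookup_map_scale flip: scale_of_nat)
  qed
  have "skew_part n f as - f as = pmap (scale (1 / fact n))
    (\<Sum>\<pi>\<in>?S. of_int (sign \<pi>) * (subst (\<lambda>i. Var (\<pi> i)) (f (permute_list \<pi> as)) - of_int (sign \<pi>) * f as))"
  proof -
    have fa: "pmap (scale (1 / fact n)) (\<Sum>\<pi>\<in>?S. f as) = f as"
      using cn[of "1 / fact n" "fact n" "f as"] by (simp add: card map_scale_eq)
    show ?thesis
      unfolding right_diff_distrib sq sum_subtractf additive_diff[of "pmap (scale (1 / fact n))", OF map_scale_add] fa
      by (simp only: skew_part_def)
  qed
  also have "\<dots> \<in> S"
    unfolding map_scale_eq
    by (intro S(3) sum) (use S(3)[of _ "of_int _"] f in \<open>simp add: of_int_Cst S(3)\<close>)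
  finally show ?thesis .
qed

lemma skew_part_basic:
  assumes f: "\<And>as. length as = n \<Longrightarrow> f as \<in> mpolys n"
    and add: "\<And>as bs x y. Suc (length as + length bs) = n \<Longrightarrow> f (as @ (x + y) # bs) = f (as @ x # bs) + f (as @ y # bs)"
    and sc: "\<And>as bs c x. Suc (length as + length bs) = n \<Longrightarrow> f (as @ scaleg c x # bs) = pmap (scale c) (f (as @ x # bs))"
  shows "\<exists>\<omega>. basic n \<omega> \<and> (\<forall>as. length as = n \<longrightarrow> pol n \<omega> (map j as) = skew_part n f as)"
proof -
  \<comment> \<open>A permutation carries the distinguished entry to the position r given by its
    inverse; the surrounding entries do not depend on that entry, so linearity in a slot survives
    permutation.\<close>
  have perm_upd: "\<exists>xs' zs'. length xs' + length zs' = length xs + length zs \<and> (\<forall>z. permute_list \<pi> (xs @ z # zs) = xs' @ z # zs')"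
    if \<pi>: "\<pi> permutes {..<Suc (length xs + length zs)}" for \<pi> and xs zs :: "'g list"
  proof -
    let ?n = "Suc (length xs + length zs)"
    define r where "r = inv \<pi> (length xs)"
    have r: "r < ?n" using permutes_in_image[OF permutes_inv[OF \<pi>], of "length xs"] by (simp add: r_def)
    have \<pi>r: "\<pi> i = length xs \<longleftrightarrow> i = r" for i
      using permutes_inverses[OF \<pi>] unfolding r_def by metis
    let ?p = "permute_list \<pi> (xs @ 0 # zs)"
    have pl: "permute_list \<pi> (xs @ z # zs) = take r ?p @ z # drop (Suc r) ?p" for z
    proof -
      have "permute_list \<pi> (xs @ z # zs) = ?p[r := z]"
      proof (rule nth_equalityI)
        fix i assume "i < length (permute_list \<pi> (xs @ z # zs))"
        then have i: "i < ?n" by simp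
        then have "\<pi> i < ?n" using permutes_in_image[OF \<pi>, of i] by simp
        then show "permute_list \<pi> (xs @ z # zs) ! i = ?p[r := z] ! i"
          using i \<pi>r[of i] \<pi> by (auto simp: permute_list_nth nth_list_update nth_append nth_Cons' )
      qed simp
      then show ?thesis using r by (simp add: upd_conv_take_nth_drop)
    qed
    show ?thesis
    proof (rule exI[of _ "take r ?p"], rule exI[of _ "drop (Suc r) ?p"], intro conjI allI pl)
      show "length (take r ?p) + length (drop (Suc r) ?p) = length xs + length zs" using r by simp
    qed
  qed
  have skew_part_add: "skew_part n f (xs @ (x + y) # zs) = skew_part n f (xs @ x # zs) + skew_part n f (xs @ y # zs)"
    if len: "Suc (length xs + length zs) = n" for xs zs x y
  proof -
    have "f (permute_list \<pi> (xs @ (x + y) # zs)) = f (permute_list \<pi> (xs @ x # zs)) + f (permute_list \<pi> (xs @ y # zs))"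
      if p: "\<pi> permutes {..<n}" for \<pi>
    proof -
      obtain xs' zs' where "length xs' + length zs' = length xs + length zs" "\<And>z. permute_list \<pi> (xs @ z # zs) = xs' @ z # zs'"
        using perm_upd[of \<pi> xs zs] p len by blast
      then show ?thesis using add[of xs' zs'] len by simp
    qed
    then show ?thesis
      unfolding skew_part_def by (simp add: subst_add distrib_left sum.distrib map_scale_add)
  qed
  have skew_part_scale: "skew_part n f (xs @ scaleg c x # zs) = pmap (scale c) (skew_part n f (xs @ x # zs))"
    if len: "Suc (length xs + length zs) = n" for xs zs x c
  proof -
    have 1: "f (permute_list \<pi> (xs @ scaleg c x # zs)) = pmap (scale c) (f (permute_list \<pi> (xs @ x # zs)))"
      if p: "\<pi> permutes {..<n}" for \<pi>
    proof -
      obtain xs' zs' where "length xs' + length zs' = length xs + length zs" "\<And>z. permute_list \<pi> (xs @ z # zs) = xs' @ z # zs'"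
        using perm_upd[of \<pi> xs zs] p len by blast
      then show ?thesis using sc[of xs' zs'] len by simp
    qed
    have m: "of_int s * pmap (scale c) P = pmap (scale c) (of_int s * P)" for s and P :: "(nat, 'v) mpoly"
      by (simp add: map_scale_eq mult.left_commute)
    have "(\<Sum>\<pi>\<in>{\<pi>. \<pi> permutes {..<n}}. of_int (sign \<pi>) * subst (\<lambda>i. Var (\<pi> i)) (f (permute_list \<pi> (xs @ scaleg c x # zs))))
      = pmap (scale c) (\<Sum>\<pi>\<in>{\<pi>. \<pi> permutes {..<n}}. of_int (sign \<pi>) * subst (\<lambda>i. Var (\<pi> i)) (f (permute_list \<pi> (xs @ x # zs))))"
      unfolding additive_sum[of "pmap (scale c)", OF map_scale_add] m[symmetric]
      by (rule sum.cong[OF refl]) (use len in \<open>simp add: 1 subst_map_scale[OF f]\<close>)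
    then show ?thesis
      unfolding skew_part_def by (simp add: map_scale_eq mult.left_commute)
  qed
  define F where "F cs = (if length cs = n then of_nat (mfact (map snd cs)) * lookup (skew_part n f (map fst cs)) (xp (map snd cs)) else 0)" for cs
  have "\<exists>\<omega>. basic n \<omega> \<and> (\<forall>as ms. length as = n \<longrightarrow> length ms = n \<longrightarrow> \<omega> (gens as ms) = F (zip as ms))"
  proof (rule basic_extension_exists)
    show "F cs = 0" if "length cs \<noteq> n" for cs using that by (simp add: F_def)
    show "F (cs @ (a + b, m) # ds) = F (cs @ (a, m) # ds) + F (cs @ (b, m) # ds)" for cs a b m ds
      by (simp add: F_def skew_part_add lookup_add distrib_left)
    show "F (cs @ (scaleg s a, m) # ds) = scale s (F (cs @ (a, m) # ds))" for cs s a m ds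
      by (simp add: F_def skew_part_scale lookup_map_scale scale_mult_right)
    show "F (cs @ c # d # ds) = - F (cs @ d # c # ds)" for cs c d ds
    proof (cases "length (cs @ c # d # ds) = n")
      case True
      let ?p = "length cs" and ?xs = "cs @ c # d # ds" and ?ys = "cs @ d # c # ds"
      let ?\<tau> = "Transposition.transpose ?p (Suc ?p)"
      have \<tau>: "?\<tau> permutes {..<n}" using True by (intro permutes_swap_id) auto
      have ys: "?ys = permute_list ?\<tau> ?xs"
      proof (rule nth_equalityI)
        fix i assume "i < length ?ys"
        then show "?ys ! i = permute_list ?\<tau> ?xs ! i"
          using \<tau> True by (auto simp: permute_list_nth nth_append nth_Cons' Transposition.transpose_def)
      qed simp
      have len: "length (map fst ?xs) = n" "length (map snd ?xs) = n" "length ?xs = n" "length ?ys = n" using True by simp_all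
      have p: "map fst ?ys = permute_list ?\<tau> (map fst ?xs)" "map snd ?ys = permute_list ?\<tau> (map snd ?xs)"
        unfolding ys using \<tau> len by (simp_all only: permute_list_map)
      have mf: "mfact (permute_list ?\<tau> (map snd ?xs)) = mfact (map snd ?xs)"
        by (rule mfact_permute) (use \<tau> len in \<open>simp only:\<close>)
      have "skew_part n f (permute_list ?\<tau> (map fst ?xs)) \<in> mpolys n"
        by (rule skew_part_mpolys[OF f]) (use len in \<open>simp_all only: length_permute_list\<close>)
      then have "F ?ys = of_nat (mfact (map snd ?xs)) * lookup (subst (\<lambda>i. Var (?\<tau> i)) (skew_part n f (permute_list ?\<tau> (map fst ?xs)))) (xp (map snd ?xs))"
        unfolding F_def p mf using len by (simp only: lookup_permute[OF \<tau> _ len(2)] if_True simp_thms)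
      also have "\<dots> = - F ?xs"
      proof -
        have "subst (\<lambda>i. Var (?\<tau> i)) (skew_part n f (permute_list ?\<tau> (map fst ?xs))) = of_int (sign ?\<tau>) * skew_part n f (map fst ?xs)"
          by (rule skew_part_permute[OF _ len(1) \<tau>]) (rule f)
        then show ?thesis unfolding F_def using len by (simp only: lookup_of_int_mult) (simp add: sign_swap_id)
      qed
      finally show ?thesis by simp
    qed (simp add: F_def)
    show "\<exists>N. \<forall>ms. length ms = length as \<longrightarrow> N \<le> sum_list ms \<longrightarrow> F (zip as ms) = 0" for as
    proof -
      let ?K = "keys (skew_part n f as)"
      define N where "N = Suc (\<Sum>e\<in>?K. \<Sum>i<n. lookup e i)"
      have "F (zip as ms) = 0" if ms: "length ms = length as" "N \<le> sum_list ms" for ms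
      proof (rule ccontr)
        assume nz: "F (zip as ms) \<noteq> 0"
        then have len: "length as = n" using ms by (auto simp: F_def split: if_splits)
        have "xp ms \<in> ?K" using nz ms by (auto simp: F_def in_keys_iff split: if_splits)
        then have "(\<Sum>i<n. lookup (xp ms) i) \<le> (\<Sum>e\<in>?K. \<Sum>i<n. lookup e i)"
          by (intro member_le_sum) auto
        moreover have "(\<Sum>i<n. lookup (xp ms) i) = sum_list ms"
          using ms len by (simp add: lookup_xp sum_list_sum_nth atLeast0LessThan)
        ultimately show False using ms(2) by (simp add: N_def)
      qed
      then show ?thesis by blast
    qed
  qed
  then obtain \<omega> where \<omega>: "basic n \<omega>" "\<And>as ms. length as = n \<Longrightarrow> length ms = n \<Longrightarrow> \<omega> (gens as ms) = F (zip as ms)" by blast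
  have "pol n \<omega> (map j as) = skew_part n f as" if "length as = n" for as
    by (rule pol_eqI[OF \<omega>(1) _ skew_part_mpolys[OF f]]) (use that \<omega>(2) in \<open>simp_all add: F_def\<close>)
  then show ?thesis using \<omega>(1) by blast
qed

text \<open>Plain linear algebra over the field: a linear map restricted to a subspace has a linear
  right inverse on its image. Nothing is said about permutations of the variables, which is why
  \<open>skew_part\<close> is applied afterwards.\<close>

lemma tmap_section:
  obtains s where "\<And>P. s P \<in> mpolys n" "\<And>P Q. s (P + Q) = s P + s Q"
    "\<And>c P. s (pmap (scale c) P) = pmap (scale c) (s P)" "\<And>P. P \<in> tot_image n \<Longrightarrow> tmap n (s P) = P"
proof -
  let ?sc = "\<lambda>c. pmap (scale c) :: (nat, 'v) mpoly \<Rightarrow> (nat, 'v) mpoly"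
  have vs: "vector_space ?sc"
    by unfold_locales
      (auto intro!: poly_mapping_eqI simp: lookup_map_scale lookup_add scale_right_distrib scale_left_distrib)
  interpret P: vector_space_pair ?sc ?sc using vs by (intro vector_space_pair.intro)
  have "Vector_Spaces.linear ?sc ?sc (tmap n)"
    by unfold_locales (simp_all add: tmap_add tmap_map_scale)
  moreover have "P.vs1.subspace (mpolys n)"
    by (rule P.vs1.subspaceI) (simp_all add: mpolys_add map_scale_mpolys)
  ultimately obtain s where s: "range s \<subseteq> mpolys n" "Vector_Spaces.linear ?sc ?sc s" "\<forall>P\<in>tmap n ` mpolys n. tmap n (s P) = P"
    using P.linear_exists_right_inverse_on by blast
  interpret s: Vector_Spaces.linear ?sc ?sc s by (rule s(2))
  show thesis
    by (rule that[of s]) (use s(1,3) in \<open>auto simp: s.add s.scale tot_image_tmap\<close>)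
qed

lemma pol_inject:
  assumes "basic n \<omega>" "basic n \<eta>" "\<And>as. length as = n \<Longrightarrow> pol n \<omega> (map j as) = pol n \<eta> (map j as)"
  shows "\<omega> = \<eta>"
proof (rule basic_eqI[OF assms(1,2)])
  fix as :: "'g list" and ms :: "nat list" assume "length as = n" "length ms = n"
  then show "\<omega> (gens as ms) = \<eta> (gens as ms)"
    using lookup_pol[OF assms(1), of "map j as" ms] lookup_pol[OF assms(2), of "map j as" ms] assms(3) by simp
qed

lemma skew_part_pol:
  assumes b: "basic n \<omega>" and as: "length as = n"
  shows "skew_part n (\<lambda>as. pol n \<omega> (map j as)) as = pol n \<omega> (map j as)"
proof -
  have "skew_part n (\<lambda>as. pol n \<omega> (map j as)) as - pol n \<omega> (map j as) \<in> {0}"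
  proof (rule skew_part_absorb)
    fix \<pi> assume \<pi>: "\<pi> permutes {..<n}"
    then show "subst (\<lambda>i. Var (\<pi> i)) (pol n \<omega> (map j (permute_list \<pi> as))) - of_int (sign \<pi>) * pol n \<omega> (map j as) \<in> {0}"
      using pol_permute[OF b, of "map j as" \<pi>] as by (simp add: permute_list_map)
  qed auto
  then show ?thesis by simp
qed

text \<open>Representatives of the classes on generators are normalised linearly and then made
  skewsymmetric. Neither operation changes the classes, so the resulting basic cochain agrees with Y
  on generators.\<close>

lemma pvc_surj:
  assumes Y: "Y \<in> pv_cochains n"
  obtains \<omega> where "basic n \<omega>" "Y = pvc n \<omega>"
proof -
  obtain s where s: "\<And>P. s P \<in> mpolys n" "\<And>P Q. s (P + Q) = s P + s Q"
    "\<And>c P. s (pmap (scale c) P) = pmap (scale c) (s P)" "\<And>P. P \<in> tot_image n \<Longrightarrow> tmap n (s P) = P"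
    by (rule tmap_section[of n]) (rule that)
  \<comment> \<open>A linear normal form depending only on the class; it turns the arbitrary
    representatives R into multilinear ones.\<close>
  define nf where "nf P = P - tmap n (s P)" for P
  have nf_add: "nf (P + Q) = nf P + nf Q" for P Q by (simp add: nf_def s(2) tmap_add)
  have nf_scale: "nf (pmap (scale c) P) = pmap (scale c) (nf P)" for c P
    unfolding nf_def s(3) tmap_map_scale by (rule additive_diff[of "pmap (scale c)", OF map_scale_add, symmetric])
  have nf_cong: "nf P = nf Q" if "tot_class n P = tot_class n Q" for P Q
  proof -
    have "nf (P - Q) = 0" using that s(4)[of "P - Q"] by (simp add: tot_class_eq nf_def)
    then show ?thesis using additive_diff[of nf P Q, OF nf_add] by simp
  qed
  have nf_class: "tot_class n (nf P) = tot_class n P" for P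
    unfolding tot_class_eq nf_def
    using tot_image_uminus[of "tmap n (s P)" n] s(1)[of P] by (simp add: tot_image_tmap)
  have "\<exists>P. length as = n \<longrightarrow> P \<in> mpolys n \<and> Y (map j as) = tot_class n P" for as
    using pv_cochainsD(2)[OF Y, of "map j as"] by (cases "length as = n") auto
  then have "\<exists>R. \<forall>as. length as = n \<longrightarrow> R as \<in> mpolys n \<and> Y (map j as) = tot_class n (R as)" by (rule choice[OF allI])
  then obtain R where R: "\<And>as. length as = n \<Longrightarrow> R as \<in> mpolys n" "\<And>as. length as = n \<Longrightarrow> Y (map j as) = tot_class n (R as)" by blast
  define f where "f as = nf (R as)" for as
  have f: "f as \<in> mpolys n" if "length as = n" for as
    unfolding f_def nf_def diff_conv_add_uminus
    by (intro mpolys_add mpolys_uminus tmap_mpolys s(1) R(1) that)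
  have Yf: "Y (map j as) = tot_class n (f as)" if "length as = n" for as
    using R(2)[OF that] by (simp add: f_def nf_class)
  have slot: "map j (xs @ z # zs) = (map j (xs @ 0 # zs))[length xs := j z]" for xs zs z
    by (simp add: list_update_append)
  obtain \<omega> where \<omega>: "basic n \<omega>" "\<And>as. length as = n \<Longrightarrow> pol n \<omega> (map j as) = skew_part n f as"
  proof -
    have "\<exists>\<omega>. basic n \<omega> \<and> (\<forall>as. length as = n \<longrightarrow> pol n \<omega> (map j as) = skew_part n f as)"
    proof (rule skew_part_basic[OF f])
      fix xs zs :: "'g list" and x y c assume len: "Suc (length xs + length zs) = n"
      have "tot_class n (R (xs @ (x + y) # zs)) = tot_class n (R (xs @ x # zs) + R (xs @ y # zs))"
        using pv_cochainsD(3)[OF Y, of "map j (xs @ 0 # zs)" "length xs" "j x" "j y"] len R(2)[of "xs @ _ # zs"]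
        unfolding slot[symmetric] j_add[symmetric] by (simp add: tot_class_add)
      from nf_cong[OF this] show "f (xs @ (x + y) # zs) = f (xs @ x # zs) + f (xs @ y # zs)"
        by (simp only: f_def nf_add)
      have "tot_class n (R (xs @ scaleg c x # zs)) = tot_class n (pmap (scale c) (R (xs @ x # zs)))"
        using pv_cochainsD(4)[OF Y, of "map j (xs @ 0 # zs)" "length xs" c "j x"] len R(2)[of "xs @ _ # zs"]
        unfolding slot[symmetric] j_scale[symmetric] by (simp add: apply_scale)
      from nf_cong[OF this] show "f (xs @ scaleg c x # zs) = pmap (scale c) (f (xs @ x # zs))"
        by (simp only: f_def nf_scale)
    qed
    then show thesis using that by blast
  qed
  have "Y (map j as) = pvc n \<omega> (map j as)" if as: "length as = n" for as
  proof -
    have "skew_part n f as - f as \<in> tot_image n"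
    proof (rule skew_part_absorb[OF _ tot_image_0 tot_image_add])
      fix \<pi> assume \<pi>: "\<pi> permutes {..<n}"
      have "tot_class n (subst (\<lambda>i. Var (\<pi> i)) (f (permute_list \<pi> as))) = tot_class n (of_int (sign \<pi>) * f as)"
        using pv_cochainsD(6)[OF Y, of "map j as" \<pi>] \<pi> as Yf[OF as] Yf[of "permute_list \<pi> as"]
        by (simp add: permute_list_map apply_permute apply_sign)
      then show "subst (\<lambda>i. Var (\<pi> i)) (f (permute_list \<pi> as)) - of_int (sign \<pi>) * f as \<in> tot_image n"
        by (simp add: tot_class_eq)
    next
      show "Cst (scale c 1) * x \<in> tot_image n" if "x \<in> tot_image n" for c x
        using that unfolding tot_image_tmap
        by (auto simp: map_scale_eq[symmetric] tmap_map_scale[symmetric] intro!: imageI map_scale_mpolys)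
    qed
    then have "tot_class n (skew_part n f as) = tot_class n (f as)" by (simp add: tot_class_eq)
    then show ?thesis using as Yf[OF as] \<omega>(2)[OF as] by (simp add: pvc_def)
  qed
  then have "Y = pvc n \<omega>" by (intro pv_cochains_eqI[OF Y pvc_cochain[OF \<omega>(1)]])
  then show thesis using that \<omega>(1) by blast
qed

end

section \<open>The kernel of the comparison map\<close>

context affine_pva_nonzero
begin

lemma tmap_pol:
  assumes b: "basic n \<omega>" and as: "length as = n"
  shows "tmap n (pol n \<omega> as) = pol n (TT \<omega>) as"
proof (rule pol_eqI[OF basic_lieder[OF b] as tmap_mpolys[OF pol_mpolys], symmetric])
  fix ms :: "nat list" assume ms: "length ms = n"
  have "of_nat (mfact ms) * lookup (Var i * pol n \<omega> as) (xp ms)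
      = of_nat (ms ! i) * \<omega> (map2 monom as (ms[i := ms ! i - 1]))" if i: "i < n" for i
  proof (cases "ms ! i = 0")
    case True
    then show ?thesis using ms i by (simp add: lookup_Var_mult lookup_xp)
  next
    case False
    have "mfact ms = ms ! i * mfact (ms[i := ms ! i - 1])"
      using False i ms mfact_del[of i ms] by (simp add: mfact_update fact_reduce)
    then show ?thesis
      using False i ms lookup_pol[OF b as, of "ms[i := ms ! i - 1]"] xp_update_diff[of i ms 1]
      by (simp add: lookup_Var_mult lookup_xp mult.assoc)
  qed
  then have "(\<Sum>i<n. of_nat (mfact ms) * lookup (Var i * pol n \<omega> as) (xp ms))
    = (\<Sum>i<n. of_nat (ms ! i) * \<omega> (map2 monom as (ms[i := ms ! i - 1])))"
    by (intro sum.cong refl) simp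
  moreover have "of_nat (mfact ms) * D (lookup (pol n \<omega> as) (xp ms)) = D (\<omega> (map2 monom as ms))"
    unfolding D_of_nat_mult[symmetric] lookup_pol[OF b as ms] ..
  ultimately show "of_nat (mfact ms) * lookup (tmap n (pol n \<omega> as)) (xp ms) = TT \<omega> (map2 monom as ms)"
    using as ms TT_mono[OF basicD(2)[OF b], of as ms]
    by (simp add: tmap_def lookup_add lookup_mapD sum_distrib_right lookup_sum distrib_left sum_distrib_left)
qed

lemma pvc_TT:
  assumes "basic n \<zeta>"
  shows "pvc n (TT \<zeta>) = pvc n 0"
proof
  fix as
  show "pvc n (TT \<zeta>) as = pvc n 0 as"
    using tmap_pol[OF assms, of as, symmetric] imageI[OF pol_mpolys[of n \<zeta> as], of "tmap n"]
    by (simp add: pvc_def tot_class_eq pol_0 tot_image_tmap)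
qed

text \<open>The section yields multilinear primitives of the values on generators. The total
  derivative commutes with the skew projection, and the polynomials of \<open>\<omega>\<close> are
  already skewsymmetric, so the projected primitives still have total derivative
  \<open>\<omega>\<close>.\<close>

lemma pvc_eq_0:
  assumes b: "basic n \<omega>" and z: "pvc n \<omega> = pvc n 0"
  obtains \<zeta> where "basic n \<zeta>" "\<omega> = TT \<zeta>"
proof -
  obtain s where s: "\<And>P. s P \<in> mpolys n" "\<And>P Q. s (P + Q) = s P + s Q"
    "\<And>c P. s (pmap (scale c) P) = pmap (scale c) (s P)" "\<And>P. P \<in> tot_image n \<Longrightarrow> tmap n (s P) = P"
    by (rule tmap_section[of n]) (rule that)
  have slot: "map j (xs @ z # zs) = (map j (xs @ 0 # zs))[length xs := j z]" for xs zs z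
    by (simp add: list_update_append)
  define f where "f as = s (pol n \<omega> (map j as))" for as
  have f: "f as \<in> mpolys n" for as by (simp add: f_def s(1))
  have "\<exists>\<zeta>. basic n \<zeta> \<and> (\<forall>as. length as = n \<longrightarrow> pol n \<zeta> (map j as) = skew_part n f as)"
  proof (rule skew_part_basic[OF f])
    fix xs zs :: "'g list" and x y c assume len: "Suc (length xs + length zs) = n"
    show "f (xs @ (x + y) # zs) = f (xs @ x # zs) + f (xs @ y # zs)"
      unfolding f_def slot[of xs "x + y"] slot[of xs x] slot[of xs y] j_add
      using pol_add_slot[OF b, of "map j (xs @ 0 # zs)" "length xs"] len by (simp add: s(2) del: map_append)
    show "f (xs @ scaleg c x # zs) = pmap (scale c) (f (xs @ x # zs))"
      unfolding f_def slot[of xs "scaleg c x"] slot[of xs x] j_scale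
      using pol_scale_slot[OF b, of "map j (xs @ 0 # zs)" "length xs"] len by (simp add: s(3) del: map_append)
  qed
  then obtain \<zeta> where \<zeta>: "basic n \<zeta>" "\<And>as. length as = n \<Longrightarrow> pol n \<zeta> (map j as) = skew_part n f as" by blast
  have tf: "tmap n (f as) = pol n \<omega> (map j as)" if "length as = n" for as
    using fun_cong[OF z, of "map j as"] that by (simp add: f_def s(4) pvc_def tot_class_eq pol_0)
  have "pol n (TT \<zeta>) (map j as) = pol n \<omega> (map j as)" if as: "length as = n" for as
  proof -
    have "skew_part n (\<lambda>as. tmap n (f as)) as = skew_part n (\<lambda>as. pol n \<omega> (map j as)) as"
      unfolding skew_part_def using as by (simp add: tf)
    then show ?thesis
      using tmap_pol[OF \<zeta>(1), of "map j as"] tmap_asym[of n f as] f as by (simp add: \<zeta>(2) skew_part_pol[OF b as])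
  qed
  then have "TT \<zeta> = \<omega>" by (intro pol_inject[OF basic_lieder[OF \<zeta>(1)] b])
  then show thesis using that \<zeta>(1) by blast
qed

end

section \<open>Comparison of the cohomologies\<close>

context lie_algebra
begin

lemma lie_d_cochain_0: "lie_d n 0 = 0"
  by (auto simp: lie_d_def fun_eq_iff)

lemma lie_coboundaries_0: "0 \<in> lie_coboundaries n"
proof (cases n)
  case 0
  then show ?thesis by (simp add: lie_coboundaries_def zero_fun_def)
next
  case (Suc m)
  have "0 \<in> lie_cochains m" by (rule lie_cochainsI) simp_all
  then have "lie_d m 0 \<in> lie_d m ` lie_cochains m" by (rule imageI)
  then show ?thesis using Suc by (simp add: lie_coboundaries_def lie_d_cochain_0)
qed

lemma lie_coboundaries_add: "\<alpha> \<in> lie_coboundaries n \<Longrightarrow> \<beta> \<in> lie_coboundaries n \<Longrightarrow> \<alpha> + \<beta> \<in> lie_coboundaries n"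
  by (cases n)
    (auto simp: lie_coboundaries_def fun_eq_iff lie_d_add[symmetric] intro!: imageI lie_cochains_add_fun)

lemma lie_coboundaries_scale:
  assumes "\<alpha> \<in> lie_coboundaries n"
  shows "(\<lambda>as. c * \<alpha> as) \<in> lie_coboundaries n"
proof (cases n)
  case 0
  then show ?thesis using assms by (simp add: lie_coboundaries_def)
next
  case (Suc m)
  then obtain \<beta> where "\<beta> \<in> lie_cochains m" "\<alpha> = lie_d m \<beta>" using assms by (auto simp: lie_coboundaries_def)
  then show ?thesis
    using Suc lie_cochains_scale_fun[of \<beta> m c] by (auto simp: lie_coboundaries_def lie_d_scale[symmetric])
qed

lemma lie_coboundaries_closed: "additive_closed (lie_coboundaries n)"
  unfolding additive_closed_def
proof (intro conjI ballI)
  fix \<alpha> \<beta> assume "\<alpha> \<in> lie_coboundaries n" "\<beta> \<in> lie_coboundaries n"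
  moreover have "\<alpha> - \<beta> = \<alpha> + (\<lambda>as. - 1 * \<beta> as)" by (simp add: fun_eq_iff)
  ultimately show "\<alpha> - \<beta> \<in> lie_coboundaries n"
    using lie_coboundaries_add[of \<alpha> n "\<lambda>as. - 1 * \<beta> as"] lie_coboundaries_scale[of \<beta> n "- 1"] by (simp only:)
qed (rule lie_coboundaries_0)

lemma lie_class_eq: "lie_class n \<alpha> = lie_class n \<beta> \<longleftrightarrow> \<alpha> - \<beta> \<in> lie_coboundaries n"
  unfolding lie_class_def by (rule coset_eq_iff[OF lie_coboundaries_closed])

lemma lie_class_add: "lie_class n \<alpha> + lie_class n \<beta> = lie_class n (\<alpha> + \<beta>)"
  unfolding lie_class_def by (rule coset_add[OF lie_coboundaries_closed])

lemma lie_H_scale_class: "lie_H_scale n c (lie_class n \<alpha>) = lie_class n (\<lambda>as. c * \<alpha> as)"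
  unfolding lie_H_scale_def lie_class_def
  by (rule coset_image[of "\<lambda>\<alpha> as. c * \<alpha> as"])
    (auto simp: lie_coboundaries_closed lie_coboundaries_scale fun_eq_iff distrib_left)

lemma lie_cocycles_add: "\<alpha> \<in> lie_cocycles n \<Longrightarrow> \<beta> \<in> lie_cocycles n \<Longrightarrow> \<alpha> + \<beta> \<in> lie_cocycles n"
  by (auto simp: lie_cocycles_def lie_d_add lie_cochains_add_fun)

lemma lie_cocycles_scale: "\<alpha> \<in> lie_cocycles n \<Longrightarrow> (\<lambda>as. c * \<alpha> as) \<in> lie_cocycles n"
  by (auto simp: lie_cocycles_def lie_d_scale lie_cochains_scale_fun)

lemma lie_cocyclesD: "\<alpha> \<in> lie_cocycles n \<Longrightarrow> \<alpha> \<in> lie_cochains n" "\<alpha> \<in> lie_cocycles n \<Longrightarrow> lie_d n \<alpha> = 0"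
  by (simp_all add: lie_cocycles_def zero_fun_def)

end

section \<open>Classes of variational cocycles and the isomorphism\<close>

context affine_pva_nonzero
begin

lemma pvc_eq:
  assumes "basic n \<omega>" "basic n \<eta>"
  shows "pvc n \<omega> = pvc n \<eta> \<longleftrightarrow> (\<exists>\<zeta>. basic n \<zeta> \<and> \<omega> = \<eta> + TT \<zeta>)"
proof
  assume e: "pvc n \<omega> = pvc n \<eta>"
  have "pvc n (\<omega> - \<eta>) = pvc n 0"
  proof
    fix as
    show "pvc n (\<omega> - \<eta>) as = pvc n 0 as"
    proof (cases "length as = n")
      case True
      have "pol n \<omega> as = pol n (\<omega> - \<eta>) as + pol n \<eta> as"
        using pol_plus[OF basic_minus[OF assms] assms(2) True] by simp
      then show ?thesis using fun_cong[OF e, of as] True by (simp add: pvc_def tot_class_eq pol_0)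
    qed (simp add: pvc_def)
  qed
  then obtain \<zeta> where "basic n \<zeta>" "\<omega> - \<eta> = TT \<zeta>" using pvc_eq_0[OF basic_minus[OF assms]] by blast
  then show "\<exists>\<zeta>. basic n \<zeta> \<and> \<omega> = \<eta> + TT \<zeta>" by (intro exI[of _ \<zeta>]) (simp add: algebra_simps)
next
  assume "\<exists>\<zeta>. basic n \<zeta> \<and> \<omega> = \<eta> + TT \<zeta>"
  then obtain \<zeta> where "basic n \<zeta>" "\<omega> = \<eta> + TT \<zeta>" by blast
  then show "pvc n \<omega> = pvc n \<eta>"
    using pvc_plus[OF assms(2) basic_lieder, of \<zeta> y0] pvc_plus[OF assms(2) basic_0] by (simp add: pvc_TT)
qed

lemma fsc_1: "fsc 1 \<omega> = \<omega>" and fsc_fsc: "fsc c (fsc d \<omega>) = fsc (c * d) \<omega>"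
  by (simp_all add: fsc_def)

lemma sign_square: "(- 1) ^ n * (- 1) ^ n = (1 :: 'k)"
  by (simp flip: power_mult_distrib)

lemma pv_coboundaries_eq: "pv_coboundaries n = {pvc n (modes.ced \<eta>) | \<eta>. basic_pred n \<eta>}"
proof (cases n)
  case 0
  then show ?thesis by (simp add: pv_coboundaries_def basic_pred_def ced_0 pvc_0)
next
  case (Suc m)
  show ?thesis
  proof (intro set_eqI iffI)
    fix Y assume "Y \<in> pv_coboundaries n"
    then obtain Z where "Z \<in> pv_cochains m" "Y = pv_d m Z" using Suc by (auto simp: pv_coboundaries_def)
    then obtain \<eta> where \<eta>: "basic m \<eta>" "Y = pvc n (modes.ced (fsc ((- 1) ^ Suc m) \<eta>))"
      using pvc_surj[of Z m] pv_d_pvc[of m] Suc by (metis ced_fsc)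
    then show "Y \<in> {pvc n (modes.ced \<eta>) | \<eta>. basic_pred n \<eta>}"
      using basic_fsc[OF \<eta>(1), of "(- 1) ^ Suc m"] Suc by (auto simp: basic_pred_def)
  next
    fix Y assume "Y \<in> {pvc n (modes.ced \<eta>) | \<eta>. basic_pred n \<eta>}"
    then obtain \<eta> where \<eta>: "basic m \<eta>" "Y = pvc n (modes.ced \<eta>)" using Suc by (auto simp: basic_pred_def)
    let ?\<eta> = "fsc ((- 1) ^ Suc m) \<eta>"
    have "fsc ((- 1) ^ Suc m) (modes.ced ?\<eta>) = modes.ced \<eta>"
      unfolding ced_fsc fsc_fsc sign_square fsc_1 ..
    then have "Y = pv_d m (pvc m ?\<eta>)" using pv_d_pvc[OF basic_fsc[OF \<eta>(1)], of "(- 1) ^ Suc m"] \<eta>(2) Suc by simp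
    then show "Y \<in> pv_coboundaries n"
      using Suc pvc_cochain[OF basic_fsc[OF \<eta>(1)]] by (auto simp: pv_coboundaries_def)
  qed
qed

lemma mem_pv_class:
  assumes "basic n \<omega>"
  shows "Y \<in> pv_class n (pvc n \<omega>) \<longleftrightarrow> (\<exists>\<eta>. basic_pred n \<eta> \<and> Y = pvc n (\<omega> + modes.ced \<eta>))"
  unfolding pv_class_def pv_coboundaries_eq elt_set_plus_def
  by (auto simp: pvc_plus[OF assms basic_ced_pred])

text \<open>Reduces equality of variational classes to a statement about basic cochains; the image
  of \<open>TT\<close> comes from the fibres of \<open>pvc\<close>, the differentials from the
  coboundaries.\<close>

lemma pv_class_eq:
  assumes b: "basic n \<omega>" "basic n \<theta>"
  shows "pv_class n (pvc n \<omega>) = pv_class n (pvc n \<theta>) \<longleftrightarrow> exact_mod n (\<omega> - \<theta>)"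
proof
  assume "pv_class n (pvc n \<omega>) = pv_class n (pvc n \<theta>)"
  moreover have "pvc n \<omega> \<in> pv_class n (pvc n \<omega>)"
    unfolding mem_pv_class[OF b(1)] by (intro exI[of _ 0]) (simp add: basic_pred_0 ced_0)
  ultimately obtain \<eta> where \<eta>: "basic_pred n \<eta>" "pvc n \<omega> = pvc n (\<theta> + modes.ced \<eta>)"
    using mem_pv_class[OF b(2)] by blast
  then obtain \<zeta> where "basic n \<zeta>" "\<omega> = \<theta> + modes.ced \<eta> + TT \<zeta>"
    using pvc_eq[OF b(1) basic_plus[OF b(2) basic_ced_pred[OF \<eta>(1)]]] by blast
  then show "exact_mod n (\<omega> - \<theta>)" unfolding exact_mod_def using \<eta>(1) by (auto simp: algebra_simps)
next
  assume "exact_mod n (\<omega> - \<theta>)"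
  then obtain \<eta> \<zeta> where \<eta>: "basic_pred n \<eta>" "basic n \<zeta>" "\<omega> - \<theta> = modes.ced \<eta> + TT \<zeta>"
    by (auto simp: exact_mod_def)
  have m: "basic_pred n (- \<eta>)" "modes.ced (- \<eta>) = - modes.ced \<eta>"
    using basic_pred_fsc[OF \<eta>(1), of "- 1"] additive_uminus[of modes.ced, OF ced_plus] by (simp_all add: fsc_def fun_Compl_def)
  have e: "pvc n (\<omega> + modes.ced \<mu>) = pvc n (\<theta> + modes.ced (\<eta> + \<mu>))" if "basic_pred n \<mu>" for \<mu>
    unfolding pvc_eq[OF basic_plus[OF b(1) basic_ced_pred[OF that]] basic_plus[OF b(2) basic_ced_pred[OF basic_pred_plus[OF \<eta>(1) that]]]]
    using \<eta>(2,3) by (intro exI[of _ \<zeta>]) (simp add: ced_plus algebra_simps)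
  show "pv_class n (pvc n \<omega>) = pv_class n (pvc n \<theta>)"
  proof (intro set_eqI iffI)
    fix Y assume "Y \<in> pv_class n (pvc n \<omega>)"
    then obtain \<mu> where "basic_pred n \<mu>" "Y = pvc n (\<omega> + modes.ced \<mu>)" using mem_pv_class[OF b(1)] by blast
    then show "Y \<in> pv_class n (pvc n \<theta>)"
      unfolding mem_pv_class[OF b(2)] using e basic_pred_plus[OF \<eta>(1)] by blast
  next
    fix Y assume "Y \<in> pv_class n (pvc n \<theta>)"
    then obtain \<mu> where \<mu>: "basic_pred n \<mu>" "Y = pvc n (\<theta> + modes.ced \<mu>)" using mem_pv_class[OF b(2)] by blast
    have "basic_pred n (\<mu> - \<eta>)" using basic_pred_plus[OF \<mu>(1) m(1)] by simp
    from this e[OF this] show "Y \<in> pv_class n (pvc n \<omega>)"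
      unfolding mem_pv_class[OF b(1)] using \<mu>(2) by (intro exI[of _ "\<mu> - \<eta>"]) simp
  qed
qed

lemma pv_class_add:
  assumes b: "basic n \<omega>" "basic n \<theta>"
  shows "pv_class n (pvc n \<omega>) + pv_class n (pvc n \<theta>) = pv_class n (pvc n (\<omega> + \<theta>))"
proof (intro set_eqI iffI)
  fix Y assume "Y \<in> pv_class n (pvc n \<omega>) + pv_class n (pvc n \<theta>)"
  then obtain \<eta> \<mu> where \<eta>: "basic_pred n \<eta>" "basic_pred n \<mu>" "Y = pvc n (\<omega> + modes.ced \<eta>) + pvc n (\<theta> + modes.ced \<mu>)"
    using mem_pv_class[OF b(1)] mem_pv_class[OF b(2)] by (auto simp: set_plus_def)
  have "Y = pvc n ((\<omega> + modes.ced \<eta>) + (\<theta> + modes.ced \<mu>))"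
    unfolding \<eta>(3) by (intro pvc_plus[symmetric] basic_plus b basic_ced_pred \<eta>)
  also have "(\<omega> + modes.ced \<eta>) + (\<theta> + modes.ced \<mu>) = (\<omega> + \<theta>) + modes.ced (\<eta> + \<mu>)"
    by (simp add: ced_plus algebra_simps)
  finally show "Y \<in> pv_class n (pvc n (\<omega> + \<theta>))"
    unfolding mem_pv_class[OF basic_plus[OF b]] using basic_pred_plus[OF \<eta>(1,2)] by blast
next
  fix Y assume "Y \<in> pv_class n (pvc n (\<omega> + \<theta>))"
  then obtain \<eta> where \<eta>: "basic_pred n \<eta>" "Y = pvc n (\<omega> + \<theta> + modes.ced \<eta>)"
    unfolding mem_pv_class[OF basic_plus[OF b]] by blast
  have "Y = pvc n \<omega> + pvc n (\<theta> + modes.ced \<eta>)"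
    using pvc_plus[OF b(1) basic_plus[OF b(2) basic_ced_pred[OF \<eta>(1)]]] \<eta>(2) by (simp add: add.assoc)
  moreover have "pvc n \<omega> \<in> pv_class n (pvc n \<omega>)"
    unfolding mem_pv_class[OF b(1)] by (intro exI[of _ 0]) (simp add: basic_pred_0 ced_0)
  moreover have "pvc n (\<theta> + modes.ced \<eta>) \<in> pv_class n (pvc n \<theta>)"
    unfolding mem_pv_class[OF b(2)] using \<eta>(1) by blast
  ultimately show "Y \<in> pv_class n (pvc n \<omega>) + pv_class n (pvc n \<theta>)"
    unfolding set_plus_def by blast
qed

lemma pv_H_scale_class:
  assumes b: "basic n \<omega>"
  shows "pv_H_scale n c (pv_class n (pvc n \<omega>)) = pv_class n (pvc n (fsc c \<omega>))"
proof (intro set_eqI iffI)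
  have fp: "fsc c (\<omega> + \<eta>) = fsc c \<omega> + fsc c \<eta>" for \<omega> \<eta>
    by (simp add: fsc_def fun_eq_iff scale_right_distrib)
  fix Y assume "Y \<in> pv_H_scale n c (pv_class n (pvc n \<omega>))"
  then obtain \<eta> \<mu> where \<eta>: "basic_pred n \<eta>" "basic_pred n \<mu>" "Y = pv_scale n c (pvc n (\<omega> + modes.ced \<eta>)) + pvc n (modes.ced \<mu>)"
    unfolding pv_H_scale_def set_plus_def pv_coboundaries_eq by (auto simp: mem_pv_class[OF b])
  have be: "basic n (\<omega> + modes.ced \<eta>)" by (intro basic_plus b basic_ced_pred \<eta>)
  have "Y = pvc n (fsc c (\<omega> + modes.ced \<eta>) + modes.ced \<mu>)"
    unfolding \<eta>(3) pvc_fsc[OF be, symmetric] by (intro pvc_plus[symmetric] basic_fsc be basic_ced_pred \<eta>)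
  also have "fsc c (\<omega> + modes.ced \<eta>) + modes.ced \<mu> = fsc c \<omega> + modes.ced (fsc c \<eta> + \<mu>)"
    by (simp add: fp ced_plus ced_fsc add.assoc)
  finally show "Y \<in> pv_class n (pvc n (fsc c \<omega>))"
    unfolding mem_pv_class[OF basic_fsc[OF b]] using basic_pred_plus[OF basic_pred_fsc[OF \<eta>(1)] \<eta>(2)] by blast
next
  fix Y assume "Y \<in> pv_class n (pvc n (fsc c \<omega>))"
  then obtain \<eta> where \<eta>: "basic_pred n \<eta>" "Y = pvc n (fsc c \<omega> + modes.ced \<eta>)"
    unfolding mem_pv_class[OF basic_fsc[OF b]] by blast
  have "Y = pv_scale n c (pvc n \<omega>) + pvc n (modes.ced \<eta>)"
    unfolding \<eta>(2) pvc_fsc[OF b, symmetric] by (intro pvc_plus basic_fsc b basic_ced_pred \<eta>)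
  moreover have "pvc n \<omega> \<in> pv_class n (pvc n \<omega>)"
    unfolding mem_pv_class[OF b] by (intro exI[of _ 0]) (simp add: basic_pred_0 ced_0)
  ultimately show "Y \<in> pv_H_scale n c (pv_class n (pvc n \<omega>))"
    unfolding pv_H_scale_def set_plus_def pv_coboundaries_eq using \<eta>(1) by blast
qed

lemma pv_cocycle_iff:
  assumes b: "basic n \<omega>"
  shows "pvc n \<omega> \<in> pv_cocycles n \<longleftrightarrow> (\<exists>\<theta>. basic (Suc n) \<theta> \<and> modes.ced \<omega> = TT \<theta>)"
proof -
  let ?s = "(- 1) ^ Suc n :: 'k"
  have "pvc n \<omega> \<in> pv_cocycles n \<longleftrightarrow> pvc (Suc n) (fsc ?s (modes.ced \<omega>)) = pvc (Suc n) 0"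
    by (simp only: pv_cocycles_def mem_Collect_eq pvc_cochain[OF b] simp_thms pv_d_pvc[OF b] pvc_0)
  also have "\<dots> \<longleftrightarrow> (\<exists>\<theta>. basic (Suc n) \<theta> \<and> fsc ?s (modes.ced \<omega>) = TT \<theta>)"
    unfolding pvc_eq[OF basic_fsc[OF basic_ced[OF b]] basic_0] by simp
  also have "\<dots> \<longleftrightarrow> (\<exists>\<theta>. basic (Suc n) \<theta> \<and> modes.ced \<omega> = TT \<theta>)"
  proof
    assume "\<exists>\<theta>. basic (Suc n) \<theta> \<and> fsc ?s (modes.ced \<omega>) = TT \<theta>"
    then obtain \<theta> where t: "basic (Suc n) \<theta>" "fsc ?s (modes.ced \<omega>) = TT \<theta>" by blast
    have "modes.ced \<omega> = fsc ?s (fsc ?s (modes.ced \<omega>))" unfolding fsc_fsc sign_square fsc_1 ..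
    also have "\<dots> = TT (fsc ?s \<theta>)" unfolding t(2) lieder_fsc ..
    finally show "\<exists>\<theta>. basic (Suc n) \<theta> \<and> modes.ced \<omega> = TT \<theta>" using basic_fsc[OF t(1)] by blast
  next
    assume "\<exists>\<theta>. basic (Suc n) \<theta> \<and> modes.ced \<omega> = TT \<theta>"
    then obtain \<theta> where t: "basic (Suc n) \<theta>" "modes.ced \<omega> = TT \<theta>" by blast
    have "fsc ?s (modes.ced \<omega>) = TT (fsc ?s \<theta>)" unfolding t(2) lieder_fsc ..
    then show "\<exists>\<theta>. basic (Suc n) \<theta> \<and> fsc ?s (modes.ced \<omega>) = TT \<theta>" using basic_fsc[OF t(1)] by blast
  qed
  finally show ?thesis .
qed

text \<open>The scalar makes up for the factor \<open>1/k\<close> in \<open>conf\<close> and for the position of the last argument of \<open>\<beta>\<close>.\<close>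

definition cocyc :: "nat \<Rightarrow> ('g list \<Rightarrow> 'k) \<Rightarrow> ('g list \<Rightarrow> 'k) \<Rightarrow> 'v poly list \<Rightarrow> 'v" where
  "cocyc n \<alpha> \<beta> = cform n \<alpha> + iota y0 (cform (Suc n) (\<lambda>as. (- 1) ^ n * k * \<beta> as))"

lemma basic_iota_fun: "basic (Suc n) \<omega> \<Longrightarrow> basic n (iota x \<omega>)"
  unfolding iota_def by (rule basic_iota)

lemma cocyc:
  assumes "\<alpha> \<in> g.lie_cochains n" "\<beta> \<in> g.lie_cochains (Suc n)"
  shows "basic n (cocyc n \<alpha> \<beta>)"
  unfolding cocyc_def by (intro basic_plus cform(1) basic_iota_fun g.lie_cochains_scale_fun assms)

lemma cocyc_add:
  assumes "\<alpha> \<in> g.lie_cochains n" "\<beta> \<in> g.lie_cochains (Suc n)" "\<alpha>' \<in> g.lie_cochains n" "\<beta>' \<in> g.lie_cochains (Suc n)"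
  shows "cocyc n (\<alpha> + \<alpha>') (\<beta> + \<beta>') = cocyc n \<alpha> \<beta> + cocyc n \<alpha>' \<beta>'"
proof -
  have e: "(\<lambda>as. (- 1) ^ n * k * (\<beta> + \<beta>') as) = (\<lambda>as. (- 1) ^ n * k * \<beta> as) + (\<lambda>as. (- 1) ^ n * k * \<beta>' as)"
    by (simp add: fun_eq_iff distrib_left)
  show ?thesis
    unfolding cocyc_def e cform_add[OF assms(1,3)] iota_plus
      cform_add[OF g.lie_cochains_scale_fun[OF assms(2)] g.lie_cochains_scale_fun[OF assms(4)]]
    by (simp only: ac_simps)
qed

lemma cocyc_scale:
  assumes "\<alpha> \<in> g.lie_cochains n" "\<beta> \<in> g.lie_cochains (Suc n)"
  shows "cocyc n (\<lambda>as. c * \<alpha> as) (\<lambda>as. c * \<beta> as) = fsc c (cocyc n \<alpha> \<beta>)"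
proof -
  have e: "(\<lambda>as. (- 1) ^ n * k * (c * \<beta> as)) = (\<lambda>as. c * ((- 1) ^ n * k * \<beta> as))"
    by (simp add: fun_eq_iff)
  have fp: "fsc c (\<omega> + \<eta>) = fsc c \<omega> + fsc c \<eta>" for \<omega> \<eta>
    by (simp add: fsc_def fun_eq_iff scale_right_distrib)
  show ?thesis
    unfolding cocyc_def e cform_scale[OF assms(1)] cform_scale[OF g.lie_cochains_scale_fun[OF assms(2)]] iota_fsc fp ..
qed

text \<open>For the second summand Cartan's formula along \<open>y0\<close> gives \<iota> d\<gamma>
  = T\<gamma> - d\<iota>\<gamma>.\<close>

lemma cocyc_exact:
  assumes "\<alpha> \<in> g.lie_coboundaries n" "\<beta> \<in> g.lie_coboundaries (Suc n)"
  shows "exact_mod n (cocyc n \<alpha> \<beta>)"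
proof -
  have cf0: "cform m 0 = 0" for m
  proof -
    have z: "0 \<in> g.lie_cochains m" by (rule g.lie_cochainsI) simp_all
    show ?thesis using cform_add[OF z z] by simp
  qed
  have "exact_mod n (cform n \<alpha>)"
  proof (cases n)
    case 0
    then have "\<alpha> = 0" using assms(1) by (simp add: g.lie_coboundaries_def zero_fun_def)
    then show ?thesis by (simp add: cf0 exact_mod_0)
  next
    case (Suc m)
    then obtain \<gamma> where \<gamma>: "\<gamma> \<in> g.lie_cochains m" "\<alpha> = g.lie_d m \<gamma>" using assms(1) by (auto simp: g.lie_coboundaries_def)
    then have "cform n \<alpha> = modes.ced (cform m \<gamma>) + TT 0" using ced_cform(2)[OF \<gamma>(1)] Suc by (simp add: lieder_0)
    then show ?thesis unfolding exact_mod_def using cform(1)[OF \<gamma>(1)] Suc basic_0 by (auto simp: basic_pred_def)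
  qed
  moreover have "exact_mod n (iota y0 (cform (Suc n) (\<lambda>as. (- 1) ^ n * k * \<beta> as)))"
  proof -
    obtain \<gamma> where \<gamma>: "\<gamma> \<in> g.lie_cochains n" "(\<lambda>as. (- 1) ^ n * k * \<beta> as) = g.lie_d n \<gamma>"
      using g.lie_coboundaries_scale[OF assms(2), of "(- 1) ^ n * k"] by (auto simp: g.lie_coboundaries_def)
    let ?w = "cform n \<gamma>"
    have b: "basic n ?w" by (rule cform(1)[OF \<gamma>(1)])
    have "iota y0 (cform (Suc n) (\<lambda>as. (- 1) ^ n * k * \<beta> as)) = modes.ced (fsc (- 1) (iota y0 ?w)) + TT ?w"
      unfolding \<gamma>(2) ced_cform(2)[OF \<gamma>(1), symmetric] cartan[of y0 ?w] ced_fsc by (simp add: fsc_def fun_eq_iff)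
    then show ?thesis
      unfolding exact_mod_def using basic_pred_fsc[OF basic_pred_iota[OF b]] b by blast
  qed
  ultimately show ?thesis unfolding cocyc_def by (rule exact_mod_plus)
qed

lemma cocyc_exactD:
  assumes "\<alpha> \<in> g.lie_cocycles n" "\<beta> \<in> g.lie_cocycles (Suc n)" "exact_mod n (cocyc n \<alpha> \<beta>)"
  shows "\<alpha> \<in> g.lie_coboundaries n" "\<beta> \<in> g.lie_coboundaries (Suc n)"
proof -
  let ?\<beta> = "\<lambda>as. (- 1) ^ n * k * \<beta> as"
  note b = g.lie_cocyclesD[OF g.lie_cocycles_scale[OF assms(2), of "(- 1) ^ n * k"]]
  note e = basic_exact_coboundary[OF g.lie_cocyclesD(1)[OF assms(1)] b assms(3)[unfolded cocyc_def]]
  show "\<alpha> \<in> g.lie_coboundaries n" by (rule e(1))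
  have "(\<lambda>as. ((- 1) ^ n / k) * ?\<beta> as) = \<beta>"
    using sign_square[of n] k_nonzero by (simp add: fun_eq_iff mult.assoc[symmetric])
  then show "\<beta> \<in> g.lie_coboundaries (Suc n)" using g.lie_coboundaries_scale[OF e(2), of "(- 1) ^ n / k"] by simp
qed

lemma cocyc_cocycle:
  assumes "\<alpha> \<in> g.lie_cocycles n" "\<beta> \<in> g.lie_cocycles (Suc n)"
  shows "pvc n (cocyc n \<alpha> \<beta>) \<in> pv_cocycles n"
proof -
  note a = g.lie_cocyclesD[OF assms(1)]
  note b = g.lie_cocyclesD[OF g.lie_cocycles_scale[OF assms(2), of "(- 1) ^ n * k"]]
  have cf0: "cform (Suc n) 0 = 0"
  proof -
    have z: "0 \<in> g.lie_cochains (Suc n)" by (rule g.lie_cochainsI) simp_all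
    show ?thesis using cform_add[OF z z] by simp
  qed
  have "modes.ced (cocyc n \<alpha> \<beta>) = TT (cform (Suc n) (\<lambda>as. (- 1) ^ n * k * \<beta> as))"
    unfolding cocyc_def ced_plus ced_cform(2)[OF a(1)] a(2) ced_iota0_cform[OF b] cf0 by simp
  then show ?thesis
    unfolding pv_cocycle_iff[OF cocyc[OF a(1) g.lie_cocyclesD(1)[OF assms(2)]]] using cform(1)[OF b(1)] by blast
qed

lemma pv_cocycle_class:
  assumes Y: "Y \<in> pv_cocycles n"
  obtains \<alpha> \<beta> where "\<alpha> \<in> g.lie_cocycles n" "\<beta> \<in> g.lie_cocycles (Suc n)" "pv_class n Y = pv_class n (pvc n (cocyc n \<alpha> \<beta>))"
proof -
  obtain \<omega> where b: "basic n \<omega>" and Y': "Y = pvc n \<omega>" using Y pvc_surj[of Y n] by (auto simp: pv_cocycles_def)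
  obtain \<theta> where t: "basic (Suc n) \<theta>" "modes.ced \<omega> = TT \<theta>" using Y pv_cocycle_iff[OF b] Y' by blast
  obtain \<alpha> \<beta> where \<alpha>: "\<alpha> \<in> g.lie_cochains n" "g.lie_d n \<alpha> = 0" and \<beta>: "\<beta> \<in> g.lie_cochains (Suc n)" "g.lie_d (Suc n) \<beta> = 0"
    and ex: "exact_mod n (\<omega> - (cform n \<alpha> + iota y0 (cform (Suc n) \<beta>)))"
    by (rule basic_cocycle_decomposition[OF b t])
  let ?\<beta> = "\<lambda>as. ((- 1) ^ n / k) * \<beta> as"
  have a: "\<alpha> \<in> g.lie_cocycles n" and b': "\<beta> \<in> g.lie_cocycles (Suc n)" using \<alpha> \<beta> by (simp_all add: g.lie_cocycles_def zero_fun_def)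
  have b: "?\<beta> \<in> g.lie_cocycles (Suc n)" by (rule g.lie_cocycles_scale[OF b'])
  have "(\<lambda>as. (- 1) ^ n * k * ?\<beta> as) = \<beta>"
    using sign_square[of n] k_nonzero by (simp add: fun_eq_iff mult.assoc[symmetric])
  then have "cform n \<alpha> + iota y0 (cform (Suc n) \<beta>) = cocyc n \<alpha> ?\<beta>" by (simp only: cocyc_def)
  then have "pv_class n Y = pv_class n (pvc n (cocyc n \<alpha> ?\<beta>))"
    unfolding Y' using ex pv_class_eq[OF \<open>basic n \<omega>\<close> cocyc[OF \<alpha>(1) g.lie_cocyclesD(1)[OF b]]] by simp
  then show thesis using that[OF a b] by blast
qed

lemma pvc_cocyc_generators:
  assumes \<alpha>: "\<alpha> \<in> g.lie_cochains n" and \<beta>: "\<beta> \<in> g.lie_cochains (Suc n)" and N: "g.is_basis_with_dual N u u'"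
    and us: "length us = n"
  shows "pvc n (cocyc n \<alpha> \<beta>) (map j us) =
    tot_class n (Cst (scale (\<alpha> us) 1 + (\<Sum>i=1..N. scale (\<beta> (us @ [u' i])) (j (u i)))))"
proof -
  let ?c = "scale (\<alpha> us) 1 + (\<Sum>i=1..N. scale (\<beta> (us @ [u' i])) (j (u i)))"
  have "pol n (cocyc n \<alpha> \<beta>) (map j us) = Cst ?c"
  proof (rule pol_eqI[OF cocyc[OF \<alpha> \<beta>] _ mpolys_Cst])
    show "length (map j us) = n" using us by simp
    fix ms :: "nat list" assume ms: "length ms = n"
    have s0: "sum_list ms = 0 \<longleftrightarrow> (\<forall>i<length ms. ms ! i = 0)"
      by (simp only: sum_list_eq_0_iff all_set_conv_all_nth)
    have z: "xp ms = 0 \<longleftrightarrow> sum_list ms = 0"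
      by (auto simp: s0 poly_mapping_eq_iff fun_eq_iff lookup_xp)
    have m1: "mfact ms = 1" if "sum_list ms = 0"
      using that by (simp add: mfact_eq_prod s0)
    \<comment> \<open>Moving the dual vector from the first to the last place costs (-1)^n, which
      cancels the sign in \<open>cocyc\<close>; the factor k there cancels the 1/k from
      \<open>iota_cform\<close>.\<close>
    have "scale (1 / k) (\<Sum>i=1..N. scale ((- 1) ^ n * k * \<beta> (u' i # us)) (j (u i))) = (\<Sum>i=1..N. scale (\<beta> (us @ [u' i])) (j (u i)))"
    proof -
      have "(1 / k) * ((- 1) ^ n * k * \<beta> (u' i # us)) = \<beta> (us @ [u' i])" for i
        using g.lie_cochains_move[OF \<beta>, of "[]" "u' i" us] us k_nonzero sign_square[of n]
        by (simp add: mult.assoc[symmetric])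
      then show ?thesis by (simp add: scale_sum_right)
    qed
    then show "of_nat (mfact ms) * lookup (Cst ?c) (xp ms) = cocyc n \<alpha> \<beta> (gens us ms)"
      using us ms m1
      by (auto simp: cocyc_def cform(2)[OF \<alpha>] iota_cform[OF g.lie_cochains_scale_fun[OF \<beta>] N] Cst_def lookup_single when_def z)
  qed
  then show ?thesis using us by (simp add: pvc_def)
qed

text \<open>A choice over all representatives of the pair of classes; \<open>class_eq_iff\<close>
  shows both that it does not depend on them and that the map is injective.\<close>

definition Phi :: "nat \<Rightarrow> ('g list \<Rightarrow> 'k) set \<times> ('g list \<Rightarrow> 'k) set \<Rightarrow> ('v list \<Rightarrow> (nat, 'v) mpoly set) set" where
  "Phi n AB = (SOME C. \<exists>\<alpha>\<in>g.lie_cocycles n. \<exists>\<beta>\<in>g.lie_cocycles (Suc n).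
     AB = (g.lie_class n \<alpha>, g.lie_class (Suc n) \<beta>) \<and> C = pv_class n (pvc n (cocyc n \<alpha> \<beta>)))"

lemma class_eq_iff:
  assumes "\<alpha> \<in> g.lie_cocycles n" "\<beta> \<in> g.lie_cocycles (Suc n)" "\<alpha>' \<in> g.lie_cocycles n" "\<beta>' \<in> g.lie_cocycles (Suc n)"
  shows "pv_class n (pvc n (cocyc n \<alpha> \<beta>)) = pv_class n (pvc n (cocyc n \<alpha>' \<beta>')) \<longleftrightarrow>
    g.lie_class n \<alpha> = g.lie_class n \<alpha>' \<and> g.lie_class (Suc n) \<beta> = g.lie_class (Suc n) \<beta>'"
proof -
  have m: "\<gamma> - \<gamma>' \<in> g.lie_cocycles l" if "\<gamma> \<in> g.lie_cocycles l" "\<gamma>' \<in> g.lie_cocycles l" for \<gamma> \<gamma>' l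
  proof -
    have "\<gamma> - \<gamma>' = \<gamma> + (\<lambda>as. - 1 * \<gamma>' as)" by (simp add: fun_eq_iff)
    then show ?thesis using g.lie_cocycles_add[OF that(1) g.lie_cocycles_scale[OF that(2), of "- 1"]] by (simp only:)
  qed
  note c = g.lie_cocyclesD(1)
  have "cocyc n \<alpha> \<beta> = cocyc n (\<alpha> - \<alpha>') (\<beta> - \<beta>') + cocyc n \<alpha>' \<beta>'"
    using cocyc_add[of "\<alpha> - \<alpha>'" n "\<beta> - \<beta>'" \<alpha>' \<beta>'] assms m[THEN c] c by simp
  then have "exact_mod n (cocyc n \<alpha> \<beta> - cocyc n \<alpha>' \<beta>') \<longleftrightarrow> exact_mod n (cocyc n (\<alpha> - \<alpha>') (\<beta> - \<beta>'))"
    by (simp add: algebra_simps)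
  also have "\<dots> \<longleftrightarrow> \<alpha> - \<alpha>' \<in> g.lie_coboundaries n \<and> \<beta> - \<beta>' \<in> g.lie_coboundaries (Suc n)"
    using cocyc_exact[of "\<alpha> - \<alpha>'" n "\<beta> - \<beta>'"] cocyc_exactD[OF m[OF assms(1,3)] m[OF assms(2,4)]] by iprover
  finally show ?thesis
    unfolding g.lie_class_eq pv_class_eq[OF cocyc[OF c[OF assms(1)] c[OF assms(2)]] cocyc[OF c[OF assms(3)] c[OF assms(4)]]] .
qed

lemma Phi_class:
  assumes "\<alpha> \<in> g.lie_cocycles n" "\<beta> \<in> g.lie_cocycles (Suc n)"
  shows "Phi n (g.lie_class n \<alpha>, g.lie_class (Suc n) \<beta>) = pv_class n (pvc n (cocyc n \<alpha> \<beta>))"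
  unfolding Phi_def
proof (rule some_equality)
  show "\<exists>\<alpha>'\<in>g.lie_cocycles n. \<exists>\<beta>'\<in>g.lie_cocycles (Suc n).
     (g.lie_class n \<alpha>, g.lie_class (Suc n) \<beta>) = (g.lie_class n \<alpha>', g.lie_class (Suc n) \<beta>') \<and>
     pv_class n (pvc n (cocyc n \<alpha> \<beta>)) = pv_class n (pvc n (cocyc n \<alpha>' \<beta>'))"
    using assms by blast
next
  fix C assume "\<exists>\<alpha>'\<in>g.lie_cocycles n. \<exists>\<beta>'\<in>g.lie_cocycles (Suc n).
     (g.lie_class n \<alpha>, g.lie_class (Suc n) \<beta>) = (g.lie_class n \<alpha>', g.lie_class (Suc n) \<beta>') \<and>
     C = pv_class n (pvc n (cocyc n \<alpha>' \<beta>'))"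
  then obtain \<alpha>' \<beta>' where "\<alpha>' \<in> g.lie_cocycles n" "\<beta>' \<in> g.lie_cocycles (Suc n)"
    "g.lie_class n \<alpha> = g.lie_class n \<alpha>'" "g.lie_class (Suc n) \<beta> = g.lie_class (Suc n) \<beta>'"
    "C = pv_class n (pvc n (cocyc n \<alpha>' \<beta>'))" by blast
  then show "C = pv_class n (pvc n (cocyc n \<alpha> \<beta>))" using class_eq_iff[OF assms, of \<alpha>' \<beta>'] by simp
qed

lemma Phi_bij: "bij_betw (Phi n) (g.lie_H n \<times> g.lie_H (Suc n)) (pv_H n)"
  unfolding bij_betw_def
proof
  show "inj_on (Phi n) (g.lie_H n \<times> g.lie_H (Suc n))"
    by (rule inj_onI) (auto simp: g.lie_H_def Phi_class class_eq_iff)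
  show "Phi n ` (g.lie_H n \<times> g.lie_H (Suc n)) = pv_H n"
  proof (intro set_eqI iffI)
    fix C assume "C \<in> Phi n ` (g.lie_H n \<times> g.lie_H (Suc n))"
    then show "C \<in> pv_H n" by (auto simp: g.lie_H_def Phi_class pv_H_def cocyc_cocycle)
  next
    fix C assume "C \<in> pv_H n"
    then obtain Y where "Y \<in> pv_cocycles n" "C = pv_class n Y" by (auto simp: pv_H_def)
    then obtain \<alpha> \<beta> where ab: "\<alpha> \<in> g.lie_cocycles n" "\<beta> \<in> g.lie_cocycles (Suc n)" "C = pv_class n (pvc n (cocyc n \<alpha> \<beta>))"
      using pv_cocycle_class by metis
    then have "C = Phi n (g.lie_class n \<alpha>, g.lie_class (Suc n) \<beta>)" by (simp add: Phi_class)
    then show "C \<in> Phi n ` (g.lie_H n \<times> g.lie_H (Suc n))" using ab by (auto simp: g.lie_H_def)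
  qed
qed

lemma Phi_add:
  assumes "A \<in> g.lie_H n" "A' \<in> g.lie_H n" "B \<in> g.lie_H (Suc n)" "B' \<in> g.lie_H (Suc n)"
  shows "Phi n (A + A', B + B') = Phi n (A, B) + Phi n (A', B')"
proof -
  obtain \<alpha> \<alpha>' \<beta> \<beta>' where c: "\<alpha> \<in> g.lie_cocycles n" "\<alpha>' \<in> g.lie_cocycles n" "\<beta> \<in> g.lie_cocycles (Suc n)" "\<beta>' \<in> g.lie_cocycles (Suc n)"
    and e: "A = g.lie_class n \<alpha>" "A' = g.lie_class n \<alpha>'" "B = g.lie_class (Suc n) \<beta>" "B' = g.lie_class (Suc n) \<beta>'"
    using assms by (auto simp: g.lie_H_def)
  note d = g.lie_cocyclesD(1)
  show ?thesis
    unfolding e g.lie_class_add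
    by (simp add: Phi_class c g.lie_cocycles_add cocyc_add d[OF c(1)] d[OF c(2)] d[OF c(3)] d[OF c(4)] pv_class_add cocyc)
qed

lemma Phi_scale:
  assumes "A \<in> g.lie_H n" "B \<in> g.lie_H (Suc n)"
  shows "Phi n (g.lie_H_scale n c A, g.lie_H_scale (Suc n) c B) = pv_H_scale n c (Phi n (A, B))"
proof -
  obtain \<alpha> \<beta> where c: "\<alpha> \<in> g.lie_cocycles n" "\<beta> \<in> g.lie_cocycles (Suc n)"
    and e: "A = g.lie_class n \<alpha>" "B = g.lie_class (Suc n) \<beta>"
    using assms by (auto simp: g.lie_H_def)
  note d = g.lie_cocyclesD(1)
  show ?thesis
    unfolding e g.lie_H_scale_class
    by (simp add: Phi_class c g.lie_cocycles_scale cocyc_scale d[OF c(1)] d[OF c(2)] pv_H_scale_class cocyc)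
qed

lemma Phi_explicit:
  assumes N: "g.is_basis_with_dual N u u'" and \<alpha>: "\<alpha> \<in> g.lie_cocycles n" and \<beta>: "\<beta> \<in> g.lie_cocycles (Suc n)"
  shows "\<exists>Y. {Y' \<in> pv_cochains n. \<forall>us. length us = n \<longrightarrow> Y' (map j us) =
        tot_class n (Cst (scale (\<alpha> us) 1 + (\<Sum>i=1..N. scale (\<beta> (us @ [u' i])) (j (u i)))))} = {Y} \<and>
      Y \<in> pv_cocycles n \<and> Phi n (g.lie_class n \<alpha>, g.lie_class (Suc n) \<beta>) = pv_class n Y"
proof (intro exI[of _ "pvc n (cocyc n \<alpha> \<beta>)"] conjI)
  note g = pvc_cocyc_generators[OF g.lie_cocyclesD(1)[OF \<alpha>] g.lie_cocyclesD(1)[OF \<beta>] N]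
  have Y: "pvc n (cocyc n \<alpha> \<beta>) \<in> pv_cochains n"
    by (intro pvc_cochain cocyc g.lie_cocyclesD(1) \<alpha> \<beta>)
  show "{Y' \<in> pv_cochains n. \<forall>us. length us = n \<longrightarrow> Y' (map j us) =
        tot_class n (Cst (scale (\<alpha> us) 1 + (\<Sum>i=1..N. scale (\<beta> (us @ [u' i])) (j (u i)))))} = {pvc n (cocyc n \<alpha> \<beta>)}"
  proof (intro set_eqI iffI)
    fix Z assume Z: "Z \<in> {Y' \<in> pv_cochains n. \<forall>us. length us = n \<longrightarrow> Y' (map j us) =
        tot_class n (Cst (scale (\<alpha> us) 1 + (\<Sum>i=1..N. scale (\<beta> (us @ [u' i])) (j (u i)))))}"
    have "Z = pvc n (cocyc n \<alpha> \<beta>)" by (rule pv_cochains_eqI[OF _ Y]) (use Z g in simp_all)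
    then show "Z \<in> {pvc n (cocyc n \<alpha> \<beta>)}" by simp
  next
    fix Z assume "Z \<in> {pvc n (cocyc n \<alpha> \<beta>)}"
    then have "Z = pvc n (cocyc n \<alpha> \<beta>)" by simp
    then show "Z \<in> {Y' \<in> pv_cochains n. \<forall>us. length us = n \<longrightarrow> Y' (map j us) =
        tot_class n (Cst (scale (\<alpha> us) 1 + (\<Sum>i=1..N. scale (\<beta> (us @ [u' i])) (j (u i)))))}"
      using Y g by simp
  qed
qed (simp_all add: cocyc_cocycle Phi_class \<alpha> \<beta>)

end

theorem theorem4p10:
  fixes scaleg :: "'k::field_char_0 \<Rightarrow> 'g::ab_group_add \<Rightarrow> 'g"
    and bracket :: "'g \<Rightarrow> 'g \<Rightarrow> 'g" and form :: "'g \<Rightarrow> 'g \<Rightarrow> 'k" and k :: 'k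
    and scale :: "'k \<Rightarrow> 'v::comm_ring_1 \<Rightarrow> 'v" and D :: "'v \<Rightarrow> 'v"
    and br :: "'v \<Rightarrow> 'v \<Rightarrow> 'v poly" and j :: "'g \<Rightarrow> 'v" and n :: nat
  defines "HL \<equiv> lie_algebra.lie_H scaleg bracket"
    and "HP \<equiv> pva.pv_H scale D br"
  assumes "affine_pva scaleg bracket form k scale D br j"
    and "k \<noteq> 0"
  shows "\<exists>\<Phi>.
    bij_betw \<Phi> (HL n \<times> HL (n + 1)) (HP n) \<and>
    (\<forall>A\<in>HL n. \<forall>A'\<in>HL n. \<forall>B\<in>HL (n + 1). \<forall>B'\<in>HL (n + 1).
       \<Phi> (A + A', B + B') = \<Phi> (A, B) + \<Phi> (A', B')) \<and>
    (\<forall>c. \<forall>A\<in>HL n. \<forall>B\<in>HL (n + 1).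
       \<Phi> (lie_algebra.lie_H_scale scaleg bracket n c A, lie_algebra.lie_H_scale scaleg bracket (n + 1) c B) =
       pva.pv_H_scale scale D br n c (\<Phi> (A, B))) \<and>
    (\<forall>N u u'. quadratic_lie_algebra.is_basis_with_dual scaleg form N u u' \<longrightarrow>
      (\<forall>\<alpha>\<in>lie_algebra.lie_cocycles scaleg bracket n. \<forall>\<beta>\<in>lie_algebra.lie_cocycles scaleg bracket (n + 1).
        \<exists>Y. {Y' \<in> pva.pv_cochains scale D n.
               \<forall>us. length us = n \<longrightarrow>
                 Y' (map j us) =
                   pva.tot_class D n
                     (Cst (scale (\<alpha> us) 1 + (\<Sum>i=1..N. scale (\<beta> (us @ [u' i])) (j (u i)))))} = {Y} \<and>
            Y \<in> pva.pv_cocycles scale D br n \<and>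
            \<Phi> (lie_algebra.lie_class scaleg bracket n \<alpha>, lie_algebra.lie_class scaleg bracket (n + 1) \<beta>) =
              pva.pv_class scale D br n Y))"
proof -
  interpret affine_pva_nonzero scaleg bracket form k scale D br j
    using assms(3,4) by (simp add: affine_pva_nonzero_def affine_pva_nonzero_axioms_def)
  show ?thesis
    unfolding HL_def HP_def Suc_eq_plus1[symmetric]
    using Phi_bij Phi_add Phi_scale Phi_explicit by (intro exI[of _ "Phi n"] conjI ballI allI impI)
qed

end
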